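(* Let $u$ be a germ of function at a point of $\mathbb C^2$ satisfying the transversality condition (T). If the 5-web $\mathcal T[u]$ is exceptional and the 3-web $\{\mathcal F(x),\mathcal F(y),\mathcal F(u)\}$ has maximal rank, then $\mathcal T[u]$ is the image, under an element of the group $\mathrm{Sym}(\mathcal T_0)$, of a germ (at some point where $w$ is holomorphic and satisfies (T)) of a web $\mathcal T[w]$, where $w$ is one of the following functions: $w(x,y)=\dfrac{\theta_1(x,\tau)}{\theta_4(x,\tau)}\dfrac{\theta_1(y,\tau)}{\theta_4(y,\tau)}$ for some $\tau\in\mathcal H$; $\tanh x\tanh y$; $\sin x\sin y$; $e^x+e^y$; $x^2-y^2$; $x^2+y^2$.
   Context: Everything is local and complex-analytic: function means germ of holomorphic function at a base point $(x_0,y_0)\in\mathbb C^2$; local diffeomorphism means germ of biholomorphism. If $du(x_0,y_0)\ne0$, $\mathcal F(u)$ is the germ of foliation whose leaves are the level curves of $u$. For $d\ge 3$, a $d$-web $\mathcal T(u_1,\dots,u_d)$ at $(x_0,y_0)$ is an unordered family of $d$ foliations $\mathcal F(u_1),\dots,\mathcal F(u_d)$ with $du_j\wedge du_k\neq0$ at $(x_0,y_0)$ for $j\ne k$. Two germs of $d$-webs (at possibly different points) are equivalent if a local diffeomorphism sends one onto the other. The rank of the web is the dimension of the complex vector space of tuples of one-variable germs $(\phi_1,\dots,\phi_d)$ ($\phi_j$ at $u_j(x_0,y_0)$) with $\sum_j\phi_j(u_j)\,du_j=0$; it is at most $(d-1)(d-2)/2$, and the web has maximal rank if equality holds. Algebraic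 webs: let $C$ be a reduced algebraic curve of degree $d$ in the dual projective plane $\check{\mathbb P}\mathbb C^2$; a point $p\in\check{\mathbb P}\mathbb C^2$ represents a line $l(p)\subset\mathbb P\mathbb C^2$, and a point $z\in \mathbb P\mathbb C^2$ gives the line $l_z\subset\check{\mathbb P}\mathbb C^2$ of lines through $z$. If $l_{z_0}$ meets $C$ in $d$ distinct points, then for $z$ near $z_0$ the points $p_1(z),\dots,p_d(z)$ of $l_z\cap C$ give $d$ lines $l(p_j(z))$ through $z$, defining a germ of $d$-web at $z_0$ (leaves are pieces of lines). A web is algebraic if obtained in this way, algebraizable if equivalent to an algebraic web, and exceptional if it has maximal rank and is not algebraizable. $\mathcal T_0=\mathcal T(x,y,x+y,x-y)$ and $\mathcal T[u]=\mathcal T(x,y,x+y,x-y,u(x,y))$. Transversality condition (T) at $(x_0,y_0)$: $u_xu_y(u_x^2-u_y^2)\neq0$ at $(x_0,y_0)$. $\mathrm{Sym}(\mathcal T_0)$ is the group of projective transformations of $\mathbb P\mathbb C^2$ preserving $\mathcal T_0$ (i.e. permuting its four pencils of parallel lines); its elements are affine maps of $\mathbb C^2$. $\mathcal H=\{\tau\in\mathbb C:\operatorname{Im}\tau>0\}$, $q=e^{i\pi\tau}$ (and $q^s:=e^{i\pi\tau s}$), and $\theta_1(x,\tau)=-i\sum_{n\in\mathbb Z}(-1)^nq^{(n+1/2)^2}e^{i(2n+1)x}$, $\theta_4(x,\tau)=\sum_{n\in\mathbb Z}(-1)^nq^{n^2}e^{2inx}$. *)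

theory Defs
  imports "HOL-Complex_Analysis.Complex_Analysis"
begin

section \<open>Holomorphic germs in two variables\<close>

type_synonym point = "complex \<times> complex"

text \<open>Holomorphic means differentiable with complex-linear derivative at every point. A germ at
  \<open>p\<close> is represented by any function defining it; all notions below depend only on the values
  near the base point.\<close>

definition holomorphic2_on :: "(point \<Rightarrow> complex) \<Rightarrow> point set \<Rightarrow> bool" where
  "holomorphic2_on f U \<longleftrightarrow>
     (\<forall>z\<in>U. \<exists>a b. (f has_derivative (\<lambda>h. a * fst h + b * snd h)) (at z))"

definition holomorphic_germ :: "point \<Rightarrow> (point \<Rightarrow> complex) \<Rightarrow> bool" where
  "holomorphic_germ p f \<longleftrightarrow> (\<exists>U. open U \<and> p \<in> U \<and> holomorphic2_on f U)"

definition dx :: "(point \<Rightarrow> complex) \<Rightarrow> point \<Rightarrow> complex" where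
  "dx f z = deriv (\<lambda>s. f (s, snd z)) (fst z)"

definition dy :: "(point \<Rightarrow> complex) \<Rightarrow> point \<Rightarrow> complex" where
  "dy f z = deriv (\<lambda>t. f (fst z, t)) (snd z)"

definition local_biholomorphism :: "point \<Rightarrow> (point \<Rightarrow> point) \<Rightarrow> bool" where
  "local_biholomorphism p \<Phi> \<longleftrightarrow>
     (\<exists>U V \<Psi>. open U \<and> p \<in> U \<and> open V \<and> homeomorphism U V \<Phi> \<Psi> \<and>
        holomorphic2_on (fst \<circ> \<Phi>) U \<and> holomorphic2_on (snd \<circ> \<Phi>) U \<and>
        holomorphic2_on (fst \<circ> \<Psi>) V \<and> holomorphic2_on (snd \<circ> \<Psi>) V)"

section \<open>Foliations and webs\<close>

text \<open>A germ of foliation at \<open>p\<close> is the germ at \<open>(p, p)\<close> of the relation ``to lie on the same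
  leaf'', a germ of relation being the class of all relations that agree with it near
  \<open>(p, p)\<close>.\<close>

type_synonym foliation_germ = "(point \<times> point) set set"

definition relation_germ :: "point \<Rightarrow> (point \<times> point) set \<Rightarrow> foliation_germ" where
  "relation_germ p R = {S. \<forall>\<^sub>F ab in nhds (p, p). ab \<in> S \<longleftrightarrow> ab \<in> R}"

definition foliation :: "point \<Rightarrow> (point \<Rightarrow> complex) \<Rightarrow> foliation_germ" where
  "foliation p u = relation_germ p {(a, b). u a = u b}"

definition web :: "point \<Rightarrow> (point \<Rightarrow> complex) list \<Rightarrow> foliation_germ set" where
  "web p us = foliation p ` set us"

definition defines_web :: "point \<Rightarrow> (point \<Rightarrow> complex) list \<Rightarrow> bool" where
  "defines_web p us \<longleftrightarrow> length us \<ge> 3 \<and> (\<forall>u\<in>set us. holomorphic_germ p u) \<and>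
     (\<forall>j<length us. \<forall>k<length us. j \<noteq> k \<longrightarrow>
        dx (us ! j) p * dy (us ! k) p - dy (us ! j) p * dx (us ! k) p \<noteq> 0)"

text \<open>For a local homeomorphism \<open>\<Phi>\<close> at \<open>p\<close>, a relation represents the image of a germ of
  foliation at \<open>p\<close> iff its preimage under \<open>\<Phi> \<times> \<Phi>\<close> represents that germ; the result is a germ at
  \<open>\<Phi> p\<close>.\<close>

definition image_foliation :: "(point \<Rightarrow> point) \<Rightarrow> foliation_germ \<Rightarrow> foliation_germ" where
  "image_foliation \<Phi> \<F> = {S. map_prod \<Phi> \<Phi> -` S \<in> \<F>}"

definition image_web ::
    "(point \<Rightarrow> point) \<Rightarrow> foliation_germ set \<Rightarrow> foliation_germ set" where
  "image_web \<Phi> W = image_foliation \<Phi> ` W"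

definition equivalent_webs ::
    "point \<Rightarrow> foliation_germ set \<Rightarrow> point \<Rightarrow> foliation_germ set \<Rightarrow> bool" where
  "equivalent_webs p W p' W' \<longleftrightarrow>
     (\<exists>\<Phi>. local_biholomorphism p \<Phi> \<and> \<Phi> p = p' \<and> image_web \<Phi> W = W')"

section \<open>Rank\<close>

text \<open>Tuples of one-variable germs are families indexed by \<open>j < length us\<close>, the \<open>j\<close>-th
  component being considered near \<open>(us ! j) p\<close>.\<close>

definition abelian_relation ::
    "point \<Rightarrow> (point \<Rightarrow> complex) list \<Rightarrow> (nat \<Rightarrow> complex \<Rightarrow> complex) \<Rightarrow> bool" where
  "abelian_relation p us \<phi> \<longleftrightarrow>
     (\<forall>j<length us. \<phi> j analytic_on {(us ! j) p}) \<and>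
     (\<forall>\<^sub>F z in nhds p.
        (\<Sum>j<length us. \<phi> j ((us ! j) z) * dx (us ! j) z) = 0 \<and>
        (\<Sum>j<length us. \<phi> j ((us ! j) z) * dy (us ! j) z) = 0)"

definition same_germs ::
    "point \<Rightarrow> (point \<Rightarrow> complex) list \<Rightarrow> (nat \<Rightarrow> complex \<Rightarrow> complex) \<Rightarrow>
      (nat \<Rightarrow> complex \<Rightarrow> complex) \<Rightarrow> bool" where
  "same_germs p us \<phi> \<psi> \<longleftrightarrow>
     (\<forall>j<length us. \<forall>\<^sub>F t in nhds ((us ! j) p). \<phi> j t = \<psi> j t)"

text \<open>The space of abelian relations, modulo equality of germs, has dimension \<open>r\<close>: it has a
  basis \<open>B 0, \<dots>, B (r - 1)\<close>.\<close>

definition has_rank :: "point \<Rightarrow> (point \<Rightarrow> complex) list \<Rightarrow> nat \<Rightarrow> bool" where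
  "has_rank p us r \<longleftrightarrow>
     (\<exists>B :: nat \<Rightarrow> nat \<Rightarrow> complex \<Rightarrow> complex.
        (\<forall>k<r. abelian_relation p us (B k)) \<and>
        (\<forall>c :: nat \<Rightarrow> complex.
           same_germs p us (\<lambda>j t. \<Sum>k<r. c k * B k j t) (\<lambda>j t. 0) \<longrightarrow> (\<forall>k<r. c k = 0)) \<and>
        (\<forall>\<phi>. abelian_relation p us \<phi> \<longrightarrow>
           (\<exists>c :: nat \<Rightarrow> complex. same_germs p us \<phi> (\<lambda>j t. \<Sum>k<r. c k * B k j t))))"

definition maximal_rank :: "point \<Rightarrow> (point \<Rightarrow> complex) list \<Rightarrow> bool" where
  "maximal_rank p us \<longleftrightarrow> has_rank p us ((length us - 1) * (length us - 2) div 2)"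

section \<open>The projective plane and algebraic webs\<close>

text \<open>A point of the projective plane or of its dual is the set of all its (nonzero) vectors of
  homogeneous coordinates.\<close>

type_synonym proj_point = "(complex ^ 3) set"

definition proj :: "complex ^ 3 \<Rightarrow> proj_point" where
  "proj v = {c *s v | c. c \<noteq> 0}"

definition affine_point :: "point \<Rightarrow> complex ^ 3" where
  "affine_point z = vector [fst z, snd z, 1]"

text \<open>With \<open>a\<close> read as homogeneous coordinates of a point of the dual plane, this is the line it
  represents; with \<open>a\<close> read as homogeneous coordinates of a point of the plane, it is the line of
  the dual plane formed by the lines through that point.\<close>

definition proj_line :: "complex ^ 3 \<Rightarrow> proj_point set" where
  "proj_line a = {proj v | v. v \<noteq> 0 \<and> (\<Sum>i\<in>UNIV. a $ i * v $ i) = 0}"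

definition ternary_form :: "nat \<Rightarrow> (complex ^ 3 \<Rightarrow> complex) \<Rightarrow> bool" where
  "ternary_form d F \<longleftrightarrow>
     (\<exists>k :: nat \<Rightarrow> nat \<Rightarrow> complex.
        \<forall>v. F v = (\<Sum>i\<le>d. \<Sum>j\<le>d - i. k i j * v $ 1 ^ i * v $ 2 ^ j * v $ 3 ^ (d - i - j)))"

text \<open>A reduced curve of degree \<open>d\<close> is the zero set of a nonzero squarefree form of degree \<open>d\<close>.
  Forms may be treated as functions since the base field is infinite, and it is enough to exclude
  homogeneous square factors since the factors of a form are forms.\<close>

definition reduced_curve :: "nat \<Rightarrow> proj_point set \<Rightarrow> bool" where
  "reduced_curve d C \<longleftrightarrow>
     (\<exists>F. ternary_form d F \<and> (\<exists>v. F v \<noteq> 0) \<and>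
        \<not> (\<exists>e G H. 1 \<le> e \<and> 2 * e \<le> d \<and> ternary_form e G \<and> ternary_form (d - 2 * e) H \<and>
             (\<forall>v. F v = G v ^ 2 * H v)) \<and>
        C = {proj a | a. a \<noteq> 0 \<and> F a = 0})"

text \<open>The vectors \<open>P j z\<close> are homogeneous coordinates of the points of \<open>l\<^sub>z \<inter> C\<close>, labelled
  continuously in \<open>z\<close>; the leaf through \<open>z\<close> of the \<open>j\<close>-th foliation is the piece near \<open>z0\<close> of
  the line represented by \<open>P j z\<close>. Webs being germs at points of \<open>\<complex>\<^sup>2\<close>, the base point lies in the
  affine chart \<open>[x : y : 1]\<close>, which up to equivalence of webs is no restriction.\<close>

definition algebraic_web :: "nat \<Rightarrow> point \<Rightarrow> foliation_germ set \<Rightarrow> bool" where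
  "algebraic_web d z0 W \<longleftrightarrow>
     (\<exists>C U P. reduced_curve d C \<and>
        finite (proj_line (affine_point z0) \<inter> C) \<and>
        card (proj_line (affine_point z0) \<inter> C) = d \<and>
        open U \<and> z0 \<in> U \<and>
        (\<forall>j<d. continuous_on U (P j) \<and> (\<forall>z\<in>U. P j z \<noteq> 0)) \<and>
        (\<forall>z\<in>U. proj_line (affine_point z) \<inter> C = (\<lambda>j. proj (P j z)) ` {..<d}) \<and>
        W = (\<lambda>j. relation_germ z0 {(z, z'). proj (affine_point z') \<in> proj_line (P j z)}) ` {..<d})"

definition algebraizable :: "point \<Rightarrow> (point \<Rightarrow> complex) list \<Rightarrow> bool" where
  "algebraizable p us \<longleftrightarrow>
     (\<exists>z0 W. algebraic_web (length us) z0 W \<and> equivalent_webs p (web p us) z0 W)"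

definition exceptional :: "point \<Rightarrow> (point \<Rightarrow> complex) list \<Rightarrow> bool" where
  "exceptional p us \<longleftrightarrow> defines_web p us \<and> maximal_rank p us \<and> \<not> algebraizable p us"

section \<open>The webs \<open>\<T>[u]\<close> and the group \<open>Sym(\<T>\<^sub>0)\<close>\<close>

definition T_web :: "(point \<Rightarrow> complex) \<Rightarrow> (point \<Rightarrow> complex) list" where
  "T_web u = [fst, snd, \<lambda>z. fst z + snd z, \<lambda>z. fst z - snd z, u]"

definition transversality :: "point \<Rightarrow> (point \<Rightarrow> complex) \<Rightarrow> bool" where
  "transversality p u \<longleftrightarrow> dx u p * dy u p * ((dx u p)\<^sup>2 - (dy u p)\<^sup>2) \<noteq> 0"

text \<open>The parallel lines \<open>\<alpha> x + \<beta> y + \<gamma> = 0\<close>, for fixed \<open>\<alpha>, \<beta>\<close>.\<close>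

definition pencil :: "complex \<Rightarrow> complex \<Rightarrow> proj_point set set" where
  "pencil \<alpha> \<beta> = {proj_line (vector [\<alpha>, \<beta>, \<gamma>]) | \<gamma>. True}"

definition T0_pencils :: "proj_point set set set" where
  "T0_pencils = {pencil 1 0, pencil 0 1, pencil 1 1, pencil 1 (-1)}"

definition projective_map :: "complex ^ 3 ^ 3 \<Rightarrow> proj_point \<Rightarrow> proj_point" where
  "projective_map A Q = (\<lambda>v. A *v v) ` Q"

text \<open>The elements of the group are affine; they are recorded here by their action on \<open>\<complex>\<^sup>2\<close>.\<close>

definition Sym_T0 :: "(point \<Rightarrow> point) set" where
  "Sym_T0 = {g. \<exists>A :: complex ^ 3 ^ 3. invertible A \<and>
     image (image (image (projective_map A))) T0_pencils = T0_pencils \<and>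
     (\<forall>z. projective_map A (proj (affine_point z)) = proj (affine_point (g z)))}"

section \<open>Theta functions\<close>

definition nome_power :: "complex \<Rightarrow> real \<Rightarrow> complex" where
  "nome_power \<tau> s = exp (\<i> * of_real pi * \<tau> * of_real s)"

definition theta1 :: "complex \<Rightarrow> complex \<Rightarrow> complex" where
  "theta1 x \<tau> = - \<i> * (\<Sum>\<^sub>\<infinity>n\<in>(UNIV :: int set).
     (-1) powi n * nome_power \<tau> ((of_int n + 1/2)\<^sup>2) * exp (\<i> * of_int (2 * n + 1) * x))"

definition theta4 :: "complex \<Rightarrow> complex \<Rightarrow> complex" where
  "theta4 x \<tau> = (\<Sum>\<^sub>\<infinity>n\<in>(UNIV :: int set).
     (-1) powi n * nome_power \<tau> ((of_int n)\<^sup>2) * exp (2 * \<i> * of_int n * x))"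

text \<open>At a pole, a quotient takes the value \<open>0\<close> here; the products below are then not
  holomorphic there, so that requiring them to be holomorphic germs excludes the poles.\<close>

definition model_functions :: "(point \<Rightarrow> complex) set" where
  "model_functions =
     {\<lambda>(x, y). theta1 x \<tau> / theta4 x \<tau> * (theta1 y \<tau> / theta4 y \<tau>) | \<tau>. Im \<tau> > 0} \<union>
     {\<lambda>(x, y). tanh x * tanh y,
      \<lambda>(x, y). sin x * sin y,
      \<lambda>(x, y). exp x + exp y,
      \<lambda>(x, y). x\<^sup>2 - y\<^sup>2,
      \<lambda>(x, y). x\<^sup>2 + y\<^sup>2}"

end

theory Submission
  imports Defs
begin

text \<open>Maximal rank of \<open>{\<F>(x), \<F>(y), \<F>(u)}\<close> means that \<open>\<F>(u)\<close> is defined by a sum \<open>f(x) + g(y)\<close>. The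
  \<open>u\<close> component of an abelian relation of \<open>\<T>[u]\<close>, multiplied by \<open>du/d(f + g)\<close>, is a function \<open>\<xi>\<close> of
  \<open>f + g\<close> satisfying an identity linear in \<open>\<xi>', \<xi>'', \<xi>'''\<close>. Rank 6 provides two such functions with
  independent pairs \<open>(\<xi>', \<xi>'')\<close>, and eliminating between their identities gives
  \<open>2 (f''(x) - g''(y)) = a(f + g) (f'(x)\<^sup>2 - g'(y)\<^sup>2)\<close>.
  Writing \<open>f'\<^sup>2 = P(f)\<close> and \<open>g'\<^sup>2 = Q(g)\<close>, this forces \<open>P'' = b P + c\<close> and \<open>Q'' = b Q + c\<close> with a common
  first integral. When \<open>b \<noteq> 0\<close>, \<open>P\<close> and \<open>Q\<close> are combinations of \<open>1, exp (2 \<beta> s), exp (- 2 \<beta> s)\<close>, and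
  \<open>exp (\<beta> f)\<close> and \<open>exp (\<beta> g)\<close> solve, after rescaling, the same equation \<open>y'\<^sup>2 = K (y\<^sup>4 + \<rho> y\<^sup>2 + 1)\<close> or a
  degenerate form of it; when \<open>b = 0\<close>, \<open>f\<close> and \<open>g\<close> solve \<open>y'\<^sup>2 = quadratic\<close>. Each solution is one of
  the models, except when \<open>\<F>(u)\<close> is a pencil of lines: then \<open>\<T>[u]\<close> is algebraic. The elliptic
  case needs that every \<open>\<rho> \<noteq> \<plusminus>2\<close> is realised by a quotient of theta functions, which is
  obtained by iterating the Landen transformation into the region where the modulus is
  invertible.\<close>

section \<open>Theta functions\<close>

text \<open>Rank 6 enters by counting: a relation is fixed by six numbers, so all six can be
  prescribed, in particular the pair \<open>\<xi>'\<close>, \<open>\<xi>''\<close> at the base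
  point. The remaining difficulty is to match germs at the given base point with explicit functions.
  An equation y'^2 = R(y) determines y up to a translation and a sign of the argument, provided that
  the model takes the value of y at the base point; each model must therefore attain every value
  that can occur, which for the theta quotient needs Liouville's theorem. The scaling \<kappa> of
  the argument must be the same for f and g, since a diagonal map permuting the four directions
  scales x and y alike up to sign; the common constants b, c and the common first integral provide
  this. When the two solutions enter as a sum of sines, a quotient of sines, a sine times an
  exponential or a product of affine functions, addition formulas rewrite them in X + Y and X - Y,
  which is where the group elements mixing x and y are needed. Non-algebraizability excludes two
  cases only: the leaves of u are parallel lines or concurrent lines.\<close>

lemma summable_exp_abs_int: "(\<lambda>k::int. exp (- \<bar>real_of_int k\<bar>)) summable_on UNIV"
proof -
  have "summable (\<lambda>n. (exp (-1::real)) ^ n)" by (rule summable_geometric) simp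
  moreover have "exp (- real n) = exp (-1) ^ n" for n
    using exp_of_nat_mult[of n "-1::real"] by simp
  ultimately have "summable (\<lambda>n. norm (exp (- real n)))" by simp
  hence s: "(\<lambda>n::nat. exp (- real n)) summable_on UNIV" by (rule norm_summable_imp_summable_on)
  have "(\<lambda>k::int. exp (- \<bar>real_of_int k\<bar>)) summable_on (range int)"
    by (subst summable_on_reindex) (simp_all add: s o_def)
  moreover have "(\<lambda>k::int. exp (- \<bar>real_of_int k\<bar>)) summable_on (range (\<lambda>n. - int n))"
    by (subst summable_on_reindex) (simp_all add: s o_def inj_on_def)
  ultimately have "(\<lambda>k::int. exp (- \<bar>real_of_int k\<bar>)) summable_on (range int \<union> range (\<lambda>n. - int n))"
    by (rule summable_on_union)
  moreover have "range int \<union> range (\<lambda>n. - int n) = UNIV"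
    by (auto simp: image_iff) (metis int_cases2)
  ultimately show ?thesis by simp
qed

lemma infsum_mult_Times:
  fixes f g :: "int \<Rightarrow> complex"
  assumes "(\<lambda>x. norm (f x)) summable_on A" "(\<lambda>x. norm (g x)) summable_on B"
  shows "infsum f A * infsum g B = (\<Sum>\<^sub>\<infinity>(k,l)\<in>A\<times>B. f k * g l)"
    and "(\<lambda>x. norm (case x of (k,l) \<Rightarrow> f k * g l)) summable_on A \<times> B"
proof -
  show s: "(\<lambda>x. norm (case x of (k,l) \<Rightarrow> f k * g l)) summable_on A \<times> B"
  proof (subst Infinite_Sum.abs_summable_on_Sigma_iff, intro conjI ballI)
    fix x show "(\<lambda>y. norm (case (x, y) of (k, l) \<Rightarrow> f k * g l)) summable_on B"
      using assms(2) by (auto simp: norm_mult intro: summable_on_cmult_right)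
  next
    have "(\<lambda>x. norm (f x) * infsum (\<lambda>y. norm (g y)) B) summable_on A"
      using assms(1) by (rule summable_on_cmult_left)
    thus "(\<lambda>x. norm (infsum (\<lambda>y. norm (case (x, y) of (k, l) \<Rightarrow> f k * g l)) B)) summable_on A"
      by (simp add: norm_mult infsum_cmult_right' abs_mult infsum_nonneg)
  qed
  have "infsum f A * infsum g B = infsum (\<lambda>x. infsum (\<lambda>y. f x * g y) B) A"
    by (simp add: infsum_cmult_right' infsum_cmult_left')
  also have "\<dots> = (\<Sum>\<^sub>\<infinity>(k,l)\<in>A\<times>B. f k * g l)"
    by (rule infsum_Sigma'_banach) (use abs_summable_summable[OF s] in simp)
  finally show "infsum f A * infsum g B = (\<Sum>\<^sub>\<infinity>(k,l)\<in>A\<times>B. f k * g l)" .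
qed

text \<open>For \<open>k = 2 * n\<close> these are the terms of \<open>\<theta>\<^sub>3\<close>, for \<open>k = 2 * n + 1\<close> those of \<open>\<theta>\<^sub>2\<close>. Summing over
  residue classes of \<open>k\<close> makes the duplication formulas consequences of the bijection
  \<open>(k, l) \<mapsto> (k + l, k - l)\<close> onto the pairs of equal parity.\<close>

definition th_term :: "complex \<Rightarrow> complex \<Rightarrow> int \<Rightarrow> complex" where
  "th_term \<tau> z k = exp (\<i> * of_real pi * \<tau> * (of_int k)\<^sup>2 / 4 + \<i> * of_int k * z)"

definition th :: "complex \<Rightarrow> int set \<Rightarrow> complex \<Rightarrow> complex" where
  "th \<tau> S z = infsum (th_term \<tau> z) S"

lemma quad_lower:
  fixes c b x :: real assumes "c > 0"
  shows "b * x - c * x\<^sup>2 \<le> b\<^sup>2 / (4 * c)"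
proof -
  have "0 \<le> (2 * c * x - b)\<^sup>2" by simp
  hence "4 * c * (b * x - c * x\<^sup>2) \<le> b\<^sup>2" by (simp add: power2_eq_square algebra_simps)
  thus ?thesis using assms by (simp add: field_simps)
qed

text \<open>The Gaussian factor absorbs the growth in z by completing the square. Taking
  \<open>R + 1\<close> instead of \<open>R\<close> leaves over a factor exp (- |k|), which makes the
  bound summable, and uniform on the strip |Im z| \<le> R.\<close>

lemma th_term_bound:
  assumes "Im \<tau> > 0" "\<bar>Im z\<bar> \<le> R"
  shows "norm (th_term \<tau> z k) \<le> exp ((R + 1)\<^sup>2 / (pi * Im \<tau>)) * exp (- \<bar>real_of_int k\<bar>)"
proof -
  have "norm (th_term \<tau> z k) = exp (- (pi * Im \<tau> / 4) * (real_of_int k)\<^sup>2 - real_of_int k * Im z)"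
    unfolding th_term_def by (simp add: algebra_simps power2_eq_square)
  also have "\<dots> \<le> exp ((R + 1)\<^sup>2 / (pi * Im \<tau>) - \<bar>real_of_int k\<bar>)"
  proof (subst exp_le_cancel_iff)
    have "- (real_of_int k * Im z) \<le> \<bar>real_of_int k\<bar> * R"
      using mult_left_mono[OF assms(2), of "\<bar>real_of_int k\<bar>"] abs_ge_minus_self[of "real_of_int k * Im z"] by (simp add: abs_mult)
    moreover have "(R + 1) * \<bar>real_of_int k\<bar> - (pi * Im \<tau> / 4) * \<bar>real_of_int k\<bar>\<^sup>2 \<le> (R+1)\<^sup>2 / (4 * (pi * Im \<tau> / 4))"
      by (rule quad_lower) (use assms in simp)
    ultimately show "- (pi * Im \<tau> / 4) * (real_of_int k)\<^sup>2 - real_of_int k * Im z \<le> (R + 1)\<^sup>2 / (pi * Im \<tau>) - \<bar>real_of_int k\<bar>"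
      by (simp add: algebra_simps)
  qed
  also have "\<dots> = exp ((R + 1)\<^sup>2 / (pi * Im \<tau>)) * exp (- \<bar>real_of_int k\<bar>)"
    by (simp add: exp_diff exp_minus field_simps)
  finally show ?thesis .
qed

lemma th_abs_summable:
  assumes "Im \<tau> > 0" shows "(\<lambda>k. norm (th_term \<tau> z k)) summable_on S"
proof (rule Infinite_Sum.abs_summable_on_comparison_test)
  have "(\<lambda>k::int. exp ((\<bar>Im z\<bar> + 1)\<^sup>2 / (pi * Im \<tau>)) * exp (- \<bar>real_of_int k\<bar>)) summable_on S"
    by (rule summable_on_cmult_right, rule summable_on_subset_banach[OF summable_exp_abs_int]) simp
  thus "(\<lambda>k::int. norm (exp ((\<bar>Im z\<bar> + 1)\<^sup>2 / (pi * Im \<tau>)) * exp (- \<bar>real_of_int k\<bar>))) summable_on S"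
    by simp
  show "norm (th_term \<tau> z k) \<le> norm (exp ((\<bar>Im z\<bar> + 1)\<^sup>2 / (pi * Im \<tau>)) * exp (- \<bar>real_of_int k\<bar>))" for k
    using th_term_bound[OF assms, of z "\<bar>Im z\<bar>" k] by simp
qed

lemma th_holomorphic:
  assumes "Im \<tau> > 0" shows "th \<tau> S holomorphic_on A"
proof -
  have "\<exists>g'. (th \<tau> S has_field_derivative g') (at z)" for z
  proof -
    define R where "R = norm z + 1"
    have ul: "uniform_limit (cball 0 R) (\<lambda>F z. \<Sum>k\<in>F. th_term \<tau> z k) (th \<tau> S) (finite_subsets_at_top S)"
      unfolding th_def
    proof (rule Weierstrass_m_test_general)
      show "norm (th_term \<tau> y k) \<le> exp ((R + 1)\<^sup>2 / (pi * Im \<tau>)) * exp (- \<bar>real_of_int k\<bar>)"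
        if "y \<in> cball 0 R" for y k
        using that abs_Im_le_cmod[of y] by (intro th_term_bound[OF assms]) auto
      show "(\<lambda>k::int. exp ((R + 1)\<^sup>2 / (pi * Im \<tau>)) * exp (- \<bar>real_of_int k\<bar>)) summable_on S"
        by (rule summable_on_cmult_right, rule summable_on_subset_banach[OF summable_exp_abs_int]) simp
    qed
    have "th \<tau> S holomorphic_on ball 0 R"
    proof (rule holomorphic_uniform_limit[OF _ ul])
      show "\<forall>\<^sub>F F in finite_subsets_at_top S. continuous_on (cball 0 R) (\<lambda>z. \<Sum>k\<in>F. th_term \<tau> z k) \<and>
          (\<lambda>z. \<Sum>k\<in>F. th_term \<tau> z k) holomorphic_on ball 0 R"
        unfolding th_term_def by (intro always_eventually allI conjI holomorphic_intros continuous_intros) auto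
    qed auto
    thus ?thesis by (intro exI[of _ "deriv (th \<tau> S) z"] holomorphic_derivI[of _ "ball 0 R"]) (auto simp: R_def)
  qed
  thus ?thesis by (meson holomorphic_onI field_differentiable_def field_differentiable_at_within)
qed

section \<open>Duplication formulas for theta series over residue classes\<close>

definition cl :: "int \<Rightarrow> int \<Rightarrow> int set" where "cl m r = {k. k mod m = r}"

lemma th_union:
  assumes "Im \<tau> > 0" "A \<inter> B = {}"
  shows "th \<tau> (A \<union> B) z = th \<tau> A z + th \<tau> B z"
  unfolding th_def by (intro infsum_Un_disjoint abs_summable_summable[OF th_abs_summable] assms)

text \<open>The parallelogram identity k^2 + l^2 = ((k + l)^2 + (k - l)^2) / 2 rewrites a product of
  two terms at \<tau> as a product of two terms at \<tau>/2. By \<open>S\<close> the resulting set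
  of index pairs splits into two products, which \<open>d\<close> keeps disjoint.\<close>

lemma th_mult:
  assumes \<tau>: "Im \<tau> > 0"
    and S: "(\<lambda>(k,l). (k + l, k - l)) ` (S \<times> S') = A \<times> A' \<union> B \<times> B'"
    and d: "A \<inter> B = {}"
  shows "th \<tau> S x * th \<tau> S' y =
     th (\<tau>/2) A ((x+y)/2) * th (\<tau>/2) A' ((x-y)/2) + th (\<tau>/2) B ((x+y)/2) * th (\<tau>/2) B' ((x-y)/2)"
proof -
  have \<tau>2: "Im (\<tau>/2) > 0" using \<tau> by simp
  let ?f = "\<lambda>(K,M). th_term (\<tau>/2) ((x+y)/2) K * th_term (\<tau>/2) ((x-y)/2) M"
  have t: "th_term \<tau> x k * th_term \<tau> y l = th_term (\<tau>/2) ((x+y)/2) (k+l) * th_term (\<tau>/2) ((x-y)/2) (k-l)" for k l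
    unfolding th_term_def exp_add[symmetric] by (rule arg_cong[where f = exp]) (simp add: field_simps power2_eq_square)
  have "th \<tau> S x * th \<tau> S' y = (\<Sum>\<^sub>\<infinity>(k,l)\<in>S\<times>S'. th_term \<tau> x k * th_term \<tau> y l)"
    unfolding th_def by (intro infsum_mult_Times th_abs_summable \<tau>)
  also have "\<dots> = infsum (?f \<circ> (\<lambda>(k,l). (k + l, k - l))) (S \<times> S')"
    by (intro infsum_cong) (simp only: t o_def split_beta fst_conv snd_conv)
  also have "\<dots> = infsum ?f ((\<lambda>(k,l). (k + l, k - l)) ` (S \<times> S'))"
    by (rule infsum_reindex[symmetric]) (auto simp: inj_on_def)
  also have "\<dots> = infsum ?f (A \<times> A' \<union> B \<times> B')" by (simp only: S)
  also have "\<dots> = infsum ?f (A \<times> A') + infsum ?f (B \<times> B')"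
    using d by (intro infsum_Un_disjoint abs_summable_summable[OF infsum_mult_Times(2)[OF th_abs_summable[OF \<tau>2] th_abs_summable[OF \<tau>2]]]) auto
  also have "\<dots> = th (\<tau>/2) A ((x+y)/2) * th (\<tau>/2) A' ((x-y)/2) + th (\<tau>/2) B ((x+y)/2) * th (\<tau>/2) B' ((x-y)/2)"
    unfolding th_def by (simp only: infsum_mult_Times(1)[OF th_abs_summable[OF \<tau>2] th_abs_summable[OF \<tau>2]])
  finally show ?thesis .
qed

lemma sumdiff_image:
  assumes "\<And>k l. k \<in> S \<Longrightarrow> l \<in> S' \<Longrightarrow> (k + l, k - l) \<in> C"
    and "\<And>K M. (K, M) \<in> C \<Longrightarrow> even (K + M) \<and> (K + M) div 2 \<in> S \<and> (K - M) div 2 \<in> S'"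
  shows "(\<lambda>(k,l). (k + l, k - l)) ` (S \<times> S') = (C :: (int \<times> int) set)"
proof (intro equalityI subsetI)
  fix x assume "x \<in> C"
  then obtain K M where x: "x = (K, M)" "(K, M) \<in> C" by (cases x) auto
  have e: "even (K + M)" "even (K - M)" using assms(2)[OF x(2)] by auto
  hence "x = (\<lambda>(k,l). (k + l, k - l)) ((K + M) div 2, (K - M) div 2)"
    unfolding x by auto presburger+
  thus "x \<in> (\<lambda>(k,l). (k + l, k - l)) ` (S \<times> S')" using assms(2)[OF x(2)] by blast
qed (use assms(1) in auto)

text \<open>With k = 2a + r and l = 2b + s, the numbers a + b and a - b have the same parity; its
  two values give the two products of classes modulo 4.\<close>

lemma sumdiff_cl:
  fixes r s :: int
  assumes rs: "r mod 2 = r" "s mod 2 = s"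
  shows "(\<lambda>(k,l). (k + l, k - l)) ` (cl 2 r \<times> cl 2 s) =
    cl 4 ((r + s) mod 4) \<times> cl 4 ((r - s) mod 4) \<union> cl 4 ((r + s + 2) mod 4) \<times> cl 4 ((r - s + 2) mod 4)"
proof (rule sumdiff_image)
  fix k l :: int assume "k \<in> cl 2 r" "l \<in> cl 2 s"
  hence "k mod 2 = r" "l mod 2 = s" unfolding cl_def by simp_all
  hence "k = 2 * (k div 2) + r" "l = 2 * (l div 2) + s" using mult_div_mod_eq[of 2 k] mult_div_mod_eq[of 2 l] by linarith+
  then obtain a b where k: "k = 2 * a + r" "l = 2 * b + s" by blast
  have "even (a - b) \<or> odd (a - b)" by blast
  then obtain c where "a - b = 2 * c \<or> a - b = 2 * c + 1" by (elim disjE evenE oddE) auto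
  hence "a = b + 2 * c \<or> a = b + 2 * c + 1" by (elim disjE) simp_all
  hence "k + l = 4 * (b + c) + (r + s) \<and> k - l = 4 * c + (r - s) \<or>
      k + l = 4 * (b + c) + (r + s + 2) \<and> k - l = 4 * c + (r - s + 2)" unfolding k by (elim disjE) simp_all
  thus "(k + l, k - l) \<in> cl 4 ((r + s) mod 4) \<times> cl 4 ((r - s) mod 4) \<union> cl 4 ((r + s + 2) mod 4) \<times> cl 4 ((r - s + 2) mod 4)"
    unfolding cl_def mem_Collect_eq Un_iff mem_Times_iff fst_conv snd_conv by (elim disjE conjE) (simp_all only: mod_mult_self4 simp_thms)
next
  fix K M :: int assume "(K, M) \<in> cl 4 ((r + s) mod 4) \<times> cl 4 ((r - s) mod 4) \<union> cl 4 ((r + s + 2) mod 4) \<times> cl 4 ((r - s + 2) mod 4)"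
  hence "K mod 4 = (r + s) mod 4 \<and> M mod 4 = (r - s) mod 4 \<or> K mod 4 = (r + s + 2) mod 4 \<and> M mod 4 = (r - s + 2) mod 4"
    unfolding cl_def mem_Collect_eq Un_iff mem_Times_iff fst_conv snd_conv .
  hence "\<exists>i. K mod 4 = (r + s + 2 * i) mod 4 \<and> M mod 4 = (r - s + 2 * i) mod 4"
    by (elim disjE) (rule exI[of _ 0], simp, rule exI[of _ 1], simp)
  then obtain i where "K mod 4 = (r + s + 2 * i) mod 4" "M mod 4 = (r - s + 2 * i) mod 4" by blast
  then obtain a b where "K - (r + s + 2 * i) = 4 * a" "M - (r - s + 2 * i) = 4 * b"
    unfolding mod_eq_dvd_iff by (elim dvdE)
  hence d: "K + M = 2 * (2 * (a + b + i) + r)" "K - M = 2 * (2 * (a - b) + s)" by simp_all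
  have h: "(2 * c) div 2 = c" for c :: int by simp
  show "even (K + M) \<and> (K + M) div 2 \<in> cl 2 r \<and> (K - M) div 2 \<in> cl 2 s"
    unfolding d h cl_def mem_Collect_eq mod_mult_self4 using rs by simp
qed

lemma sumdiff_ev_ev: "(\<lambda>(k,l). (k + l, k - l)) ` (cl 2 0 \<times> cl 2 0) = cl 4 0 \<times> cl 4 0 \<union> cl 4 2 \<times> cl 4 2"
  using sumdiff_cl[of 0 0] by simp

lemma sumdiff_odd_odd: "(\<lambda>(k,l). (k + l, k - l)) ` (cl 2 1 \<times> cl 2 1) = cl 4 0 \<times> cl 4 2 \<union> cl 4 2 \<times> cl 4 0"
  using sumdiff_cl[of 1 1] by (simp add: Un_commute)

lemma sumdiff_odd_ev: "(\<lambda>(k,l). (k + l, k - l)) ` (cl 2 1 \<times> cl 2 0) = cl 4 1 \<times> cl 4 1 \<union> cl 4 3 \<times> cl 4 3"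
  using sumdiff_cl[of 1 0] by simp

lemma cl_disj: "a \<noteq> b \<Longrightarrow> cl m a \<inter> cl m b = {}" by (auto simp: cl_def)

lemma image_eq_witness:
  assumes "\<And>k. k \<in> S \<Longrightarrow> f k \<in> T" "\<And>k. k \<in> T \<Longrightarrow> g k \<in> S \<and> f (g k) = k"
  shows "f ` S = T"
  using assms by (metis image_subset_iff image_eqI subsetI subset_antisym)

text \<open>The classes 0 and 2 modulo 4 are the doubles of the even and of the odd numbers, so they
  lead back to the two basic series. After the halving in \<open>th_mult\<close> the net effect is
  to pass from \<tau> to 2\<tau>.\<close>

lemma th_double:
  shows "th \<tau> (cl 4 0) z = th (4*\<tau>) (cl 2 0) (2*z)" "th \<tau> (cl 4 2) z = th (4*\<tau>) (cl 2 1) (2*z)"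
proof -
  have t: "th_term \<tau> z (2*k) = th_term (4*\<tau>) (2*z) k" for k
    unfolding th_term_def by (rule arg_cong[where f = exp]) (simp add: field_simps)
  have *: "th \<tau> ((\<lambda>k. 2*k) ` S) z = th (4*\<tau>) S (2*z)" for S
    unfolding th_def by (subst infsum_reindex) (simp_all add: inj_on_def o_def t)
  have "(\<lambda>k. 2*k) ` cl 2 0 = cl 4 0" "(\<lambda>k. 2*k) ` cl 2 1 = cl 4 2"
    by (rule image_eq_witness[where g = "\<lambda>k. k div 2"]; simp only: cl_def mem_Collect_eq; presburger)+
  thus "th \<tau> (cl 4 0) z = th (4*\<tau>) (cl 2 0) (2*z)" "th \<tau> (cl 4 2) z = th (4*\<tau>) (cl 2 1) (2*z)"
    by (simp_all only: *[symmetric])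
qed

lemma th_minus: "th \<tau> S (-z) = th \<tau> (uminus ` S) z"
  unfolding th_def by (subst infsum_reindex) (simp_all add: inj_on_def o_def th_term_def[abs_def])

lemma th_even: "th \<tau> (cl 2 0) (-z) = th \<tau> (cl 2 0) z" "th \<tau> (cl 2 1) (-z) = th \<tau> (cl 2 1) z"
   "th \<tau> (cl 4 3) z = th \<tau> (cl 4 1) (-z)"
proof -
  have "uminus ` cl 2 0 = cl 2 0" "uminus ` cl 2 1 = cl 2 1" "uminus ` cl 4 1 = cl 4 3"
    by (rule image_eq_witness[where g = "uminus"]; simp only: cl_def mem_Collect_eq; presburger)+
  thus "th \<tau> (cl 2 0) (-z) = th \<tau> (cl 2 0) z" "th \<tau> (cl 2 1) (-z) = th \<tau> (cl 2 1) z"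
   "th \<tau> (cl 4 3) z = th \<tau> (cl 4 1) (-z)" by (simp_all only: th_minus)
qed

lemma th_shift:
  assumes "\<And>k. k \<in> S \<Longrightarrow> exp (\<i> * of_int k * c) = w"
  shows "th \<tau> S (z + c) = w * th \<tau> S z"
proof -
  have t: "th_term \<tau> (z + c) k = w * th_term \<tau> z k" if "k \<in> S" for k
    unfolding th_term_def assms[OF that, symmetric] exp_add[symmetric]
    by (rule arg_cong[where f = exp]) (simp add: algebra_simps)
  show ?thesis unfolding th_def infsum_cmult_right'[symmetric] by (rule infsum_cong) (rule t)
qed

lemma exp_i_half_pi_mult:
  "k \<in> cl 4 r \<Longrightarrow> exp (\<i> * of_int k * (of_real pi / 2)) = exp (\<i> * of_int r * (of_real pi / 2))"
proof -
  assume "k \<in> cl 4 r"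
  then obtain j where "k = 4*j + r" unfolding cl_def by (metis (mono_tags) mem_Collect_eq div_mult_mod_eq mult.commute)
  hence "\<i> * of_int k * (of_real pi / 2) = \<i> * of_int r * (of_real pi / 2) + \<i> * (of_int j * (of_real pi * 2))"
    by (simp add: field_simps)
  thus ?thesis by (simp only: exp_plus_2pin)
qed

text \<open>(k + 2)^2 / 4 = k^2 / 4 + k + 1, so a shift of z by \<pi>\<tau> renumbers the terms up
  to a common factor.\<close>

lemma th_quasi:
  "th \<tau> S (z + of_real pi * \<tau>) = exp (- \<i> * of_real pi * \<tau> - 2 * \<i> * z) * th \<tau> ((+) 2 ` S) z"
proof -
  have t: "th_term \<tau> (z + of_real pi * \<tau>) k = exp (- \<i> * of_real pi * \<tau> - 2 * \<i> * z) * th_term \<tau> z (2 + k)" for k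
    unfolding th_term_def exp_add[symmetric]
    by (rule arg_cong[where f = exp]) (simp add: field_simps power2_eq_square)
  show ?thesis unfolding th_def t infsum_cmult_right'[symmetric]
    by (subst infsum_reindex) (simp_all add: o_def inj_on_def)
qed

abbreviation "ev \<equiv> cl 2 0"
abbreviation "od \<equiv> cl 2 1"

lemma th_ev_sq:
  assumes "Im \<tau> > 0"
  shows "(th \<tau> ev z)\<^sup>2 = th (2*\<tau>) ev 0 * th (2*\<tau>) ev (2*z) + th (2*\<tau>) od 0 * th (2*\<tau>) od (2*z)"
  using th_mult[OF assms sumdiff_ev_ev cl_disj, of z z] by (simp add: th_double power2_eq_square)

lemma th_od_sq:
  assumes "Im \<tau> > 0"
  shows "(th \<tau> od z)\<^sup>2 = th (2*\<tau>) od 0 * th (2*\<tau>) ev (2*z) + th (2*\<tau>) ev 0 * th (2*\<tau>) od (2*z)"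
  using th_mult[OF assms sumdiff_odd_odd cl_disj, of z z] by (simp add: th_double power2_eq_square)

lemma th_od_ev:
  assumes "Im \<tau> > 0"
  shows "th \<tau> od x * th \<tau> ev y = th (\<tau>/2) (cl 4 1) ((x+y)/2) * th (\<tau>/2) (cl 4 1) ((x-y)/2)
     + th (\<tau>/2) (cl 4 1) (-((x+y)/2)) * th (\<tau>/2) (cl 4 1) (-((x-y)/2))"
  using th_mult[OF assms sumdiff_odd_ev cl_disj, of x y] by (simp add: th_even(3))

lemma th_od_split:
  assumes "Im \<tau> > 0" shows "th \<tau> od z = th \<tau> (cl 4 1) z + th \<tau> (cl 4 1) (-z)"
proof -
  have "od = cl 4 1 \<union> cl 4 3" unfolding cl_def set_eq_iff Un_iff mem_Collect_eq by presburger
  thus ?thesis using th_union[OF assms cl_disj[of 1 3 4], of z] by (simp add: th_even(3))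
qed

lemma th_ev_split:
  assumes "Im \<tau> > 0" shows "th (\<tau>/2) ev z = th (2*\<tau>) ev (2*z) + th (2*\<tau>) od (2*z)"
proof -
  have "ev = cl 4 0 \<union> cl 4 2" unfolding cl_def set_eq_iff Un_iff mem_Collect_eq by presburger
  thus ?thesis using th_union[of "\<tau>/2", OF _ cl_disj[of 0 2 4], of z] assms by (simp add: th_double)
qed

lemma th_sq_add:
  assumes "Im \<tau> > 0"
  shows "(th \<tau> ev z)\<^sup>2 + (th \<tau> od z)\<^sup>2 = th (\<tau>/2) ev 0 * th (\<tau>/2) ev z"
  unfolding th_ev_sq[OF assms] th_od_sq[OF assms] th_ev_split[OF assms] by (simp add: algebra_simps)

lemma th_ev_od_double:
  assumes "Im \<tau> > 0"
  shows "2 * th \<tau> od z * th \<tau> ev z = th (\<tau>/2) od 0 * th (\<tau>/2) od z"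
proof -
  have "Im (\<tau>/2) > 0" using assms by simp
  from th_od_split[OF this, of 0] th_od_split[OF this, of z] th_od_ev[OF assms, of z z] show ?thesis
    by (simp add: algebra_simps)
qed

lemma exp_i_int_pi: "exp (\<i> * of_int k * of_real pi) = (-1) powi k"
  using exp_power_int[of "\<i> * of_real pi" k] by (simp add: mult_ac)

lemma th_shift_pi:
  "th \<tau> ev (z + of_real pi) = th \<tau> ev z" "th \<tau> od (z + of_real pi) = - th \<tau> od z"
  "th \<tau> (cl 4 1) (z + of_real pi / 2) = \<i> * th \<tau> (cl 4 1) z"
proof -
  have "exp (\<i> * of_int k * of_real pi) = 1" if "k \<in> ev" for k
    using that unfolding exp_i_int_pi cl_def mem_Collect_eq even_iff_mod_2_eq_zero[symmetric]
      odd_iff_mod_2_eq_one[symmetric] by (simp add: power_int_minus_left)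
  from th_shift[OF this] show "th \<tau> ev (z + of_real pi) = th \<tau> ev z" by simp
  have "exp (\<i> * of_int k * of_real pi) = -1" if "k \<in> od" for k
    using that unfolding exp_i_int_pi cl_def mem_Collect_eq even_iff_mod_2_eq_zero[symmetric]
      odd_iff_mod_2_eq_one[symmetric] by (simp add: power_int_minus_left)
  from th_shift[OF this] show "th \<tau> od (z + of_real pi) = - th \<tau> od z" by simp
  have "exp (\<i> * (of_real pi/2)) = \<i>"
    using cis_conv_exp[of "pi/2"] by simp
  hence "exp (\<i> * of_int k * (of_real pi/2)) = \<i>" if "k \<in> cl 4 1" for k
    using exp_i_half_pi_mult[OF that] by simp
  from th_shift[OF this] show "th \<tau> (cl 4 1) (z + of_real pi/2) = \<i> * th \<tau> (cl 4 1) z" by simp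
qed

section \<open>Jacobi's theta_1 and theta_4: Wronskian and differential equation of their
  quotient\<close>

definition t1 :: "complex \<Rightarrow> complex \<Rightarrow> complex" where "t1 \<tau> z = th \<tau> od (z - of_real pi / 2)"
definition t4 :: "complex \<Rightarrow> complex \<Rightarrow> complex" where "t4 \<tau> z = th \<tau> ev (z + of_real pi / 2)"

lemma t1_sq:
  assumes "Im \<tau> > 0"
  shows "(t1 \<tau> z)\<^sup>2 = th (2*\<tau>) od 0 * th (2*\<tau>) ev (2*z) - th (2*\<tau>) ev 0 * th (2*\<tau>) od (2*z)"
  using th_od_sq[OF assms, of "z - of_real pi / 2"] th_shift_pi(1)[of "2*\<tau>" "2*z - of_real pi"]
    th_shift_pi(2)[of "2*\<tau>" "2*z - of_real pi"] by (simp add: t1_def algebra_simps)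

lemma t4_sq:
  assumes "Im \<tau> > 0"
  shows "(t4 \<tau> z)\<^sup>2 = th (2*\<tau>) ev 0 * th (2*\<tau>) ev (2*z) - th (2*\<tau>) od 0 * th (2*\<tau>) od (2*z)"
  using th_ev_sq[OF assms, of "z + of_real pi / 2"] th_shift_pi(1,2)[of "2*\<tau>" "2*z"]
  by (simp add: t4_def algebra_simps)

text \<open>With s and d the half sum and the half difference,
  \<open>t1 \<tau> x * t4 \<tau> y\<close> is -i (F(s) F(d) - F(-s) F(-d)). Exchanging x and y
  changes only the sign of d, so the difference factors as -i (F(s) + F(-s)) (F(d) - F(-d)), and
  F(s) + F(-s) is the full series over the odd numbers.\<close>

lemma t1_t4_wronski:
  fixes \<tau> x y :: complex
  defines "F \<equiv> th (\<tau>/2) (cl 4 1)"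
  assumes "Im \<tau> > 0"
  shows "t1 \<tau> x * t4 \<tau> y - t1 \<tau> y * t4 \<tau> x = - \<i> * th (\<tau>/2) od ((x+y)/2) * (F ((x-y)/2) - F (-((x-y)/2)))"
proof -
  have p: "t1 \<tau> x * t4 \<tau> y = - \<i> * (F ((x+y)/2) * F ((x-y)/2) - F (-((x+y)/2)) * F (-((x-y)/2)))" for x y
  proof -
    have 1: "F ((x-y)/2) = \<i> * F ((x-y)/2 - of_real pi/2)"
      using th_shift_pi(3)[of "\<tau>/2" "(x-y)/2 - of_real pi/2"] by (simp add: F_def)
    have 2: "F (-((x-y)/2) + of_real pi/2) = \<i> * F (-((x-y)/2))"
      using th_shift_pi(3)[of "\<tau>/2" "-((x-y)/2)"] by (simp add: F_def)
    have "((x - of_real pi/2) + (y + of_real pi/2))/2 = (x+y)/2" "((x - of_real pi/2) - (y + of_real pi/2))/2 = (x-y)/2 - of_real pi/2"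
         "- (((x - of_real pi/2) - (y + of_real pi/2))/2) = - ((x-y)/2) + of_real pi/2"
      by (simp_all add: field_simps)
    from th_od_ev[OF assms(2), of "x - of_real pi/2" "y + of_real pi/2", unfolded this, folded F_def, unfolded 2]
    show ?thesis unfolding t1_def t4_def 1 by (simp add: algebra_simps 2[unfolded add.commute[of "- _"] add_uminus_conv_diff])
  qed
  have "th (\<tau>/2) od ((x+y)/2) = F ((x+y)/2) + F (-((x+y)/2))"
    using assms th_od_split[of "\<tau>/2"] by (simp add: F_def)
  moreover have "(y + x)/2 = (x+y)/2" "(y-x)/2 = -((x-y)/2)" "-(-((x-y)/2)) = (x-y)/2" by (simp_all add: field_simps)
  ultimately show ?thesis unfolding p by (simp only:) (simp add: algebra_simps)
qed

lemma t1_t4_holomorphic: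
  assumes "Im \<tau> > 0" shows "t1 \<tau> holomorphic_on A" "t4 \<tau> holomorphic_on A"
proof -
  have "(th \<tau> od \<circ> (\<lambda>z. z - of_real pi / 2)) holomorphic_on A" "(th \<tau> ev \<circ> (\<lambda>z. z + of_real pi / 2)) holomorphic_on A"
    by (intro holomorphic_on_compose holomorphic_intros th_holomorphic assms)+
  thus "t1 \<tau> holomorphic_on A" "t4 \<tau> holomorphic_on A" by (simp_all add: o_def t1_def[abs_def] t4_def[abs_def])
qed

lemma t1_t4_deriv:
  assumes "Im \<tau> > 0"
  shows "(t1 \<tau> has_field_derivative deriv (t1 \<tau>) z) (at z)" "(t4 \<tau> has_field_derivative deriv (t4 \<tau>) z) (at z)"
  using t1_t4_holomorphic[OF assms, of UNIV] by (auto intro: holomorphic_derivI)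

text \<open>Differentiate the preceding factorization in x at x = z. Its last factor vanishes there,
  so only the derivative of that factor survives, and its two halves add up to F'(0).\<close>

lemma t1_t4_wronskian:
  fixes \<tau> z :: complex
  assumes "Im \<tau> > 0"
  shows "deriv (t1 \<tau>) z * t4 \<tau> z - t1 \<tau> z * deriv (t4 \<tau>) z = - \<i> * th (\<tau>/2) od z * deriv (th (\<tau>/2) (cl 4 1)) 0"
proof -
  define F where "F = th (\<tau>/2) (cl 4 1)"
  define G where "G = th (\<tau>/2) od"
  have \<tau>2: "Im (\<tau>/2) > 0" using assms by simp
  have F: "(F has_field_derivative deriv F 0) (at 0)" and G: "(G has_field_derivative deriv G z) (at z)"
    unfolding F_def G_def using th_holomorphic[OF \<tau>2, of _ UNIV] by (auto intro: holomorphic_derivI)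
  have d1: "((\<lambda>x. F ((x-z)/2)) has_field_derivative deriv F 0 * (1/2)) (at z)"
    by (rule DERIV_chain2[of F]) (use F in \<open>auto intro!: derivative_eq_intros\<close>)
  have d2: "((\<lambda>x. F (-((x-z)/2))) has_field_derivative deriv F 0 * (-1/2)) (at z)"
    by (rule DERIV_chain2[of F]) (use F in \<open>auto intro!: derivative_eq_intros\<close>)
  have d3: "((\<lambda>x. G ((x+z)/2)) has_field_derivative deriv G z * (1/2)) (at z)"
    by (rule DERIV_chain2[of G]) (use G in \<open>auto intro!: derivative_eq_intros\<close>)
  have "((\<lambda>x. t1 \<tau> x * t4 \<tau> z - t1 \<tau> z * t4 \<tau> x) has_field_derivative
        (deriv (t1 \<tau>) z * t4 \<tau> z - t1 \<tau> z * deriv (t4 \<tau>) z)) (at z)"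
    by (auto intro!: derivative_eq_intros t1_t4_deriv[OF assms])
  moreover have "((\<lambda>x. - \<i> * G ((x+z)/2) * (F ((x-z)/2) - F (-((x-z)/2)))) has_field_derivative
        - \<i> * G z * deriv F 0) (at z)"
    by (rule derivative_eq_intros d1 d2 d3 refl)+ (simp add: field_simps)
  ultimately show ?thesis
    unfolding t1_t4_wronski[OF assms] F_def[symmetric] G_def[symmetric] by (rule DERIV_unique)
qed

text \<open>The theta constants \<open>\<theta>\<^sub>2(0)\<close> and \<open>\<theta>\<^sub>3(0)\<close>.\<close>

abbreviation "c2 \<tau> \<equiv> th \<tau> od 0"
abbreviation "c3 \<tau> \<equiv> th \<tau> ev 0"

lemma theta_consts:
  assumes "Im \<tau> > 0"
  shows "(c3 \<tau>)\<^sup>2 = (c3 (2*\<tau>))\<^sup>2 + (c2 (2*\<tau>))\<^sup>2" "(c2 \<tau>)\<^sup>2 = 2 * c3 (2*\<tau>) * c2 (2*\<tau>)"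
    "(t4 \<tau> 0)\<^sup>2 = (c3 (2*\<tau>))\<^sup>2 - (c2 (2*\<tau>))\<^sup>2"
  using th_ev_sq[OF assms, of 0] th_od_sq[OF assms, of 0] t4_sq[OF assms, of 0]
  by (simp_all add: power2_eq_square)

text \<open>The square of the Wronskian is a multiple of the square of
  \<open>th (\<tau>/2) od z\<close>, hence a linear combination of E^2 + Q^2 and Q E, where E and Q
  are the two basic series at 2\<tau> and 2z. The squares of \<open>t1\<close> and \<open>t4\<close>
  are linear in E and Q with determinant a^2 - b^2, which is the square of
  \<open>t4 \<tau> 0\<close>; so the squared Wronskian is a quadratic form in them.\<close>

lemma theta_ode:
  assumes \<tau>: "Im \<tau> > 0" and nz: "c2 \<tau> \<noteq> 0" "c3 \<tau> \<noteq> 0" "t4 \<tau> 0 \<noteq> 0"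
  obtains K where "\<And>z. (deriv (t1 \<tau>) z * t4 \<tau> z - t1 \<tau> z * deriv (t4 \<tau>) z)\<^sup>2 =
     K * ((t1 \<tau> z)^4 + (t4 \<tau> z)^4 - ((c2 \<tau>)\<^sup>2/(c3 \<tau>)\<^sup>2 + (c3 \<tau>)\<^sup>2/(c2 \<tau>)\<^sup>2) * ((t1 \<tau> z)\<^sup>2 * (t4 \<tau> z)\<^sup>2))"
proof -
  define D where "D = deriv (th (\<tau>/2) (cl 4 1)) 0"
  define a b where "a = c3 (2*\<tau>)" "b = c2 (2*\<tau>)"
  define p r where "p = c2 \<tau>" "r = c3 \<tau>"
  have \<tau>2: "Im (2*\<tau>) > 0" "Im (\<tau>/2) > 0" using \<tau> by auto
  have r2: "r\<^sup>2 = a\<^sup>2 + b\<^sup>2" and p2: "p\<^sup>2 = 2*a*b" and ab: "a\<^sup>2 - b\<^sup>2 \<noteq> 0"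
    using theta_consts[OF \<tau>] nz by (auto simp: a_b_def p_r_def)
  have pr0: "p \<noteq> 0" "r \<noteq> 0" using nz by (auto simp: p_r_def)
  show ?thesis
  proof (rule that[of "- 2 * D\<^sup>2 * p * r / (a\<^sup>2 - b\<^sup>2)\<^sup>2"])
    fix z
    define E Q where "E = th (2*\<tau>) ev (2*z)" "Q = th (2*\<tau>) od (2*z)"
    define W X Y where "W = deriv (t1 \<tau>) z * t4 \<tau> z - t1 \<tau> z * deriv (t4 \<tau>) z" "X = t1 \<tau> z" "Y = t4 \<tau> z"
    have "W = - \<i> * th (\<tau>/2) od z * D" using t1_t4_wronskian[OF \<tau>] by (simp add: D_def W_X_Y_def)
    hence W: "W\<^sup>2 = - D\<^sup>2 * (th (\<tau>/2) od z)\<^sup>2" by (simp add: power_mult_distrib)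
    have s: "(th (\<tau>/2) od z)\<^sup>2 = p * th \<tau> ev (2*z) + r * th \<tau> od (2*z)"
      using th_od_sq[OF \<tau>2(2), of z] by (simp add: p_r_def)
    have EQ1: "E\<^sup>2 + Q\<^sup>2 = r * th \<tau> ev (2*z)"
      using th_sq_add[OF \<tau>2(1), of "2*z"] by (simp add: E_Q_def p_r_def)
    have EQ2: "2 * Q * E = p * th \<tau> od (2*z)"
      using th_ev_od_double[OF \<tau>2(1), of "2*z"] by (simp add: E_Q_def p_r_def)
    have X2: "X\<^sup>2 = b * E - a * Q" and Y2: "Y\<^sup>2 = a * E - b * Q"
      using t1_sq[OF \<tau>, of z] t4_sq[OF \<tau>, of z] by (simp_all add: a_b_def E_Q_def W_X_Y_def)
    have "p * r * W\<^sup>2 = - D\<^sup>2 * (p * r * (th (\<tau>/2) od z)\<^sup>2)" unfolding W by (simp add: algebra_simps)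
    also have "p * r * (th (\<tau>/2) od z)\<^sup>2 = p\<^sup>2 * (E\<^sup>2 + Q\<^sup>2) + r\<^sup>2 * (2 * Q * E)"
      unfolding s EQ1 EQ2 by (simp add: algebra_simps power2_eq_square)
    finally have "p * r * W\<^sup>2 = - D\<^sup>2 * (p\<^sup>2 * (E\<^sup>2 + Q\<^sup>2) + r\<^sup>2 * (2 * Q * E))" .
    hence "(p * r * W\<^sup>2) * (a\<^sup>2 - b\<^sup>2)\<^sup>2 = (- D\<^sup>2 * (p\<^sup>2 * (E\<^sup>2 + Q\<^sup>2) + r\<^sup>2 * (2 * Q * E))) * (a\<^sup>2 - b\<^sup>2)\<^sup>2" by simp
    also have "\<dots> = - 2 * D\<^sup>2 * (p\<^sup>2 * r\<^sup>2 * (X\<^sup>2*X\<^sup>2 + Y\<^sup>2*Y\<^sup>2) - (p\<^sup>2*p\<^sup>2 + r\<^sup>2*r\<^sup>2) * (X\<^sup>2 * Y\<^sup>2))"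
      unfolding p2 r2 X2 Y2 by algebra
    finally have m: "(p * r * W\<^sup>2) * (a\<^sup>2 - b\<^sup>2)\<^sup>2 = - 2 * D\<^sup>2 * (p\<^sup>2 * r\<^sup>2 * (X\<^sup>2*X\<^sup>2 + Y\<^sup>2*Y\<^sup>2) - (p\<^sup>2*p\<^sup>2 + r\<^sup>2*r\<^sup>2) * (X\<^sup>2 * Y\<^sup>2))" .
    define g where "g = a\<^sup>2 - b\<^sup>2"
    have "W\<^sup>2 = - 2 * D\<^sup>2 * p * r / g\<^sup>2 * (X^4 + Y^4 - (p\<^sup>2/r\<^sup>2 + r\<^sup>2/p\<^sup>2) * (X\<^sup>2 * Y\<^sup>2))"
      using m[folded g_def] pr0 ab[folded g_def] by (simp add: divide_simps) algebra
    thus "(deriv (t1 \<tau>) z * t4 \<tau> z - t1 \<tau> z * deriv (t4 \<tau>) z)\<^sup>2 =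
     - 2 * D\<^sup>2 * p * r / (a\<^sup>2 - b\<^sup>2)\<^sup>2 * ((t1 \<tau> z)^4 + (t4 \<tau> z)^4 - ((c2 \<tau>)\<^sup>2/(c3 \<tau>)\<^sup>2 + (c3 \<tau>)\<^sup>2/(c2 \<tau>)\<^sup>2) * ((t1 \<tau> z)\<^sup>2 * (t4 \<tau> z)\<^sup>2))"
      by (simp add: W_X_Y_def p_r_def g_def)
  qed
qed

text \<open>The theta constants as power series in \<open>p = exp (\<i> * pi * \<tau> / 4)\<close>, divided by their leading
  power \<open>p ^ m\<close>.\<close>

definition nseries :: "int set \<Rightarrow> nat \<Rightarrow> complex \<Rightarrow> complex" where
  "nseries S m p = (\<Sum>\<^sub>\<infinity>k\<in>S. p ^ (nat (k\<^sup>2) - m))"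

text \<open>k^2 \<ge> |k|, and the truncated subtraction of \<open>m\<close> in the exponent costs
  at most the factor exp m.\<close>

lemma nseries_bound:
  fixes p :: complex
  assumes "norm p \<le> exp (-1)"
  shows "norm (p ^ (nat (k\<^sup>2) - m)) \<le> exp (real m) * exp (- \<bar>real_of_int k\<bar>)"
proof -
  have "norm (p ^ (nat (k\<^sup>2) - m)) \<le> exp (-1) ^ (nat (k\<^sup>2) - m)"
    unfolding norm_power by (rule power_mono[OF assms norm_ge_zero])
  also have "\<dots> = exp (- real (nat (k\<^sup>2) - m))" using exp_of_nat_mult[of "nat (k\<^sup>2) - m" "-1::real"] by simp
  also have "\<dots> \<le> exp (real m - \<bar>real_of_int k\<bar>)"
  proof (subst exp_le_cancel_iff)
    have "\<bar>k\<bar> \<le> k\<^sup>2" by (metis abs_le_square_iff abs_power2 int_one_le_iff_zero_less less_le_not_le linorder_not_le mult_le_cancel_right1 power2_eq_square abs_mult_self_eq abs_zero mult_cancel_right1 order_refl zero_less_abs_iff)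
    hence "\<bar>real_of_int k\<bar> \<le> real (nat (k\<^sup>2))" by (metis of_int_abs of_int_le_iff of_int_of_nat_eq of_nat_nat zero_le_power2)
    moreover have "real (nat (k\<^sup>2)) \<le> real m + real (nat (k\<^sup>2) - m)" by linarith
    ultimately show "- real (nat (k\<^sup>2) - m) \<le> real m - \<bar>real_of_int k\<bar>" by linarith
  qed
  finally show ?thesis by (simp add: exp_diff exp_minus field_simps)
qed

lemma nseries_holomorphic: "nseries S m holomorphic_on ball 0 (exp (-1))"
proof -
  have ul: "uniform_limit (cball 0 (exp (-1))) (\<lambda>F p. \<Sum>k\<in>F. p ^ (nat (k\<^sup>2) - m)) (nseries S m) (finite_subsets_at_top S)"
    unfolding nseries_def
  proof (rule Weierstrass_m_test_general)
    show "norm (p ^ (nat (k\<^sup>2) - m)) \<le> exp (real m) * exp (- \<bar>real_of_int k\<bar>)"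
      if "p \<in> cball 0 (exp (-1))" for p :: complex and k
      using that nseries_bound by simp
    show "(\<lambda>k::int. exp (real m) * exp (- \<bar>real_of_int k\<bar>)) summable_on S"
      by (rule summable_on_cmult_right, rule summable_on_subset_banach[OF summable_exp_abs_int]) simp
  qed
  show ?thesis
  proof (rule holomorphic_uniform_limit[OF _ ul])
    show "\<forall>\<^sub>F F in finite_subsets_at_top S. continuous_on (cball 0 (exp (-1))) (\<lambda>p::complex. \<Sum>k\<in>F. p ^ (nat (k\<^sup>2) - m)) \<and>
          (\<lambda>p. \<Sum>k\<in>F. p ^ (nat (k\<^sup>2) - m)) holomorphic_on ball 0 (exp (-1))"
      by (intro always_eventually allI conjI holomorphic_intros continuous_intros)
  qed auto
qed

text \<open>At 0 only the terms with exponent 0 survive, by 0 ^ 0 = 1. For odd k the exponent k^2 -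
  1 vanishes exactly at k = 1 and k = -1.\<close>

lemma nseries_at_0: "nseries ev 0 0 = 1" "nseries od 1 0 = 2"
proof -
  have "nseries ev 0 0 = (\<Sum>\<^sub>\<infinity>k\<in>{0::int}. 1)" unfolding nseries_def
    by (rule infsum_cong_neutral) (auto simp: cl_def power_0_left)
  thus "nseries ev 0 0 = 1" by simp
  have *: "k = 1 \<or> k = -1" if "k mod 2 = 1" "nat (k\<^sup>2) \<le> 1" for k :: int
  proof -
    have "k\<^sup>2 \<le> 1" using that(2) by simp
    hence "\<bar>k\<bar> \<le> 1" by (simp add: abs_square_le_1)
    thus ?thesis using that(1) by (auto simp: abs_le_iff)
  qed
  have "nseries od 1 0 = (\<Sum>\<^sub>\<infinity>k\<in>{1,-1::int}. 1)" unfolding nseries_def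
    by (rule infsum_cong_neutral) (auto simp: cl_def power_0_left dest!: *)
  thus "nseries od 1 0 = 2" by simp
qed

text \<open>For k = 2j the number exp (i \<pi> / 4) has k^2-th power (-1)^(j^2) = (-1)^j, so
  \<open>t4 \<tau> 0\<close> is the same power series as \<open>c3 \<tau>\<close>, taken at a
  rotated argument.\<close>

lemma th_nseries:
  assumes "Im \<tau> > 0" defines "p \<equiv> exp (\<i> * of_real pi * \<tau> / 4)"
  shows "c3 \<tau> = nseries ev 0 p" "c2 \<tau> = p * nseries od 1 p" "t4 \<tau> 0 = nseries ev 0 (exp (\<i> * of_real pi / 4) * p)"
proof -
  have t: "th_term \<tau> 0 k = p ^ nat (k\<^sup>2)" for k
  proof -
    have "p ^ nat (k\<^sup>2) = exp (of_nat (nat (k\<^sup>2)) * (\<i> * of_real pi * \<tau> / 4))"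
      unfolding p_def by (simp only: exp_of_nat_mult)
    also have "of_nat (nat (k\<^sup>2)) = (of_int k :: complex)\<^sup>2" by (simp add: of_nat_nat)
    finally show ?thesis unfolding th_term_def by (simp add: mult_ac)
  qed
  show "c3 \<tau> = nseries ev 0 p" unfolding th_def nseries_def by (rule infsum_cong) (simp add: t)
  have "nat (k\<^sup>2) = Suc (nat (k\<^sup>2) - 1)" if "k \<in> od" for k
  proof -
    have "k \<noteq> 0" using that by (auto simp: cl_def)
    hence "k\<^sup>2 > 0" by simp
    thus ?thesis by simp
  qed
  hence "p ^ nat (k\<^sup>2) = p * p ^ (nat (k\<^sup>2) - 1)" if "k \<in> od" for k using that by (metis power_Suc)
  thus "c2 \<tau> = p * nseries od 1 p" unfolding th_def nseries_def infsum_cmult_right'[symmetric]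
    by (intro infsum_cong) (simp add: t)
  have "th_term \<tau> (of_real pi/2) k = (exp (\<i> * of_real pi / 4) * p) ^ nat (k\<^sup>2)" if k: "k \<in> ev" for k
  proof -
    obtain j where j: "k = 2*j" using k unfolding cl_def mem_Collect_eq even_iff_mod_2_eq_zero[symmetric] dvd_def by blast
    have "exp (\<i> * of_real pi / 4) ^ nat (k\<^sup>2) = exp (of_nat (nat (k\<^sup>2)) * (\<i> * of_real pi / 4))"
      by (simp only: exp_of_nat_mult)
    also have "of_nat (nat (k\<^sup>2)) = (of_int (4*j\<^sup>2) :: complex)" by (simp add: of_nat_nat j power_mult_distrib)
    also have "of_int (4*j\<^sup>2) * (\<i> * of_real pi / 4) = \<i> * of_int (j\<^sup>2) * of_real pi" by (simp add: mult_ac)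
    also have "exp \<dots> = (-1) powi j" unfolding exp_i_int_pi by (simp add: power_int_minus_left)
    finally have "exp (\<i> * of_real pi / 4) ^ nat (k\<^sup>2) = (-1) powi j" .
    moreover have "th_term \<tau> (of_real pi/2) k = th_term \<tau> 0 k * exp (\<i> * of_int j * of_real pi)"
      unfolding th_term_def exp_add[symmetric] by (rule arg_cong[where f = exp]) (simp add: j)
    ultimately show ?thesis unfolding t exp_i_int_pi by (simp add: power_mult_distrib)
  qed
  thus "t4 \<tau> 0 = nseries ev 0 (exp (\<i> * of_real pi / 4) * p)" unfolding t4_def th_def nseries_def
    by (intro infsum_cong) simp
qed

lemma nseries_nz:
  obtains d where "0 < d" "d \<le> exp (-1)" "\<And>p. norm p < d \<Longrightarrow> nseries ev 0 p \<noteq> 0" "\<And>p. norm p < d \<Longrightarrow> nseries od 1 p \<noteq> 0"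
proof -
  have c: "isCont (nseries S m) 0" for S m
    using holomorphic_on_imp_continuous_on[OF nseries_holomorphic] by (simp add: continuous_on_eq_continuous_at)
  obtain d1 where d1: "d1 > 0" "\<And>p. dist 0 p < d1 \<Longrightarrow> nseries ev 0 p \<noteq> 0"
    using continuous_at_avoid[OF c, of ev 0 0] nseries_at_0 by auto
  obtain d2 where d2: "d2 > 0" "\<And>p. dist 0 p < d2 \<Longrightarrow> nseries od 1 p \<noteq> 0"
    using continuous_at_avoid[OF c, of od 1 0] nseries_at_0 by auto
  show ?thesis using d1 d2 by (intro that[of "min (min d1 d2) (exp (-1))"]) auto
qed

text \<open>For large Im \<tau> the leading terms dominate. In general one descends from 2\<tau> to
  \<tau>: the product of the squares of \<open>c3 \<tau>\<close> and \<open>t4 \<tau> 0\<close> is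
  the fourth power of \<open>t4 (2*\<tau>) 0\<close>, and the square of \<open>c2 \<tau>\<close> is
  \<open>2 * c3 (2*\<tau>) * c2 (2*\<tau>)\<close>.\<close>

lemma theta_consts_nonzero:
  assumes "Im \<tau> > 0" shows "c2 \<tau> \<noteq> 0" "c3 \<tau> \<noteq> 0" "t4 \<tau> 0 \<noteq> 0"
proof -
  define P where "P \<tau> = (c2 \<tau> \<noteq> 0 \<and> c3 \<tau> \<noteq> 0 \<and> t4 \<tau> 0 \<noteq> 0)" for \<tau>
  obtain d where d: "0 < d" "d \<le> exp (-1)" "\<And>p. norm p < d \<Longrightarrow> nseries ev 0 p \<noteq> 0" "\<And>p. norm p < d \<Longrightarrow> nseries od 1 p \<noteq> 0"
    using nseries_nz by blast
  have large: "P \<tau>" if "Im \<tau> > - 4 * ln d / pi" "Im \<tau> > 0" for \<tau>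
  proof -
    define p where "p = exp (\<i> * of_real pi * \<tau> / 4)"
    have "- (pi * Im \<tau> / 4) < ln d" using that(1) by (simp add: field_simps)
    hence "exp (- (pi * Im \<tau> / 4)) < exp (ln d)" by (subst exp_less_cancel_iff)
    moreover have "norm p = exp (- (pi * Im \<tau> / 4))" by (simp add: p_def)
    ultimately have "norm p < d" using d(1) by simp
    moreover have "norm (exp (\<i> * of_real pi / 4) * p) = norm p" by (simp add: norm_mult)
    moreover have "p \<noteq> 0" by (simp add: p_def)
    ultimately show ?thesis unfolding P_def th_nseries[OF that(2)] p_def[symmetric] using d by auto
  qed
  have step: "P \<tau>" if "P (2*\<tau>)" "Im \<tau> > 0" for \<tau>
  proof -
    have 2: "Im (2*\<tau>) > 0" using that by simp
    define a b where "a = c3 (2*\<tau>)" "b = c2 (2*\<tau>)"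
    define A B where "A = c3 (2*(2*\<tau>))" "B = c2 (2*(2*\<tau>))"
    have "(c3 \<tau>)\<^sup>2 * (t4 \<tau> 0)\<^sup>2 = a\<^sup>2*a\<^sup>2 - b\<^sup>2*b\<^sup>2" 
      unfolding theta_consts[OF that(2)] a_b_def by (simp add: algebra_simps)
    moreover have "a\<^sup>2 = A\<^sup>2+B\<^sup>2" "b\<^sup>2 = 2*A*B" using theta_consts[OF 2] by (simp_all add: a_b_def A_B_def)
    ultimately have "(c3 \<tau>)\<^sup>2 * (t4 \<tau> 0)\<^sup>2 = (A\<^sup>2-B\<^sup>2)\<^sup>2" by algebra
    moreover have "A\<^sup>2 - B\<^sup>2 = (t4 (2*\<tau>) 0)\<^sup>2" using theta_consts[OF 2] by (simp_all add: A_B_def)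
    ultimately have "c3 \<tau> \<noteq> 0" "t4 \<tau> 0 \<noteq> 0" using that(1) by (auto simp: P_def)
    moreover have "c2 \<tau> \<noteq> 0" using theta_consts(2)[OF that(2)] that(1) by (auto simp: P_def)
    ultimately show ?thesis by (simp add: P_def)
  qed
  have i: "Im (2^n*\<tau>) = 2^n * Im \<tau>" for n
    by (induction n) (simp_all add: mult.assoc)
  have "P (2^n * \<tau>) \<Longrightarrow> P \<tau>" for n
  proof (induction n)
    case (Suc n)
    have "P (2 * (2^n*\<tau>))" using Suc.prems by (simp add: mult_ac)
    moreover have "Im (2^n*\<tau>) > 0" unfolding i using assms by simp
    ultimately show ?case using step Suc.IH by blast
  qed simp
  moreover obtain n where n: "- 4 * ln d / pi / Im \<tau> < 2^n" using real_arch_pow[of 2] by auto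
  have "P (2^n * \<tau>)"
  proof (rule large)
    show "- 4 * ln d / pi < Im (2^n * \<tau>)" unfolding i using n assms by (subst (asm) pos_divide_less_eq) auto
    show "0 < Im (2^n * \<tau>)" unfolding i using assms by simp
  qed
  ultimately have "P \<tau>" by blast
  thus "c2 \<tau> \<noteq> 0" "c3 \<tau> \<noteq> 0" "t4 \<tau> 0 \<noteq> 0" by (auto simp: P_def)
qed

section \<open>Surjectivity of the elliptic modulus\<close>

definition modulus :: "complex \<Rightarrow> complex" where "modulus \<tau> = (c2 \<tau> / c3 \<tau>)\<^sup>2"

text \<open>The quotient is a nonconstant holomorphic function of p = exp (i \<pi> \<tau> / 4) that
  vanishes at p = 0, so by the open mapping theorem it covers a disc. A nonzero w comes from a
  nonzero p, whose logarithm gives \<tau>; |p| < 1 makes its imaginary part positive.\<close>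

lemma theta_ratio_small:
  obtains d where "d > 0" "\<And>w. norm w < d \<Longrightarrow> w \<noteq> 0 \<Longrightarrow> \<exists>\<tau>. Im \<tau> > 0 \<and> c2 \<tau> / c3 \<tau> = w"
proof -
  obtain e where e: "0 < e" "e \<le> exp (-1)" "\<And>p. norm p < e \<Longrightarrow> nseries ev 0 p \<noteq> 0" "\<And>p. norm p < e \<Longrightarrow> nseries od 1 p \<noteq> 0"
    using nseries_nz by blast
  define r where "r p = p * nseries od 1 p / nseries ev 0 p" for p
  have sub: "ball 0 e \<subseteq> ball 0 (exp (-1))" using e by auto
  have hol: "r holomorphic_on ball 0 e" unfolding r_def[abs_def]
    by (intro holomorphic_intros holomorphic_on_subset[OF nseries_holomorphic sub]) (use e in auto)
  have "\<not> r constant_on ball 0 e"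
  proof
    assume "r constant_on ball 0 e"
    hence "r (of_real (e/2)) = r 0" using e(1) unfolding constant_on_def by (metis centre_in_ball dist_0_norm mem_ball norm_of_real abs_of_pos half_gt_zero field_sum_of_halves less_add_same_cancel1)
    thus False using e(1) e(3,4)[of "of_real (e/2)"] by (simp add: r_def)
  qed
  hence "open (r ` ball 0 e)" by (intro open_mapping_thm[OF hol]) auto
  moreover have "0 \<in> r ` ball 0 e" using e(1) by (intro image_eqI[of _ _ 0]) (auto simp: r_def)
  ultimately obtain d where d: "d > 0" "ball 0 d \<subseteq> r ` ball 0 e" using open_contains_ball by blast
  show ?thesis
  proof (rule that[OF d(1)])
    fix w :: complex assume w: "norm w < d" "w \<noteq> 0"
    then obtain p where p: "norm p < e" "r p = w" using d(2) by (auto simp: subset_iff image_iff)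
    have p0: "p \<noteq> 0" using p w by (auto simp: r_def)
    define \<tau> where "\<tau> = - 4 * \<i> * Ln p / of_real pi"
    have t: "exp (\<i> * of_real pi * \<tau> / 4) = p" using p0 by (simp add: \<tau>_def)
    have "Im \<tau> = - 4 * ln (norm p) / pi" using p0 by (simp add: \<tau>_def)
    moreover have "ln (norm p) < 0"
    proof -
      have "norm p < 1" using p e(2) by (smt (verit) exp_le_one_iff)
      thus ?thesis using p0 by simp
    qed
    ultimately have "Im \<tau> > 0" by (simp add: divide_neg_pos)
    moreover from th_nseries[OF this] have "c2 \<tau> / c3 \<tau> = w" using p by (simp add: t r_def)
    ultimately show "\<exists>\<tau>. Im \<tau> > 0 \<and> c2 \<tau> / c3 \<tau> = w" by blast
  qed
qed

text \<open>The shift by 4 changes the sign of \<open>c2 \<tau> / c3 \<tau>\<close>, a square root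
  of the modulus. This gives access to the second root in \<open>landen_step\<close>.\<close>

lemma theta_consts_shift: "c2 (\<tau> + 4) = - c2 \<tau>" "c3 (\<tau> + 4) = c3 \<tau>"
proof -
  have t: "th_term (\<tau> + 4) 0 k = (-1) powi (k\<^sup>2) * th_term \<tau> 0 k" for k
    unfolding th_term_def exp_i_int_pi[symmetric] exp_add[symmetric]
    by (rule arg_cong[where f = exp]) (simp add: algebra_simps)
  have "th_term (\<tau> + 4) 0 k = - th_term \<tau> 0 k" if "k \<in> od" for k
    using that unfolding t cl_def mem_Collect_eq odd_iff_mod_2_eq_one[symmetric] by (simp add: power_int_minus_left)
  hence "c2 (\<tau> + 4) = (\<Sum>\<^sub>\<infinity>k\<in>od. - th_term \<tau> 0 k)" unfolding th_def by (rule infsum_cong)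
  thus "c2 (\<tau> + 4) = - c2 \<tau>" by (simp add: th_def infsum_uminus)
  have "th_term (\<tau> + 4) 0 k = th_term \<tau> 0 k" if "k \<in> ev" for k
    using that unfolding t cl_def mem_Collect_eq even_iff_mod_2_eq_zero[symmetric] by (simp add: power_int_minus_left)
  thus "c3 (\<tau> + 4) = c3 \<tau>" unfolding th_def by (rule infsum_cong)
qed

lemma modulus_half:
  assumes "Im \<tau> > 0" defines "r \<equiv> c2 \<tau> / c3 \<tau>"
  shows "modulus (\<tau>/2) = 2 * r / (1 + r\<^sup>2)"
proof -
  have "Im (\<tau>/2) > 0" using assms by simp
  from theta_consts(1,2)[OF this] have "modulus (\<tau>/2) = (2 * c3 \<tau> * c2 \<tau>) / ((c3 \<tau>)\<^sup>2 + (c2 \<tau>)\<^sup>2)"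
    by (simp add: modulus_def power_divide)
  also have "\<dots> = (2 * c3 \<tau> * c2 \<tau> / (c3 \<tau>)\<^sup>2) / (((c3 \<tau>)\<^sup>2 + (c2 \<tau>)\<^sup>2) / (c3 \<tau>)\<^sup>2)"
    using theta_consts_nonzero(2)[OF assms(1)] by simp
  also have "\<dots> = 2 * r / (1 + r\<^sup>2)"
    using theta_consts_nonzero(2)[OF assms(1)] by (simp add: r_def power2_eq_square add_divide_distrib)
  finally show ?thesis .
qed

text \<open>The equation determines k only up to sign: k = 2r / (1 + r^2) with r a square root of
  k1. The two square roots belong to \<tau> and \<tau> + 4, so both values are reached after
  halving.\<close>

lemma landen_step:
  assumes "Im \<tau> > 0" "modulus \<tau> = k1" "k\<^sup>2 * (1 + k1)\<^sup>2 = 4 * k1" "1 + k1 \<noteq> 0"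
  shows "\<exists>\<tau>. Im \<tau> > 0 \<and> modulus \<tau> = k"
proof -
  define r where "r = c2 \<tau> / c3 \<tau>"
  have r: "r\<^sup>2 = k1" using assms(2) by (simp add: modulus_def r_def)
  have "(k * (1 + r\<^sup>2))\<^sup>2 = (2*r)\<^sup>2" using assms(3) by (simp add: r power_mult_distrib)
  hence "k * (1 + r\<^sup>2) = 2*r \<or> k * (1 + r\<^sup>2) = - (2*r)" by (rule power2_eq_iff[THEN iffD1])
  hence c: "k = 2 * r / (1 + r\<^sup>2) \<or> k = 2 * (-r) / (1 + (-r)\<^sup>2)" using assms(4) by (auto simp: r field_simps)
  have "modulus (\<tau>/2) = 2 * r / (1 + r\<^sup>2)" unfolding r_def by (rule modulus_half[OF assms(1)])
  moreover have "modulus ((\<tau>+4)/2) = 2 * (-r) / (1 + (-r)\<^sup>2)"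
    using modulus_half[of "\<tau>+4"] assms(1) unfolding theta_consts_shift r_def by simp
  moreover have "Im (\<tau>/2) > 0" "Im ((\<tau>+4)/2) > 0" using assms(1) by auto
  ultimately show ?thesis using c by metis
qed

text \<open>Descending Landen transformation: \<open>k1 = (1 - k') / (1 + k')\<close> with \<open>k'\<^sup>2 = 1 - k\<^sup>2\<close> is
  the modulus at \<open>2 * \<tau>\<close> if \<open>k\<close> is the one at \<open>\<tau>\<close>, and iterating it tends to \<open>0\<close>.\<close>

definition landen :: "complex \<Rightarrow> complex" where
  "landen k = (1 - csqrt (1 - k\<^sup>2)) / (1 + csqrt (1 - k\<^sup>2))"

text \<open>Let s be the principal root of 1 - k^2, so Re s \<ge> 0. The identity |1 + s|^2 - |1 -
  s|^2 = 4 Re s decides between the inside and the boundary of the unit disc, and the quadratic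
  estimate comes from \<open>landen k\<close> times (1 + s)^2 being k^2, with |1 + s| \<ge>
  1.\<close>

lemma landen:
  assumes "k \<noteq> 0" "k \<noteq> 1" "k \<noteq> -1"
  shows "landen k \<noteq> 0" "landen k \<noteq> 1" "landen k \<noteq> -1" "k\<^sup>2 * (1 + landen k)\<^sup>2 = 4 * landen k"
    "norm k < 1 \<Longrightarrow> norm (landen k) \<le> (norm k)\<^sup>2"
    "Re (csqrt (1 - k\<^sup>2)) > 0 \<Longrightarrow> norm (landen k) < 1"
    "\<not> Re (csqrt (1 - k\<^sup>2)) > 0 \<Longrightarrow> norm (landen k) = 1"
proof -
  define s where "s = csqrt (1 - k\<^sup>2)"
  have s2: "s\<^sup>2 = 1 - k\<^sup>2" by (simp add: s_def)
  have re: "Re s \<ge> 0" using csqrt_principal[of "1 - k\<^sup>2"] by (auto simp: s_def)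
  have s1: "1 + s \<noteq> 0"
  proof
    assume "1 + s = 0" hence "Re (1 + s) = 0" by simp
    thus False using re by simp
  qed
  have s0: "s \<noteq> 0"
  proof
    assume "s = 0" hence "k\<^sup>2 = 1" using s2 by simp
    thus False using assms by (simp add: power2_eq_1_iff)
  qed
  have l: "landen k = (1 - s) / (1 + s)" by (simp add: landen_def s_def)
  have "s \<noteq> 1" using s2 assms(1) by auto
  thus "landen k \<noteq> 0" using s1 by (simp add: l)
  show "landen k \<noteq> 1" using s1 s0 by (simp add: l field_simps)
  show "landen k \<noteq> -1" using s1 by (simp add: l field_simps)
  have frac: "(1 - s) * t * (2 / t)\<^sup>2 = 4 * ((1 - s) / t)" "(1 - s) / t * t\<^sup>2 = (1 - s) * t" if "t \<noteq> 0" for t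
    using that by (simp_all add: field_simps power2_eq_square)
  have "1 + landen k = 2 / (1 + s)" using s1 by (simp add: l field_simps)
  moreover have k2: "k\<^sup>2 = (1 - s) * (1 + s)" using s2 by (simp add: algebra_simps power2_eq_square)
  ultimately show "k\<^sup>2 * (1 + landen k)\<^sup>2 = 4 * landen k" using frac(1)[OF s1] by (simp only: l)
  have n: "norm (landen k) = norm (1 - s) / norm (1 + s)" by (simp add: l norm_divide)
  have sq: "(norm (1 + s))\<^sup>2 = (norm (1 - s))\<^sup>2 + 4 * Re s"
    by (simp add: cmod_power2) (simp add: power2_eq_square algebra_simps)
  have np: "norm (1 + s) > 0" using s1 by simp
  show "Re (csqrt (1 - k\<^sup>2)) > 0 \<Longrightarrow> norm (landen k) < 1"
  proof -
    assume "Re (csqrt (1 - k\<^sup>2)) > 0"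
    hence "(norm (1 - s))\<^sup>2 < (norm (1 + s))\<^sup>2" using sq by (simp add: s_def)
    hence "norm (1 - s) < norm (1 + s)" by (rule power2_less_imp_less) simp
    thus ?thesis using np by (simp add: n)
  qed
  show "\<not> Re (csqrt (1 - k\<^sup>2)) > 0 \<Longrightarrow> norm (landen k) = 1"
  proof -
    assume "\<not> Re (csqrt (1 - k\<^sup>2)) > 0"
    hence "(norm (1 - s))\<^sup>2 = (norm (1 + s))\<^sup>2" using sq re by (simp add: s_def)
    hence "norm (1 - s) = norm (1 + s)" by simp
    thus ?thesis using np by (simp add: n)
  qed
  show "norm (landen k) \<le> (norm k)\<^sup>2" if "norm k < 1"
  proof -
    have "landen k * (1 + s)\<^sup>2 = k\<^sup>2" unfolding k2 l by (rule frac(2)[OF s1])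
    hence "norm (landen k) * (norm (1 + s))\<^sup>2 = (norm k)\<^sup>2" by (metis norm_mult norm_power)
    moreover have "1 \<le> norm (1 + s)" using complex_Re_le_cmod[of "1 + s"] re by simp
    hence "1 \<le> (norm (1 + s))\<^sup>2" by simp
    hence "norm (landen k) * 1 \<le> norm (landen k) * (norm (1 + s))\<^sup>2" by (rule mult_left_mono) simp
    ultimately show ?thesis by simp
  qed
qed

text \<open>Inside the unit disc the norms of the Landen iterates decrease quadratically. From any
  other k one step leads into the disc or onto its boundary, and from the boundary a second step
  leads inside.\<close>

lemma modulus_surj:
  assumes "k \<noteq> 0" "k \<noteq> 1" "k \<noteq> -1"
  obtains \<tau> where "Im \<tau> > 0" "modulus \<tau> = k"
proof -
  define R where "R k = (\<exists>\<tau>. Im \<tau> > 0 \<and> modulus \<tau> = k)" for k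
  obtain d where d: "d > 0" "\<And>w. norm w < d \<Longrightarrow> w \<noteq> 0 \<Longrightarrow> \<exists>\<tau>. Im \<tau> > 0 \<and> c2 \<tau> / c3 \<tau> = w"
    using theta_ratio_small by blast
  have step: "R k" if hyp: "R (landen k)" "k \<noteq> 0" "k \<noteq> 1" "k \<noteq> -1" for k
  proof -
    obtain \<tau> where "Im \<tau> > 0" "modulus \<tau> = landen k" using hyp(1) unfolding R_def by blast
    moreover have "1 + landen k \<noteq> 0" using landen(3)[OF that(2-4)] by (simp add: add_eq_0_iff)
    ultimately show ?thesis unfolding R_def using landen_step landen(4)[OF that(2-4)] by blast
  qed
  have 1: "R k" if hyp: "k \<noteq> 0" "norm k < 1" for k
  proof -
    \<comment> \<open>The threshold is d^2 and not d because \<open>theta_ratio_small\<close>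
      produces a square root of the modulus.\<close>
    have "norm k ^ (2^n) < d\<^sup>2 \<Longrightarrow> k \<noteq> 0 \<Longrightarrow> norm k < 1 \<Longrightarrow> R k" for n
    proof (induction n arbitrary: k)
      case 0
      have "(norm (csqrt k))\<^sup>2 < d\<^sup>2" using 0 by (simp flip: norm_power)
      hence "norm (csqrt k) < d" using d(1) by (simp add: power2_less_imp_less)
      then obtain \<tau> where "Im \<tau> > 0" "c2 \<tau> / c3 \<tau> = csqrt k" using d(2) 0 by (metis csqrt_eq_0)
      thus ?case unfolding R_def modulus_def by (metis power2_csqrt)
    next
      case (Suc n)
      have k: "k \<noteq> 1" "k \<noteq> -1" using Suc.prems by auto
      note L = landen[OF Suc.prems(2) k]
      have "norm (landen k) ^ (2^n) \<le> ((norm k)\<^sup>2) ^ (2^n)" by (rule power_mono[OF L(5)[OF Suc.prems(3)]]) simp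
      also have "\<dots> < d\<^sup>2" using Suc.prems(1) by (simp flip: power_mult)
      finally have "norm (landen k) ^ (2^n) < d\<^sup>2" .
      moreover have "norm (landen k) < 1"
        using L(5)[OF Suc.prems(3)] power_strict_mono[OF Suc.prems(3), of 2] by simp
      ultimately have "R (landen k)" using Suc.IH L(1) by blast
      thus ?case using step Suc.prems k by blast
    qed
    moreover obtain n where n: "norm k ^ n < d\<^sup>2" using real_arch_pow_inv[of "d\<^sup>2" "norm k"] d(1) hyp(2) by auto
    have "norm k ^ (2^n) \<le> norm k ^ n" using that by (intro power_decreasing) auto
    ultimately show ?thesis using n that by (meson le_less_trans)
  qed
  have "R k"
  proof (cases "Re (csqrt (1 - k\<^sup>2)) > 0")
    case True
    thus ?thesis using step 1 landen(1,6)[OF assms] assms by blast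
  next
    case False
    define k1 where "k1 = landen k"
    have k1: "norm k1 = 1" "k1 \<noteq> 0" "k1 \<noteq> 1" "k1 \<noteq> -1" using landen[OF assms] False by (auto simp: k1_def)
    \<comment> \<open>Otherwise 1 - k1^2, being the square of an imaginary number, is real and \<le>
      0; then k1^2 \<ge> 1 is real of norm 1, so k1^2 = 1, which is excluded.\<close>
    have "Re (csqrt (1 - k1\<^sup>2)) > 0"
    proof (rule ccontr)
      assume "\<not> Re (csqrt (1 - k1\<^sup>2)) > 0"
      hence "Re (csqrt (1 - k1\<^sup>2)) = 0" using csqrt_principal[of "1 - k1\<^sup>2"] by auto
      hence "Re ((csqrt (1 - k1\<^sup>2))\<^sup>2) \<le> 0" "Im ((csqrt (1 - k1\<^sup>2))\<^sup>2) = 0" by (simp_all add: power2_eq_square)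
      hence "Re (k1\<^sup>2) \<ge> 1" "Im (k1\<^sup>2) = 0" by (simp_all add: power2_csqrt)
      moreover have "norm (k1\<^sup>2) = 1" using k1 by (simp add: norm_power)
      ultimately have "k1\<^sup>2 = 1" using complex_Re_le_cmod[of "k1\<^sup>2"] by (simp add: complex_eq_iff)
      thus False using k1 by (simp add: power2_eq_1_iff)
    qed
    hence "R k1" using step 1 landen(1,6)[OF k1(2-4)] k1 by blast
    thus ?thesis using step assms by (simp add: k1_def)
  qed
  thus ?thesis using that by (auto simp: R_def)
qed

section \<open>Every value is taken by the theta quotient\<close>

lemma doubly_periodic_bounded:
  fixes f :: "complex \<Rightarrow> complex"
  assumes c: "continuous_on UNIV f" and p: "\<And>z. f (z + a) = f z" "\<And>z. f (z + b) = f z"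
    and basis: "\<And>z. \<exists>s t. z = of_real s * a + of_real t * b"
  shows "bounded (range f)"
proof -
  have int: "f (z + of_int m * w) = f z" if "\<And>z. f (z + w) = f z" for w m z
  proof -
    have 1: "f (z + of_nat n * w) = f z" for n z
      by (induction n) (simp_all add: ring_distribs that flip: add.assoc, metis that add.assoc add.commute)
    show ?thesis
    proof (cases m rule: int_cases2)
      case (nonneg n) thus ?thesis using 1 by simp
    next
      case (nonpos n) thus ?thesis using 1[of "z - of_nat n * w" n] by simp
    qed
  qed
  define g where "g = (\<lambda>(s,t). of_real s * a + of_real t * b :: complex)"
  have "compact (f ` g ` ({0..1} \<times> {0..1}))" unfolding g_def split_beta
    by (intro compact_continuous_image continuous_on_subset[OF c] compact_Times continuous_intros) auto
  moreover have "range f \<subseteq> f ` g ` ({0..1} \<times> {0..1})"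
  proof
    fix y assume "y \<in> range f"
    then obtain z where z: "y = f z" by blast
    obtain s t where st: "z = of_real s * a + of_real t * b" using basis by blast
    have fr: "of_real x = of_real (frac x) + (of_int \<lfloor>x\<rfloor> :: complex)" for x by (simp add: frac_def)
    have "z = (g (frac s, frac t) + of_int \<lfloor>s\<rfloor> * a) + of_int \<lfloor>t\<rfloor> * b"
      unfolding st g_def split fr[of s] fr[of t] frac_frac by (simp add: algebra_simps)
    hence "y = f (g (frac s, frac t))" unfolding z by (simp only: int[OF p(1)] int[OF p(2)])
    moreover have "(frac s, frac t) \<in> {0..1} \<times> {0..1}" by (auto intro: less_imp_le frac_lt_1)
    ultimately show "y \<in> f ` g ` ({0..1} \<times> {0..1})" by blast
  qed
  ultimately show ?thesis using bounded_subset compact_imp_bounded by blast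
qed

lemma t1_t4_periods:
  shows "t1 \<tau> (z + of_real pi) = - t1 \<tau> z" "t4 \<tau> (z + of_real pi) = t4 \<tau> z"
    "t1 \<tau> (z + of_real pi * \<tau>) = - exp (- \<i> * of_real pi * \<tau> - 2 * \<i> * z) * t1 \<tau> z"
    "t4 \<tau> (z + of_real pi * \<tau>) = - exp (- \<i> * of_real pi * \<tau> - 2 * \<i> * z) * t4 \<tau> z"
proof -
  show "t1 \<tau> (z + of_real pi) = - t1 \<tau> z" "t4 \<tau> (z + of_real pi) = t4 \<tau> z"
    using th_shift_pi(2)[of \<tau> "z - of_real pi/2"] th_shift_pi(1)[of \<tau> "z + of_real pi/2"]
    by (simp_all add: t1_def t4_def algebra_simps)
  have i: "(+) 2 ` od = od" "(+) 2 ` ev = ev"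
    by (rule image_eq_witness[where g = "\<lambda>k. k - 2"]; simp only: cl_def mem_Collect_eq; presburger)+
  have e: "exp (- \<i> * of_real pi * \<tau> - 2 * \<i> * (z - of_real pi/2)) = - exp (- \<i> * of_real pi * \<tau> - 2 * \<i> * z)"
    "exp (- \<i> * of_real pi * \<tau> - 2 * \<i> * (z + of_real pi/2)) = - exp (- \<i> * of_real pi * \<tau> - 2 * \<i> * z)"
  proof -
    have "- \<i> * of_real pi * \<tau> - 2 * \<i> * (z - of_real pi/2) = (- \<i> * of_real pi * \<tau> - 2 * \<i> * z) + \<i> * of_real pi"
      "- \<i> * of_real pi * \<tau> - 2 * \<i> * (z + of_real pi/2) = (- \<i> * of_real pi * \<tau> - 2 * \<i> * z) - \<i> * of_real pi"
      by (simp_all add: algebra_simps)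
    thus "exp (- \<i> * of_real pi * \<tau> - 2 * \<i> * (z - of_real pi/2)) = - exp (- \<i> * of_real pi * \<tau> - 2 * \<i> * z)"
    "exp (- \<i> * of_real pi * \<tau> - 2 * \<i> * (z + of_real pi/2)) = - exp (- \<i> * of_real pi * \<tau> - 2 * \<i> * z)"
      by (simp_all only: exp_add exp_diff) simp_all
  qed
  have r: "z + of_real pi * \<tau> - of_real pi / 2 = (z - of_real pi / 2) + of_real pi * \<tau>"
    "z + of_real pi * \<tau> + of_real pi / 2 = (z + of_real pi / 2) + of_real pi * \<tau>" by simp_all
  show "t1 \<tau> (z + of_real pi * \<tau>) = - exp (- \<i> * of_real pi * \<tau> - 2 * \<i> * z) * t1 \<tau> z"
    "t4 \<tau> (z + of_real pi * \<tau>) = - exp (- \<i> * of_real pi * \<tau> - 2 * \<i> * z) * t4 \<tau> z"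
    unfolding t1_def t4_def r th_quasi i e by simp_all
qed

lemma t1_0: "t1 \<tau> 0 = 0" and t1_half: "t1 \<tau> (of_real pi / 2) = c2 \<tau>"
proof -
  have "th \<tau> od (of_real pi / 2) = - th \<tau> od (- (of_real pi / 2))"
    using th_shift_pi(2)[of \<tau> "- (of_real pi/2)"] by simp
  thus "t1 \<tau> 0 = 0" unfolding t1_def by (simp add: th_even(2))
qed (simp add: t1_def)

text \<open>Otherwise the Wronskian vanishes identically, \<open>t1 / t4\<close> is constant near 0
  with value 0, and by continuation \<open>t1\<close> vanishes everywhere, against its value
  \<open>c2 \<tau>\<close> at \<pi>/2.\<close>

lemma theta_wronskian_const_nonzero:
  assumes "Im \<tau> > 0" shows "deriv (th (\<tau>/2) (cl 4 1)) 0 \<noteq> 0"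
proof
  assume D: "deriv (th (\<tau>/2) (cl 4 1)) 0 = 0"
  have W: "deriv (t1 \<tau>) z * t4 \<tau> z - t1 \<tau> z * deriv (t4 \<tau>) z = 0" for z
    using t1_t4_wronskian[OF assms, of z] by (simp add: D)
  have nz: "t4 \<tau> 0 \<noteq> 0" by (rule theta_consts_nonzero[OF assms])
  have "isCont (t4 \<tau>) 0" using t1_t4_deriv[OF assms] DERIV_isCont by blast
  then obtain e where e: "e > 0" "\<And>z. dist 0 z < e \<Longrightarrow> t4 \<tau> z \<noteq> 0" using continuous_at_avoid nz by blast
  have d: "((\<lambda>z. t1 \<tau> z / t4 \<tau> z) has_field_derivative 0) (at z)" if "z \<in> ball 0 e" for z
  proof -
    have "((\<lambda>z. t1 \<tau> z / t4 \<tau> z) has_field_derivative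
       (deriv (t1 \<tau>) z * t4 \<tau> z - t1 \<tau> z * deriv (t4 \<tau>) z) / (t4 \<tau> z * t4 \<tau> z)) (at z)"
      by (rule DERIV_divide t1_t4_deriv assms e)+ (use that e in auto)
    thus ?thesis by (simp add: W)
  qed
  have "t1 \<tau> z / t4 \<tau> z = t1 \<tau> 0 / t4 \<tau> 0" if "z \<in> ball 0 e" for z
    by (rule has_field_derivative_zero_constant[THEN exE, of "ball 0 e" "\<lambda>z. t1 \<tau> z / t4 \<tau> z"])
       (use d that e(1) in \<open>auto intro: has_field_derivative_at_within\<close>)
  hence z: "t1 \<tau> z = 0" if "z \<in> ball 0 e" for z using that e(2)[of z] by (auto simp: t1_0)
  have "t1 \<tau> (of_real pi/2) = 0"
  proof (rule analytic_continuation_open[where s = "ball 0 e" and s' = UNIV and f = "t1 \<tau>" and g = "\<lambda>_. 0"])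
    show "t1 \<tau> holomorphic_on UNIV" by (rule t1_t4_holomorphic[OF assms])
  qed (use e(1) z in \<open>auto intro: holomorphic_intros\<close>)
  thus False using t1_half theta_consts_nonzero(1)[OF assms] by simp
qed

text \<open>At a common zero z the identity \<open>t1_t4_wronski\<close> gives 0 for all x. The
  factor G is nonzero near 0, so F(w) - F(-w) vanishes on an open set, hence everywhere, and its
  derivative 2 F'(0) contradicts the preceding lemma.\<close>

lemma t1_t4_no_common_zero:
  assumes "Im \<tau> > 0" "t1 \<tau> z = 0" "t4 \<tau> z = 0" shows False
proof -
  define F where "F = th (\<tau>/2) (cl 4 1)"
  define G where "G = th (\<tau>/2) od"
  have \<tau>2: "Im (\<tau>/2) > 0" using assms by simp
  have F': "(F has_field_derivative deriv F w) (at w)" for w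
    unfolding F_def using th_holomorphic[OF \<tau>2, of _ UNIV] by (auto intro: holomorphic_derivI)
  have Fh: "F holomorphic_on UNIV" unfolding F_def by (rule th_holomorphic[OF \<tau>2])
  have p: "G ((x+z)/2) * (F ((x-z)/2) - F (-((x-z)/2))) = 0" for x
    using t1_t4_wronski[OF assms(1), of x z] assms(2,3) by (simp add: F_def G_def)
  have "G 0 \<noteq> 0" unfolding G_def by (rule theta_consts_nonzero[OF \<tau>2])
  moreover have "isCont G 0" using th_holomorphic[OF \<tau>2, of _ UNIV] unfolding G_def
    by (meson holomorphic_on_imp_continuous_on continuous_on_eq_continuous_at open_UNIV UNIV_I)
  ultimately obtain e where e: "e > 0" "\<And>w. dist 0 w < e \<Longrightarrow> G w \<noteq> 0" using continuous_at_avoid by blast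
  define H where "H w = F w - F (- w)" for w
  \<comment> \<open>The substitution x = 2w + z turns the two arguments into w + z and w; near w =
    -z the first is close to 0.\<close>
  have e1: "((2*w + z) + z)/2 = w + z" "((2*w + z) - z)/2 = w" for w by (simp_all add: field_simps)
  have H0: "H w = 0" if "w \<in> ball (- z) e" for w
    using p[of "2*w + z", unfolded e1] e(2)[of "w + z"] that by (simp add: H_def dist_norm norm_minus_commute add.commute)
  have Hh: "H holomorphic_on UNIV" unfolding H_def[abs_def]
    by (intro holomorphic_intros Fh holomorphic_on_compose[OF _ holomorphic_on_subset[OF Fh], unfolded o_def]) auto
  have "H w = 0" for w
    by (rule analytic_continuation_open[where s = "ball (- z) e" and s' = UNIV and f = H and g = "\<lambda>_. 0"])
       (use e(1) H0 Hh in \<open>auto intro: holomorphic_intros\<close>)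
  hence "(H has_field_derivative 0) (at 0)" by (metis DERIV_const ext)
  moreover have "(H has_field_derivative 2 * deriv F 0) (at 0)" unfolding H_def[abs_def]
  proof -
    have "((\<lambda>w. F (- w)) has_field_derivative deriv F 0 * (-1)) (at 0)"
      by (rule DERIV_chain2[of F]) (use F'[of 0] in \<open>auto intro!: derivative_eq_intros\<close>)
    from DERIV_diff[OF F'[of 0] this] show "((\<lambda>w. F w - F (- w)) has_field_derivative 2 * deriv F 0) (at 0)" by simp
  qed
  ultimately have "2 * deriv F 0 = 0" using DERIV_unique by blast
  thus False using theta_wronskian_const_nonzero[OF assms(1)] by (simp add: F_def)
qed

text \<open>If v were omitted, \<open>M\<close> would be entire, and doubly periodic because both
  theta functions pick up the same factor under \<pi>\<tau>; Liouville makes it constant. The other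
  period is 2\<pi>, since \<open>t1\<close> changes sign under \<pi>.\<close>

lemma theta_quotient_surj:
  assumes \<tau>: "Im \<tau> > 0"
  obtains z where "t4 \<tau> z \<noteq> 0" "t1 \<tau> z / t4 \<tau> z = v"
proof -
  have "\<exists>z. t1 \<tau> z - v * t4 \<tau> z = 0"
  proof (rule ccontr)
    assume "\<not> ?thesis"
    hence nz: "t1 \<tau> z - v * t4 \<tau> z \<noteq> 0" for z by blast
    define M where "M z = t4 \<tau> z / (t1 \<tau> z - v * t4 \<tau> z)" for z
    have hol: "M holomorphic_on UNIV" unfolding M_def[abs_def]
      by (intro holomorphic_intros t1_t4_holomorphic[OF \<tau>]) (use nz in auto)
    have per: "M (z + 2 * of_real pi) = M z" "M (z + of_real pi * \<tau>) = M z" for z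
    proof -
      have "z + 2 * of_real pi = (z + of_real pi) + of_real pi" by simp
      thus "M (z + 2 * of_real pi) = M z" by (simp only: M_def t1_t4_periods minus_minus)
      define E where "E = - exp (- \<i> * of_real pi * \<tau> - 2 * \<i> * z)"
      have "E \<noteq> 0" by (simp add: E_def)
      moreover have "E * t1 \<tau> z - v * (E * t4 \<tau> z) = E * (t1 \<tau> z - v * t4 \<tau> z)" by (simp add: algebra_simps)
      ultimately show "M (z + of_real pi * \<tau>) = M z" unfolding M_def t1_t4_periods E_def[symmetric] by simp
    qed
    have "bounded (range M)"
    proof (rule doubly_periodic_bounded[OF holomorphic_on_imp_continuous_on[OF hol] per])
      fix z
      define t where "t = Im z / (pi * Im \<tau>)"
      define s where "s = (Re z - t * pi * Re \<tau>) / (2 * pi)"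
      have "z = of_real s * (2 * of_real pi) + of_real t * (of_real pi * \<tau>)"
        using \<tau> by (simp add: complex_eq_iff s_def t_def)
      thus "\<exists>s t. z = of_real s * (2 * of_real pi) + of_real t * (of_real pi * \<tau>)" by blast
    qed
    then obtain c where c: "\<And>z. M z = c" using Liouville_theorem[OF hol] by (metis constant_on_def UNIV_I)
    have c1: "t4 \<tau> z = c * (t1 \<tau> z - v * t4 \<tau> z)" for z using c[of z] nz[of z] by (simp add: M_def field_simps)
    \<comment> \<open>Translation by \<pi> changes the sign of \<open>t1\<close> and keeps
      \<open>t4\<close>, so comparing the two instances isolates the \<open>t1\<close> term.\<close>
    have "c * t1 \<tau> (of_real pi/2) = 0"
      using c1[of "of_real pi/2"] c1[of "of_real pi/2 + of_real pi"] unfolding t1_t4_periods by algebra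
    hence "c = 0" using t1_half theta_consts_nonzero(1)[OF \<tau>] by simp
    thus False using c1[of 0] theta_consts_nonzero(3)[OF \<tau>] by simp
  qed
  then obtain z where z: "t1 \<tau> z = v * t4 \<tau> z" by auto
  hence "t4 \<tau> z \<noteq> 0" using t1_t4_no_common_zero[OF \<tau>, of z] by auto
  thus ?thesis using z that by simp
qed

lemma theta_quotient_ode:
  assumes "\<rho> \<noteq> 2" "\<rho> \<noteq> -2"
  obtains \<tau> K where "Im \<tau> > 0" "K \<noteq> 0"
    "\<And>z. t4 \<tau> z \<noteq> 0 \<Longrightarrow> ((\<lambda>z. t1 \<tau> z / t4 \<tau> z) has_field_derivative deriv (\<lambda>z. t1 \<tau> z / t4 \<tau> z) z) (at z)"
    "\<And>z. t4 \<tau> z \<noteq> 0 \<Longrightarrow> (deriv (\<lambda>z. t1 \<tau> z / t4 \<tau> z) z)\<^sup>2 =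
        K * ((t1 \<tau> z / t4 \<tau> z)^4 + 1 + \<rho> * (t1 \<tau> z / t4 \<tau> z)\<^sup>2)"
proof -
  \<comment> \<open>The modulus is taken as a root of k^2 + \<rho> k + 1, so that k + 1/k = -
    \<rho>; the excluded values of \<rho> are those for which k = 1 or k = -1.\<close>
  define k where "k = (- \<rho> + csqrt (\<rho>\<^sup>2 - 4)) / 2"
  have q: "k\<^sup>2 + \<rho> * k + 1 = 0"
  proof -
    have "2 * k + \<rho> = csqrt (\<rho>\<^sup>2 - 4)" by (simp add: k_def field_simps)
    hence "(2 * k + \<rho>)\<^sup>2 = \<rho>\<^sup>2 - 4" by simp
    hence "4 * (k\<^sup>2 + \<rho> * k + 1) = 0" by (simp add: power2_eq_square algebra_simps)
    thus ?thesis by (metis mult_eq_0_iff zero_neq_numeral)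
  qed
  have q': "k * k + 1 = - \<rho> * k" using q unfolding power2_eq_square by algebra
  have k0: "k \<noteq> 0" using q by auto
  have "\<rho> = 2" if "k = -1" using q that by algebra
  moreover have "\<rho> = -2" if "k = 1" using q that by algebra
  ultimately have k: "k \<noteq> 0" "k \<noteq> 1" "k \<noteq> -1" using k0 assms by blast+
  obtain \<tau> where \<tau>: "Im \<tau> > 0" "modulus \<tau> = k" using modulus_surj[OF k] by blast
  note nz = theta_consts_nonzero[OF \<tau>(1)]
  have "(c2 \<tau>)\<^sup>2/(c3 \<tau>)\<^sup>2 + (c3 \<tau>)\<^sup>2/(c2 \<tau>)\<^sup>2 = k + 1 / k"
    using \<tau>(2)[symmetric] by (simp add: modulus_def power_divide)
  also have "\<dots> = (k * k + 1) / k" using k0 by (simp add: add_divide_distrib)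
  also have "\<dots> = - \<rho>" unfolding q' using k0 by simp
  finally have r: "(c2 \<tau>)\<^sup>2/(c3 \<tau>)\<^sup>2 + (c3 \<tau>)\<^sup>2/(c2 \<tau>)\<^sup>2 = - \<rho>" .
  obtain K where K: "\<And>z. (deriv (t1 \<tau>) z * t4 \<tau> z - t1 \<tau> z * deriv (t4 \<tau>) z)\<^sup>2 =
     K * ((t1 \<tau> z)^4 + (t4 \<tau> z)^4 + \<rho> * ((t1 \<tau> z)\<^sup>2 * (t4 \<tau> z)\<^sup>2))"
    using theta_ode[OF \<tau>(1) nz] unfolding r mult_minus_left diff_minus_eq_add by blast
  have d: "((\<lambda>z. t1 \<tau> z / t4 \<tau> z) has_field_derivative
       (deriv (t1 \<tau>) z * t4 \<tau> z - t1 \<tau> z * deriv (t4 \<tau>) z) / (t4 \<tau> z * t4 \<tau> z)) (at z)" if "t4 \<tau> z \<noteq> 0" for z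
    by (rule DERIV_divide t1_t4_deriv \<tau> that)+
  show ?thesis
  proof (rule that[OF \<tau>(1)])
    show "K \<noteq> 0"
    proof
      assume "K = 0"
      hence "deriv (t1 \<tau>) 0 * t4 \<tau> 0 - t1 \<tau> 0 * deriv (t4 \<tau>) 0 = 0" using K[of 0] by simp
      thus False using t1_t4_wronskian[OF \<tau>(1), of 0] theta_wronskian_const_nonzero[OF \<tau>(1)]
        theta_consts_nonzero(1)[of "\<tau>/2"] \<tau>(1) by simp
    qed
    fix z assume z: "t4 \<tau> z \<noteq> 0"
    note D = DERIV_imp_deriv[OF d[OF z]]
    show "((\<lambda>z. t1 \<tau> z / t4 \<tau> z) has_field_derivative deriv (\<lambda>z. t1 \<tau> z / t4 \<tau> z) z) (at z)"
      unfolding D by (rule d[OF z])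
    show "(deriv (\<lambda>z. t1 \<tau> z / t4 \<tau> z) z)\<^sup>2 = K * ((t1 \<tau> z / t4 \<tau> z)^4 + 1 + \<rho> * (t1 \<tau> z / t4 \<tau> z)\<^sup>2)"
    proof -
      have "K * (X^4 + Y^4 + \<rho> * (X\<^sup>2 * Y\<^sup>2)) / (Y * Y)\<^sup>2 = K * ((X / Y)^4 + 1 + \<rho> * (X / Y)\<^sup>2)" if "Y \<noteq> 0" for X Y :: complex
        using that by (simp add: power_divide field_simps power2_eq_square power4_eq_xxxx)
      from this[OF z] show ?thesis unfolding D power_divide[of _ "t4 \<tau> z * t4 \<tau> z"] K .
    qed
  qed
qed

text \<open>The signs and the prefactor are shifts of the argument: (-1)^n = exp (2 i n \<pi>/2) and
  -i (-1)^n = exp (- i (2n + 1) \<pi>/2).\<close>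

lemma theta_eq: "theta1 x \<tau> = t1 \<tau> x" "theta4 x \<tau> = t4 \<tau> x"
proof -
  have b: "(\<lambda>n. 2*n) ` UNIV = ev" "(\<lambda>n. 2*n+1) ` UNIV = od"
    by (rule image_eq_witness[where g = "\<lambda>k. k div 2"]; simp only: cl_def mem_Collect_eq UNIV_I; presburger)+
  have inj: "inj (\<lambda>n::int. 2*n)" "inj (\<lambda>n::int. 2*n+1)" by (auto simp: inj_def)
  have 4: "(-1) powi n * nome_power \<tau> ((of_int n)\<^sup>2) * exp (2 * \<i> * of_int n * x) = th_term \<tau> (x + of_real pi/2) (2*n)" for n
    unfolding th_term_def nome_power_def exp_i_int_pi[symmetric] exp_add[symmetric]
    by (rule arg_cong[where f = exp]) (simp add: algebra_simps)
  show "theta4 x \<tau> = t4 \<tau> x" unfolding theta4_def t4_def th_def b(1)[symmetric] infsum_reindex[OF inj(1)] o_def 4 ..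
  have "exp (\<i> * of_real pi / 2) = \<i>" using cis_conv_exp[of "pi/2"] by simp
  hence "exp (- (\<i> * of_real pi / 2)) = - \<i>" by (simp only: exp_minus inverse_i)
  note e = this[symmetric]
  have 1: "- \<i> * ((-1) powi n * nome_power \<tau> ((of_int n + 1/2)\<^sup>2) * exp (\<i> * of_int (2 * n + 1) * x)) = th_term \<tau> (x - of_real pi/2) (2*n+1)" for n
  proof -
    have "(-1) powi n = exp (- (\<i> * of_int n * of_real pi))" using exp_i_int_pi[of "-n"] by (simp add: power_int_minus_left)
    thus ?thesis unfolding th_term_def nome_power_def
      by (subst (1) e) (simp only: exp_add[symmetric], rule arg_cong[where f = exp], simp add: field_simps power2_eq_square)
  qed
  show "theta1 x \<tau> = t1 \<tau> x" unfolding theta1_def t1_def th_def b(2)[symmetric] infsum_reindex[OF inj(2)] o_def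
    infsum_cmult_right'[symmetric] 1 ..
qed

section \<open>Webs and their images\<close>

lemma eventually_nhds_compose:
  assumes "eventually P (nhds (f x))" "isCont f x" shows "\<forall>\<^sub>F z in nhds x. P (f z)"
  using eventually_compose_filterlim[OF assms(1)] assms(2) by (metis isCont_def tendsto_at_iff_tendsto_nhds)

lemma holomorphic_germ_isCont:
  assumes "holomorphic_germ p u" shows "isCont u p"
  using assms unfolding holomorphic_germ_def holomorphic2_on_def by (meson has_derivative_continuous)

lemma relation_germ_cong:
  assumes "\<forall>\<^sub>F ab in nhds (p, p). ab \<in> R \<longleftrightarrow> ab \<in> R'"
  shows "relation_germ p R = relation_germ p R'"
  unfolding relation_germ_def set_eq_iff mem_Collect_eq
proof (intro allI iffI)
  fix S assume "\<forall>\<^sub>F ab in nhds (p, p). ab \<in> S \<longleftrightarrow> ab \<in> R"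
  thus "\<forall>\<^sub>F ab in nhds (p, p). ab \<in> S \<longleftrightarrow> ab \<in> R'" using assms by eventually_elim auto
next
  fix S assume "\<forall>\<^sub>F ab in nhds (p, p). ab \<in> S \<longleftrightarrow> ab \<in> R'"
  thus "\<forall>\<^sub>F ab in nhds (p, p). ab \<in> S \<longleftrightarrow> ab \<in> R" using assms by eventually_elim auto
qed

lemma foliation_cong:
  assumes "\<forall>\<^sub>F z in nhds p. v z = \<phi> (u z)" "isCont u p" "open V" "u p \<in> V" "inj_on \<phi> V"
  shows "foliation p v = foliation p u"
  unfolding foliation_def
proof (rule relation_germ_cong)
  have "\<forall>\<^sub>F z in nhds p. u z \<in> V"
    by (rule eventually_nhds_compose[where P = "\<lambda>x. x \<in> V"]) (use assms(2,3,4) eventually_nhds_in_open in auto)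
  hence h: "\<forall>\<^sub>F z in nhds p. v z = \<phi> (u z) \<and> u z \<in> V" using assms(1) by eventually_elim simp
  show "\<forall>\<^sub>F ab in nhds (p, p). ab \<in> {(a, b). v a = v b} \<longleftrightarrow> ab \<in> {(a, b). u a = u b}"
    unfolding nhds_prod
  proof (rule eventually_mono[OF eventually_prodI[OF h h]])
    fix ab assume "(v (fst ab) = \<phi> (u (fst ab)) \<and> u (fst ab) \<in> V) \<and> v (snd ab) = \<phi> (u (snd ab)) \<and> u (snd ab) \<in> V"
    thus "ab \<in> {(a, b). v a = v b} \<longleftrightarrow> ab \<in> {(a, b). u a = u b}"
      by (cases ab) (simp add: inj_on_eq_iff[OF assms(5)])
  qed
qed

lemma foliation_scale:
  assumes "k \<noteq> 0"
  shows "foliation p (\<lambda>z. k * \<alpha> * fst z + k * \<beta> * snd z + c) = foliation p (\<lambda>z. \<alpha> * fst z + \<beta> * snd z)"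
  by (rule foliation_cong[where \<phi> = "\<lambda>t. k * t + c" and V = UNIV])
     (use assms in \<open>simp_all add: inj_on_def algebra_simps\<close>)

lemma image_foliation_eq:
  fixes g L :: "point \<Rightarrow> point"
  assumes g: "continuous_on UNIV g" and L: "continuous_on UNIV L"
    and i: "\<And>z. L (g z) = z" "\<And>z. g (L z) = z"
  shows "image_foliation g (foliation (L p) w) = foliation p (\<lambda>z. w (L z))"
proof -
  have "isCont (map_prod h h) x" if h: "continuous_on UNIV h" for h :: "point \<Rightarrow> point" and x
  proof -
    have "continuous_on UNIV (\<lambda>z. (h (fst z), h (snd z)))"
      by (intro continuous_on_Pair continuous_on_compose2[OF h] continuous_on_fst continuous_on_snd continuous_on_id) auto
    hence "isCont (\<lambda>z. (h (fst z), h (snd z))) x" unfolding continuous_on_eq_continuous_at[OF open_UNIV] by (rule bspec) simp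
    thus ?thesis by (simp add: map_prod_def case_prod_beta')
  qed
  note cg = this[OF g] and cL = this[OF L]
  have "(\<forall>\<^sub>F ab in nhds (L p, L p). map_prod g g ab \<in> S \<longleftrightarrow> w (fst ab) = w (snd ab)) \<longleftrightarrow>
        (\<forall>\<^sub>F ab in nhds (p, p). ab \<in> S \<longleftrightarrow> w (L (fst ab)) = w (L (snd ab)))" for S
  proof
    assume "\<forall>\<^sub>F ab in nhds (L p, L p). map_prod g g ab \<in> S \<longleftrightarrow> w (fst ab) = w (snd ab)"
    hence "\<forall>\<^sub>F ab in nhds (map_prod L L (p, p)). map_prod g g ab \<in> S \<longleftrightarrow> w (fst ab) = w (snd ab)" by simp
    from eventually_nhds_compose[OF this cL]
    show "\<forall>\<^sub>F ab in nhds (p, p). ab \<in> S \<longleftrightarrow> w (L (fst ab)) = w (L (snd ab))"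
      by (simp add: map_prod_def i split_beta)
  next
    assume "\<forall>\<^sub>F ab in nhds (p, p). ab \<in> S \<longleftrightarrow> w (L (fst ab)) = w (L (snd ab))"
    hence "\<forall>\<^sub>F ab in nhds (map_prod g g (L p, L p)). ab \<in> S \<longleftrightarrow> w (L (fst ab)) = w (L (snd ab))" by (simp add: i)
    from eventually_nhds_compose[OF this cg]
    show "\<forall>\<^sub>F ab in nhds (L p, L p). map_prod g g ab \<in> S \<longleftrightarrow> w (fst ab) = w (snd ab)"
      by (simp add: map_prod_def i split_beta)
  qed
  thus ?thesis unfolding image_foliation_def foliation_def relation_germ_def set_eq_iff mem_Collect_eq
    by (simp add: split_beta)
qed

text \<open>Linear maps \<open>(x, y) \<mapsto> (a * x + b * y, a' * x + b' * y)\<close> permuting the four directions of \<open>\<T>\<^sub>0\<close>.\<close>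

definition T0_linear :: "complex \<Rightarrow> complex \<Rightarrow> complex \<Rightarrow> complex \<Rightarrow> bool" where
  "T0_linear a b a' b' \<longleftrightarrow> (\<exists>l e n. l \<noteq> 0 \<and> (e = 1 \<or> e = -1) \<and> (n = 1 \<or> n = -1) \<and>
     (a = l \<and> b = 0 \<and> a' = 0 \<and> b' = e * l \<or> a = l \<and> b = n * l \<and> a' = e * l \<and> b' = - (e * n * l)))"

text \<open>Stated for any F homogeneous of degree 0, in order to serve both for pencils in the
  projective plane and for germs of foliations.\<close>

lemma T0_linear_perm:
  assumes hom: "\<And>k \<alpha> \<beta>. k \<noteq> 0 \<Longrightarrow> F (k * \<alpha>) (k * \<beta>) = F \<alpha> \<beta>" and "T0_linear a b a' b'"
  shows "{F a b, F a' b', F (a + a') (b + b'), F (a - a') (b - b')} = {F 1 0, F 0 1, F 1 1, F 1 (-1)}"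
proof -
  obtain l e n where l: "l \<noteq> 0" "e = 1 \<or> e = -1" "n = 1 \<or> n = -1"
    "a = l \<and> b = 0 \<and> a' = 0 \<and> b' = e * l \<or> a = l \<and> b = n * l \<and> a' = e * l \<and> b' = - (e * n * l)"
    using assms(2) unfolding T0_linear_def by blast
  have k: "F k 0 = F 1 0" "F 0 k = F 0 1" "F k k = F 1 1" "F k (-k) = F 1 (-1)" "F (-k) k = F 1 (-1)" if "k \<noteq> 0" for k
    using hom[OF that, of 1 0] hom[OF that, of 0 1] hom[OF that, of 1 1] hom[OF that, of 1 "-1"] hom[of "-k" 1 "-1"] that by simp_all
  have l': "- l \<noteq> 0" "l + l \<noteq> 0" "- (l + l) \<noteq> 0" "- l - l \<noteq> 0" using l(1) by (auto simp: add_eq_0_iff)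
  show ?thesis using l(2-4) k[OF l(1)] k[OF l'(1)] k[OF l'(2)] k[OF l'(3)] k[OF l'(4)] by auto
qed

lemma T0_linear_det: "T0_linear a b a' b' \<Longrightarrow> a * b' - b * a' \<noteq> 0"
  unfolding T0_linear_def by auto

text \<open>U V (U^2 - V^2) is the product of the four linear forms attached to the directions; a
  linear map permuting the directions multiplies it by a constant.\<close>

lemma T0_linear_transversality:
  assumes "T0_linear a b a' b'" "a * X + a' * Y = k * U" "b * X + b' * Y = k * V" "k \<noteq> 0" "U * V * (U\<^sup>2 - V\<^sup>2) \<noteq> 0"
  shows "X * Y * (X\<^sup>2 - Y\<^sup>2) \<noteq> 0"
proof -
  define T where "T U V = U * V * (U\<^sup>2 - V\<^sup>2)" for U V :: complex
  have "T (k * U) (k * V) = k^4 * T U V" by (simp add: T_def power4_eq_xxxx power2_eq_square algebra_simps)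
  hence "T (a * X + a' * Y) (b * X + b' * Y) \<noteq> 0" using assms(4,5) unfolding assms(2,3) by (simp only: T_def) simp
  moreover have "\<exists>c. T (a * X + a' * Y) (b * X + b' * Y) = c * T X Y"
  proof -
    obtain l e n where "l \<noteq> 0" "e = 1 \<or> e = -1" "n = 1 \<or> n = -1"
      "a = l \<and> b = 0 \<and> a' = 0 \<and> b' = e * l \<or> a = l \<and> b = n * l \<and> a' = e * l \<and> b' = - (e * n * l)"
      using assms(1) unfolding T0_linear_def by blast
    moreover from this have sq: "e * e = 1" "n * n = 1" by auto
    moreover have "T (l * X) (e * l * Y) = e * l^4 * T X Y"
      "T (l * X + e * l * Y) (n * l * X + - (e * n * l) * Y) = 4 * e * n * l^4 * T X Y"
      using sq unfolding T_def by algebra+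
    ultimately have "T (a * X + a' * Y) (b * X + b' * Y) = (e * l^4) * T X Y \<or>
      T (a * X + a' * Y) (b * X + b' * Y) = (4 * e * n * l^4) * T X Y" by auto
    thus ?thesis by blast
  qed
  ultimately show ?thesis by (auto simp: T_def)
qed

section \<open>Projective action on lines and pencils\<close>

lemma proj_scale: "c \<noteq> 0 \<Longrightarrow> proj (c *s v) = proj v"
  unfolding proj_def
proof (intro set_eqI iffI; clarify)
  fix d :: complex assume "c \<noteq> 0" "d \<noteq> 0"
  thus "\<exists>c'. d *s (c *s v) = c' *s v \<and> c' \<noteq> 0" by (intro exI[of _ "d * c"]) (simp add: vector_smult_assoc)
  show "\<exists>c'. d *s v = c' *s (c *s v) \<and> c' \<noteq> 0" using \<open>c \<noteq> 0\<close> \<open>d \<noteq> 0\<close>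
    by (intro exI[of _ "d / c"]) (simp add: vector_smult_assoc)
qed

lemma projective_map_proj: "projective_map A (proj v) = proj (A *v v)"
proof -
  have *: "A *v (c *s v) = c *s (A *v v)" for c by (rule vector_scalar_commute)
  have "projective_map A (proj v) = {A *v (c *s v) |c. c \<noteq> 0}" unfolding projective_map_def proj_def by blast
  thus ?thesis by (simp only: * proj_def)
qed

lemma proj_line_scale:
  assumes "k \<noteq> 0" shows "proj_line (k *s a) = proj_line a"
proof -
  have "(\<Sum>i\<in>UNIV. (k *s a) $ i * v $ i) = k * (\<Sum>i\<in>UNIV. a $ i * v $ i)" for v
    by (simp add: sum_distrib_left mult.assoc)
  thus ?thesis using assms unfolding proj_line_def by simp
qed

lemma pencil_scale:
  assumes "k \<noteq> 0" shows "pencil (k * \<alpha>) (k * \<beta>) = pencil \<alpha> \<beta>"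
proof -
  have "proj_line (vector [k * \<alpha>, k * \<beta>, \<gamma>]) = proj_line (vector [\<alpha>, \<beta>, \<gamma> / k])" for \<gamma>
  proof -
    have "vector [k * \<alpha>, k * \<beta>, \<gamma>] = k *s (vector [\<alpha>, \<beta>, \<gamma> / k] :: complex^3)"
      using assms by (simp add: vec_eq_iff forall_3)
    thus ?thesis using proj_line_scale[OF assms] by metis
  qed
  moreover have "proj_line (vector [\<alpha>, \<beta>, \<gamma>]) = proj_line (vector [k * \<alpha>, k * \<beta>, k * \<gamma>])" for \<gamma>
    using calculation[of "k * \<gamma>"] assms by simp
  ultimately show ?thesis unfolding pencil_def by blast
qed

text \<open>B is the matrix of the given affine map and A its inverse. Lines transform
  contragrediently: A sends the line with coefficients \<alpha> to the one with coefficients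
  \<alpha> B. Hence pencils are moved by the linear part alone, to which
  \<open>T0_linear_perm\<close> applies.\<close>

lemma Sym_T0_inverse:
  assumes lin: "T0_linear a b a' b'"
    and i: "\<And>z. g (a * fst z + b * snd z + c, a' * fst z + b' * snd z + c') = z"
  shows "g \<in> Sym_T0"
proof -
  define d where "d = a * b' - b * a'"
  have d: "d \<noteq> 0" using T0_linear_det[OF lin] by (simp add: d_def)
  define B :: "complex^3^3" where "B = vector [vector [a, b, c], vector [a', b', c'], vector [0, 0, 1]]"
  define A :: "complex^3^3" where "A = vector [vector [b'/d, -b/d, (b*c' - b'*c)/d], vector [-a'/d, a/d, (a'*c - a*c')/d], vector [0, 0, 1]]"
  have AB: "A ** B = mat 1" "B ** A = mat 1"
    using d unfolding A_def B_def
    by (simp_all add: vec_eq_iff forall_3 matrix_matrix_mult_def sum_3 mat_def; simp add: field_simps; simp add: d_def algebra_simps)+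
  have inv: "invertible A" using AB unfolding invertible_def by blast
  have BA: "B *v (A *v v) = v" "A *v (B *v v) = v" for v
    using AB by (simp_all add: matrix_vector_mul_assoc)
  have line: "projective_map A ` proj_line \<alpha> = proj_line (\<alpha> v* B)" for \<alpha>
  proof -
    have dot: "(\<Sum>i\<in>UNIV. (\<alpha> v* B) $ i * w $ i) = (\<Sum>i\<in>UNIV. \<alpha> $ i * (B *v w) $ i)" for w
      by (simp add: vector_matrix_mult_def matrix_vector_mult_def sum_3 algebra_simps)
    show ?thesis
    proof (intro set_eqI iffI)
      fix Q assume "Q \<in> projective_map A ` proj_line \<alpha>"
      then obtain v where v: "v \<noteq> 0" "(\<Sum>i\<in>UNIV. \<alpha> $ i * v $ i) = 0" "Q = proj (A *v v)"
        unfolding proj_line_def using projective_map_proj by blast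
      have "A *v v \<noteq> 0" using v(1) BA(1)[of v] by (metis matrix_vector_mult_0_right)
      thus "Q \<in> proj_line (\<alpha> v* B)" unfolding proj_line_def mem_Collect_eq dot
        using v by (intro exI[of _ "A *v v"]) (simp add: BA)
    next
      fix Q assume "Q \<in> proj_line (\<alpha> v* B)"
      then obtain w where w: "w \<noteq> 0" "(\<Sum>i\<in>UNIV. \<alpha> $ i * (B *v w) $ i) = 0" "Q = proj w"
        unfolding proj_line_def dot by blast
      have "B *v w \<noteq> 0" using w(1) BA(2)[of w] by (metis matrix_vector_mult_0_right)
      moreover have "Q = projective_map A (proj (B *v w))" using w(3) by (simp add: projective_map_proj BA)
      ultimately show "Q \<in> projective_map A ` proj_line \<alpha>" unfolding proj_line_def using w(2) by blast
    qed
  qed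
  have pen: "image (projective_map A) ` pencil \<alpha> \<beta> = pencil (\<alpha> * a + \<beta> * a') (\<alpha> * b + \<beta> * b')" for \<alpha> \<beta>
  proof -
    have v: "vector [\<alpha>, \<beta>, \<gamma>] v* B = vector [\<alpha> * a + \<beta> * a', \<alpha> * b + \<beta> * b', \<alpha> * c + \<beta> * c' + \<gamma>]" for \<gamma>
      by (simp add: vec_eq_iff forall_3 vector_matrix_mult_def sum_3 B_def algebra_simps)
    have "image (projective_map A) ` pencil \<alpha> \<beta> = {proj_line (vector [\<alpha> * a + \<beta> * a', \<alpha> * b + \<beta> * b', \<alpha> * c + \<beta> * c' + \<gamma>]) |\<gamma>. True}"
      unfolding pencil_def using line by (auto simp: image_iff v[symmetric])
    also have "\<dots> = pencil (\<alpha> * a + \<beta> * a') (\<alpha> * b + \<beta> * b')"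
      unfolding pencil_def
    proof (intro set_eqI iffI; clarify)
      fix \<gamma>
      show "\<exists>\<gamma>'. proj_line (vector [\<alpha> * a + \<beta> * a', \<alpha> * b + \<beta> * b', \<alpha> * c + \<beta> * c' + \<gamma>]) =
         proj_line (vector [\<alpha> * a + \<beta> * a', \<alpha> * b + \<beta> * b', \<gamma>']) \<and> True" by blast
      show "\<exists>\<gamma>'. proj_line (vector [\<alpha> * a + \<beta> * a', \<alpha> * b + \<beta> * b', \<gamma>]) =
         proj_line (vector [\<alpha> * a + \<beta> * a', \<alpha> * b + \<beta> * b', \<alpha> * c + \<beta> * c' + \<gamma>']) \<and> True"
        by (intro exI[of _ "\<gamma> - \<alpha> * c - \<beta> * c'"]) simp
    qed
    finally show ?thesis .
  qed
  have "image (image (projective_map A)) ` T0_pencils = {pencil a b, pencil a' b', pencil (a + a') (b + b'), pencil (a - a') (b - b')}"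
    unfolding T0_pencils_def by (simp add: pen)
  also have "\<dots> = T0_pencils" unfolding T0_pencils_def
    by (rule T0_linear_perm[of pencil, OF pencil_scale lin])
  finally have 1: "image (image (projective_map A)) ` T0_pencils = T0_pencils" .
  have 2: "projective_map A (proj (affine_point z)) = proj (affine_point (g z))" for z
  proof -
    define x y where "x = (b' * (fst z - c) - b * (snd z - c')) / d" "y = (a * (snd z - c') - a' * (fst z - c)) / d"
    have "(a * x + b * y + c, a' * x + b' * y + c') = z"
      using d by (simp add: x_y_def prod_eq_iff field_simps) (simp add: d_def algebra_simps)
    hence g: "g z = (x, y)" using i[of "(x, y)"] by simp
    have "A *v affine_point z = affine_point (x, y)"
      using d by (simp add: vec_eq_iff forall_3 matrix_vector_mult_def sum_3 A_def affine_point_def x_y_def field_simps)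
    thus ?thesis by (simp add: projective_map_proj g)
  qed
  show ?thesis unfolding Sym_T0_def using inv 1 2 by blast
qed

section \<open>Partial derivatives and transport of germs\<close>

lemma holomorphic_germ_has_derivative:
  assumes "holomorphic_germ p u"
  shows "(u has_derivative (\<lambda>h. dx u p * fst h + dy u p * snd h)) (at p)"
proof -
  obtain a b where ab: "(u has_derivative (\<lambda>h. a * fst h + b * snd h)) (at p)"
    using assms unfolding holomorphic_germ_def holomorphic2_on_def by blast
  have "((\<lambda>s. u (s, snd p)) has_derivative (\<lambda>h. a * fst (h, 0::complex) + b * snd (h, 0::complex))) (at (fst p))"
    by (rule has_derivative_compose[where g = u and f = "\<lambda>s. (s, snd p)", of "\<lambda>h. (h, 0)"])
       (use ab in \<open>auto intro!: derivative_eq_intros\<close>)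
  hence "((\<lambda>s. u (s, snd p)) has_field_derivative a) (at (fst p))" by (simp add: has_field_derivative_def mult_commute_abs)
  hence a: "dx u p = a" unfolding dx_def by (rule DERIV_imp_deriv)
  have "((\<lambda>t. u (fst p, t)) has_derivative (\<lambda>h. a * fst (0::complex, h) + b * snd (0::complex, h))) (at (snd p))"
    by (rule has_derivative_compose[where g = u and f = "\<lambda>t. (fst p, t)", of "\<lambda>h. (0, h)"])
       (use ab in \<open>auto intro!: derivative_eq_intros\<close>)
  hence "((\<lambda>t. u (fst p, t)) has_field_derivative b) (at (snd p))" by (simp add: has_field_derivative_def mult_commute_abs)
  hence b: "dy u p = b" unfolding dy_def by (rule DERIV_imp_deriv)
  show ?thesis using ab by (simp add: a b)
qed

lemma dx_dy_cong:
  assumes "\<forall>\<^sub>F z in nhds p. u z = v z" shows "dx u p = dx v p" "dy u p = dy v p"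
proof -
  have "\<forall>\<^sub>F s in nhds (fst p). u (s, snd p) = v (s, snd p)"
    by (rule eventually_nhds_compose[where f = "\<lambda>s. (s, snd p)" and P = "\<lambda>z. u z = v z"])
       (use assms in \<open>simp_all add: continuous_Pair\<close>)
  moreover have "\<forall>\<^sub>F t in nhds (snd p). u (fst p, t) = v (fst p, t)"
    by (rule eventually_nhds_compose[where f = "\<lambda>t. (fst p, t)" and P = "\<lambda>z. u z = v z"])
       (use assms in \<open>simp_all add: continuous_Pair\<close>)
  ultimately show "dx u p = dx v p" "dy u p = dy v p" unfolding dx_def dy_def by (blast intro: deriv_cong_ev)+
qed

lemma dx_dy_unique:
  assumes "(u has_derivative (\<lambda>h. a * fst h + b * snd h)) (at p)" 
  shows "dx u p = a" "dy u p = b"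
proof -
  have "((\<lambda>s. u (s, snd p)) has_derivative (\<lambda>h. a * fst (h, 0::complex) + b * snd (h, 0::complex))) (at (fst p))"
    by (rule has_derivative_compose[where g = u and f = "\<lambda>s. (s, snd p)", of "\<lambda>h. (h, 0)"])
       (use assms in \<open>auto intro!: derivative_eq_intros\<close>)
  hence "((\<lambda>s. u (s, snd p)) has_field_derivative a) (at (fst p))" by (simp add: has_field_derivative_def mult_commute_abs)
  thus "dx u p = a" unfolding dx_def by (rule DERIV_imp_deriv)
  have "((\<lambda>t. u (fst p, t)) has_derivative (\<lambda>h. a * fst (0::complex, h) + b * snd (0::complex, h))) (at (snd p))"
    by (rule has_derivative_compose[where g = u and f = "\<lambda>t. (fst p, t)", of "\<lambda>h. (0, h)"])
       (use assms in \<open>auto intro!: derivative_eq_intros\<close>)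
  hence "((\<lambda>t. u (fst p, t)) has_field_derivative b) (at (snd p))" by (simp add: has_field_derivative_def mult_commute_abs)
  thus "dy u p = b" unfolding dy_def by (rule DERIV_imp_deriv)
qed

lemma analytic_locally_injective:
  assumes "\<phi> analytic_on {t}" "deriv \<phi> t \<noteq> 0"
  obtains V where "open V" "t \<in> V" "inj_on \<phi> V" "\<phi> holomorphic_on V"
proof -
  obtain e where e: "e > 0" "\<phi> holomorphic_on ball t e" using assms(1) unfolding analytic_on_def by blast
  obtain r where "r > 0" "ball t r \<subseteq> ball t e" "inj_on \<phi> (ball t r)"
    using has_complex_derivative_locally_injective[OF e(2) _ _ assms(2)] e(1) by auto
  thus ?thesis using e(2) by (intro that[of "ball t r"]) (auto intro: holomorphic_on_subset)
qed

lemma foliation_cong_analytic: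
  assumes "\<forall>\<^sub>F z in nhds p. v z = \<phi> (u z)" "isCont u p" "\<phi> analytic_on {u p}" "deriv \<phi> (u p) \<noteq> 0"
  shows "foliation p v = foliation p u"
  using analytic_locally_injective[OF assms(3,4)] foliation_cong[OF assms(1,2)] by metis

text \<open>Everything is reduced to finding a model \<open>w\<close>, an affine map \<open>L\<close> and a one-variable \<open>\<phi>\<close>
  with \<open>w \<circ> L = \<phi> \<circ> u\<close>; the element of the group is then the inverse of \<open>L\<close>.\<close>

lemma web_model:
  assumes u: "holomorphic_germ p u" "transversality p u"
    and lin: "T0_linear a b a' b'"
    and w: "holomorphic_germ (a * fst p + b * snd p + c, a' * fst p + b' * snd p + c') w"
    and \<phi>: "\<phi> analytic_on {u p}" "deriv \<phi> (u p) \<noteq> 0"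
    and eq: "\<forall>\<^sub>F z in nhds p. w (a * fst z + b * snd z + c, a' * fst z + b' * snd z + c') = \<phi> (u z)"
  shows "\<exists>g\<in>Sym_T0. \<exists>p'. holomorphic_germ p' w \<and> transversality p' w \<and> g p' = p \<and>
           web p (T_web u) = image_web g (web p' (T_web w))"
proof -
  define L where "L z = (a * fst z + b * snd z + c, a' * fst z + b' * snd z + c')" for z
  define d where "d = a * b' - b * a'"
  have d: "d \<noteq> 0" using T0_linear_det[OF lin] by (simp add: d_def)
  define g where "g z = ((b' * (fst z - c) - b * (snd z - c')) / d, (a * (snd z - c') - a' * (fst z - c)) / d)" for z
  have Lg: "L (g z) = z" for z
    using d by (simp add: L_def g_def prod_eq_iff field_simps) (simp add: d_def algebra_simps)
  have gL: "g (L z) = z" for z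
    using d by (simp add: L_def g_def prod_eq_iff field_simps) (simp add: d_def algebra_simps)
  have cL: "continuous_on UNIV L" and cg: "continuous_on UNIV g"
    unfolding L_def[abs_def] g_def[abs_def] using d by (auto intro!: continuous_intros)
  have g: "g \<in> Sym_T0" by (rule Sym_T0_inverse[OF lin, where c = c and c' = c']) (use gL in \<open>simp add: L_def\<close>)
  have Lp: "holomorphic_germ (L p) w" using w by (simp add: L_def)
  have eqL: "\<forall>\<^sub>F z in nhds p. w (L z) = \<phi> (u z)" using eq by (simp add: L_def)
  define X Y where "X = dx w (L p)" "Y = dy w (L p)"
  have "(L has_derivative (\<lambda>h. (a * fst h + b * snd h, a' * fst h + b' * snd h))) (at p)"
    unfolding L_def[abs_def] by (rule has_derivative_Pair) (auto intro!: derivative_eq_intros)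
  from has_derivative_compose[OF this holomorphic_germ_has_derivative[OF Lp]]
  have "((\<lambda>z. w (L z)) has_derivative (\<lambda>h. (a * X + a' * Y) * fst h + (b * X + b' * Y) * snd h)) (at p)"
    by (simp add: X_Y_def algebra_simps)
  from dx_dy_unique[OF this] have 1: "dx (\<lambda>z. w (L z)) p = a * X + a' * Y" "dy (\<lambda>z. w (L z)) p = b * X + b' * Y" by auto
  have "(\<phi> has_derivative (\<lambda>h. deriv \<phi> (u p) * h)) (at (u p))"
    using analytic_on_imp_differentiable_at[OF \<phi>(1)] field_differentiable_derivI unfolding has_field_derivative_def by blast
  from has_derivative_compose[OF holomorphic_germ_has_derivative[OF u(1)] this]
  have "((\<lambda>z. \<phi> (u z)) has_derivative (\<lambda>h. (deriv \<phi> (u p) * dx u p) * fst h + (deriv \<phi> (u p) * dy u p) * snd h)) (at p)"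
    by (simp add: algebra_simps)
  from dx_dy_unique[OF this] dx_dy_cong[OF eqL] 1
  have "a * X + a' * Y = deriv \<phi> (u p) * dx u p" "b * X + b' * Y = deriv \<phi> (u p) * dy u p" by auto
  from T0_linear_transversality[OF lin this \<phi>(2)] u(2)
  have tr: "transversality (L p) w" by (simp add: transversality_def X_Y_def)
  have im: "image_foliation g (foliation (L p) v) = foliation p (\<lambda>z. v (L z))" for v
    by (rule image_foliation_eq[OF cg cL Lg gL])
  define F where "F \<alpha> \<beta> = foliation p (\<lambda>z. \<alpha> * fst z + \<beta> * snd z)" for \<alpha> \<beta>
  have F: "F (k * \<alpha>) (k * \<beta>) = F \<alpha> \<beta>" if "k \<noteq> 0" for k \<alpha> \<beta>
    using foliation_scale[OF that, of p \<alpha> \<beta> 0] by (simp add: F_def)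
  have F': "foliation p (\<lambda>z. \<alpha> * fst z + \<beta> * snd z + \<gamma>) = F \<alpha> \<beta>" for \<alpha> \<beta> \<gamma>
    using foliation_scale[of 1 p \<alpha> \<beta> \<gamma>] by (simp add: F_def)
  have fu: "foliation p (\<lambda>z. w (L z)) = foliation p u"
    by (rule foliation_cong_analytic[OF eqL holomorphic_germ_isCont[OF u(1)] \<phi>])
  have e: "(\<lambda>z. fst (L z)) = (\<lambda>z. a * fst z + b * snd z + c)" "(\<lambda>z. snd (L z)) = (\<lambda>z. a' * fst z + b' * snd z + c')"
    "(\<lambda>z. fst (L z) + snd (L z)) = (\<lambda>z. (a + a') * fst z + (b + b') * snd z + (c + c'))"
    "(\<lambda>z. fst (L z) - snd (L z)) = (\<lambda>z. (a - a') * fst z + (b - b') * snd z + (c - c'))"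
    by (simp_all add: L_def fun_eq_iff algebra_simps)
  have "image_web g (web (L p) (T_web w)) = {F a b, F a' b', F (a + a') (b + b'), F (a - a') (b - b')} \<union> {foliation p u}"
    unfolding image_web_def web_def T_web_def by (simp add: im e F' fu insert_commute)
  also have "{F a b, F a' b', F (a + a') (b + b'), F (a - a') (b - b')} = {F 1 0, F 0 1, F 1 1, F 1 (-1)}"
    by (rule T0_linear_perm[of F, OF F lin])
  also have "\<dots> \<union> {foliation p u} = web p (T_web u)"
    unfolding web_def T_web_def F_def by (simp add: insert_commute)
  finally have "web p (T_web u) = image_web g (web (L p) (T_web w))" by (rule sym)
  thus ?thesis using Lp tr gL[of p] by (intro bexI[OF _ g] exI[of _ "L p"] conjI)
qed

lemma holomorphic_germ_mult:
  assumes "A analytic_on {x}" "B analytic_on {y}"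
  shows "holomorphic_germ (x, y) (\<lambda>z. A (fst z) * B (snd z))" "holomorphic_germ (x, y) (\<lambda>z. A (fst z) + B (snd z))"
proof -
  obtain r where r: "r > 0" "A holomorphic_on ball x r" using assms(1) unfolding analytic_on_def by blast
  obtain s where s: "s > 0" "B holomorphic_on ball y s" using assms(2) unfolding analytic_on_def by blast
  have U: "open (ball x r \<times> ball y s)" "(x, y) \<in> ball x r \<times> ball y s" using r s by (auto intro: open_Times)
  have d: "((\<lambda>z. A (fst z)) has_derivative (\<lambda>h. deriv A (fst z) * fst h)) (at z)"
     "((\<lambda>z. B (snd z)) has_derivative (\<lambda>h. deriv B (snd z) * snd h)) (at z)" if "z \<in> ball x r \<times> ball y s" for z
  proof -
    have "(A has_derivative (\<lambda>h. deriv A (fst z) * h)) (at (fst z))"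
      using holomorphic_derivI[OF r(2), of "fst z" UNIV] that unfolding has_field_derivative_def by auto
    from has_derivative_compose[OF has_derivative_fst[OF has_derivative_ident] this]
    show "((\<lambda>z. A (fst z)) has_derivative (\<lambda>h. deriv A (fst z) * fst h)) (at z)" by simp
    have "(B has_derivative (\<lambda>h. deriv B (snd z) * h)) (at (snd z))"
      using holomorphic_derivI[OF s(2), of "snd z" UNIV] that unfolding has_field_derivative_def by auto
    from has_derivative_compose[OF has_derivative_snd[OF has_derivative_ident] this]
    show "((\<lambda>z. B (snd z)) has_derivative (\<lambda>h. deriv B (snd z) * snd h)) (at z)" by simp
  qed
  have "\<exists>a b. ((\<lambda>z. A (fst z) * B (snd z)) has_derivative (\<lambda>h. a * fst h + b * snd h)) (at z)"
    if "z \<in> ball x r \<times> ball y s" for z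
    using has_derivative_mult[OF d[OF that]]
    by (intro exI[of _ "deriv A (fst z) * B (snd z)"] exI[of _ "A (fst z) * deriv B (snd z)"]) (simp add: algebra_simps)
  thus "holomorphic_germ (x, y) (\<lambda>z. A (fst z) * B (snd z))"
    unfolding holomorphic_germ_def holomorphic2_on_def using U by blast
  have "\<exists>a b. ((\<lambda>z. A (fst z) + B (snd z)) has_derivative (\<lambda>h. a * fst h + b * snd h)) (at z)"
    if "z \<in> ball x r \<times> ball y s" for z
    using has_derivative_add[OF d[OF that]] by blast
  thus "holomorphic_germ (x, y) (\<lambda>z. A (fst z) + B (snd z))"
    unfolding holomorphic_germ_def holomorphic2_on_def using U by blast
qed

section \<open>Germs of analytic functions and hexagonal 3-webs\<close>

lemma analytic_at_ball:
  assumes "f analytic_on {x}" obtains r where "r > 0" "f holomorphic_on ball x r"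
  using assms unfolding analytic_on_def by blast

lemma analytic_DERIV: "f analytic_on {x} \<Longrightarrow> (f has_field_derivative deriv f x) (at x)"
  by (rule analytic_derivI)

lemma analytic_eventually:
  assumes "f analytic_on {x}" shows "\<forall>\<^sub>F w in nhds x. f analytic_on {w}"
proof -
  obtain S where "open S" "x \<in> S" "f holomorphic_on S" using assms unfolding analytic_at by blast
  thus ?thesis unfolding eventually_nhds analytic_at by blast
qed

lemma analytic_isCont: "f analytic_on {x} \<Longrightarrow> isCont f x"
  using analytic_DERIV DERIV_isCont by blast

lemma analytic_compose:
  assumes "g analytic_on {f x}" "f analytic_on {x}" shows "(\<lambda>z. g (f z)) analytic_on {x}"
  using analytic_on_compose_gen[of f "{x}" g "{f x}"] assms by (simp add: o_def)

lemma primitive_at: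
  assumes "f analytic_on {x}"
  obtains F where "F analytic_on {x}" "F x = 0" "\<forall>\<^sub>F z in nhds x. (F has_field_derivative f z) (at z)" "deriv F x = f x"
proof -
  obtain r where r: "r > 0" "f holomorphic_on ball x r" using analytic_at_ball[OF assms] by blast
  obtain F where F: "\<And>z. z \<in> ball x r \<Longrightarrow> (F has_field_derivative f z) (at z within ball x r)"
    by (rule holomorphic_convex_primitive'[OF convex_ball open_ball r(2)]) blast
  define G where "G z = F z - F x" for z
  have G: "(G has_field_derivative f z) (at z)" if "z \<in> ball x r" for z
    unfolding G_def[abs_def] using F[OF that] that by (auto simp: at_within_open[of _ "ball x r"] intro!: derivative_eq_intros)
  show ?thesis
  proof (rule that[of G])
    show "\<forall>\<^sub>F z in nhds x. (G has_field_derivative f z) (at z)" unfolding eventually_nhds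
      by (rule exI[of _ "ball x r"]) (use r G in auto)
    have "G holomorphic_on ball x r" unfolding holomorphic_on_open[OF open_ball] using G by blast
    thus "G analytic_on {x}" unfolding analytic_at using r(1) by (intro exI[of _ "ball x r"]) simp
    show "G x = 0" by (simp add: G_def)
    show "deriv G x = f x" using G[of x] r by (intro DERIV_imp_deriv) auto
  qed
qed

lemma local_inverse:
  assumes "f analytic_on {x}" "deriv f x \<noteq> 0"
  obtains X where "X analytic_on {f x}" "X (f x) = x" "\<forall>\<^sub>F s in nhds (f x). f (X s) = s"
    "\<forall>\<^sub>F z in nhds x. X (f z) = z" "deriv X (f x) \<noteq> 0"
    "\<forall>\<^sub>F s in nhds (f x). deriv f (X s) * deriv X s = 1"
proof -
  obtain V where V: "open V" "x \<in> V" "inj_on f V" "f holomorphic_on V" using analytic_locally_injective[OF assms] by blast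
  obtain X where X: "X holomorphic_on (f ` V)" "\<And>z. z \<in> V \<Longrightarrow> deriv f z * deriv X (f z) = 1" "\<And>z. z \<in> V \<Longrightarrow> X (f z) = z"
    using holomorphic_has_inverse[OF V(4,1,3)] by blast
  have o: "open (f ` V)" by (rule open_mapping_thm3[OF V(4,1,3)])
  show ?thesis
  proof (rule that[of X])
    show "X analytic_on {f x}" unfolding analytic_at using o X(1) V(2) by blast
    show "X (f x) = x" using X V by blast
    show "\<forall>\<^sub>F s in nhds (f x). f (X s) = s" unfolding eventually_nhds using o V X(3) by (intro exI[of _ "f ` V"]) auto
    show "\<forall>\<^sub>F z in nhds x. X (f z) = z" unfolding eventually_nhds using V X(3) by blast
    show "deriv X (f x) \<noteq> 0" using X(2)[OF V(2)] by auto
    show "\<forall>\<^sub>F s in nhds (f x). deriv f (X s) * deriv X s = 1" unfolding eventually_nhds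
      using o V X by (intro exI[of _ "f ` V"]) auto
  qed
qed

lemma eventually_slice:
  fixes x0 :: "'a::t2_space" and y0 :: "'b::t2_space"
  assumes "\<forall>\<^sub>F z in nhds (x0, y0). P z"
  shows "\<forall>\<^sub>F x in nhds x0. P (x, y0)" "\<forall>\<^sub>F y in nhds y0. P (x0, y)"
proof -
  show "\<forall>\<^sub>F x in nhds x0. P (x, y0)"
    by (rule eventually_nhds_compose[where f = "\<lambda>x. (x, y0)" and P = P]) (use assms in \<open>simp_all add: continuous_Pair\<close>)
  show "\<forall>\<^sub>F y in nhds y0. P (x0, y)"
    by (rule eventually_nhds_compose[where f = "\<lambda>y. (x0, y)" and P = P]) (use assms in \<open>simp_all add: continuous_Pair\<close>)
qed

lemma eventually_box:
  fixes x0 y0 :: complex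
  assumes "\<forall>\<^sub>F z in nhds (x0, y0). P z"
  obtains r where "r > 0" "\<And>x y. x \<in> ball x0 r \<Longrightarrow> y \<in> ball y0 r \<Longrightarrow> P (x, y)"
proof -
  obtain Q R where QR: "eventually Q (nhds x0)" "eventually R (nhds y0)" "\<And>x y. Q x \<Longrightarrow> R y \<Longrightarrow> P (x, y)"
    using assms unfolding nhds_prod eventually_prod_filter by blast
  obtain a where a: "a > 0" "\<And>x. dist x x0 < a \<Longrightarrow> Q x" using QR(1) unfolding eventually_nhds_metric by blast
  obtain b where b: "b > 0" "\<And>y. dist y y0 < b \<Longrightarrow> R y" using QR(2) unfolding eventually_nhds_metric by blast
  show ?thesis by (rule that[of "min a b"]) (use a b QR(3) in \<open>auto simp: dist_commute\<close>)
qed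

lemma eventually_fst:
  fixes x0 :: "'a::t2_space" and y0 :: "'b::t2_space"
  shows "\<forall>\<^sub>F x in nhds x0. P x \<Longrightarrow> \<forall>\<^sub>F z in nhds (x0, y0). P (fst z)"
  by (rule eventually_nhds_compose[where f = fst and P = P]) simp_all

lemma eventually_snd:
  fixes x0 :: "'a::t2_space" and y0 :: "'b::t2_space"
  shows "\<forall>\<^sub>F y in nhds y0. P y \<Longrightarrow> \<forall>\<^sub>F z in nhds (x0, y0). P (snd z)"
  by (rule eventually_nhds_compose[where f = snd and P = P]) simp_all

lemma eventually_nonzero:
  fixes f :: "'a::t2_space \<Rightarrow> complex"
  assumes "isCont f x" "f x \<noteq> 0" shows "\<forall>\<^sub>F z in nhds x. f z \<noteq> 0"
proof (rule eventually_nhds_compose[where P = "\<lambda>w. w \<noteq> 0", OF _ assms(1)])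
  show "\<forall>\<^sub>F w in nhds (f x). w \<noteq> 0"
    using eventually_nhds_in_open[of "- {0}" "f x"] assms(2) by (simp add: open_Compl)
qed

text \<open>\<open>holomorphic2_on\<close> gives a derivative at each point and no continuity of the
  partial derivatives. Cauchy's inequality for the one-variable function u(x, t) - u(x0, t) converts
  uniform continuity of u into continuity of its t-derivative.\<close>

lemma dy_continuous:
  assumes "holomorphic_germ (x0, y0) u"
  shows "isCont (\<lambda>x. dy u (x, y0)) x0"
proof -
  obtain U where U: "open U" "(x0, y0) \<in> U" "holomorphic2_on u U" using assms unfolding holomorphic_germ_def by blast
  have "\<forall>\<^sub>F z in nhds (x0, y0). z \<in> U" by (rule eventually_nhds_in_open[OF U(1,2)])
  then obtain r' where r': "r' > 0" "\<And>x y. x \<in> ball x0 r' \<Longrightarrow> y \<in> ball y0 r' \<Longrightarrow> (x, y) \<in> U" using eventually_box by blast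
  define r where "r = r' / 2"
  define K where "K = cball x0 r \<times> cball y0 r"
  have r: "r > 0" and KU: "K \<subseteq> U" using r' by (auto simp: r_def K_def)
  have cont: "continuous_on U u" using U(3) unfolding holomorphic2_on_def
    by (meson continuous_at_imp_continuous_on has_derivative_continuous)
  have d: "((\<lambda>t. u (x, t)) has_field_derivative dy u (x, t)) (at t)" if "(x, t) \<in> U" for x t
  proof -
    have "holomorphic_germ (x, t) u" using U(1,3) that unfolding holomorphic_germ_def by blast
    from holomorphic_germ_has_derivative[OF this]
    have "((\<lambda>t. u (x, t)) has_derivative (\<lambda>h. dx u (x,t) * fst (0::complex, h) + dy u (x,t) * snd (0::complex, h))) (at t)"
      by (intro has_derivative_compose[where g = u and f = "\<lambda>t. (x, t)", of "\<lambda>h. (0, h)"])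
       (auto intro!: derivative_eq_intros)
    thus ?thesis by (simp add: has_field_derivative_def mult_commute_abs)
  qed
  have "uniformly_continuous_on K u"
    by (rule compact_uniformly_continuous[OF continuous_on_subset[OF cont KU]]) (simp add: K_def compact_Times)
  hence uc: "\<exists>d>0. \<forall>z\<in>K. \<forall>z'\<in>K. dist z' z < d \<longrightarrow> dist (u z') (u z) < e" if "e > 0" for e
    using that unfolding uniformly_continuous_on_def by blast
  show ?thesis unfolding continuous_at_eps_delta
  proof (intro allI impI)
    fix e :: real assume e: "e > 0"
    obtain d where d0: "d > 0" "\<And>z z'. z \<in> K \<Longrightarrow> z' \<in> K \<Longrightarrow> dist z' z < d \<Longrightarrow> dist (u z') (u z) < e * r / 2"
      using uc[of "e * r / 2"] e r by auto
    show "\<exists>d>0. \<forall>x'. dist x' x0 < d \<longrightarrow> dist (dy u (x', y0)) (dy u (x0, y0)) < e"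
    proof (intro exI[of _ "min d r"] conjI allI impI)
      show "min d r > 0" using d0 r by simp
      fix x assume x: "dist x x0 < min d r"
      define h where "h t = u (x, t) - u (x0, t)" for t
      have h: "(h has_field_derivative dy u (x, t) - dy u (x0, t)) (at t)" if "t \<in> cball y0 r" for t
        unfolding h_def[abs_def] using that x KU r by (intro DERIV_diff d) (auto simp: K_def dist_commute)
      have B: "norm (h t) \<le> e * r / 2" if "t \<in> cball y0 r" for t
        using d0(2)[of "(x0, t)" "(x, t)"] that x r by (auto simp: h_def K_def dist_commute dist_Pair_Pair dist_norm norm_minus_commute)
      have "norm ((deriv ^^ 1) h y0) \<le> fact 1 * (e * r / 2) / r ^ 1"
      proof (rule Cauchy_inequality)
        show "h holomorphic_on ball y0 r" unfolding holomorphic_on_open[OF open_ball] by (intro ballI exI) (rule h, simp)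
        show "continuous_on (cball y0 r) h" using h DERIV_isCont by (meson continuous_at_imp_continuous_on)
      qed (use r B in \<open>auto simp: dist_norm\<close>)
      moreover have "deriv h y0 = dy u (x, y0) - dy u (x0, y0)" using h[of y0] r by (intro DERIV_imp_deriv) auto
      ultimately have "norm (dy u (x, y0) - dy u (x0, y0)) \<le> e / 2" using r by simp
      thus "dist (dy u (x, y0)) (dy u (x0, y0)) < e" using e by (simp add: dist_norm)
    qed
  qed
qed

lemma dx_dy_coords [simp]:
  "dx fst z = 1" "dy fst z = 0" "dx snd z = 0" "dy snd z = 1"
  "dx (\<lambda>z. fst z + snd z) z = 1" "dy (\<lambda>z. fst z + snd z) z = 1"
  "dx (\<lambda>z. fst z - snd z) z = 1" "dy (\<lambda>z. fst z - snd z) z = -1"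
  unfolding dx_def dy_def by (auto intro!: DERIV_imp_deriv derivative_eq_intros)

lemma sum_lessThan_3: "(\<Sum>j<3. F j) = F 0 + F 1 + F (2::nat)" for F :: "nat \<Rightarrow> complex"
  by (simp add: eval_nat_numeral)

text \<open>A nonzero abelian relation of \<open>{\<F>(x), \<F>(y), \<F>(u)}\<close> has no zero component at the base point
  (\<open>\<phi>\<^sub>3\<close> would vanish along the curve \<open>y = y0\<close>, which is transverse to the leaves of \<open>u\<close>), so that
  it can be integrated to \<open>\<Phi>(u) = f(x) + g(y)\<close>.\<close>

lemma hexagonal_web:
  assumes u: "holomorphic_germ (x0, y0) u" and nz: "dx u (x0, y0) \<noteq> 0" "dy u (x0, y0) \<noteq> 0"
    and rk: "maximal_rank (x0, y0) [fst, snd, u]"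
  obtains f g \<Phi> where "f analytic_on {x0}" "f x0 = 0" "deriv f x0 \<noteq> 0" "g analytic_on {y0}" "g y0 = 0" "deriv g y0 \<noteq> 0"
    "\<Phi> analytic_on {u (x0, y0)}" "\<Phi> (u (x0, y0)) = 0" "deriv \<Phi> (u (x0, y0)) \<noteq> 0"
    "\<forall>\<^sub>F z in nhds (x0, y0). \<Phi> (u z) = f (fst z) + g (snd z)"
proof -
  let ?p = "(x0, y0)"
  let ?us = "[fst, snd, u]"
  obtain B :: "nat \<Rightarrow> nat \<Rightarrow> complex \<Rightarrow> complex" where B: "abelian_relation ?p ?us (B 0)"
    "\<And>c. same_germs ?p ?us (\<lambda>j t. \<Sum>k<1. c k * B k j t) (\<lambda>j t. 0) \<Longrightarrow> c 0 = 0"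
    using rk unfolding maximal_rank_def has_rank_def by auto
  define \<phi> where "\<phi> = B 0"
  have nonzero: "\<not> same_germs ?p ?us \<phi> (\<lambda>j t. 0)" using B(2)[of "\<lambda>_. 1"] by (auto simp: \<phi>_def)
  have a: "\<phi> j analytic_on {(?us ! j) ?p}" if "j < 3" for j
    using B(1) that unfolding abelian_relation_def \<phi>_def by simp
  have an: "\<phi> 0 analytic_on {x0}" "\<phi> 1 analytic_on {y0}" "\<phi> 2 analytic_on {u ?p}"
    using a[of 0] a[of 1] a[of 2] by simp_all
  have l: "length ?us = 3" by simp
  have E: "\<forall>\<^sub>F z in nhds ?p. (\<Sum>j<3. \<phi> j ((?us ! j) z) * dx (?us ! j) z) = 0 \<and> (\<Sum>j<3. \<phi> j ((?us ! j) z) * dy (?us ! j) z) = 0"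
    using B(1)[unfolded abelian_relation_def l] unfolding \<phi>_def by blast
  have E1: "\<forall>\<^sub>F z in nhds ?p. \<phi> 0 (fst z) = - \<phi> 2 (u z) * dx u z"
    by (rule eventually_mono[OF E]) (simp add: sum_lessThan_3 eq_neg_iff_add_eq_0)
  have E2: "\<forall>\<^sub>F z in nhds ?p. \<phi> 1 (snd z) = - \<phi> 2 (u z) * dy u z"
    by (rule eventually_mono[OF E]) (simp add: sum_lessThan_3 eq_neg_iff_add_eq_0)
  have cu: "isCont u ?p" by (rule holomorphic_germ_isCont[OF u])
  have nz2: "\<phi> 2 (u ?p) \<noteq> 0"
  proof
    assume z: "\<phi> 2 (u ?p) = 0"
    have "\<phi> 1 y0 = 0" using eventually_nhds_x_imp_x[OF E2] z by simp
    hence "\<forall>\<^sub>F x in nhds x0. \<phi> 2 (u (x, y0)) * dy u (x, y0) = 0" using eventually_slice(1)[OF E2] by simp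
    moreover have "\<forall>\<^sub>F x in nhds x0. dy u (x, y0) \<noteq> 0"
      by (rule eventually_nonzero[OF dy_continuous[OF u] nz(2)])
    ultimately have "\<forall>\<^sub>F x in nhds x0. \<phi> 2 (u (x, y0)) = 0" by eventually_elim auto
    moreover define h where "h x = u (x, y0)" for x
    ultimately have h0: "\<forall>\<^sub>F x in nhds x0. \<phi> 2 (h x) = 0" by (simp add: h_def)
    have ha: "h analytic_on {x0}"
    proof -
      obtain U where U: "open U" "?p \<in> U" "holomorphic2_on u U" using u unfolding holomorphic_germ_def by blast
      have "\<forall>\<^sub>F x in nhds x0. (x, y0) \<in> U" by (rule eventually_slice(1)[OF eventually_nhds_in_open[OF U(1,2)]])
      then obtain S where S: "open S" "x0 \<in> S" "\<And>x. x \<in> S \<Longrightarrow> (x, y0) \<in> U" unfolding eventually_nhds by blast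
      have "\<exists>f'. (h has_field_derivative f') (at x)" if "x \<in> S" for x
      proof -
        have "holomorphic_germ (x, y0) u" using U(1,3) S(3)[OF that] unfolding holomorphic_germ_def by blast
        from holomorphic_germ_has_derivative[OF this]
        have "((\<lambda>s. u (s, y0)) has_derivative (\<lambda>h. dx u (x,y0) * fst (h, 0::complex) + dy u (x,y0) * snd (h, 0::complex))) (at x)"
          by (intro has_derivative_compose[where g = u and f = "\<lambda>s. (s, y0)", of "\<lambda>h. (h, 0)"])
           (auto intro!: derivative_eq_intros)
        hence "(h has_field_derivative dx u (x, y0)) (at x)" by (simp add: has_field_derivative_def mult_commute_abs h_def[abs_def])
        thus ?thesis by blast
      qed
      hence "h holomorphic_on S" unfolding holomorphic_on_open[OF S(1)] by blast
      thus ?thesis unfolding analytic_at using S(1,2) by blast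
    qed
    have "deriv h x0 \<noteq> 0" using nz(1) by (simp add: dx_def h_def[abs_def])
    \<comment> \<open>x -> u(x, y0) is locally invertible, so vanishing of the component along the
      slice is vanishing on a whole neighbourhood of \<open>u ?p\<close>.\<close>
    from ha this obtain X where X: "X analytic_on {h x0}" "X (h x0) = x0" "\<forall>\<^sub>F s in nhds (h x0). h (X s) = s"
      by (rule local_inverse) blast
    have "\<forall>\<^sub>F s in nhds (h x0). \<phi> 2 (h (X s)) = 0"
      by (rule eventually_nhds_compose[where f = X and P = "\<lambda>x. \<phi> 2 (h x) = 0"]) (use X h0 analytic_isCont in auto)
    hence z2: "\<forall>\<^sub>F s in nhds (u ?p). \<phi> 2 s = 0" using X(3) unfolding h_def by eventually_elim simp
    have "\<forall>\<^sub>F z in nhds ?p. \<phi> 2 (u z) = 0" by (rule eventually_nhds_compose[OF z2 cu])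
    hence "\<forall>\<^sub>F z in nhds ?p. \<phi> 0 (fst z) = 0" "\<forall>\<^sub>F z in nhds ?p. \<phi> 1 (snd z) = 0"
      using E1 E2 by (eventually_elim, simp)+
    from eventually_slice(1)[OF this(1)] eventually_slice(2)[OF this(2)] z2
    have c: "\<forall>\<^sub>F t in nhds ((?us ! j) ?p). \<phi> j t = 0" if "j = 0 \<or> j = 1 \<or> j = 2" for j using that by (elim disjE) simp_all
    have "same_germs ?p ?us \<phi> (\<lambda>j t. 0)" unfolding same_germs_def
    proof (intro allI impI c)
      fix j assume "j < length ?us" thus "j = 0 \<or> j = 1 \<or> j = 2" by simp linarith
    qed
    thus False using nonzero by blast
  qed
  obtain F where F: "F analytic_on {x0}" "F x0 = 0" "\<forall>\<^sub>F z in nhds x0. (F has_field_derivative - \<phi> 0 z) (at z)" "deriv F x0 = - \<phi> 0 x0"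
    by (rule primitive_at[of "\<lambda>z. - \<phi> 0 z" x0]) (use an in \<open>auto intro: analytic_on_neg\<close>)
  obtain G where G: "G analytic_on {y0}" "G y0 = 0" "\<forall>\<^sub>F z in nhds y0. (G has_field_derivative - \<phi> 1 z) (at z)" "deriv G y0 = - \<phi> 1 y0"
    by (rule primitive_at[of "\<lambda>z. - \<phi> 1 z" y0]) (use an in \<open>auto intro: analytic_on_neg\<close>)
  obtain \<Phi> where \<Phi>: "\<Phi> analytic_on {u ?p}" "\<Phi> (u ?p) = 0" "\<forall>\<^sub>F t in nhds (u ?p). (\<Phi> has_field_derivative \<phi> 2 t) (at t)" "deriv \<Phi> (u ?p) = \<phi> 2 (u ?p)"
    by (rule primitive_at[OF an(3)]) blast
  obtain U where U: "open U" "?p \<in> U" "holomorphic2_on u U" using u unfolding holomorphic_germ_def by blast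
  have "\<forall>\<^sub>F z in nhds ?p. z \<in> U" by (rule eventually_nhds_in_open[OF U(1,2)])
  hence "\<forall>\<^sub>F z in nhds ?p. ((\<lambda>z. \<Phi> (u z) - F (fst z) - G (snd z)) has_derivative (\<lambda>h. 0)) (at z)"
    using eventually_nhds_compose[OF \<Phi>(3) cu] eventually_fst[OF F(3), of y0] eventually_snd[OF G(3), of x0] E1 E2
  proof eventually_elim
    case (elim z)
    have "holomorphic_germ z u" using U(1,3) elim(1) unfolding holomorphic_germ_def by blast
    note d = holomorphic_germ_has_derivative[OF this]
    have 1: "((\<lambda>z. \<Phi> (u z)) has_derivative (\<lambda>h. \<phi> 2 (u z) * (dx u z * fst h + dy u z * snd h))) (at z)"
      by (rule has_derivative_compose[OF d elim(2)[unfolded has_field_derivative_def]])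
    have 2: "((\<lambda>z. F (fst z)) has_derivative (\<lambda>h. - \<phi> 0 (fst z) * fst h)) (at z)"
      by (rule has_derivative_compose[OF has_derivative_fst[OF has_derivative_ident] elim(3)[unfolded has_field_derivative_def]])
    have 3: "((\<lambda>z. G (snd z)) has_derivative (\<lambda>h. - \<phi> 1 (snd z) * snd h)) (at z)"
      by (rule has_derivative_compose[OF has_derivative_snd[OF has_derivative_ident] elim(4)[unfolded has_field_derivative_def]])
    have "(\<lambda>h. \<phi> 2 (u z) * (dx u z * fst h + dy u z * snd h) - (- \<phi> 0 (fst z) * fst h) - (- \<phi> 1 (snd z) * snd h)) = (\<lambda>h. 0)"
      using elim(5,6) by (simp add: fun_eq_iff algebra_simps)
    with has_derivative_diff[OF has_derivative_diff[OF 1 2] 3] show ?case by simp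
  qed
  then obtain r where r: "r > 0" "\<And>x y. x \<in> ball x0 r \<Longrightarrow> y \<in> ball y0 r \<Longrightarrow> ((\<lambda>z. \<Phi> (u z) - F (fst z) - G (snd z)) has_derivative (\<lambda>h. 0)) (at (x, y))"
    by (rule eventually_box) blast
  have "\<exists>c. \<forall>z\<in>ball x0 r \<times> ball y0 r. \<Phi> (u z) - F (fst z) - G (snd z) = c"
    by (rule has_derivative_zero_constant) (use r in \<open>auto intro: convex_Times has_derivative_at_withinI\<close>)
  then obtain c where c: "\<And>z. z \<in> ball x0 r \<times> ball y0 r \<Longrightarrow> \<Phi> (u z) - F (fst z) - G (snd z) = c" by blast
  have "c = 0" using c[of ?p] r \<Phi>(2) F(2) G(2) by simp
  hence eq: "\<forall>\<^sub>F z in nhds ?p. \<Phi> (u z) = F (fst z) + G (snd z)" unfolding eventually_nhds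
    by (intro exI[of _ "ball x0 r \<times> ball y0 r"]) (use r c in \<open>auto simp: open_Times algebra_simps\<close>)
  show ?thesis
  proof (rule that[OF F(1,2) _ G(1,2) _ \<Phi>(1,2) _ eq])
    show "deriv F x0 \<noteq> 0" using eventually_nhds_x_imp_x[OF E1] nz nz2 F(4) by simp
    show "deriv G y0 \<noteq> 0" using eventually_nhds_x_imp_x[OF E2] nz nz2 G(4) by simp
    show "deriv \<Phi> (u ?p) \<noteq> 0" using nz2 \<Phi>(4) by simp
  qed
qed

section \<open>The functional equation of a web of maximal rank\<close>

lemma deriv_eq_on_open:
  assumes "open S" "x \<in> S" "\<And>z. z \<in> S \<Longrightarrow> h z = k z" "(h has_field_derivative a) (at x)" "(k has_field_derivative b) (at x)"
  shows "a = (b::complex)"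
proof -
  have "(k has_field_derivative a) (at x)" using assms(1-4) by (metis has_field_derivative_transform_within_open)
  thus ?thesis using assms(5) DERIV_unique by blast
qed

lemma DERIV_compose_add:
  fixes F f :: "complex \<Rightarrow> complex"
  assumes "F analytic_on {f x + c}" "f analytic_on {x}"
  shows "((\<lambda>x. F (f x + c)) has_field_derivative deriv F (f x + c) * deriv f x) (at x)"
proof -
  have "((\<lambda>x. f x + c) has_field_derivative deriv f x) (at x)"
    using DERIV_add[OF analytic_DERIV[OF assms(2)] DERIV_const[of c]] by simp
  thus "((\<lambda>x. F (f x + c)) has_field_derivative deriv F (f x + c) * deriv f x) (at x)"
    by (rule DERIV_chain2[where f = F and g = "\<lambda>x. f x + c", OF analytic_DERIV[OF assms(1)]])
qed

lemma DERIV_compose_add':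
  fixes F f :: "complex \<Rightarrow> complex"
  assumes "F analytic_on {c + f x}" "f analytic_on {x}"
  shows "((\<lambda>x. F (c + f x)) has_field_derivative deriv F (c + f x) * deriv f x) (at x)"
  using DERIV_compose_add[of F f x c] assms unfolding add.commute[of c] by blast

text \<open>The mixed derivative \<open>\<partial>\<^sub>x \<partial>\<^sub>y\<close> of the potential of an abelian relation is annihilated by
  \<open>\<partial>\<^sub>x\<^sup>2 - \<partial>\<^sub>y\<^sup>2\<close> on its \<open>x + y\<close> and \<open>x - y\<close> components, hence also on its \<open>u\<close> component.\<close>

lemma relation_pde:
  fixes f g \<xi> \<phi>0 \<phi>2 \<phi>3 :: "complex \<Rightarrow> complex"
  assumes an: "f analytic_on {x0}" "g analytic_on {y0}" "\<xi> analytic_on {f x0 + g y0}"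
      "\<phi>2 analytic_on {x0 + y0}" "\<phi>3 analytic_on {x0 - y0}"
    and E: "\<forall>\<^sub>F z in nhds (x0, y0). \<phi>0 (fst z) + \<phi>2 (fst z + snd z) + \<phi>3 (fst z - snd z) + \<xi> (f (fst z) + g (snd z)) * deriv f (fst z) = 0"
  defines "f1 \<equiv> deriv f" and "f2 \<equiv> deriv (deriv f)" and "f3 \<equiv> deriv (deriv (deriv f))"
    and "g1 \<equiv> deriv g" and "g2 \<equiv> deriv (deriv g)" and "g3 \<equiv> deriv (deriv (deriv g))"
    and "G \<equiv> deriv \<xi>" and "G1 \<equiv> deriv (deriv \<xi>)" and "G2 \<equiv> deriv (deriv (deriv \<xi>))"
  shows "\<forall>\<^sub>F z in nhds (x0, y0). \<forall>x y. z = (x, y) \<longrightarrow>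
      (G2 (f x + g y) * f1 x ^ 3 + 3 * G1 (f x + g y) * f1 x * f2 x + G (f x + g y) * f3 x) * g1 y =
      (G2 (f x + g y) * g1 y ^ 3 + 3 * G1 (f x + g y) * g1 y * g2 y + G (f x + g y) * g3 y) * f1 x"
proof -
  define P where "P x y \<longleftrightarrow> f analytic_on {x} \<and> g analytic_on {y} \<and> \<xi> analytic_on {f x + g y} \<and> \<phi>2 analytic_on {x + y} \<and> \<phi>3 analytic_on {x - y} \<and>
     \<phi>0 x + \<phi>2 (x + y) + \<phi>3 (x - y) + \<xi> (f x + g y) * f1 x = 0" for x y
  have "isCont (\<lambda>z. f (fst z)) (x0, y0)" by (rule isCont_o2[where g = f]) (simp_all add: analytic_isCont an)
  moreover have "isCont (\<lambda>z. g (snd z)) (x0, y0)" by (rule isCont_o2[where g = g]) (simp_all add: analytic_isCont an)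
  ultimately have cf: "isCont (\<lambda>z. f (fst z) + g (snd z)) (x0, y0)" by (rule continuous_add)
  have "\<forall>\<^sub>F z in nhds (x0, y0). \<xi> analytic_on {f (fst z) + g (snd z)}"
    by (rule eventually_nhds_compose[where P = "\<lambda>w. \<xi> analytic_on {w}", OF _ cf]) (simp add: analytic_eventually an)
  moreover have "\<forall>\<^sub>F z in nhds (x0, y0). \<phi>2 analytic_on {fst z + snd z}"
    by (rule eventually_nhds_compose[where P = "\<lambda>w. \<phi>2 analytic_on {w}"]) (simp_all add: analytic_eventually an)
  moreover have "\<forall>\<^sub>F z in nhds (x0, y0). \<phi>3 analytic_on {fst z - snd z}"
    by (rule eventually_nhds_compose[where P = "\<lambda>w. \<phi>3 analytic_on {w}"]) (simp_all add: analytic_eventually an)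
  ultimately have "\<forall>\<^sub>F z in nhds (x0, y0). P (fst z) (snd z)"
    using eventually_fst[OF analytic_eventually[OF an(1)], of y0] eventually_snd[OF analytic_eventually[OF an(2)], of x0] E
    by eventually_elim (simp add: P_def f1_def)
  then obtain r where r: "r > 0" "\<And>x y. x \<in> ball x0 r \<Longrightarrow> y \<in> ball y0 r \<Longrightarrow> P x y"
    by (rule eventually_box) auto
  have main: "(G2 (f x + g y) * f1 x ^ 3 + 3 * G1 (f x + g y) * f1 x * f2 x + G (f x + g y) * f3 x) * g1 y =
      (G2 (f x + g y) * g1 y ^ 3 + 3 * G1 (f x + g y) * g1 y * g2 y + G (f x + g y) * g3 y) * f1 x"
    if "x \<in> ball x0 r" "y \<in> ball y0 r" for x y
  proof -
    let ?A = "\<lambda>x y. deriv \<phi>2 (x + y)" let ?B = "\<lambda>x y. deriv \<phi>3 (x - y)"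
    let ?A1 = "\<lambda>x y. deriv (deriv \<phi>2) (x + y)" let ?B1 = "\<lambda>x y. deriv (deriv \<phi>3) (x - y)"
    let ?A2 = "\<lambda>x y. deriv (deriv (deriv \<phi>2)) (x + y)" let ?B2 = "\<lambda>x y. deriv (deriv (deriv \<phi>3)) (x - y)"
    have p: "f analytic_on {x}" "f1 analytic_on {x}" "f2 analytic_on {x}" "g analytic_on {y}" "g1 analytic_on {y}" "g2 analytic_on {y}"
        "\<xi> analytic_on {f x + g y}" "G analytic_on {f x + g y}" "G1 analytic_on {f x + g y}"
        "\<phi>2 analytic_on {x + y}" "deriv \<phi>2 analytic_on {x + y}" "deriv (deriv \<phi>2) analytic_on {x + y}"
        "\<phi>3 analytic_on {x - y}" "deriv \<phi>3 analytic_on {x - y}" "deriv (deriv \<phi>3) analytic_on {x - y}"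
        "\<phi>0 x + \<phi>2 (x + y) + \<phi>3 (x - y) + \<xi> (f x + g y) * f1 x = 0" if "x \<in> ball x0 r" "y \<in> ball y0 r" for x y
      using r(2)[OF that] unfolding P_def f1_def f2_def g1_def g2_def G_def G1_def by (auto intro: analytic_deriv)
    have df: "(f has_field_derivative f1 x) (at x)" "(f1 has_field_derivative f2 x) (at x)" "(f2 has_field_derivative f3 x) (at x)"
       if "x \<in> ball x0 r" "y \<in> ball y0 r" for x y
      using p[OF that] unfolding f1_def f2_def f3_def by (auto intro: analytic_DERIV)
    have dg: "(g has_field_derivative g1 y) (at y)" "(g1 has_field_derivative g2 y) (at y)" "(g2 has_field_derivative g3 y) (at y)"
       if "x \<in> ball x0 r" "y \<in> ball y0 r" for x y
      using p[OF that] unfolding g1_def g2_def g3_def by (auto intro: analytic_DERIV)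
    have dx: "((\<lambda>x. \<xi> (f x + g y)) has_field_derivative G (f x + g y) * f1 x) (at x)"
        "((\<lambda>x. G (f x + g y)) has_field_derivative G1 (f x + g y) * f1 x) (at x)"
        "((\<lambda>x. G1 (f x + g y)) has_field_derivative G2 (f x + g y) * f1 x) (at x)"
      if "x \<in> ball x0 r" "y \<in> ball y0 r" for x y
      unfolding f1_def G2_def G1_def G_def
      by (rule DERIV_compose_add p(1,7-9)[OF that, unfolded G1_def G_def])+
    have dy: "((\<lambda>y. \<xi> (f x + g y)) has_field_derivative G (f x + g y) * g1 y) (at y)"
        "((\<lambda>y. G (f x + g y)) has_field_derivative G1 (f x + g y) * g1 y) (at y)"
        "((\<lambda>y. G1 (f x + g y)) has_field_derivative G2 (f x + g y) * g1 y) (at y)"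
      if "x \<in> ball x0 r" "y \<in> ball y0 r" for x y
      unfolding g1_def G2_def G1_def G_def
      by (rule DERIV_compose_add' p(4,7-9)[OF that, unfolded G1_def G_def])+
    have lin: "((\<lambda>x. F (x + y)) has_field_derivative deriv F (x + y)) (at x)" "((\<lambda>y. F (x + y)) has_field_derivative deriv F (x + y)) (at y)"
      if "F analytic_on {x + y}" for F :: "complex \<Rightarrow> complex" and x y
      using DERIV_compose_add[of F "\<lambda>x. x" x y] DERIV_compose_add'[of F x "\<lambda>x. x" y] that by (simp_all add: analytic_on_ident)
    have lin': "((\<lambda>x. F (x - y)) has_field_derivative deriv F (x - y)) (at x)" "((\<lambda>y. F (x - y)) has_field_derivative - deriv F (x - y)) (at y)"
      if "F analytic_on {x - y}" for F :: "complex \<Rightarrow> complex" and x y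
      using DERIV_compose_add[of F "\<lambda>x. x" x "-y"] DERIV_compose_add'[of F x "\<lambda>y. - y" y] that
      by (simp_all add: analytic_on_ident analytic_on_neg)
    have L: "((\<lambda>y. \<phi>2 (x + y)) has_field_derivative ?A x y) (at y)" "((\<lambda>y. \<phi>3 (x - y)) has_field_derivative - ?B x y) (at y)"
        "((\<lambda>x. ?A x y) has_field_derivative ?A1 x y) (at x)" "((\<lambda>x. ?B x y) has_field_derivative ?B1 x y) (at x)"
        "((\<lambda>y. ?A x y) has_field_derivative ?A1 x y) (at y)" "((\<lambda>y. ?B x y) has_field_derivative - ?B1 x y) (at y)"
        "((\<lambda>x. ?A1 x y) has_field_derivative ?A2 x y) (at x)" "((\<lambda>x. ?B1 x y) has_field_derivative ?B2 x y) (at x)"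
        "((\<lambda>y. ?A1 x y) has_field_derivative ?A2 x y) (at y)" "((\<lambda>y. ?B1 x y) has_field_derivative - ?B2 x y) (at y)"
      if "x \<in> ball x0 r" "y \<in> ball y0 r" for x y
      by (rule lin[of \<phi>2] lin[of "deriv \<phi>2"] lin[of "deriv (deriv \<phi>2)"] lin'[of \<phi>3] lin'[of "deriv \<phi>3"] lin'[of "deriv (deriv \<phi>3)"], rule p[OF that])+
    \<comment> \<open>The derivative in y removes \<open>\<phi>0\<close>; what remains equates the
      \<open>\<xi>\<close> term with a function of x - y minus a function of x + y, on which the
      second derivatives in x and in y agree.\<close>
    have s1: "?A x y - ?B x y + G (f x + g y) * g1 y * f1 x = 0" if "x \<in> ball x0 r" "y \<in> ball y0 r" for x y
    proof (rule deriv_eq_on_open[of "ball y0 r" y "\<lambda>y. \<phi>0 x + \<phi>2 (x + y) + \<phi>3 (x - y) + \<xi> (f x + g y) * f1 x" "\<lambda>_. 0"])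
      show "((\<lambda>y. \<phi>0 x + \<phi>2 (x + y) + \<phi>3 (x - y) + \<xi> (f x + g y) * f1 x) has_field_derivative ?A x y - ?B x y + G (f x + g y) * g1 y * f1 x) (at y)"
        by (rule derivative_eq_intros L[OF that] dy[OF that] refl)+ simp
    qed (use that p in auto)
    have N: "G (f x + g y) * g1 y * f1 x = ?B x y - ?A x y" if "x \<in> ball x0 r" "y \<in> ball y0 r" for x y
      using s1[OF that] by (simp add: algebra_simps)
    have x1: "G1 (f x + g y) * f1 x * g1 y * f1 x + G (f x + g y) * g1 y * f2 x = ?B1 x y - ?A1 x y"
      if "x \<in> ball x0 r" "y \<in> ball y0 r" for x y
    proof (rule deriv_eq_on_open[of "ball x0 r" x "\<lambda>x. G (f x + g y) * g1 y * f1 x" "\<lambda>x. ?B x y - ?A x y"])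
      show "((\<lambda>x. G (f x + g y) * g1 y * f1 x) has_field_derivative G1 (f x + g y) * f1 x * g1 y * f1 x + G (f x + g y) * g1 y * f2 x) (at x)"
        by (rule derivative_eq_intros dx[OF that] df[OF that] refl)+ simp
      show "((\<lambda>x. ?B x y - ?A x y) has_field_derivative ?B1 x y - ?A1 x y) (at x)"
        by (rule DERIV_diff L[OF that])+
    qed (use that N in auto)
    have y1: "G1 (f x + g y) * g1 y * g1 y * f1 x + G (f x + g y) * g2 y * f1 x = - ?B1 x y - ?A1 x y"
      if "x \<in> ball x0 r" "y \<in> ball y0 r" for x y
    proof (rule deriv_eq_on_open[of "ball y0 r" y "\<lambda>y. G (f x + g y) * g1 y * f1 x" "\<lambda>y. ?B x y - ?A x y"])
      show "((\<lambda>y. G (f x + g y) * g1 y * f1 x) has_field_derivative G1 (f x + g y) * g1 y * g1 y * f1 x + G (f x + g y) * g2 y * f1 x) (at y)"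
        by (rule derivative_eq_intros dy[OF that] dg[OF that] refl)+ (simp add: algebra_simps)
      show "((\<lambda>y. ?B x y - ?A x y) has_field_derivative - ?B1 x y - ?A1 x y) (at y)"
        by (rule DERIV_diff L[OF that])+
    qed (use that N in auto)
    have x2: "(G2 (f x + g y) * f1 x * f1 x * g1 y * f1 x + G1 (f x + g y) * f2 x * g1 y * f1 x + G1 (f x + g y) * f1 x * g1 y * f2 x)
        + (G1 (f x + g y) * f1 x * g1 y * f2 x + G (f x + g y) * g1 y * f3 x) = ?B2 x y - ?A2 x y"
    proof (rule deriv_eq_on_open[of "ball x0 r" x "\<lambda>x. G1 (f x + g y) * f1 x * g1 y * f1 x + G (f x + g y) * g1 y * f2 x" "\<lambda>x. ?B1 x y - ?A1 x y"])
      show "((\<lambda>x. G1 (f x + g y) * f1 x * g1 y * f1 x + G (f x + g y) * g1 y * f2 x) has_field_derivative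
         (G2 (f x + g y) * f1 x * f1 x * g1 y * f1 x + G1 (f x + g y) * f2 x * g1 y * f1 x + G1 (f x + g y) * f1 x * g1 y * f2 x)
        + (G1 (f x + g y) * f1 x * g1 y * f2 x + G (f x + g y) * g1 y * f3 x)) (at x)"
        by (rule derivative_eq_intros dx[OF that] df[OF that] refl)+ (simp add: algebra_simps)
      show "((\<lambda>x. ?B1 x y - ?A1 x y) has_field_derivative ?B2 x y - ?A2 x y) (at x)"
        by (rule DERIV_diff L[OF that])+
    qed (use that x1 in auto)
    have y2: "(G2 (f x + g y) * g1 y * g1 y * g1 y * f1 x + G1 (f x + g y) * g2 y * g1 y * f1 x + G1 (f x + g y) * g1 y * g2 y * f1 x)
        + (G1 (f x + g y) * g1 y * g2 y * f1 x + G (f x + g y) * g3 y * f1 x) = ?B2 x y - ?A2 x y"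
    proof (rule deriv_eq_on_open[of "ball y0 r" y "\<lambda>y. G1 (f x + g y) * g1 y * g1 y * f1 x + G (f x + g y) * g2 y * f1 x" "\<lambda>y. - ?B1 x y - ?A1 x y"])
      show "((\<lambda>y. G1 (f x + g y) * g1 y * g1 y * f1 x + G (f x + g y) * g2 y * f1 x) has_field_derivative
         (G2 (f x + g y) * g1 y * g1 y * g1 y * f1 x + G1 (f x + g y) * g2 y * g1 y * f1 x + G1 (f x + g y) * g1 y * g2 y * f1 x)
        + (G1 (f x + g y) * g1 y * g2 y * f1 x + G (f x + g y) * g3 y * f1 x)) (at y)"
        by (rule derivative_eq_intros dy[OF that] dg[OF that] refl)+ (simp add: algebra_simps)
      have "((\<lambda>y. - ?B1 x y - ?A1 x y) has_field_derivative - (- ?B2 x y) - ?A2 x y) (at y)"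
        by (rule DERIV_diff DERIV_minus L[OF that])+
      thus "((\<lambda>y. - ?B1 x y - ?A1 x y) has_field_derivative ?B2 x y - ?A2 x y) (at y)" by simp
    qed (use that y1 in auto)
    show ?thesis using trans[OF x2 y2[symmetric]] by (simp add: power3_eq_cube algebra_simps)
  qed
  show ?thesis unfolding eventually_nhds
    by (rule exI[of _ "ball x0 r \<times> ball y0 r"]) (use r(1) main in \<open>auto simp: open_Times\<close>)
qed

text \<open>A nonzero solution would be (t - t0)^n h with n \<ge> 2 and h nonzero at t0. Then A K''
  has order n - 2 with leading coefficient n (n - 1) A h, while the other terms have higher order
  and cannot cancel it.\<close>

lemma second_order_unique:
  fixes K A B C :: "complex \<Rightarrow> complex"
  assumes K: "K analytic_on {t0}" "K t0 = 0" "deriv K t0 = 0"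
    and c: "isCont A t0" "isCont B t0" "isCont C t0" "A t0 \<noteq> 0"
    and E: "\<forall>\<^sub>F t in nhds t0. A t * deriv (deriv K) t = B t * deriv K t + C t * K t"
  shows "\<forall>\<^sub>F t in nhds t0. K t = 0"
proof (rule ccontr)
  assume ne: "\<not> ?thesis"
  obtain r where r: "r > 0" "K holomorphic_on ball t0 r" using analytic_at_ball[OF K(1)] by blast
  have "\<not> K constant_on ball t0 r"
  proof
    assume "K constant_on ball t0 r"
    hence "\<forall>z\<in>ball t0 r. K z = 0" using r(1) K(2) unfolding constant_on_def by (metis centre_in_ball)
    hence "\<forall>\<^sub>F t in nhds t0. K t = 0" unfolding eventually_nhds using r(1) by (intro exI[of _ "ball t0 r"]) auto
    thus False using ne by blast
  qed
  from holomorphic_factor_zero_nonconstant[OF r(2) open_ball _ _ K(2) this] r(1)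
  obtain h s n where h: "0 < n" "0 < s" "ball t0 s \<subseteq> ball t0 r" "h holomorphic_on ball t0 s"
     "\<And>w. w \<in> ball t0 s \<Longrightarrow> K w = (w - t0)^n * h w" "\<And>w. w \<in> ball t0 s \<Longrightarrow> h w \<noteq> 0" by (metis centre_in_ball connected_ball)
  define h1 where "h1 = deriv h"
  define h2 where "h2 = deriv h1"
  have hd: "(h has_field_derivative h1 w) (at w)" "(h1 has_field_derivative h2 w) (at w)" if "w \<in> ball t0 s" for w
    unfolding h1_def h2_def using that h(4) by (auto intro!: holomorphic_derivI[of _ "ball t0 s"] holomorphic_deriv)
  have c2: "isCont h w" "isCont h1 w" "isCont h2 w" if "w \<in> ball t0 s" for w
  proof -
    show "isCont h w" "isCont h1 w" using hd[OF that] DERIV_isCont by blast+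
    have "h2 holomorphic_on ball t0 s" unfolding h1_def h2_def using h(4) by (intro holomorphic_deriv) auto
    thus "isCont h2 w" using that by (meson continuous_on_eq_continuous_at holomorphic_on_imp_continuous_on open_ball)
  qed
  have K1: "deriv K w = of_nat n * (w - t0)^(n-1) * h w + (w - t0)^n * h1 w" if "w \<in> ball t0 s" for w
  proof (rule DERIV_imp_deriv)
    have "((\<lambda>w. (w - t0)^n * h w) has_field_derivative of_nat n * (w - t0)^(n-1) * h w + (w - t0)^n * h1 w) (at w)"
      by (rule derivative_eq_intros hd that refl)+ (simp add: algebra_simps)
    thus "(K has_field_derivative of_nat n * (w - t0)^(n-1) * h w + (w - t0)^n * h1 w) (at w)"
      by (rule has_field_derivative_transform_within_open[where S = "ball t0 s"]) (use that h(5) in auto)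
  qed
  have n1: "n \<noteq> 1" using K1[of t0] K(3) h(2) h(6)[of t0] by auto
  define m where "m = n - 2"
  have n: "n = m + 2" using n1 h(1) by (simp add: m_def)
  have K2: "deriv (deriv K) w = of_nat (m+2) * (of_nat (m+1) * (w - t0)^m * h w + (w - t0)^(m+1) * h1 w) +
       (of_nat (m+2) * (w - t0)^(m+1) * h1 w + (w - t0)^(m+2) * h2 w)" if "w \<in> ball t0 s" for w
  proof (rule DERIV_imp_deriv)
    have "((\<lambda>w. of_nat (m+2) * (w - t0)^(m+1) * h w + (w - t0)^(m+2) * h1 w) has_field_derivative
      of_nat (m+2) * (of_nat (m+1) * (w - t0)^m * h w + (w - t0)^(m+1) * h1 w) +
       (of_nat (m+2) * (w - t0)^(m+1) * h1 w + (w - t0)^(m+2) * h2 w)) (at w)"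
      by (rule derivative_eq_intros hd that refl)+ (simp add: algebra_simps)
    thus "(deriv K has_field_derivative of_nat (m+2) * (of_nat (m+1) * (w - t0)^m * h w + (w - t0)^(m+1) * h1 w) +
       (of_nat (m+2) * (w - t0)^(m+1) * h1 w + (w - t0)^(m+2) * h2 w)) (at w)"
      by (rule has_field_derivative_transform_within_open[where S = "ball t0 s"]) (use that K1 n in auto)
  qed
  \<comment> \<open>\<open>Lf\<close> and \<open>Rf\<close> are the two sides of the equation after
    division by (w - t0)^m, where m = n - 2. Being continuous, they agree at t0 as well, where only
    the leading coefficient is left.\<close>
  define Lf where "Lf w = A w * (of_nat (m+2) * (of_nat (m+1) * h w + (w - t0) * h1 w) +
       (of_nat (m+2) * (w - t0) * h1 w + (w - t0)^2 * h2 w))" for w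
  define Rf where "Rf w = B w * (of_nat (m+2) * (w - t0) * h w + (w - t0)^2 * h1 w) + C w * (w - t0)^2 * h w" for w
  have "\<forall>\<^sub>F w in nhds t0. w \<in> ball t0 s" using h(2) by (intro eventually_nhds_in_open) auto
  hence "\<forall>\<^sub>F w in nhds t0. w \<noteq> t0 \<longrightarrow> Lf w - Rf w = 0" using E
  proof eventually_elim
    case (elim w)
    show ?case
    proof
      assume w: "w \<noteq> t0"
      have "(w - t0)^m * (Lf w - Rf w) = A w * deriv (deriv K) w - (B w * deriv K w + C w * K w)"
        unfolding K2[OF elim(1)] K1[OF elim(1)] h(5)[OF elim(1)] Lf_def Rf_def n
        by (simp add: algebra_simps power_add power2_eq_square)
      thus "Lf w - Rf w = 0" using elim(2) w by simp
    qed
  qed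
  hence ev0: "\<forall>\<^sub>F w in at t0. Lf w - Rf w = 0" unfolding eventually_at_filter by eventually_elim auto
  have "isCont (\<lambda>w. Lf w - Rf w) t0" unfolding Lf_def Rf_def
    by (intro continuous_intros c c2) (use h(2) in auto)
  hence "((\<lambda>w. Lf w - Rf w) \<longlongrightarrow> Lf t0 - Rf t0) (at t0)" by (simp add: isCont_def)
  moreover have "((\<lambda>w. Lf w - Rf w) \<longlongrightarrow> 0) (at t0)" by (rule tendsto_eventually[OF ev0])
  ultimately have "Lf t0 - Rf t0 = 0" using tendsto_unique[OF at_neq_bot] by blast
  hence "A t0 * (of_nat (m+2) * (of_nat (m+1) * h t0)) = 0" by (simp add: Lf_def Rf_def)
  moreover have "(of_nat (m+2) :: complex) \<noteq> 0" "(of_nat (m+1) :: complex) \<noteq> 0" by (simp_all only: of_nat_eq_0_iff)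
  ultimately show False using c(4) h(6)[of t0] h(2) by (simp del: of_nat_add)
qed

text \<open>The unknowns are numbered below 6, like the basis of relations, and are moved to the
  index type 6, where a left inverse of a square matrix is also a right inverse.\<close>

lemma square_system_solvable:
  fixes M :: "nat \<Rightarrow> nat \<Rightarrow> complex"
  assumes inj: "\<And>c. (\<And>i. i < 6 \<Longrightarrow> (\<Sum>k<6. M i k * c k) = 0) \<Longrightarrow> (\<And>k. k < 6 \<Longrightarrow> c k = 0)"
  obtains c where "\<And>i. i < 6 \<Longrightarrow> (\<Sum>k<6. M i k * c k) = b i"
proof -
  obtain h where h: "bij_betw h (UNIV :: 6 set) {..<6::nat}"
    using ex_bij_betw_finite_nat[of "UNIV :: 6 set"] by (auto simp: atLeast0LessThan)
  define A :: "complex^6^6" where "A = (\<chi> i j. M (h i) (h j))"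
  have hs: "h i < 6" for i using h by (auto dest: bij_betwE)
  have hinv: "\<exists>i. k = h i" if "k < 6" for k using h that unfolding bij_betw_def by (metis imageE lessThan_iff)
  have sum: "(A *v v) $ i = (\<Sum>k<6. M (h i) k * c k)" if "\<And>j. v $ j = c (h j)" for v c i
    unfolding A_def matrix_vector_mult_def by (simp add: that sum.reindex_bij_betw[OF h, of "\<lambda>k. M (h i) k * c k", symmetric])
  have ker: "v = 0" if v: "A *v v = 0" for v
  proof -
    define c where "c k = v $ (inv_into UNIV h k)" for k
    have vc: "v $ j = c (h j)" for j using h by (simp add: c_def bij_betw_def)
    have "(\<Sum>k<6. M i k * c k) = 0" if i: "i < 6" for i
    proof -
      obtain i' where "i = h i'" using hinv[OF i] by blast
      thus ?thesis using sum[OF vc, of i'] v by simp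
    qed
    hence "c k = 0" if "k < 6" for k using inj that by blast
    thus "v = 0" using vc hs by (simp add: vec_eq_iff)
  qed
  have "inj ((*v) A)"
  proof (rule injI)
    fix v w assume "A *v v = A *v w"
    hence "A *v (v - w) = 0" by (simp add: matrix_vector_mult_diff_distrib)
    from ker[OF this] show "v = w" by simp
  qed
  then obtain B where "B ** A = mat 1" unfolding matrix_left_invertible_injective[symmetric] by (rule exE)
  hence AB: "A ** B = mat 1" by (simp add: matrix_left_right_inverse)
  define v where "v = B *v (\<chi> i. b (h i))"
  define c where "c k = v $ (inv_into UNIV h k)" for k
  have vc: "v $ j = c (h j)" for j using h by (simp add: c_def bij_betw_def)
  have Av: "A *v v = (\<chi> i. b (h i))" unfolding v_def matrix_vector_mul_assoc AB by (rule matrix_vector_mul_lid)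
  have "(\<Sum>k<6. M i k * c k) = b i" if i: "i < 6" for i
  proof -
    obtain i' where "i = h i'" using hinv[OF i] by blast
    thus ?thesis using sum[OF vc, of i'] Av by simp
  qed
  thus ?thesis using that by blast
qed

lemma sum_lessThan_5: "(\<Sum>j<5. F j) = F 0 + F 1 + F 2 + F 3 + F (4::nat)" for F :: "nat \<Rightarrow> complex"
  by (simp add: eval_nat_numeral)

lemma analytic_zero_deriv:
  assumes "F analytic_on {t}" "\<forall>\<^sub>F s in nhds t. deriv F s = 0" "F t = 0"
  shows "\<forall>\<^sub>F s in nhds t. F s = 0"
proof -
  have "\<forall>\<^sub>F s in nhds t. (F has_field_derivative 0) (at s)"
    using assms(2) analytic_eventually[OF assms(1)] by eventually_elim (metis analytic_DERIV)
  then obtain e where e: "e > 0" "\<And>s. dist s t < e \<Longrightarrow> (F has_field_derivative 0) (at s)" unfolding eventually_nhds_metric by blast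
  have "\<exists>c. \<forall>x\<in>ball t e. F x = c"
    by (rule has_field_derivative_zero_constant) (use e(2) in \<open>auto simp: dist_commute intro: has_field_derivative_at_within\<close>)
  then obtain c where c: "\<And>x. x \<in> ball t e \<Longrightarrow> F x = c" by blast
  hence "c = 0" using e(1) assms(3) by (metis centre_in_ball)
  thus ?thesis unfolding eventually_nhds_metric using e(1) c by (intro exI[of _ e]) (auto simp: dist_commute)
qed

lemma deriv_lincomb:
  fixes F :: "nat \<Rightarrow> complex \<Rightarrow> complex"
  assumes "\<And>k. k < n \<Longrightarrow> F k analytic_on {t}"
  shows "(\<lambda>t. \<Sum>k<n. c k * F k t) analytic_on {t}"
    "deriv (\<lambda>t. \<Sum>k<n. c k * F k t) t = (\<Sum>k<n. c k * deriv (F k) t)"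
    "deriv (deriv (\<lambda>t. \<Sum>k<n. c k * F k t)) t = (\<Sum>k<n. c k * deriv (deriv (F k)) t)"
proof -
  show "(\<lambda>t. \<Sum>k<n. c k * F k t) analytic_on {t}"
    by (intro analytic_on_sum analytic_on_mult analytic_on_const assms) auto
  have 1: "deriv (\<lambda>t. \<Sum>k<n. c k * F k t) s = (\<Sum>k<n. c k * deriv (F k) s)" if "\<And>k. k < n \<Longrightarrow> F k analytic_on {s}" for s F
    by (intro DERIV_imp_deriv DERIV_sum DERIV_cmult analytic_DERIV that) auto
  show "deriv (\<lambda>t. \<Sum>k<n. c k * F k t) t = (\<Sum>k<n. c k * deriv (F k) t)" by (rule 1[OF assms])
  have "\<forall>\<^sub>F s in nhds t. \<forall>k\<in>{..<n}. F k analytic_on {s}"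
    by (rule eventually_ball_finite) (use assms analytic_eventually in auto)
  hence "\<forall>\<^sub>F s in nhds t. deriv (\<lambda>t. \<Sum>k<n. c k * F k t) s = (\<Sum>k<n. c k * deriv (F k) s)"
    by eventually_elim (rule 1, auto)
  hence "deriv (deriv (\<lambda>t. \<Sum>k<n. c k * F k t)) t = deriv (\<lambda>s. \<Sum>k<n. c k * deriv (F k) s) t"
    by (rule deriv_cong_ev) simp
  also have "\<dots> = (\<Sum>k<n. c k * deriv (deriv (F k)) t)" by (rule 1) (intro analytic_deriv assms)
  finally show "deriv (deriv (\<lambda>t. \<Sum>k<n. c k * F k t)) t = (\<Sum>k<n. c k * deriv (deriv (F k)) t)" .
qed

lemma abelian_lincomb:
  fixes B :: "nat \<Rightarrow> nat \<Rightarrow> complex \<Rightarrow> complex"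
  assumes "\<And>k. k < r \<Longrightarrow> abelian_relation p us (B k)"
  shows "abelian_relation p us (\<lambda>j t. \<Sum>k<r. c k * B k j t)"
  unfolding abelian_relation_def
proof (intro conjI allI impI)
  fix j assume j: "j < length us"
  have "B k j analytic_on {(us ! j) p}" if "k < r" for k
    using assms[OF that] j unfolding abelian_relation_def by blast
  thus "(\<lambda>t. \<Sum>k<r. c k * B k j t) analytic_on {(us ! j) p}" by (rule deriv_lincomb(1))
next
  have "\<forall>\<^sub>F z in nhds p. \<forall>k\<in>{..<r}. (\<Sum>j<length us. B k j ((us ! j) z) * dx (us ! j) z) = 0 \<and>
        (\<Sum>j<length us. B k j ((us ! j) z) * dy (us ! j) z) = 0"
    by (rule eventually_ball_finite) (use assms in \<open>auto simp: abelian_relation_def\<close>)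
  thus "\<forall>\<^sub>F z in nhds p. (\<Sum>j<length us. (\<Sum>k<r. c k * B k j ((us ! j) z)) * dx (us ! j) z) = 0 \<and>
        (\<Sum>j<length us. (\<Sum>k<r. c k * B k j ((us ! j) z)) * dy (us ! j) z) = 0"
  proof eventually_elim
    case (elim z)
    have "(\<Sum>j<length us. (\<Sum>k<r. c k * B k j ((us ! j) z)) * D j) = (\<Sum>k<r. c k * (\<Sum>j<length us. B k j ((us ! j) z) * D j))" for D
      unfolding sum_distrib_right sum_distrib_left by (subst sum.swap) (simp add: mult.assoc)
    thus ?case using elim by simp
  qed
qed

text \<open>Since u = \<Psi>(f + g), the last term of the relation is \<open>\<phi> 4 (u)\<close> du
  = \<xi>(f + g) d(f + g) for this \<xi>. The relation is then split into its dx part and its dy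
  part.\<close>

lemma T_relation:
  fixes f g \<Psi> :: "complex \<Rightarrow> complex"
  assumes ab: "abelian_relation (x0, y0) (T_web u) \<phi>"
    and \<Psi>: "\<Psi> analytic_on {0}" and f: "f analytic_on {x0}" "f x0 = 0" and g: "g analytic_on {y0}" "g y0 = 0"
    and eq: "\<forall>\<^sub>F z in nhds (x0, y0). u z = \<Psi> (f (fst z) + g (snd z))"
    and \<xi>: "\<And>t. \<xi> t = \<phi> 4 (\<Psi> t) * deriv \<Psi> t"
  shows "\<phi> 0 analytic_on {x0}" "\<phi> 1 analytic_on {y0}" "\<phi> 2 analytic_on {x0 + y0}" "\<phi> 3 analytic_on {x0 - y0}" "\<phi> 4 analytic_on {\<Psi> 0}"
    "\<xi> analytic_on {0}"
    "\<forall>\<^sub>F z in nhds (x0, y0). \<phi> 0 (fst z) + \<phi> 2 (fst z + snd z) + \<phi> 3 (fst z - snd z) + \<xi> (f (fst z) + g (snd z)) * deriv f (fst z) = 0"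
    "\<forall>\<^sub>F z in nhds (x0, y0). \<phi> 1 (snd z) + \<phi> 2 (fst z + snd z) - \<phi> 3 (fst z - snd z) + \<xi> (f (fst z) + g (snd z)) * deriv g (snd z) = 0"
proof -
  let ?us = "T_web u" let ?p = "(x0, y0)"
  have l: "length ?us = 5" by (simp add: T_web_def)
  have nth: "?us ! 0 = fst" "?us ! 1 = snd" "?us ! 2 = (\<lambda>z. fst z + snd z)" "?us ! 3 = (\<lambda>z. fst z - snd z)" "?us ! 4 = u"
    by (simp_all add: T_web_def eval_nat_numeral)
  have up: "u ?p = \<Psi> 0" using eventually_nhds_x_imp_x[OF eq] f(2) g(2) by simp
  have a: "\<phi> j analytic_on {(?us ! j) ?p}" if "j < 5" for j
    using ab[unfolded abelian_relation_def l] that by blast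
  show an: "\<phi> 0 analytic_on {x0}" "\<phi> 1 analytic_on {y0}" "\<phi> 2 analytic_on {x0 + y0}" "\<phi> 3 analytic_on {x0 - y0}" "\<phi> 4 analytic_on {\<Psi> 0}"
    using a[of 0] a[of 1] a[of 2] a[of 3] a[of 4] unfolding nth up by simp_all
  show "\<xi> analytic_on {0}" unfolding \<xi>[abs_def]
    by (intro analytic_on_mult analytic_compose[OF an(5) \<Psi>] analytic_deriv \<Psi>)
  have E: "\<forall>\<^sub>F z in nhds ?p. (\<Sum>j<5. \<phi> j ((?us ! j) z) * dx (?us ! j) z) = 0 \<and> (\<Sum>j<5. \<phi> j ((?us ! j) z) * dy (?us ! j) z) = 0"
    using ab[unfolded abelian_relation_def l] by blast
  have "isCont (\<lambda>z. f (fst z)) ?p" by (rule isCont_o2[where g = f]) (simp_all add: analytic_isCont f)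
  moreover have "isCont (\<lambda>z. g (snd z)) ?p" by (rule isCont_o2[where g = g]) (simp_all add: analytic_isCont g)
  ultimately have cf: "isCont (\<lambda>z. f (fst z) + g (snd z)) ?p" by (rule continuous_add)
  have "\<forall>\<^sub>F z in nhds ?p. \<Psi> analytic_on {f (fst z) + g (snd z)}"
    by (rule eventually_nhds_compose[where P = "\<lambda>w. \<Psi> analytic_on {w}", OF _ cf]) (simp add: analytic_eventually f g \<Psi>)
  moreover have "\<forall>\<^sub>F z in nhds ?p. \<forall>\<^sub>F w in nhds z. u w = \<Psi> (f (fst w) + g (snd w))"
    using eq by (simp add: eventually_eventually)
  ultimately have "\<forall>\<^sub>F z in nhds ?p. u z = \<Psi> (f (fst z) + g (snd z)) \<and> dx u z = deriv \<Psi> (f (fst z) + g (snd z)) * deriv f (fst z) \<and>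
      dy u z = deriv \<Psi> (f (fst z) + g (snd z)) * deriv g (snd z)"
    using eventually_fst[OF analytic_eventually[OF f(1)], of y0] eventually_snd[OF analytic_eventually[OF g(1)], of x0]
  proof eventually_elim
    case (elim z)
    have "dx (\<lambda>w. \<Psi> (f (fst w) + g (snd w))) z = deriv \<Psi> (f (fst z) + g (snd z)) * deriv f (fst z)"
      unfolding dx_def fst_conv snd_conv by (rule DERIV_imp_deriv, rule DERIV_compose_add) (use elim in auto)
    moreover have "dy (\<lambda>w. \<Psi> (f (fst w) + g (snd w))) z = deriv \<Psi> (f (fst z) + g (snd z)) * deriv g (snd z)"
      unfolding dy_def fst_conv snd_conv by (rule DERIV_imp_deriv, rule DERIV_compose_add') (use elim in auto)
    ultimately show ?case using dx_dy_cong[OF elim(2)] eventually_nhds_x_imp_x[OF elim(2)] by simp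
  qed
  note D = this
  show "\<forall>\<^sub>F z in nhds (x0, y0). \<phi> 0 (fst z) + \<phi> 2 (fst z + snd z) + \<phi> 3 (fst z - snd z) + \<xi> (f (fst z) + g (snd z)) * deriv f (fst z) = 0"
    using D E by eventually_elim (simp add: sum_lessThan_5 nth nth(2)[unfolded One_nat_def] \<xi> mult.assoc)
  show "\<forall>\<^sub>F z in nhds (x0, y0). \<phi> 1 (snd z) + \<phi> 2 (fst z + snd z) - \<phi> 3 (fst z - snd z) + \<xi> (f (fst z) + g (snd z)) * deriv g (snd z) = 0"
    using D E by eventually_elim (simp add: sum_lessThan_5 nth nth(2)[unfolded One_nat_def] \<xi> mult.assoc)
qed

text \<open>An abelian relation of the 5-web is determined by six numbers: the \<open>u\<close> component by its
  2-jet, because of the second order equation satisfied by its derivative, and then the relation of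
  \<open>\<T>\<^sub>0\<close> that remains by three more.\<close>

lemma T_relation_unique:
  fixes f g \<Psi> :: "complex \<Rightarrow> complex"
  assumes ab: "abelian_relation (x0, y0) (T_web u) \<phi>"
    and \<Psi>: "\<Psi> analytic_on {0}" "deriv \<Psi> 0 \<noteq> 0" and f: "f analytic_on {x0}" "f x0 = 0" and g: "g analytic_on {y0}" "g y0 = 0"
    and eq: "\<forall>\<^sub>F z in nhds (x0, y0). u z = \<Psi> (f (fst z) + g (snd z))"
    and nz: "deriv f x0 \<noteq> 0" "deriv g y0 \<noteq> 0" "(deriv f x0)\<^sup>2 \<noteq> (deriv g y0)\<^sup>2"
    and \<xi>: "\<And>t. \<xi> t = \<phi> 4 (\<Psi> t) * deriv \<Psi> t"
    and z: "\<phi> 2 (x0 + y0) = 0" "\<phi> 3 (x0 - y0) = 0" "deriv (\<phi> 2) (x0 + y0) = 0"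
    "\<xi> 0 = 0" "deriv \<xi> 0 = 0" "deriv (deriv \<xi>) 0 = 0"
  shows "same_germs (x0, y0) (T_web u) \<phi> (\<lambda>j t. 0)"
proof -
  let ?p = "(x0, y0)"
  note T = T_relation[OF ab \<Psi>(1) f g eq, of \<xi>, OF \<xi>]
  have up: "u ?p = \<Psi> 0" using eventually_nhds_x_imp_x[OF eq] f(2) g(2) by simp
  have x0': "\<xi> analytic_on {f x0 + g y0}" using T(6) f(2) g(2) by simp
  note pde = relation_pde[OF f(1) g(1) x0' T(3,4,7)]
  obtain X where X: "X analytic_on {0}" "X 0 = x0" "\<forall>\<^sub>F s in nhds 0. f (X s) = s"
    by (rule local_inverse[OF f(1) nz(1), unfolded f(2)]) blast
  define f1 f2 f3 where "f1 = deriv f" "f2 = deriv (deriv f)" "f3 = deriv (deriv (deriv f))"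
  define c1 c2 c3 where "c1 = deriv g y0" "c2 = deriv (deriv g) y0" "c3 = deriv (deriv (deriv g)) y0"
  have cX: "isCont X 0" by (rule analytic_isCont[OF X(1)])
  have cont: "isCont (\<lambda>t. F (X t)) 0" if "F analytic_on {x0}" for F :: "complex \<Rightarrow> complex"
    by (rule isCont_o2[OF cX]) (use that X(2) analytic_isCont in simp)
  have fa: "f1 analytic_on {x0}" "f2 analytic_on {x0}" "f3 analytic_on {x0}" unfolding f1_f2_f3_def by (intro analytic_deriv f)+
  have G0: "\<forall>\<^sub>F t in nhds 0. deriv \<xi> t = 0"
  \<comment> \<open>On the slice y = y0 the equation of \<open>relation_pde\<close> is a linear
    second order equation for \<xi>' in the variable t = f(x). Its leading coefficient f' g' (f'^2 -
    g'^2) is nonzero at the base point by \<open>nz\<close>.\<close>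
  proof (rule second_order_unique[where A = "\<lambda>t. f1 (X t)^3 * c1 - c1^3 * f1 (X t)" and B = "\<lambda>t. 3 * c1 * c2 * f1 (X t) - 3 * f1 (X t) * f2 (X t) * c1"
        and C = "\<lambda>t. c3 * f1 (X t) - f3 (X t) * c1"])
    show "deriv \<xi> analytic_on {0}" by (intro analytic_deriv T(6))
    show "isCont (\<lambda>t. f1 (X t)^3 * c1 - c1^3 * f1 (X t)) 0" "isCont (\<lambda>t. 3 * c1 * c2 * f1 (X t) - 3 * f1 (X t) * f2 (X t) * c1) 0"
      "isCont (\<lambda>t. c3 * f1 (X t) - f3 (X t) * c1) 0"
      by (intro continuous_diff continuous_mult continuous_power continuous_const cont fa)+
    have "f1 x0 ^ 3 * c1 - c1 ^ 3 * f1 x0 = f1 x0 * c1 * ((f1 x0)\<^sup>2 - c1\<^sup>2)" by (simp add: power2_eq_square power3_eq_cube algebra_simps)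
    thus "f1 (X 0)^3 * c1 - c1^3 * f1 (X 0) \<noteq> 0" using nz by (simp add: X(2) f1_f2_f3_def c1_c2_c3_def)
    have "\<forall>\<^sub>F x in nhds x0. (deriv (deriv (deriv \<xi>)) (f x) * f1 x ^ 3 + 3 * deriv (deriv \<xi>) (f x) * f1 x * f2 x + deriv \<xi> (f x) * f3 x) * c1 =
      (deriv (deriv (deriv \<xi>)) (f x) * c1 ^ 3 + 3 * deriv (deriv \<xi>) (f x) * c1 * c2 + deriv \<xi> (f x) * c3) * f1 x"
      using eventually_slice(1)[OF pde] unfolding f1_f2_f3_def c1_c2_c3_def by eventually_elim (simp add: g(2))
    hence "\<forall>\<^sub>F x in nhds (X 0). (deriv (deriv (deriv \<xi>)) (f x) * f1 x ^ 3 + 3 * deriv (deriv \<xi>) (f x) * f1 x * f2 x + deriv \<xi> (f x) * f3 x) * c1 =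
      (deriv (deriv (deriv \<xi>)) (f x) * c1 ^ 3 + 3 * deriv (deriv \<xi>) (f x) * c1 * c2 + deriv \<xi> (f x) * c3) * f1 x" by (simp only: X(2))
    from eventually_nhds_compose[OF this cX] X(3)
    show "\<forall>\<^sub>F t in nhds 0. (f1 (X t)^3 * c1 - c1^3 * f1 (X t)) * deriv (deriv (deriv \<xi>)) t =
       (3 * c1 * c2 * f1 (X t) - 3 * f1 (X t) * f2 (X t) * c1) * deriv (deriv \<xi>) t + (c3 * f1 (X t) - f3 (X t) * c1) * deriv \<xi> t"
    proof eventually_elim
      case (elim t)
      show ?case using elim(1) unfolding elim(2) by algebra
    qed
  qed (use z in auto)
  have \<xi>0: "\<forall>\<^sub>F t in nhds 0. \<xi> t = 0" by (rule analytic_zero_deriv[OF T(6) G0 z(4)])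
  have "\<forall>\<^sub>F t in nhds 0. deriv \<Psi> t \<noteq> 0" by (rule eventually_nonzero[OF analytic_isCont[OF analytic_deriv[OF \<Psi>(1)]] \<Psi>(2)])
  hence 4: "\<forall>\<^sub>F t in nhds 0. \<phi> 4 (\<Psi> t) = 0" using \<xi>0 by eventually_elim (simp add: \<xi>)
  obtain Y where Y: "Y analytic_on {\<Psi> 0}" "Y (\<Psi> 0) = 0" "\<forall>\<^sub>F s in nhds (\<Psi> 0). \<Psi> (Y s) = s"
    by (rule local_inverse[OF \<Psi>]) blast
  have "\<forall>\<^sub>F s in nhds (\<Psi> 0). \<phi> 4 (\<Psi> (Y s)) = 0"
    by (rule eventually_nhds_compose[where f = Y and P = "\<lambda>t. \<phi> 4 (\<Psi> t) = 0"]) (use Y(2) 4 analytic_isCont[OF Y(1)] in auto)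
  hence z4: "\<forall>\<^sub>F s in nhds (\<Psi> 0). \<phi> 4 s = 0" using Y(3) by eventually_elim simp
  have "isCont (\<lambda>z. f (fst z)) ?p" by (rule isCont_o2[where g = f]) (simp_all add: analytic_isCont f)
  moreover have "isCont (\<lambda>z. g (snd z)) ?p" by (rule isCont_o2[where g = g]) (simp_all add: analytic_isCont g)
  ultimately have cf: "isCont (\<lambda>z. f (fst z) + g (snd z)) ?p" by (rule continuous_add)
  have \<xi>p: "\<forall>\<^sub>F z in nhds ?p. \<xi> (f (fst z) + g (snd z)) = 0"
    by (rule eventually_nhds_compose[where P = "\<lambda>t. \<xi> t = 0", OF _ cf]) (use \<xi>0 f g in simp)
  have E1: "\<forall>\<^sub>F z in nhds ?p. \<phi> 0 (fst z) + \<phi> 2 (fst z + snd z) + \<phi> 3 (fst z - snd z) = 0" using T(7) \<xi>p by eventually_elim simp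
  have E2: "\<forall>\<^sub>F z in nhds ?p. \<phi> 1 (snd z) + \<phi> 2 (fst z + snd z) - \<phi> 3 (fst z - snd z) = 0" using T(8) \<xi>p by eventually_elim simp
  have a2: "\<forall>\<^sub>F z in nhds ?p. \<phi> 2 analytic_on {fst z + snd z}"
    by (rule eventually_nhds_compose[where P = "\<lambda>w. \<phi> 2 analytic_on {w}"]) (simp_all add: analytic_eventually T)
  have a3: "\<forall>\<^sub>F z in nhds ?p. \<phi> 3 analytic_on {fst z - snd z}"
    by (rule eventually_nhds_compose[where P = "\<lambda>w. \<phi> 3 analytic_on {w}"]) (simp_all add: analytic_eventually T)
  have "\<forall>\<^sub>F z in nhds ?p. (\<phi> 0 (fst z) + \<phi> 2 (fst z + snd z) + \<phi> 3 (fst z - snd z) = 0) \<and> \<phi> 2 analytic_on {fst z + snd z} \<and> \<phi> 3 analytic_on {fst z - snd z}"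
    using E1 a2 a3 by eventually_elim blast
  then obtain r where r: "r > 0" "\<And>x y. x \<in> ball x0 r \<Longrightarrow> y \<in> ball y0 r \<Longrightarrow> \<phi> 0 x + \<phi> 2 (x + y) + \<phi> 3 (x - y) = 0 \<and> \<phi> 2 analytic_on {x + y} \<and> \<phi> 3 analytic_on {x - y}"
    by (rule eventually_box) auto
  have d: "deriv (\<phi> 2) (x + y) = deriv (\<phi> 3) (x - y)" if "x \<in> ball x0 r" "y \<in> ball y0 r" for x y
  proof -
    have 1: "((\<lambda>y. \<phi> 2 (x + y)) has_field_derivative deriv (\<phi> 2) (x + y)) (at y)"
      using DERIV_compose_add'[of "\<phi> 2" x "\<lambda>y. y" y] r(2)[OF that] by (simp add: analytic_on_ident)
    have 2: "((\<lambda>y. \<phi> 3 (x - y)) has_field_derivative - deriv (\<phi> 3) (x - y)) (at y)"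
      using DERIV_compose_add'[of "\<phi> 3" x "\<lambda>y. - y" y] r(2)[OF that] by (simp add: analytic_on_ident analytic_on_neg)
    have "0 + deriv (\<phi> 2) (x + y) + - deriv (\<phi> 3) (x - y) = 0"
    proof (rule deriv_eq_on_open[of "ball y0 r" y "\<lambda>y. \<phi> 0 x + \<phi> 2 (x + y) + \<phi> 3 (x - y)" "\<lambda>_. 0"])
      show "((\<lambda>y. \<phi> 0 x + \<phi> 2 (x + y) + \<phi> 3 (x - y)) has_field_derivative 0 + deriv (\<phi> 2) (x + y) + - deriv (\<phi> 3) (x - y)) (at y)"
        by (rule DERIV_add DERIV_const 1 2)+
    qed (use that r in auto)
    thus ?thesis by simp
  qed
  have d3: "deriv (\<phi> 3) (x0 - y0) = 0" using d[of x0 y0] r(1) z(3) by simp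
  have z2: "\<forall>\<^sub>F t in nhds (x0 + y0). deriv (\<phi> 2) t = 0" unfolding eventually_nhds_metric
  proof (intro exI[of _ r] conjI allI impI)
    fix t assume t: "dist t (x0 + y0) < r"
    \<comment> \<open>Moving by (s, s) changes x + y and keeps x - y, so the derivative of
      \<open>\<phi> 2\<close> is constant; moving by (s, -s) does the same for
      \<open>\<phi> 3\<close> below.\<close>
    define s where "s = (t - (x0 + y0)) / 2"
    have s: "norm s < r" using t r(1) unfolding s_def by (simp add: dist_norm norm_divide)
    have e: "(x0 + s) + (y0 + s) = t" "(x0 + s) - (y0 + s) = x0 - y0" by (simp_all add: s_def field_simps)
    have "deriv (\<phi> 2) ((x0 + s) + (y0 + s)) = deriv (\<phi> 3) ((x0 + s) - (y0 + s))" by (rule d) (use s in \<open>simp_all add: dist_norm\<close>)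
    thus "deriv (\<phi> 2) t = 0" unfolding e using d3 by simp
  qed (rule r(1))
  have z3: "\<forall>\<^sub>F t in nhds (x0 - y0). deriv (\<phi> 3) t = 0" unfolding eventually_nhds_metric
  proof (intro exI[of _ r] conjI allI impI)
    fix t assume t: "dist t (x0 - y0) < r"
    define s where "s = (t - (x0 - y0)) / 2"
    have s: "norm s < r" using t r(1) unfolding s_def by (simp add: dist_norm norm_divide)
    have e: "(x0 + s) + (y0 - s) = x0 + y0" "(x0 + s) - (y0 - s) = t" by (simp_all add: s_def field_simps)
    have "deriv (\<phi> 2) ((x0 + s) + (y0 - s)) = deriv (\<phi> 3) ((x0 + s) - (y0 - s))" by (rule d) (use s in \<open>simp_all add: dist_norm\<close>)
    thus "deriv (\<phi> 3) t = 0" unfolding e using z(3) by simp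
  qed (rule r(1))
  have g2: "\<forall>\<^sub>F t in nhds (x0 + y0). \<phi> 2 t = 0" by (rule analytic_zero_deriv[OF T(3) z2 z(1)])
  have g3: "\<forall>\<^sub>F t in nhds (x0 - y0). \<phi> 3 t = 0" by (rule analytic_zero_deriv[OF T(4) z3 z(2)])
  have p2: "\<forall>\<^sub>F z in nhds ?p. \<phi> 2 (fst z + snd z) = 0"
    by (rule eventually_nhds_compose[where P = "\<lambda>w. \<phi> 2 w = 0"]) (simp_all add: g2)
  have p3: "\<forall>\<^sub>F z in nhds ?p. \<phi> 3 (fst z - snd z) = 0"
    by (rule eventually_nhds_compose[where P = "\<lambda>w. \<phi> 3 w = 0"]) (simp_all add: g3)
  have "\<forall>\<^sub>F z in nhds ?p. \<phi> 0 (fst z) = 0" using E1 p2 p3 by eventually_elim simp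
  from eventually_slice(1)[OF this] have g0: "\<forall>\<^sub>F t in nhds x0. \<phi> 0 t = 0" by simp
  have "\<forall>\<^sub>F z in nhds ?p. \<phi> 1 (snd z) = 0" using E2 p2 p3 by eventually_elim simp
  from eventually_slice(2)[OF this] have g1: "\<forall>\<^sub>F t in nhds y0. \<phi> 1 t = 0" by simp
  have nth: "T_web u ! 0 = fst" "T_web u ! 1 = snd" "T_web u ! 2 = (\<lambda>z. fst z + snd z)" "T_web u ! 3 = (\<lambda>z. fst z - snd z)" "T_web u ! 4 = u"
    by (simp_all add: T_web_def eval_nat_numeral)
  have c: "\<forall>\<^sub>F t in nhds ((T_web u ! j) ?p). \<phi> j t = 0" if "j = 0 \<or> j = 1 \<or> j = 2 \<or> j = 3 \<or> j = 4" for j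
    using that g0 g1 g2 g3 z4 by (elim disjE) (simp_all only: nth up fst_conv snd_conv)
  show ?thesis unfolding same_germs_def
  proof (intro allI impI c)
    fix j assume "j < length (T_web u)"
    hence "j < 5" by (simp add: T_web_def)
    thus "j = 0 \<or> j = 1 \<or> j = 2 \<or> j = 3 \<or> j = 4" by linarith
  qed
qed

text \<open>By \<open>T_relation_unique\<close> the six initial data are injective on relations, and
  rank 6 makes them a square system, hence surjective. So there are \<xi>1 and \<xi>2 whose pairs
  (\<xi>', \<xi>'') at 0 are (1, 0) and (0, 1), and the determinant \<open>W\<close> of these pairs
  is nonzero near 0.\<close>

lemma functional_equation:
  fixes f g \<Psi> :: "complex \<Rightarrow> complex"
  assumes rk: "maximal_rank (x0, y0) (T_web u)"
    and \<Psi>: "\<Psi> analytic_on {0}" "deriv \<Psi> 0 \<noteq> 0" and f: "f analytic_on {x0}" "f x0 = 0" and g: "g analytic_on {y0}" "g y0 = 0"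
    and eq: "\<forall>\<^sub>F z in nhds (x0, y0). u z = \<Psi> (f (fst z) + g (snd z))"
    and nz: "deriv f x0 \<noteq> 0" "deriv g y0 \<noteq> 0" "(deriv f x0)\<^sup>2 \<noteq> (deriv g y0)\<^sup>2"
  obtains a where "a analytic_on {0}"
    "\<forall>\<^sub>F z in nhds (x0, y0). 2 * (deriv (deriv f) (fst z) - deriv (deriv g) (snd z)) =
        a (f (fst z) + g (snd z)) * ((deriv f (fst z))\<^sup>2 - (deriv g (snd z))\<^sup>2)"
proof -
  let ?p = "(x0, y0)" let ?us = "T_web u"
  have l: "length ?us = 5" "(5 - 1) * (5 - 2) div 2 = (6::nat)" by (simp_all add: T_web_def)
  have "has_rank ?p ?us 6" using rk unfolding maximal_rank_def l .
  then obtain B :: "nat \<Rightarrow> nat \<Rightarrow> complex \<Rightarrow> complex" where B: "\<And>k. k < 6 \<Longrightarrow> abelian_relation ?p ?us (B k)"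
    "\<And>c. same_germs ?p ?us (\<lambda>j t. \<Sum>k<6. c k * B k j t) (\<lambda>j t. 0) \<Longrightarrow> \<forall>k<6. c k = 0"
    unfolding has_rank_def by blast
  define \<xi> where "\<xi> k t = B k 4 (\<Psi> t) * deriv \<Psi> t" for k t
  have T: "B k 2 analytic_on {x0 + y0}" "\<xi> k analytic_on {0}" if "k < 6" for k
    using T_relation(3,6)[OF B(1)[OF that] \<Psi>(1) f g eq, where \<xi> = "\<xi> k", OF \<xi>_def] by blast+
  define \<phi> where "\<phi> c j t = (\<Sum>k<6. c k * B k j t)" for c j t
  define \<eta> where "\<eta> c t = (\<Sum>k<6. c k * \<xi> k t)" for c t
  have ab: "abelian_relation ?p ?us (\<phi> c)" for c unfolding \<phi>_def[abs_def] by (rule abelian_lincomb[OF B(1)])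
  have \<eta>: "\<eta> c t = \<phi> c 4 (\<Psi> t) * deriv \<Psi> t" for c t
    by (simp add: \<eta>_def \<phi>_def \<xi>_def sum_distrib_right mult.assoc)
  \<comment> \<open>The rows are the six initial data of \<open>T_relation_unique\<close>, in the
    order of its hypotheses; the columns are the basis relations.\<close>
  define M where "M i k = (if i = 0 then B k 2 (x0 + y0) else if i = 1 then B k 3 (x0 - y0) else if i = 2 then deriv (B k 2) (x0 + y0)
     else if i = 3 then \<xi> k 0 else if i = 4 then deriv (\<xi> k) 0 else deriv (deriv (\<xi> k)) 0)" for i k :: nat
  have M: "(\<Sum>k<6. M 0 k * c k) = \<phi> c 2 (x0 + y0)" "(\<Sum>k<6. M 1 k * c k) = \<phi> c 3 (x0 - y0)"
    "(\<Sum>k<6. M 2 k * c k) = deriv (\<phi> c 2) (x0 + y0)" "(\<Sum>k<6. M 3 k * c k) = \<eta> c 0"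
    "(\<Sum>k<6. M 4 k * c k) = deriv (\<eta> c) 0" "(\<Sum>k<6. M 5 k * c k) = deriv (deriv (\<eta> c)) 0" for c
    using deriv_lincomb(2)[of 6 "\<lambda>k. B k 2" "x0 + y0" c, OF T(1)] deriv_lincomb(2,3)[of 6 "\<xi>" 0 c, OF T(2)]
    by (simp_all add: M_def mult.commute \<phi>_def[abs_def] \<eta>_def[abs_def])
  have inj: "c k = 0" if c: "\<And>i. i < 6 \<Longrightarrow> (\<Sum>k<6. M i k * c k) = 0" and k: "k < 6" for c k
  proof -
    have "same_germs ?p ?us (\<phi> c) (\<lambda>j t. 0)"
      by (rule T_relation_unique[OF ab \<Psi> f g eq nz, where \<xi> = "\<eta> c", OF \<eta>]) (use c M[of c] in simp_all)
    thus ?thesis using B(2)[of c] k unfolding \<phi>_def[abs_def] by blast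
  qed
  have sol: "\<exists>\<xi>. \<xi> analytic_on {0} \<and> deriv \<xi> 0 = b \<and> deriv (deriv \<xi>) 0 = b' \<and>
     (\<forall>\<^sub>F z in nhds ?p. \<forall>x y. z = (x, y) \<longrightarrow>
      (deriv (deriv (deriv \<xi>)) (f x + g y) * deriv f x ^ 3 + 3 * deriv (deriv \<xi>) (f x + g y) * deriv f x * deriv (deriv f) x
          + deriv \<xi> (f x + g y) * deriv (deriv (deriv f)) x) * deriv g y =
      (deriv (deriv (deriv \<xi>)) (f x + g y) * deriv g y ^ 3 + 3 * deriv (deriv \<xi>) (f x + g y) * deriv g y * deriv (deriv g) y
          + deriv \<xi> (f x + g y) * deriv (deriv (deriv g)) y) * deriv f x)" for b b'
  proof -
    obtain c where c: "\<And>i. i < 6 \<Longrightarrow> (\<Sum>k<6. M i k * c k) = (if i = 4 then b else if i = 5 then b' else 0)"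
      using square_system_solvable[of M "\<lambda>i. if i = 4 then b else if i = 5 then b' else 0"] inj by blast
    note S = T_relation[OF ab \<Psi>(1) f g eq, where \<xi> = "\<eta> c", OF \<eta>]
    have S6: "\<eta> c analytic_on {f x0 + g y0}" using S(6) f(2) g(2) by simp
    show ?thesis
      by (rule exI[of _ "\<eta> c"], intro conjI S(6) relation_pde[OF f(1) g(1) S6 S(3) S(4) S(7)]) (use c[of 4] c[of 5] M[of c] in simp_all)
  qed
  obtain \<xi>1 where x1: "\<xi>1 analytic_on {0}" "deriv \<xi>1 0 = 1" "deriv (deriv \<xi>1) 0 = 0"
     "\<forall>\<^sub>F z in nhds ?p. \<forall>x y. z = (x, y) \<longrightarrow>
      (deriv (deriv (deriv \<xi>1)) (f x + g y) * deriv f x ^ 3 + 3 * deriv (deriv \<xi>1) (f x + g y) * deriv f x * deriv (deriv f) x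
          + deriv \<xi>1 (f x + g y) * deriv (deriv (deriv f)) x) * deriv g y =
      (deriv (deriv (deriv \<xi>1)) (f x + g y) * deriv g y ^ 3 + 3 * deriv (deriv \<xi>1) (f x + g y) * deriv g y * deriv (deriv g) y
          + deriv \<xi>1 (f x + g y) * deriv (deriv (deriv g)) y) * deriv f x" using sol[of 1 0] by blast
  obtain \<xi>2 where x2: "\<xi>2 analytic_on {0}" "deriv \<xi>2 0 = 0" "deriv (deriv \<xi>2) 0 = 1"
     "\<forall>\<^sub>F z in nhds ?p. \<forall>x y. z = (x, y) \<longrightarrow>
      (deriv (deriv (deriv \<xi>2)) (f x + g y) * deriv f x ^ 3 + 3 * deriv (deriv \<xi>2) (f x + g y) * deriv f x * deriv (deriv f) x
          + deriv \<xi>2 (f x + g y) * deriv (deriv (deriv f)) x) * deriv g y =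
      (deriv (deriv (deriv \<xi>2)) (f x + g y) * deriv g y ^ 3 + 3 * deriv (deriv \<xi>2) (f x + g y) * deriv g y * deriv (deriv g) y
          + deriv \<xi>2 (f x + g y) * deriv (deriv (deriv g)) y) * deriv f x" using sol[of 0 1] by blast
  define W where "W t = deriv (deriv \<xi>1) t * deriv \<xi>2 t - deriv (deriv \<xi>2) t * deriv \<xi>1 t" for t
  define V where "V t = deriv (deriv (deriv \<xi>1)) t * deriv \<xi>2 t - deriv (deriv (deriv \<xi>2)) t * deriv \<xi>1 t" for t
  have Wa: "W analytic_on {0}" and Va: "V analytic_on {0}"
    unfolding W_def[abs_def] V_def[abs_def] by (intro analytic_on_diff analytic_on_mult analytic_deriv x1 x2)+
  have W0: "W 0 \<noteq> 0" by (simp add: W_def x1 x2)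
  \<comment> \<open>Eliminating the third derivatives of f and g from the two identities leaves V
    (f'^2 - g'^2) + 3 W (f'' - g'') = 0. The factor 2 is taken so that 2 f'' is the derivative of
    f'^2 in the variable f.\<close>
  define a where "a t = - (2/3) * V t / W t" for t
  have "isCont (\<lambda>z. f (fst z)) ?p" by (rule isCont_o2[where g = f]) (simp_all add: analytic_isCont f)
  moreover have "isCont (\<lambda>z. g (snd z)) ?p" by (rule isCont_o2[where g = g]) (simp_all add: analytic_isCont g)
  ultimately have cf: "isCont (\<lambda>z. f (fst z) + g (snd z)) ?p" by (rule continuous_add)
  have "\<forall>\<^sub>F t in nhds 0. W t \<noteq> 0" by (rule eventually_nonzero[OF analytic_isCont[OF Wa] W0])
  hence Wn: "\<forall>\<^sub>F z in nhds ?p. W (f (fst z) + g (snd z)) \<noteq> 0"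
    by (intro eventually_nhds_compose[where P = "\<lambda>t. W t \<noteq> 0", OF _ cf]) (simp add: f g)
  have fn: "\<forall>\<^sub>F z in nhds ?p. deriv f (fst z) \<noteq> 0"
    by (rule eventually_fst, rule eventually_nonzero[OF analytic_isCont[OF analytic_deriv[OF f(1)]] nz(1)])
  have gn: "\<forall>\<^sub>F z in nhds ?p. deriv g (snd z) \<noteq> 0"
    by (rule eventually_snd, rule eventually_nonzero[OF analytic_isCont[OF analytic_deriv[OF g(1)]] nz(2)])
  show ?thesis
  proof (rule that[of a])
    show "a analytic_on {0}" unfolding a_def[abs_def]
      by (intro analytic_on_divide analytic_on_mult analytic_on_const Wa Va) (use W0 in auto)
    show "\<forall>\<^sub>F z in nhds (x0, y0). 2 * (deriv (deriv f) (fst z) - deriv (deriv g) (snd z)) =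
        a (f (fst z) + g (snd z)) * ((deriv f (fst z))\<^sup>2 - (deriv g (snd z))\<^sup>2)"
      using x1(4) x2(4) Wn fn gn
    proof eventually_elim
      case (elim z)
      obtain x y where z: "z = (x, y)" by (cases z)
      define f1 g1 f2 g2 t where "f1 = deriv f x" "g1 = deriv g y" "f2 = deriv (deriv f) x" "g2 = deriv (deriv g) y" "t = f x + g y"
      note d = f1_g1_f2_g2_t_def
      have n: "f1 \<noteq> 0" "g1 \<noteq> 0" "W t \<noteq> 0" using elim(3-5) by (simp_all add: z d)
      have "f1 * g1 * (V t * (f1\<^sup>2 - g1\<^sup>2) + 3 * W t * (f2 - g2)) = 0"
        using elim(1)[rule_format, OF z, folded d] elim(2)[rule_format, OF z, folded d] unfolding V_def W_def by algebra
      hence "3 * W t * (f2 - g2) = - V t * (f1\<^sup>2 - g1\<^sup>2)" using n by (simp add: add_eq_0_iff)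
      moreover have "3 * (a t * W t) = - 2 * V t" unfolding a_def using n(3) by simp
      ultimately have "W t * (3 * (2 * (f2 - g2) - a t * (f1\<^sup>2 - g1\<^sup>2))) = 0" by algebra
      moreover have "W t * 3 \<noteq> 0" using n(3) by simp
      ultimately have "2 * (f2 - g2) - a t * (f1\<^sup>2 - g1\<^sup>2) = 0" unfolding mult.assoc[symmetric] mult_eq_0_iff[of "W t * 3"] by blast
      hence "2 * (f2 - g2) = a t * (f1\<^sup>2 - g1\<^sup>2)" by simp
      thus ?case by (simp add: z d)
    qed
  qed
qed

text \<open>With \<open>P = f'\<^sup>2\<close> and \<open>Q = g'\<^sup>2\<close> as functions of \<open>s = f x\<close> and \<open>t = g y\<close>, the equation becomes
  \<open>P' s - Q' t = a (s + t) * (P s - Q t)\<close>. Applying \<open>\<partial>\<^sub>s + \<partial>\<^sub>t\<close> and \<open>\<partial>\<^sub>s - \<partial>\<^sub>t\<close> repeatedly shows that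
  \<open>2 * a' + a\<^sup>2\<close> is constant.\<close>

lemma functional_equation_ode:
  fixes P Q a :: "complex \<Rightarrow> complex"
  assumes P: "P analytic_on {0}" and Q: "Q analytic_on {0}" and a: "a analytic_on {0}"
    and eq: "\<forall>\<^sub>F z in nhds (0, 0). deriv P (fst z) - deriv Q (snd z) = a (fst z + snd z) * (P (fst z) - Q (snd z))"
    and ne: "P 0 \<noteq> Q 0"
  obtains b c e where "\<forall>\<^sub>F s in nhds 0. deriv (deriv P) s = b * P s + c" "\<forall>\<^sub>F s in nhds 0. deriv (deriv Q) s = b * Q s + c"
    "(deriv P 0)\<^sup>2 = b * (P 0)\<^sup>2 + 2 * c * P 0 + e" "(deriv Q 0)\<^sup>2 = b * (Q 0)\<^sup>2 + 2 * c * Q 0 + e"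
proof -
  define R where "R s t \<longleftrightarrow> P analytic_on {s} \<and> Q analytic_on {t} \<and> a analytic_on {s + t} \<and> P s - Q t \<noteq> 0 \<and>
     deriv P s - deriv Q t = a (s + t) * (P s - Q t)" for s t
  have "isCont (\<lambda>z. P (fst z)) (0, 0)" by (rule isCont_o2[where g = P]) (simp_all add: analytic_isCont P)
  moreover have "isCont (\<lambda>z. Q (snd z)) (0, 0)" by (rule isCont_o2[where g = Q]) (simp_all add: analytic_isCont Q)
  ultimately have "isCont (\<lambda>z. P (fst z) - Q (snd z)) (0, 0)" by (rule continuous_diff)
  hence "\<forall>\<^sub>F z in nhds (0, 0). P (fst z) - Q (snd z) \<noteq> 0" by (rule eventually_nonzero) (use ne in simp)
  moreover have "\<forall>\<^sub>F z in nhds (0, 0). a analytic_on {fst z + snd z}"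
    by (rule eventually_nhds_compose[where P = "\<lambda>w. a analytic_on {w}"]) (simp_all add: analytic_eventually a)
  ultimately have "\<forall>\<^sub>F z in nhds (0, 0). R (fst z) (snd z)"
    using eventually_fst[OF analytic_eventually[OF P], of 0] eventually_snd[OF analytic_eventually[OF Q], of 0] eq
    by eventually_elim (simp add: R_def)
  then obtain r where r: "r > 0" "\<And>s t. s \<in> ball 0 r \<Longrightarrow> t \<in> ball 0 r \<Longrightarrow> R s t" by (rule eventually_box) auto
  define P1 P2 P3 where "P1 = deriv P" "P2 = deriv (deriv P)" "P3 = deriv (deriv (deriv P))"
  define Q1 Q2 Q3 where "Q1 = deriv Q" "Q2 = deriv (deriv Q)" "Q3 = deriv (deriv (deriv Q))"
  define a1 where "a1 = deriv a"
  define \<beta> where "\<beta> z = 2 * a1 z + (a z)\<^sup>2" for z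
  note defs = P1_P2_P3_def Q1_Q2_Q3_def a1_def
  have b0: "0 \<in> ball (0::complex) r" using r(1) by simp
  have an: "P analytic_on {s}" "P1 analytic_on {s}" "P2 analytic_on {s}" "Q analytic_on {t}" "Q1 analytic_on {t}" "Q2 analytic_on {t}"
    "a analytic_on {s + t}" "a1 analytic_on {s + t}" "\<beta> analytic_on {s + t}" "P s - Q t \<noteq> 0" "P1 s - Q1 t = a (s + t) * (P s - Q t)"
    if "s \<in> ball 0 r" "t \<in> ball 0 r" for s t
  proof -
    have "R s t" by (rule r(2)[OF that])
    thus 1: "P analytic_on {s}" "Q analytic_on {t}" "a analytic_on {s + t}" "P s - Q t \<noteq> 0" "P1 s - Q1 t = a (s + t) * (P s - Q t)"
      unfolding R_def defs by auto
    thus "P1 analytic_on {s}" "P2 analytic_on {s}" "Q1 analytic_on {t}" "Q2 analytic_on {t}" "a1 analytic_on {s + t}"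
      unfolding defs by (intro analytic_deriv; simp)+
    thus "\<beta> analytic_on {s + t}" unfolding \<beta>_def[abs_def] using 1 by (intro analytic_on_add analytic_on_mult analytic_on_const analytic_on_power) auto
  qed
  have dP: "(P has_field_derivative P1 s) (at s)" "(P1 has_field_derivative P2 s) (at s)" "(P2 has_field_derivative P3 s) (at s)" if "s \<in> ball 0 r" for s
    using an(1-3)[OF that b0] unfolding defs by (auto intro: analytic_DERIV)
  have dQ: "(Q has_field_derivative Q1 s) (at s)" "(Q1 has_field_derivative Q2 s) (at s)" "(Q2 has_field_derivative Q3 s) (at s)" if "s \<in> ball 0 r" for s
    using an(4-6)[OF b0 that] unfolding defs by (auto intro: analytic_DERIV)
  have ds: "((\<lambda>s. F (s + t)) has_field_derivative deriv F (s + t)) (at s)" and dt: "((\<lambda>t. F (s + t)) has_field_derivative deriv F (s + t)) (at t)"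
    if "F analytic_on {s + t}" for F and s t :: complex
    using DERIV_compose_add[of F "\<lambda>s. s" s t] DERIV_compose_add'[of F s "\<lambda>t. t" t] that by (simp_all add: analytic_on_ident)
  have 1: "P2 s = a1 (s + t) * (P s - Q t) + a (s + t) * P1 s" if st: "s \<in> ball 0 r" "t \<in> ball 0 r" for s t
  proof (rule deriv_eq_on_open[of "ball 0 r" s "\<lambda>s. P1 s - Q1 t" "\<lambda>s. a (s + t) * (P s - Q t)"])
    show "((\<lambda>s. P1 s - Q1 t) has_field_derivative P2 s) (at s)" using DERIV_diff[OF dP(2)[OF st(1)] DERIV_const[of "Q1 t"]] by simp
    show "((\<lambda>s. a (s + t) * (P s - Q t)) has_field_derivative a1 (s + t) * (P s - Q t) + a (s + t) * P1 s) (at s)"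
      by (rule derivative_eq_intros ds[OF an(7)[OF st], folded a1_def] dP[OF st(1)] refl)+ (simp add: algebra_simps)
  qed (use st an in auto)
  have 2: "- Q2 t = a1 (s + t) * (P s - Q t) - a (s + t) * Q1 t" if st: "s \<in> ball 0 r" "t \<in> ball 0 r" for s t
  proof (rule deriv_eq_on_open[of "ball 0 r" t "\<lambda>t. P1 s - Q1 t" "\<lambda>t. a (s + t) * (P s - Q t)"])
    show "((\<lambda>t. P1 s - Q1 t) has_field_derivative - Q2 t) (at t)" using DERIV_diff[OF DERIV_const[of "P1 s"] dQ(2)[OF st(2)]] by simp
    show "((\<lambda>t. a (s + t) * (P s - Q t)) has_field_derivative a1 (s + t) * (P s - Q t) - a (s + t) * Q1 t) (at t)"
      by (rule derivative_eq_intros dt[OF an(7)[OF st], folded a1_def] dQ[OF st(2)] refl)+ (simp add: algebra_simps)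
  qed (use st an in auto)
  \<comment> \<open>Adding \<open>1\<close> and \<open>2\<close> gives \<open>m\<close>, where
    \<beta> = 2 a' + a^2 appears; subtracting them gives \<open>p\<close>, with a alone.\<close>
  have m: "P2 s - Q2 t = \<beta> (s + t) * (P s - Q t)" and p: "P2 s + Q2 t = a (s + t) * (P1 s + Q1 t)" if st: "s \<in> ball 0 r" "t \<in> ball 0 r" for s t
    using 1[OF st] 2[OF st] an(11)[OF st] unfolding \<beta>_def by algebra+
  have 3: "P3 s = deriv \<beta> (s + t) * (P s - Q t) + \<beta> (s + t) * P1 s" if st: "s \<in> ball 0 r" "t \<in> ball 0 r" for s t
  proof (rule deriv_eq_on_open[of "ball 0 r" s "\<lambda>s. P2 s - Q2 t" "\<lambda>s. \<beta> (s + t) * (P s - Q t)"])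
    show "((\<lambda>s. P2 s - Q2 t) has_field_derivative P3 s) (at s)" using DERIV_diff[OF dP(3)[OF st(1)] DERIV_const[of "Q2 t"]] by simp
    show "((\<lambda>s. \<beta> (s + t) * (P s - Q t)) has_field_derivative deriv \<beta> (s + t) * (P s - Q t) + \<beta> (s + t) * P1 s) (at s)"
      by (rule derivative_eq_intros ds[OF an(9)[OF st]] dP[OF st(1)] refl)+ (simp add: algebra_simps)
  qed (use st m in auto)
  have 4: "- Q3 t = deriv \<beta> (s + t) * (P s - Q t) - \<beta> (s + t) * Q1 t" if st: "s \<in> ball 0 r" "t \<in> ball 0 r" for s t
  proof (rule deriv_eq_on_open[of "ball 0 r" t "\<lambda>t. P2 s - Q2 t" "\<lambda>t. \<beta> (s + t) * (P s - Q t)"])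
    show "((\<lambda>t. P2 s - Q2 t) has_field_derivative - Q3 t) (at t)" using DERIV_diff[OF DERIV_const[of "P2 s"] dQ(3)[OF st(2)]] by simp
    show "((\<lambda>t. \<beta> (s + t) * (P s - Q t)) has_field_derivative deriv \<beta> (s + t) * (P s - Q t) - \<beta> (s + t) * Q1 t) (at t)"
      by (rule derivative_eq_intros dt[OF an(9)[OF st]] dQ[OF st(2)] refl)+ (simp add: algebra_simps)
  qed (use st m in auto)
  have 5: "P3 s = a1 (s + t) * (P1 s + Q1 t) + a (s + t) * P2 s" if st: "s \<in> ball 0 r" "t \<in> ball 0 r" for s t
  proof (rule deriv_eq_on_open[of "ball 0 r" s "\<lambda>s. P2 s + Q2 t" "\<lambda>s. a (s + t) * (P1 s + Q1 t)"])
    show "((\<lambda>s. P2 s + Q2 t) has_field_derivative P3 s) (at s)" using DERIV_add[OF dP(3)[OF st(1)] DERIV_const[of "Q2 t"]] by simp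
    show "((\<lambda>s. a (s + t) * (P1 s + Q1 t)) has_field_derivative a1 (s + t) * (P1 s + Q1 t) + a (s + t) * P2 s) (at s)"
      by (rule derivative_eq_intros ds[OF an(7)[OF st], folded a1_def] dP[OF st(1)] refl)+ (simp add: algebra_simps)
  qed (use st p in auto)
  have 6: "Q3 t = a1 (s + t) * (P1 s + Q1 t) + a (s + t) * Q2 t" if st: "s \<in> ball 0 r" "t \<in> ball 0 r" for s t
  proof (rule deriv_eq_on_open[of "ball 0 r" t "\<lambda>t. P2 s + Q2 t" "\<lambda>t. a (s + t) * (P1 s + Q1 t)"])
    show "((\<lambda>t. P2 s + Q2 t) has_field_derivative Q3 t) (at t)" using DERIV_add[OF DERIV_const[of "P2 s"] dQ(3)[OF st(2)]] by simp
    show "((\<lambda>t. a (s + t) * (P1 s + Q1 t)) has_field_derivative a1 (s + t) * (P1 s + Q1 t) + a (s + t) * Q2 t) (at t)"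
      by (rule derivative_eq_intros dt[OF an(7)[OF st], folded a1_def] dQ[OF st(2)] refl)+ (simp add: algebra_simps)
  qed (use st p in auto)
  have \<beta>0: "deriv \<beta> z = 0" if z: "z \<in> ball 0 r" for z
  proof -
    \<comment> \<open>By \<open>3\<close> and \<open>4\<close>, P''' - Q''' is 2 \<beta>' (P - Q) +
      \<beta> (P' - Q'). By \<open>5\<close> and \<open>6\<close> it is a (P'' - Q''), which by
      \<open>m\<close> and the original equation is \<beta> (P' - Q').\<close>
    have "2 * deriv \<beta> (z + 0) * (P z - Q 0) = 0"
      using 3[OF z b0] 4[OF z b0] 5[OF z b0] 6[OF z b0] m[OF z b0] an(11)[OF z b0] by algebra
    thus ?thesis using an(10)[OF z b0] by simp
  qed
  have "\<exists>b. \<forall>z\<in>ball 0 r. \<beta> z = b"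
  proof (rule has_field_derivative_zero_constant)
    fix z :: complex assume z: "z \<in> ball 0 r"
    show "(\<beta> has_field_derivative 0) (at z within ball 0 r)"
      using analytic_DERIV[of \<beta> z] an(9)[OF z b0] \<beta>0[OF z] by (simp add: has_field_derivative_at_within)
  qed simp
  then obtain b where b: "\<And>z. z \<in> ball 0 r \<Longrightarrow> \<beta> z = b" by blast
  define c where "c = Q2 0 - b * Q 0"
  have eP: "P2 s = b * P s + c" if "s \<in> ball 0 r" for s using m[OF that b0] b[OF that] by (simp add: c_def algebra_simps)
  have eQ: "Q2 t = b * Q t + c" if "t \<in> ball 0 r" for t
    using m[OF b0 that] b[OF that] m[OF b0 b0] b[OF b0] unfolding c_def by simp algebra
  define e where "e = (P1 0)\<^sup>2 - b * (P 0)\<^sup>2 - 2 * c * P 0"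
  \<comment> \<open>Together with P'' + Q'' = b (P + Q) + 2 c, this says that the first integral
    y'^2 - b y^2 - 2 c y has the same value for P and for Q.\<close>
  have "(P1 0)\<^sup>2 - (Q1 0)\<^sup>2 = (P2 0 + Q2 0) * (P 0 - Q 0)" using p[OF b0 b0] an(11)[OF b0 b0] by algebra
  hence "(Q1 0)\<^sup>2 = b * (Q 0)\<^sup>2 + 2 * c * Q 0 + e" unfolding eP[OF b0] eQ[OF b0] e_def by algebra
  moreover have "\<forall>\<^sub>F s in nhds 0. s \<in> ball (0::complex) r" using b0 by (intro eventually_nhds_in_open) auto
  hence "\<forall>\<^sub>F s in nhds 0. P2 s = b * P s + c" "\<forall>\<^sub>F s in nhds 0. Q2 s = b * Q s + c"
    by (auto elim!: eventually_mono simp: eP eQ)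
  ultimately show ?thesis using that[of b c e] unfolding defs e_def by simp
qed

section \<open>Differential equations\<close>

text \<open>For a local inverse X of \<psi>, the function k = X(y) satisfies k'^2 = \<kappa>^2; by
  continuity k' is one of the two constants, so k is affine. The inverse exists because the common
  equation and y'(x0) \<noteq> 0 force \<psi>'(z0) \<noteq> 0.\<close>

lemma ode_solve:
  fixes y \<psi> R :: "complex \<Rightarrow> complex"
  assumes y: "y analytic_on {x0}" "deriv y x0 \<noteq> 0" "\<forall>\<^sub>F x in nhds x0. (deriv y x)\<^sup>2 = R (y x)"
    and \<psi>: "\<psi> analytic_on {z0}" "\<psi> z0 = y x0" "\<forall>\<^sub>F z in nhds z0. \<kappa>\<^sup>2 * (deriv \<psi> z)\<^sup>2 = R (\<psi> z)" and \<kappa>: "\<kappa> \<noteq> 0"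
  obtains \<epsilon> where "\<epsilon> = 1 \<or> \<epsilon> = -1" "\<forall>\<^sub>F x in nhds x0. y x = \<psi> (z0 + \<epsilon> * \<kappa> * (x - x0))"
proof -
  have sq: "\<kappa>\<^sup>2 * (deriv \<psi> z0)\<^sup>2 = (deriv y x0)\<^sup>2"
    using eventually_nhds_x_imp_x[OF y(3)] eventually_nhds_x_imp_x[OF \<psi>(3)] \<psi>(2) by simp
  hence d0: "deriv \<psi> z0 \<noteq> 0" using y(2) by auto
  obtain X where X: "X analytic_on {\<psi> z0}" "X (\<psi> z0) = z0" "\<forall>\<^sub>F s in nhds (\<psi> z0). \<psi> (X s) = s" "deriv X (\<psi> z0) \<noteq> 0"
    "\<forall>\<^sub>F s in nhds (\<psi> z0). deriv \<psi> (X s) * deriv X s = 1"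
    by (rule local_inverse[OF \<psi>(1) d0]) blast
  note X = X[unfolded \<psi>(2)]
  define k where "k x = X (y x)" for x
  have ka: "k analytic_on {x0}" unfolding k_def[abs_def] by (rule analytic_compose[OF X(1) y(1)])
  have k0: "k x0 = z0" using X(2) by (simp add: k_def)
  have cy: "isCont y x0" and cX: "isCont X (y x0)" using analytic_isCont y(1) X(1) by blast+
  have ck: "isCont k x0" using analytic_isCont[OF ka] .
  have 1: "\<forall>\<^sub>F x in nhds x0. \<psi> (k x) = y x"
    unfolding k_def by (rule eventually_nhds_compose[OF X(3) cy])
  have 2: "\<forall>\<^sub>F x in nhds x0. deriv \<psi> (k x) * deriv X (y x) = 1"
    unfolding k_def by (rule eventually_nhds_compose[OF X(5) cy])
  have 3: "\<forall>\<^sub>F x in nhds x0. \<kappa>\<^sup>2 * (deriv \<psi> (k x))\<^sup>2 = R (\<psi> (k x))"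
    by (rule eventually_nhds_compose[OF _ ck]) (simp add: k0 \<psi>(3))
  have 4: "\<forall>\<^sub>F x in nhds x0. X analytic_on {y x}" by (rule eventually_nhds_compose[OF analytic_eventually[OF X(1)] cy])
  have sqk: "\<forall>\<^sub>F x in nhds x0. (deriv k x)\<^sup>2 = \<kappa>\<^sup>2"
    using 1 2 3 4 y(3) analytic_eventually[OF y(1)]
  proof eventually_elim
    case (elim x)
    have dk: "deriv k x = deriv X (y x) * deriv y x" unfolding k_def[abs_def]
      by (rule DERIV_imp_deriv, rule DERIV_chain2[where f = X and g = y]) (use elim analytic_DERIV in auto)
    have "(deriv k x)\<^sup>2 = (deriv X (y x))\<^sup>2 * (\<kappa>\<^sup>2 * (deriv \<psi> (k x))\<^sup>2)" unfolding dk elim(3) elim(1) power_mult_distrib elim(5) ..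
    also have "\<dots> = \<kappa>\<^sup>2 * (deriv \<psi> (k x) * deriv X (y x))\<^sup>2" by (simp add: power_mult_distrib mult_ac)
    finally show ?case using elim(2) by simp
  qed
  have "(deriv k x0)\<^sup>2 = \<kappa>\<^sup>2" by (rule eventually_nhds_x_imp_x[OF sqk])
  hence "deriv k x0 = \<kappa> \<or> deriv k x0 = - \<kappa>" by (rule power2_eq_iff[THEN iffD1])
  then obtain \<epsilon> :: complex where e: "\<epsilon> = 1 \<or> \<epsilon> = -1" "deriv k x0 = \<epsilon> * \<kappa>" by (metis mult_1 mult_minus1)
  have "deriv k x0 + \<epsilon> * \<kappa> \<noteq> 0" using e \<kappa> by (simp add: e(2)) auto
  moreover have "isCont (\<lambda>x. deriv k x + \<epsilon> * \<kappa>) x0" by (intro continuous_add continuous_const analytic_isCont analytic_deriv ka)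
  ultimately have "\<forall>\<^sub>F x in nhds x0. deriv k x + \<epsilon> * \<kappa> \<noteq> 0" by (intro eventually_nonzero)
  hence dk: "\<forall>\<^sub>F x in nhds x0. deriv k x = \<epsilon> * \<kappa>" using sqk
  proof eventually_elim
    case (elim x)
    have "(deriv k x + \<epsilon> * \<kappa>) * (deriv k x - \<epsilon> * \<kappa>) = 0" using elim(2) e(1) by (auto simp: power2_eq_square algebra_simps)
    thus ?case using elim(1) by simp
  qed
  define l where "l x = k x - (z0 + \<epsilon> * \<kappa> * (x - x0))" for x
  have la: "l analytic_on {x0}" unfolding l_def[abs_def] by (intro analytic_intros ka)
  have "\<forall>\<^sub>F x in nhds x0. deriv l x = 0" using dk analytic_eventually[OF ka]
  proof eventually_elim
    case (elim x)
    have "(l has_field_derivative deriv k x - \<epsilon> * \<kappa> * 1) (at x)" unfolding l_def[abs_def]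
      by (rule derivative_eq_intros analytic_DERIV[OF elim(2)] refl)+ simp
    thus ?case using elim(1) by (simp add: DERIV_imp_deriv)
  qed
  hence "\<forall>\<^sub>F x in nhds x0. l x = 0" by (rule analytic_zero_deriv[OF la]) (simp add: l_def k0)
  hence "\<forall>\<^sub>F x in nhds x0. y x = \<psi> (z0 + \<epsilon> * \<kappa> * (x - x0))" using 1 by eventually_elim (simp add: l_def)
  thus ?thesis using that e(1) by blast
qed

text \<open>In the variable s = f(x), with inverse X, the derivative of f'^2 is 2 f' f'' X' = 2 f'',
  since f' X' = 1.\<close>

lemma arc_length_square:
  assumes f: "f analytic_on {x0}" "f x0 = 0" "deriv f x0 \<noteq> 0"
  obtains X P where "X analytic_on {0}" "X 0 = x0" "P analytic_on {0}" "P 0 = (deriv f x0)\<^sup>2"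
    "\<forall>\<^sub>F s in nhds 0. f (X s) = s \<and> P s = (deriv f (X s))\<^sup>2 \<and> deriv P s = 2 * deriv (deriv f) (X s)"
    "\<forall>\<^sub>F x in nhds x0. (deriv f x)\<^sup>2 = P (f x)"
proof -
  obtain X where X: "X analytic_on {0}" "X 0 = x0" "\<forall>\<^sub>F s in nhds 0. f (X s) = s" "\<forall>\<^sub>F x in nhds x0. X (f x) = x"
    "\<forall>\<^sub>F s in nhds 0. deriv f (X s) * deriv X s = 1"
    by (rule local_inverse[OF f(1,3), unfolded f(2)]) blast
  define P where "P s = (deriv f (X s))\<^sup>2" for s
  have fX: "deriv f analytic_on {X 0}" using f(1) X(2) by (simp add: analytic_deriv)
  have Pa: "P analytic_on {0}" unfolding P_def[abs_def] by (intro analytic_on_power analytic_compose[OF fX X(1)])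
  have "\<forall>\<^sub>F s in nhds 0. deriv f analytic_on {X s}"
    by (rule eventually_nhds_compose[OF analytic_eventually[OF fX] analytic_isCont[OF X(1)]])
  hence "\<forall>\<^sub>F s in nhds 0. f (X s) = s \<and> P s = (deriv f (X s))\<^sup>2 \<and> deriv P s = 2 * deriv (deriv f) (X s)"
    using X(3,5) analytic_eventually[OF X(1)]
  proof eventually_elim
    case (elim s)
    have "((\<lambda>s. deriv f (X s)) has_field_derivative deriv (deriv f) (X s) * deriv X s) (at s)"
      by (rule DERIV_chain2[where f = "deriv f" and g = X]) (use elim analytic_DERIV in auto)
    from DERIV_power[OF this, of 2]
    have "(P has_field_derivative 2 * (deriv (deriv f) (X s) * deriv X s) * deriv f (X s)) (at s)"
      unfolding P_def[abs_def] by (simp add: mult_ac)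
    hence "deriv P s = 2 * deriv (deriv f) (X s) * (deriv f (X s) * deriv X s)" by (simp add: DERIV_imp_deriv mult_ac)
    thus ?case using elim by (simp add: P_def)
  qed
  moreover have "\<forall>\<^sub>F x in nhds x0. (deriv f x)\<^sup>2 = P (f x)" using X(4) by eventually_elim (simp add: P_def)
  ultimately show ?thesis using that[of X P] X Pa by (simp add: P_def)
qed

text \<open>U and V are the constants obtained by factoring the equation as (D - 2\<beta>) (D +
  2\<beta>) (P + c/b) = 0. Their product is expressed by the first integral, so A * A' depends only
  on b, c and e; this is what allows f and g to be compared.\<close>

lemma linear_ode_exp:
  fixes P :: "complex \<Rightarrow> complex"
  assumes P: "P analytic_on {0}" "\<forall>\<^sub>F s in nhds 0. deriv (deriv P) s = b * P s + c"
    and b: "b = 4 * \<beta>\<^sup>2" "\<beta> \<noteq> 0" and e: "(deriv P 0)\<^sup>2 = b * (P 0)\<^sup>2 + 2 * c * P 0 + e"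
  obtains A A' where "\<forall>\<^sub>F s in nhds 0. P s = A * exp (2 * \<beta> * s) + A' * exp (- (2 * \<beta> * s)) - c / b"
    "A * A' = (c\<^sup>2 - b * e) / (4 * b\<^sup>2)"
proof -
  have b0: "b \<noteq> 0" using b by simp
  define U where "U s = (deriv P s + 2 * \<beta> * (P s + c / b)) * exp (- (2 * \<beta> * s))" for s
  define V where "V s = (deriv P s - 2 * \<beta> * (P s + c / b)) * exp (2 * \<beta> * s)" for s
  have Ua: "(\<lambda>s. U s - U 0) analytic_on {0}" and Va: "(\<lambda>s. V s - V 0) analytic_on {0}"
    unfolding U_def[abs_def] V_def[abs_def] by (intro analytic_intros P)+
  have dU: "\<forall>\<^sub>F s in nhds 0. deriv (\<lambda>s. U s - U 0) s = 0" and dV: "\<forall>\<^sub>F s in nhds 0. deriv (\<lambda>s. V s - V 0) s = 0"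
  proof -
    show "\<forall>\<^sub>F s in nhds 0. deriv (\<lambda>s. U s - U 0) s = 0" using P(2) analytic_eventually[OF P(1)]
    proof eventually_elim
      case (elim s)
      have "((\<lambda>s. U s - U 0) has_field_derivative
         (deriv (deriv P) s + 2 * \<beta> * deriv P s) * exp (- (2 * \<beta> * s)) + (deriv P s + 2 * \<beta> * (P s + c / b)) * (exp (- (2 * \<beta> * s)) * (- (2 * \<beta>)))) (at s)"
        unfolding U_def[abs_def] by (rule derivative_eq_intros analytic_DERIV analytic_deriv elim(2) refl)+ simp
      hence "deriv (\<lambda>s. U s - U 0) s = (deriv (deriv P) s - 4 * \<beta>\<^sup>2 * (P s + c / b)) * exp (- (2 * \<beta> * s))"
        by (simp add: DERIV_imp_deriv algebra_simps power2_eq_square)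
      thus ?case unfolding elim(1) b(1)[symmetric] using b0 by (simp add: distrib_left)
    qed
    show "\<forall>\<^sub>F s in nhds 0. deriv (\<lambda>s. V s - V 0) s = 0" using P(2) analytic_eventually[OF P(1)]
    proof eventually_elim
      case (elim s)
      have "((\<lambda>s. V s - V 0) has_field_derivative
         (deriv (deriv P) s - 2 * \<beta> * deriv P s) * exp (2 * \<beta> * s) + (deriv P s - 2 * \<beta> * (P s + c / b)) * (exp (2 * \<beta> * s) * (2 * \<beta>))) (at s)"
        unfolding V_def[abs_def] by (rule derivative_eq_intros analytic_DERIV analytic_deriv elim(2) refl)+ simp
      hence "deriv (\<lambda>s. V s - V 0) s = (deriv (deriv P) s - 4 * \<beta>\<^sup>2 * (P s + c / b)) * exp (2 * \<beta> * s)"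
        by (simp add: DERIV_imp_deriv algebra_simps power2_eq_square)
      thus ?case unfolding elim(1) b(1)[symmetric] using b0 by (simp add: distrib_left)
    qed
  qed
  have "\<forall>\<^sub>F s in nhds 0. U s - U 0 = 0" "\<forall>\<^sub>F s in nhds 0. V s - V 0 = 0"
    by (rule analytic_zero_deriv[OF Ua dU], simp) (rule analytic_zero_deriv[OF Va dV], simp)
  hence ev: "\<forall>\<^sub>F s in nhds 0. P s = U 0 / (4 * \<beta>) * exp (2 * \<beta> * s) + (- V 0 / (4 * \<beta>)) * exp (- (2 * \<beta> * s)) - c / b"
  proof eventually_elim
    case (elim s)
    define E where "E = exp (2 * \<beta> * s)"
    have E: "E \<noteq> 0" "exp (- (2 * \<beta> * s)) = 1 / E" by (simp_all add: E_def exp_minus divide_inverse)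
    define w where "w = P s + c / b"
    have "U 0 = (deriv P s + 2 * \<beta> * w) * (1 / E)" "V 0 = (deriv P s - 2 * \<beta> * w) * E"
      using elim unfolding U_def[of s] V_def[of s] E(2) E_def[symmetric] w_def[symmetric] by simp_all
    hence "U 0 * E = deriv P s + 2 * \<beta> * w" "V 0 * (1 / E) = deriv P s - 2 * \<beta> * w" using E(1) by simp_all
    hence "U 0 * E - V 0 * (1 / E) = 4 * \<beta> * w" by algebra
    hence "U 0 * E - V 0 * (1 / E) = 4 * \<beta> * (P s + c / b)" unfolding w_def .
    hence "P s = (U 0 * E - V 0 * (1 / E)) / (4 * \<beta>) - c / b" using b(2) by simp
    thus ?case unfolding E(2) E_def[symmetric] by (simp add: diff_divide_distrib)
  qed
  have "U 0 * V 0 = (deriv P 0)\<^sup>2 - b * (P 0 + c / b)\<^sup>2" unfolding U_def V_def b(1) by (simp add: algebra_simps power2_eq_square)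
  also have "\<dots> = e - c\<^sup>2 / b" unfolding e using b0 by (simp add: power2_eq_square field_simps)
  finally have UV: "U 0 * V 0 = e - c\<^sup>2 / b" .
  have "U 0 / (4 * \<beta>) * (- V 0 / (4 * \<beta>)) = - (U 0 * V 0) / (4 * b)" unfolding b(1) by (simp add: power2_eq_square)
  also have "\<dots> = - (e - c\<^sup>2 / b) / (4 * b)" unfolding UV ..
  also have "\<dots> = (c\<^sup>2 - b * e) / (4 * b\<^sup>2)" using b0 by (simp add: field_simps power2_eq_square)
  finally show ?thesis using that[OF ev] by blast
qed

lemma linear_ode_poly:
  fixes P :: "complex \<Rightarrow> complex"
  assumes P: "P analytic_on {0}" "\<forall>\<^sub>F s in nhds 0. deriv (deriv P) s = c"
  shows "\<forall>\<^sub>F s in nhds 0. P s = c / 2 * s\<^sup>2 + deriv P 0 * s + P 0"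
proof -
  have 1: "\<forall>\<^sub>F s in nhds 0. deriv P s - (c * s + deriv P 0) = 0"
  proof (rule analytic_zero_deriv)
    show "(\<lambda>s. deriv P s - (c * s + deriv P 0)) analytic_on {0}" by (intro analytic_intros P)
    show "\<forall>\<^sub>F s in nhds 0. deriv (\<lambda>s. deriv P s - (c * s + deriv P 0)) s = 0" using P(2) analytic_eventually[OF P(1)]
    proof eventually_elim
      case (elim s)
      have "((\<lambda>s. deriv P s - (c * s + deriv P 0)) has_field_derivative deriv (deriv P) s - c) (at s)"
        by (rule derivative_eq_intros analytic_DERIV analytic_deriv elim(2) refl)+ simp
      thus ?case using elim(1) by (simp add: DERIV_imp_deriv)
    qed
  qed simp
  have "\<forall>\<^sub>F s in nhds 0. P s - (c / 2 * s\<^sup>2 + deriv P 0 * s + P 0) = 0"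
  proof (rule analytic_zero_deriv)
    show "(\<lambda>s. P s - (c / 2 * s\<^sup>2 + deriv P 0 * s + P 0)) analytic_on {0}" by (intro analytic_intros P) simp
    show "\<forall>\<^sub>F s in nhds 0. deriv (\<lambda>s. P s - (c / 2 * s\<^sup>2 + deriv P 0 * s + P 0)) s = 0" using 1 analytic_eventually[OF P(1)]
    proof eventually_elim
      case (elim s)
      have "((\<lambda>s. P s - (c / 2 * s\<^sup>2 + deriv P 0 * s + P 0)) has_field_derivative deriv P s - (c * s + deriv P 0)) (at s)"
        by (rule derivative_eq_intros analytic_DERIV elim(2) refl)+ simp
      thus ?case using elim(1) by (simp add: DERIV_imp_deriv)
    qed
  qed simp
  thus ?thesis by eventually_elim simp
qed

section \<open>Algebraizable webs\<close>

definition dot3 :: "complex^3 \<Rightarrow> complex^3 \<Rightarrow> complex" where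
  "dot3 a b = a$1 * b$1 + a$2 * b$2 + a$3 * b$3"

text \<open>The cross product; for two points of the projective plane it is the line joining them.
  So \<open>cr3 (affine_point z) q\<close> is the leaf through z of the pencil with vertex
  q.\<close>

definition cr3 :: "complex^3 \<Rightarrow> complex^3 \<Rightarrow> complex^3" where
  "cr3 a b = vector [a$2 * b$3 - a$3 * b$2, a$3 * b$1 - a$1 * b$3, a$1 * b$2 - a$2 * b$1]"

lemma ternary_form_add:
  assumes "ternary_form d F" "ternary_form d G" shows "ternary_form d (\<lambda>v. F v + G v)"
proof -
  obtain k where k: "\<And>v. F v = (\<Sum>i\<le>d. \<Sum>j\<le>d - i. k i j * v $ 1 ^ i * v $ 2 ^ j * v $ 3 ^ (d - i - j))"
    using assms(1) unfolding ternary_form_def by blast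
  obtain l where l: "\<And>v. G v = (\<Sum>i\<le>d. \<Sum>j\<le>d - i. l i j * v $ 1 ^ i * v $ 2 ^ j * v $ 3 ^ (d - i - j))"
    using assms(2) unfolding ternary_form_def by blast
  show ?thesis unfolding ternary_form_def
    by (rule exI[of _ "\<lambda>i j. k i j + l i j"]) (simp add: k l sum.distrib distrib_right)
qed

lemma ternary_form_monomial:
  assumes "i + j + l = d" shows "ternary_form d (\<lambda>v. c * v $ 1 ^ i * v $ 2 ^ j * v $ 3 ^ l)"
  unfolding ternary_form_def
proof (intro exI[of _ "\<lambda>i' j'. if i' = i then if j' = j then c else 0 else 0"] allI)
  fix v :: "complex^3"
  have "(\<Sum>j'\<le>d - i'. (if i' = i then if j' = j then c else 0 else 0) * v $ 1 ^ i' * v $ 2 ^ j' * v $ 3 ^ (d - i' - j')) =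
      (if i' = i then c * v $ 1 ^ i * v $ 2 ^ j * v $ 3 ^ l else 0)" if "i' \<le> d" for i'
  proof (cases "i' = i")
    case True
    have "(\<Sum>j'\<le>d - i'. (if j' = j then c else 0) * v $ 1 ^ i' * v $ 2 ^ j' * v $ 3 ^ (d - i' - j')) =
       (\<Sum>j'\<le>d - i'. if j' = j then c * v $ 1 ^ i * v $ 2 ^ j * v $ 3 ^ l else 0)"
      by (rule sum.cong) (use True assms in auto)
    also have "\<dots> = c * v $ 1 ^ i * v $ 2 ^ j * v $ 3 ^ l" using True assms by simp
    finally show ?thesis using True by simp
  qed simp
  hence "(\<Sum>i'\<le>d. \<Sum>j'\<le>d - i'. (if i' = i then if j' = j then c else 0 else 0) * v $ 1 ^ i' * v $ 2 ^ j' * v $ 3 ^ (d - i' - j')) =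
     (\<Sum>i'\<le>d. if i' = i then c * v $ 1 ^ i * v $ 2 ^ j * v $ 3 ^ l else 0)" by (intro sum.cong) auto
  also have "\<dots> = c * v $ 1 ^ i * v $ 2 ^ j * v $ 3 ^ l" using assms by simp
  finally show "c * v $ 1 ^ i * v $ 2 ^ j * v $ 3 ^ l = (\<Sum>i'\<le>d. \<Sum>j'\<le>d - i'. (if i' = i then if j' = j then c else 0 else 0) * v $ 1 ^ i' * v $ 2 ^ j' * v $ 3 ^ (d - i' - j'))" by simp
qed

lemma ternary_form_sum:
  assumes "finite A" "\<And>a. a \<in> A \<Longrightarrow> ternary_form d (F a)" shows "ternary_form d (\<lambda>v. \<Sum>a\<in>A. F a v)"
  using assms
proof (induction A rule: finite_induct)
  case empty
  show ?case using ternary_form_monomial[of d 0 0 d 0] by simp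
next
  case (insert x A)
  thus ?case using ternary_form_add[of d "F x" "\<lambda>v. \<Sum>a\<in>A. F a v"] by simp
qed

lemma ternary_form_mult_dot:
  assumes "ternary_form d F" shows "ternary_form (Suc d) (\<lambda>v. F v * dot3 v q)"
proof -
  obtain k where k: "\<And>v. F v = (\<Sum>i\<le>d. \<Sum>j\<le>d - i. k i j * v $ 1 ^ i * v $ 2 ^ j * v $ 3 ^ (d - i - j))"
    using assms unfolding ternary_form_def by blast
  have alg: "c * X * Y * Z * (x * a + y * b + z * w) = c * a * (x * X) * Y * Z + c * b * X * (y * Y) * Z + c * w * X * Y * (z * Z)"
    for c X Y Z x y z a b w :: complex by (simp add: algebra_simps)
  have e: "F v * dot3 v q = (\<Sum>i\<le>d. \<Sum>j\<le>d - i.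
      (k i j * vec_nth q 1) * vec_nth v 1 ^ Suc i * vec_nth v 2 ^ j * vec_nth v 3 ^ (d - i - j) + (k i j * vec_nth q 2) * vec_nth v 1 ^ i * vec_nth v 2 ^ Suc j * vec_nth v 3 ^ (d - i - j)
      + (k i j * vec_nth q 3) * vec_nth v 1 ^ i * vec_nth v 2 ^ j * vec_nth v 3 ^ Suc (d - i - j))" for v
    unfolding k sum_distrib_right by (intro sum.cong refl) (simp only: dot3_def power_Suc alg)
  show ?thesis unfolding e
    by (intro ternary_form_sum ternary_form_add ternary_form_monomial) auto
qed

lemma ternary_form_prod_dot: "ternary_form d (\<lambda>v. \<Prod>j<d. dot3 v (q j))"
proof (induction d)
  case 0
  show ?case using ternary_form_monomial[of 0 0 0 0 1] by simp
next
  case (Suc d)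
  show ?case using ternary_form_mult_dot[OF Suc] by simp
qed

lemma ternary_form_scale:
  assumes "ternary_form d F" shows "F (c *s v) = c ^ d * F v"
proof -
  obtain k where k: "\<And>v. F v = (\<Sum>i\<le>d. \<Sum>j\<le>d - i. k i j * v $ 1 ^ i * v $ 2 ^ j * v $ 3 ^ (d - i - j))"
    using assms unfolding ternary_form_def by blast
  have "k i j * (c *s v) $ 1 ^ i * (c *s v) $ 2 ^ j * (c *s v) $ 3 ^ (d - i - j) =
     c ^ d * (k i j * v $ 1 ^ i * v $ 2 ^ j * v $ 3 ^ (d - i - j))" if "i \<le> d" "j \<le> d - i" for i j
  proof -
    have "c ^ d = c ^ i * c ^ j * c ^ (d - i - j)" using that by (simp flip: power_add)
    thus ?thesis by (simp add: power_mult_distrib mult_ac)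
  qed
  thus ?thesis unfolding k sum_distrib_left by (intro sum.cong refl) auto
qed

lemma ternary_form_line_holomorphic:
  assumes "ternary_form d F" shows "(\<lambda>t. F (a + t *s b)) holomorphic_on A"
proof -
  obtain k where k: "\<And>v. F v = (\<Sum>i\<le>d. \<Sum>j\<le>d - i. k i j * v $ 1 ^ i * v $ 2 ^ j * v $ 3 ^ (d - i - j))"
    using assms unfolding ternary_form_def by blast
  show ?thesis unfolding k vector_add_component vector_smult_component by (intro holomorphic_intros)
qed

text \<open>On the line \<open>t \<mapsto> a + t b\<close> of the dual plane the product of the \<open>d\<close> linear forms has simple roots,
  whereas a square factor of positive degree would have a root there, by Liouville's theorem.\<close>

lemma product_of_lines_squarefree:
  fixes q :: "nat \<Rightarrow> complex^3"
  assumes b: "\<And>j. j < d \<Longrightarrow> dot3 b (q j) \<noteq> 0"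
    and ind: "\<And>i j. i < d \<Longrightarrow> j < d \<Longrightarrow> i \<noteq> j \<Longrightarrow> dot3 a (q i) * dot3 b (q j) \<noteq> dot3 a (q j) * dot3 b (q i)"
    and e: "1 \<le> e" and G: "ternary_form e G" and H: "ternary_form h H"
    and F: "\<And>v. (\<Prod>j<d. dot3 v (q j)) = G v ^ 2 * H v"
  shows False
proof -
  define \<phi> where "\<phi> t = G (a + t *s b)" for t
  have hol: "\<phi> holomorphic_on A" for A unfolding \<phi>_def by (rule ternary_form_line_holomorphic[OF G])
  have "(\<Prod>j<d. dot3 b (q j)) \<noteq> 0" using b by simp
  hence Gb: "G b \<noteq> 0" using F[of b] by auto
  have cont: "isCont (\<lambda>s. G (b + s *s a)) 0"
    using holomorphic_on_imp_continuous_on[OF ternary_form_line_holomorphic[OF G, of b a UNIV]]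
    by (simp add: continuous_on_eq_continuous_at)
  have "((\<lambda>s. G (b + s *s a)) \<longlongrightarrow> G b) (at 0)" using cont by (simp add: isCont_def)
  moreover have "filterlim inverse (at (0::complex)) at_infinity" by (rule filterlim_inverse_at_iff[THEN iffD2]) (simp add: filterlim_ident)
  ultimately have lim: "((\<lambda>t. G (b + inverse t *s a)) \<longlongrightarrow> G b) at_infinity" by (rule filterlim_compose)
  hence ev: "\<forall>\<^sub>F t in at_infinity. norm (G (b + inverse t *s a)) > norm (G b) / 2"
    using order_tendstoD(1)[OF tendsto_norm[OF lim], of "norm (G b) / 2"] Gb by simp
  obtain t0 where t0: "\<phi> t0 = 0"
  proof (rule Liouville_weak_inverse[OF hol])
    fix B :: real
    have "\<forall>\<^sub>F t in at_infinity. norm (t::complex) \<ge> max 1 (2 * \<bar>B\<bar> / norm (G b))"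
      unfolding eventually_at_infinity by blast
    thus "\<forall>\<^sub>F t in at_infinity. B \<le> norm (\<phi> t)" using ev
    proof eventually_elim
      case (elim t)
      have t: "norm t \<ge> 1" "t \<noteq> 0" using elim(1) by auto
      have h: "a + t *s b = t *s (b + inverse t *s a)" using t(2) by (simp add: vec_eq_iff algebra_simps)
      have "norm (\<phi> t) = norm t ^ e * norm (G (b + inverse t *s a))"
        unfolding \<phi>_def h ternary_form_scale[OF G] norm_mult norm_power ..
      moreover have "norm t \<le> norm t ^ e" using power_increasing[of 1 e "norm t"] t(1) e by simp
      hence "norm t * (norm (G b) / 2) \<le> norm t ^ e * norm (G (b + inverse t *s a))"
        by (rule mult_mono) (use elim(2) in simp_all)
      ultimately have "norm (\<phi> t) \<ge> norm t * (norm (G b) / 2)" by simp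
      moreover have "norm t * norm (G b) \<ge> 2 * \<bar>B\<bar>" using elim(1) Gb by (simp add: pos_divide_le_eq)
      ultimately show ?case by linarith
    qed
  qed blast
  define \<psi> where "\<psi> t = H (a + t *s b)" for t
  have d\<phi>: "(\<phi> has_field_derivative deriv \<phi> t0) (at t0)" using holomorphic_derivI[OF hol[of UNIV]] by simp
  have d\<psi>: "(\<psi> has_field_derivative deriv \<psi> t0) (at t0)"
    using holomorphic_derivI[OF ternary_form_line_holomorphic[OF H, of a b UNIV]] unfolding \<psi>_def[abs_def] by simp
  have "((\<lambda>t. \<phi> t ^ 2 * \<psi> t) has_field_derivative 2 * (deriv \<phi> t0 * \<phi> t0) * \<psi> t0 + \<phi> t0 ^ 2 * deriv \<psi> t0) (at t0)"
    by (rule derivative_eq_intros d\<phi> d\<psi> refl)+ (simp add: algebra_simps)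
  hence D0: "((\<lambda>t. \<phi> t ^ 2 * \<psi> t) has_field_derivative 0) (at t0)" by (simp add: t0)
  have lin: "dot3 (a + t *s b) (q j) = dot3 a (q j) + t * dot3 b (q j)" for t j by (simp add: dot3_def algebra_simps)
  have prod: "\<phi> t ^ 2 * \<psi> t = (\<Prod>j<d. dot3 a (q j) + t * dot3 b (q j))" for t
    using F[of "a + t *s b"] by (simp add: \<phi>_def \<psi>_def lin)
  have "(\<Prod>j<d. dot3 a (q j) + t0 * dot3 b (q j)) = 0" using prod[of t0] t0 by simp
  then obtain m where m: "m < d" "dot3 a (q m) + t0 * dot3 b (q m) = 0" by auto
  define R where "R t = (\<Prod>j\<in>{..<d} - {m}. dot3 a (q j) + t * dot3 b (q j))" for t
  have "R holomorphic_on UNIV" unfolding R_def[abs_def] by (intro holomorphic_intros)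
  hence dR: "(R has_field_derivative deriv R t0) (at t0)" using holomorphic_derivI[of R UNIV] by simp
  have pr: "\<phi> t ^ 2 * \<psi> t = (dot3 a (q m) + t * dot3 b (q m)) * R t" for t
    unfolding prod R_def using m(1) by (subst prod.remove[of _ m]) auto
  have "((\<lambda>t. (dot3 a (q m) + t * dot3 b (q m)) * R t) has_field_derivative
     dot3 b (q m) * R t0 + (dot3 a (q m) + t0 * dot3 b (q m)) * deriv R t0) (at t0)"
    by (rule derivative_eq_intros dR refl)+ (simp add: algebra_simps)
  from DERIV_unique[OF this D0[unfolded pr]] have "dot3 b (q m) * R t0 = 0" by (simp add: m(2))
  hence "R t0 = 0" using b[OF m(1)] by simp
  then obtain j where j: "j < d" "j \<noteq> m" "dot3 a (q j) + t0 * dot3 b (q j) = 0" unfolding R_def by auto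
  have "dot3 a (q m) = - (t0 * dot3 b (q m))" "dot3 a (q j) = - (t0 * dot3 b (q j))"
    using m(2) j(3) by (simp_all only: eq_neg_iff_add_eq_0)
  hence "dot3 a (q m) * dot3 b (q j) = dot3 a (q j) * dot3 b (q m)" by simp
  thus False using ind[OF m(1) j(1)] j(2) by simp
qed

lemma dot3_sum: "(\<Sum>i\<in>UNIV. a $ i * v $ i) = dot3 a v"
  by (simp add: sum_3 dot3_def)

lemma proj_eqD: "proj v = proj w \<Longrightarrow> \<exists>c. c \<noteq> 0 \<and> v = c *s w"
proof -
  assume "proj v = proj w"
  moreover have "v \<in> proj v" unfolding proj_def by (rule CollectI, rule exI[of _ 1]) simp
  ultimately show ?thesis unfolding proj_def by auto
qed

lemma proj_in_proj_line:
  assumes "v \<noteq> 0" shows "proj v \<in> proj_line a \<longleftrightarrow> dot3 a v = 0"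
proof
  assume "proj v \<in> proj_line a"
  then obtain w where w: "dot3 a w = 0" "proj v = proj w" unfolding proj_line_def dot3_sum by blast
  then obtain c where "v = c *s w" using proj_eqD by blast
  moreover have "dot3 a (c *s w) = c * dot3 a w" by (simp add: dot3_def algebra_simps)
  ultimately show "dot3 a v = 0" using w(1) by simp
qed (use assms in \<open>auto simp: proj_line_def dot3_sum\<close>)

lemma affine_point_nonzero: "affine_point z \<noteq> 0"
  by (simp add: affine_point_def vec_eq_iff forall_3)

lemma cr3_orthogonal: "dot3 a (cr3 a b) = 0" "dot3 b (cr3 a b) = 0" "dot3 (cr3 a b) b = 0"
  by (simp_all add: dot3_def cr3_def algebra_simps)

lemma orthogonal_cr3:
  assumes "dot3 a v = 0" "dot3 v b = 0" "cr3 a b \<noteq> 0" "v \<noteq> 0"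
  obtains c where "c \<noteq> 0" "v = c *s cr3 a b"
proof -
  define w where "w = cr3 a b"
  have p: "w$1 * v$2 = w$2 * v$1" "w$2 * v$3 = w$3 * v$2" "w$1 * v$3 = w$3 * v$1"
    using assms(1,2) unfolding w_def cr3_def dot3_def by (simp_all, algebra+)
  have "\<exists>i. w $ i \<noteq> 0" using assms(3) by (auto simp: vec_eq_iff w_def)
  then obtain i where i: "w $ i \<noteq> 0" by blast
  have pij: "w $ i * v $ j = w $ j * v $ i" for j
    using p exhaust_3[of i] exhaust_3[of j] by (elim disjE) simp_all
  have v: "v = (v $ i / w $ i) *s w" using pij i by (simp add: vec_eq_iff field_simps)
  have c: "v $ i / w $ i \<noteq> 0"
  proof
    assume "v $ i / w $ i = 0"
    hence "v = 0" using v by (simp only: vector_smult_lzero)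
    thus False using assms(4) by simp
  qed
  show ?thesis by (rule that[OF c]) (use v in \<open>simp only: w_def\<close>)
qed

text \<open>The lines through a point form a line of the dual plane, so d pencils come from a curve
  that is a union of d lines. The condition on \<open>q i\<close> and \<open>q j\<close> says that
  these two vertices are seen from z0 in different directions.\<close>

lemma pencils_algebraic:
  fixes q :: "nat \<Rightarrow> complex^3" and z0 :: point
  assumes d: "2 \<le> d"
    and ind: "\<And>i j. i < d \<Longrightarrow> j < d \<Longrightarrow> i \<noteq> j \<Longrightarrow>
      (q i $ 1 - fst z0 * q i $ 3) * (q j $ 2 - snd z0 * q j $ 3) \<noteq> (q j $ 1 - fst z0 * q j $ 3) * (q i $ 2 - snd z0 * q i $ 3)"
  shows "algebraic_web d z0 ((\<lambda>j. relation_germ z0 {(z, z'). dot3 (cr3 (affine_point z) (q j)) (affine_point z') = 0}) ` {..<d})"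
proof -
  define F where "F v = (\<Prod>j<d. dot3 v (q j))" for v
  define P where "P j z = cr3 (affine_point z) (q j)" for j z
  define C where "C = {proj a | a. a \<noteq> 0 \<and> F a = 0}"
  define \<alpha> where "\<alpha> j = q j $ 1 - fst z0 * q j $ 3" for j
  define \<beta> where "\<beta> j = q j $ 2 - snd z0 * q j $ 3" for j
  have ind': "\<alpha> i * \<beta> j \<noteq> \<alpha> j * \<beta> i" if "i < d" "j < d" "i \<noteq> j" for i j using ind[OF that] by (simp add: \<alpha>_def \<beta>_def)
  have P0: "P j z0 $ 1 = - \<beta> j" "P j z0 $ 2 = \<alpha> j" for j
    by (simp_all add: P_def cr3_def affine_point_def \<alpha>_def \<beta>_def algebra_simps)
  have other: "\<exists>i<d. i \<noteq> j" for j
    using d by (intro exI[of _ "if j = 0 then 1 else 0"]) auto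
  have Pnz: "P j z0 \<noteq> 0" if "j < d" for j
  proof
    assume "P j z0 = 0"
    hence "\<alpha> j = 0" "\<beta> j = 0" using P0[of j] by simp_all
    moreover obtain i where "i < d" "i \<noteq> j" using other by blast
    ultimately show False using ind'[of i j] that by simp
  qed
  have tf: "ternary_form d F" unfolding F_def by (rule ternary_form_prod_dot)
  obtain m where m: "\<And>j. j < d \<Longrightarrow> m * \<alpha> j + \<beta> j \<noteq> 0"
  proof -
    have "infinite (UNIV :: complex set)" by (rule infinite_UNIV_char_0)
    hence "UNIV - (\<lambda>j. - \<beta> j / \<alpha> j) ` {..<d} \<noteq> {}" using finite_subset[of UNIV "(\<lambda>j. - \<beta> j / \<alpha> j) ` {..<d}"] by auto
    then obtain m where m: "\<And>j. j < d \<Longrightarrow> m \<noteq> - \<beta> j / \<alpha> j" by blast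
    have "\<alpha> j \<noteq> 0 \<or> \<beta> j \<noteq> 0" if "j < d" for j
    proof -
      obtain i where "i < d" "i \<noteq> j" using other by blast
      thus ?thesis using ind'[of i j] that by auto
    qed
    hence "m * \<alpha> j + \<beta> j \<noteq> 0" if "j < d" for j using m[OF that] that by (cases "\<alpha> j = 0") (auto simp: field_simps add_eq_0_iff)
    thus ?thesis using that by blast
  qed
  \<comment> \<open>These are two lines through z0, spanning the dual line of z0. The choice of
    \<open>m\<close> keeps b off the dual lines of all the vertices.\<close>
  define a b :: "complex^3" where "a = vector [1, 0, - fst z0]" "b = vector [m, 1, - (m * fst z0) - snd z0]"
  have ab: "dot3 a (q j) = \<alpha> j" "dot3 b (q j) = m * \<alpha> j + \<beta> j" for j
    by (simp_all add: a_b_def dot3_def \<alpha>_def \<beta>_def algebra_simps)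
  have sqf: "\<not> (\<exists>e G H. 1 \<le> e \<and> 2 * e \<le> d \<and> ternary_form e G \<and> ternary_form (d - 2 * e) H \<and> (\<forall>v. F v = G v ^ 2 * H v))"
  proof (intro notI, elim exE conjE)
    fix e G H assume H: "1 \<le> e" "ternary_form e G" "ternary_form (d - 2 * e) H" "\<forall>v. F v = G v ^ 2 * H v"
    show False
    proof (rule product_of_lines_squarefree[of d b q a e G "d - 2 * e" H])
      fix i j assume ij: "i < d" "j < d" "i \<noteq> j"
      show "dot3 a (q i) * dot3 b (q j) \<noteq> dot3 a (q j) * dot3 b (q i)" using ind'[OF ij] unfolding ab by (simp add: algebra_simps)
    qed (use H m in \<open>auto simp: ab F_def\<close>)
  qed
  have "F b \<noteq> 0" using m by (simp add: F_def ab)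
  hence red: "reduced_curve d C" unfolding reduced_curve_def C_def by (intro exI[of _ F] conjI tf sqf refl exI[of _ b])
  define U where "U = (\<Inter>j<d. {z. P j z \<noteq> 0})"
  have cP: "continuous_on A (P j)" for A j
  proof -
    have "continuous_on A (\<lambda>z. P j z $ i)" for i
    proof -
      consider "i = 1" | "i = 2" | "i = 3" using exhaust_3 by blast
      thus ?thesis by cases (simp_all add: P_def cr3_def affine_point_def continuous_on_diff continuous_on_mult continuous_on_fst continuous_on_snd)
    qed
    hence "continuous_on A (\<lambda>z. \<chi> i. P j z $ i)" by (rule continuous_on_vec_lambda)
    thus ?thesis by simp
  qed
  have oU: "open U" unfolding U_def
  proof (intro open_INT ballI)
    fix j
    have "open (P j -` (- {0}))" by (rule open_vimage[OF _ cP]) (simp add: open_Compl)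
    thus "open {z. P j z \<noteq> 0}" by (simp add: vimage_def)
  qed simp
  have z0U: "z0 \<in> U" using Pnz by (simp add: U_def)
  have line: "proj_line (affine_point z) \<inter> C = (\<lambda>j. proj (P j z)) ` {..<d}" if z: "z \<in> U" for z
  proof (intro equalityI subsetI)
    fix Q assume "Q \<in> proj_line (affine_point z) \<inter> C"
    then obtain v where v: "v \<noteq> 0" "F v = 0" "Q = proj v" "proj v \<in> proj_line (affine_point z)" unfolding C_def by blast
    have 1: "dot3 (affine_point z) v = 0" using v(4) proj_in_proj_line[OF v(1)] by simp
    obtain j where j: "j < d" "dot3 v (q j) = 0" using v(2) unfolding F_def by auto
    have nz: "cr3 (affine_point z) (q j) \<noteq> 0" using z j(1) by (simp add: U_def P_def)
    obtain c where "c \<noteq> 0" "v = c *s cr3 (affine_point z) (q j)" using orthogonal_cr3[OF 1 j(2) nz v(1)] by blast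
    hence "Q = proj (P j z)" using v(3) proj_scale by (simp add: P_def)
    thus "Q \<in> (\<lambda>j. proj (P j z)) ` {..<d}" using j(1) by blast
  next
    fix Q assume "Q \<in> (\<lambda>j. proj (P j z)) ` {..<d}"
    then obtain j where j: "j < d" "Q = proj (P j z)" by blast
    have nz: "P j z \<noteq> 0" using z j(1) by (simp add: U_def)
    have "F (P j z) = 0" unfolding F_def using j(1) cr3_orthogonal(3) by (auto simp: P_def)
    moreover have "dot3 (affine_point z) (P j z) = 0" unfolding P_def by (rule cr3_orthogonal(1))
    hence "proj (P j z) \<in> proj_line (affine_point z)" using proj_in_proj_line[OF nz] by simp
    ultimately show "Q \<in> proj_line (affine_point z) \<inter> C" unfolding C_def j(2) using nz by blast
  qed
  have inj: "inj_on (\<lambda>j. proj (P j z0)) {..<d}"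
  proof (rule inj_onI, rule ccontr)
    fix i j assume ij: "i \<in> {..<d}" "j \<in> {..<d}" "proj (P i z0) = proj (P j z0)" "i \<noteq> j"
    obtain c where "P i z0 = c *s P j z0" using proj_eqD[OF ij(3)] by blast
    hence "P i z0 $ 1 = c * P j z0 $ 1" "P i z0 $ 2 = c * P j z0 $ 2" by simp_all
    hence "\<beta> i = c * \<beta> j" "\<alpha> i = c * \<alpha> j" unfolding P0 by simp_all
    thus False using ind'[of i j] ij by simp
  qed
  have card: "card (proj_line (affine_point z0) \<inter> C) = d" "finite (proj_line (affine_point z0) \<inter> C)"
    unfolding line[OF z0U] by (simp_all add: card_image[OF inj])
  have W: "{(z, z'). dot3 (cr3 (affine_point z) (q j)) (affine_point z') = 0} = {(z, z'). proj (affine_point z') \<in> proj_line (P j z)}" for j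
    unfolding proj_in_proj_line[OF affine_point_nonzero] P_def ..
  show ?thesis unfolding algebraic_web_def
  proof (intro exI[of _ C] exI[of _ U] exI[of _ P] conjI allI impI ballI)
    show "(\<lambda>j. relation_germ z0 {(z, z'). dot3 (cr3 (affine_point z) (q j)) (affine_point z') = 0}) ` {..<d} =
      (\<lambda>j. relation_germ z0 {(z, z'). proj (affine_point z') \<in> proj_line (P j z)}) ` {..<d}" by (simp only: W)
  qed (use red card oU z0U line cP in \<open>auto simp: U_def\<close>)
qed

lemma equivalent_webs_refl: "equivalent_webs p W p W"
proof -
  have "homeomorphism UNIV UNIV (id :: point \<Rightarrow> point) id" by (simp add: homeomorphism_def)
  moreover have "holomorphic2_on (fst \<circ> id) UNIV" "holomorphic2_on (snd \<circ> id) UNIV" unfolding holomorphic2_on_def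
  proof -
    have "((fst \<circ> id) has_derivative (\<lambda>h. 1 * fst h + 0 * snd h)) (at z)" for z :: point by (auto simp: o_def intro!: derivative_eq_intros)
    thus "\<forall>z\<in>UNIV. \<exists>a b. ((fst \<circ> id) has_derivative (\<lambda>h. a * fst h + b * snd h)) (at (z::point))" by blast
    have "((snd \<circ> id) has_derivative (\<lambda>h. 0 * fst h + 1 * snd h)) (at z)" for z :: point by (auto simp: o_def intro!: derivative_eq_intros)
    thus "\<forall>z\<in>UNIV. \<exists>a b. ((snd \<circ> id) has_derivative (\<lambda>h. a * fst h + b * snd h)) (at (z::point))" by blast
  qed
  ultimately have "local_biholomorphism p id" unfolding local_biholomorphism_def by (meson UNIV_I open_UNIV)
  moreover have "image_web id W = W" unfolding image_web_def image_foliation_def by (simp add: map_prod.id)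
  ultimately show ?thesis unfolding equivalent_webs_def by (intro exI[of _ id]) simp
qed

text \<open>The four foliations of \<open>\<T>\<^sub>0\<close> are pencils with vertices at infinity, so \<open>\<T>[u]\<close> is
  algebraic as soon as \<open>\<F>(u)\<close> is a pencil as well.\<close>

lemma pencil_algebraizable:
  fixes p :: point and q :: "complex^3"
  defines "m \<equiv> q $ 1 - fst p * q $ 3" and "n \<equiv> q $ 2 - snd p * q $ 3"
  assumes tr: "m * n * (m\<^sup>2 - n\<^sup>2) \<noteq> 0"
    and fol: "foliation p u = relation_germ p {(z, z'). dot3 (cr3 (affine_point z) q) (affine_point z') = 0}"
  shows "algebraizable p (T_web u)"
proof -
  \<comment> \<open>The first four vertices lie at infinity, each in the direction of its leaves:
    vertical for \<open>fst\<close>, horizontal for \<open>snd\<close>, (1, -1) for the sum and (1,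
    1) for the difference.\<close>
  define Q :: "nat \<Rightarrow> complex^3" where "Q j = [vector [0, 1, 0], vector [1, 0, 0], vector [1, -1, 0], vector [1, 1, 0], q] ! j" for j
  have Q: "Q 0 = vector [0, 1, 0]" "Q 1 = vector [1, 0, 0]" "Q 2 = vector [1, -1, 0]" "Q 3 = vector [1, 1, 0]" "Q 4 = q"
    by (simp_all add: Q_def eval_nat_numeral)
  have nz: "m \<noteq> 0" "n \<noteq> 0" "m + n \<noteq> 0" "m \<noteq> n"
    using tr by (auto simp: power2_eq_square add_eq_0_iff)
  have five: "{..<5::nat} = {0, 1, 2, 3, 4}" by auto
  have "algebraic_web 5 p ((\<lambda>j. relation_germ p {(z, z'). dot3 (cr3 (affine_point z) (Q j)) (affine_point z') = 0}) ` {..<5})"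
  proof (rule pencils_algebraic)
    fix i j :: nat assume ij: "i < 5" "j < 5" "i \<noteq> j"
    hence "i \<in> {0,1,2,3,4}" "j \<in> {0,1,2,3,4}" by (auto simp: five[symmetric])
    moreover have "Q 4 $ 1 - fst p * Q 4 $ 3 = m" "Q 4 $ 2 - snd p * Q 4 $ 3 = n" by (simp_all add: Q m_def n_def)
    ultimately show "(Q i $ 1 - fst p * Q i $ 3) * (Q j $ 2 - snd p * Q j $ 3) \<noteq> (Q j $ 1 - fst p * Q j $ 3) * (Q i $ 2 - snd p * Q i $ 3)"
      using nz ij(3) by (auto simp: Q(1-4) Q(2)[unfolded One_nat_def] add_eq_0_iff)
  qed simp
  moreover have "foliation p fst = relation_germ p {(z, z'). dot3 (cr3 (affine_point z) (Q 0)) (affine_point z') = 0}"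
    "foliation p snd = relation_germ p {(z, z'). dot3 (cr3 (affine_point z) (Q 1)) (affine_point z') = 0}"
    "foliation p (\<lambda>z. fst z + snd z) = relation_germ p {(z, z'). dot3 (cr3 (affine_point z) (Q 2)) (affine_point z') = 0}"
    "foliation p (\<lambda>z. fst z - snd z) = relation_germ p {(z, z'). dot3 (cr3 (affine_point z) (Q 3)) (affine_point z') = 0}"
    unfolding foliation_def Q
    by (intro relation_germ_cong always_eventually allI; auto simp: dot3_def cr3_def affine_point_def algebra_simps add_eq_0_iff; algebra)+
  hence "web p (T_web u) = (\<lambda>j. relation_germ p {(z, z'). dot3 (cr3 (affine_point z) (Q j)) (affine_point z') = 0}) ` {..<5}"
    unfolding web_def T_web_def five using fol by (simp add: Q(5))
  ultimately have "algebraic_web 5 p (web p (T_web u))" by simp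
  moreover have l: "length (T_web u) = 5" by (simp add: T_web_def)
  ultimately show ?thesis unfolding algebraizable_def l using equivalent_webs_refl by blast
qed

section \<open>Classification\<close>

lemma exp_solve:
  fixes y :: "complex \<Rightarrow> complex"
  assumes y: "y analytic_on {x0}" "deriv y x0 \<noteq> 0" "\<forall>\<^sub>F x in nhds x0. (deriv y x)\<^sup>2 = \<kappa>\<^sup>2 * (y x)\<^sup>2" and \<kappa>: "\<kappa> \<noteq> 0"
  obtains z0 \<epsilon> where "\<epsilon> = 1 \<or> \<epsilon> = -1" "\<forall>\<^sub>F x in nhds x0. y x = exp (z0 + \<epsilon> * \<kappa> * (x - x0))"
proof -
  have "(deriv y x0)\<^sup>2 = \<kappa>\<^sup>2 * (y x0)\<^sup>2" using eventually_nhds_x_imp_x[OF y(3)] .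
  \<comment> \<open>0 is the only value omitted by exp; here the equation turns it into y'(x0) =
    0.\<close>
  hence "y x0 \<noteq> 0" using y(2) by auto
  hence e: "exp (Ln (y x0)) = y x0" by simp
  have "deriv exp z = exp z" for z :: complex by (rule DERIV_imp_deriv) (rule DERIV_exp)
  hence "\<forall>\<^sub>F z in nhds (Ln (y x0)). \<kappa>\<^sup>2 * (deriv exp z)\<^sup>2 = \<kappa>\<^sup>2 * (exp z)\<^sup>2" by simp
  note E = this
  have an: "exp analytic_on {Ln (y x0)}" by (intro analytic_intros)
  show ?thesis by (rule ode_solve[OF y an e E \<kappa>]) (rule that)
qed

lemma sin_solve:
  fixes y :: "complex \<Rightarrow> complex"
  assumes y: "y analytic_on {x0}" "deriv y x0 \<noteq> 0" "\<forall>\<^sub>F x in nhds x0. (deriv y x)\<^sup>2 = \<kappa>\<^sup>2 * (1 - (y x)\<^sup>2)" and \<kappa>: "\<kappa> \<noteq> 0"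
  obtains z0 \<epsilon> where "\<epsilon> = 1 \<or> \<epsilon> = -1" "\<forall>\<^sub>F x in nhds x0. y x = sin (z0 + \<epsilon> * \<kappa> * (x - x0))"
proof -
  have "deriv sin z = cos z" for z :: complex by (rule DERIV_imp_deriv) (rule DERIV_sin)
  hence "\<forall>\<^sub>F z in nhds (Arcsin (y x0)). \<kappa>\<^sup>2 * (deriv sin z)\<^sup>2 = \<kappa>\<^sup>2 * (1 - (sin z)\<^sup>2)" by (simp add: cos_squared_eq)
  note E = this
  have an: "sin analytic_on {Arcsin (y x0)}" by (intro analytic_intros)
  show ?thesis by (rule ode_solve[OF y an sin_Arcsin E \<kappa>]) (rule that)
qed

lemma square_solve:
  fixes y :: "complex \<Rightarrow> complex"
  assumes y: "y analytic_on {x0}" "deriv y x0 \<noteq> 0" "\<forall>\<^sub>F x in nhds x0. (deriv y x)\<^sup>2 = \<kappa>\<^sup>2 * (4 * y x)" and \<kappa>: "\<kappa> \<noteq> 0"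
  obtains z0 \<epsilon> where "\<epsilon> = 1 \<or> \<epsilon> = -1" "\<forall>\<^sub>F x in nhds x0. y x = (z0 + \<epsilon> * \<kappa> * (x - x0))\<^sup>2"
proof -
  have "deriv (\<lambda>z. z\<^sup>2) z = 2 * z" for z :: complex by (rule DERIV_imp_deriv) (auto intro!: derivative_eq_intros)
  hence "\<forall>\<^sub>F z in nhds (csqrt (y x0)). \<kappa>\<^sup>2 * (deriv (\<lambda>z. z\<^sup>2) z)\<^sup>2 = \<kappa>\<^sup>2 * (4 * z\<^sup>2)" by (simp add: power2_eq_square)
  note E = this
  have "(\<lambda>z. z\<^sup>2) analytic_on {csqrt (y x0)}" by (intro analytic_intros)
  note an = this
  show ?thesis by (rule ode_solve[OF y an power2_csqrt E \<kappa>]) (rule that)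
qed

lemma line_solve:
  fixes y :: "complex \<Rightarrow> complex"
  assumes y: "y analytic_on {x0}" "deriv y x0 \<noteq> 0" "\<forall>\<^sub>F x in nhds x0. (deriv y x)\<^sup>2 = \<kappa>\<^sup>2" and \<kappa>: "\<kappa> \<noteq> 0"
  obtains \<epsilon> where "\<epsilon> = 1 \<or> \<epsilon> = -1" "\<forall>\<^sub>F x in nhds x0. y x = y x0 + \<epsilon> * \<kappa> * (x - x0)"
proof -
  have "\<forall>\<^sub>F z in nhds (y x0). \<kappa>\<^sup>2 * (deriv (\<lambda>z. z) z)\<^sup>2 = \<kappa>\<^sup>2" by simp
  note E = this
  have "(\<lambda>z. z) analytic_on {y x0}" by (intro analytic_intros)
  note an = this
  show ?thesis by (rule ode_solve[OF y an refl E \<kappa>]) (rule that)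
qed

lemma analytic_tanh:
  fixes z :: complex
  assumes "exp z + exp (-z) \<noteq> 0" shows "tanh analytic_on {z}" "deriv tanh z = 1 - (tanh z)\<^sup>2"
proof -
  have "(\<lambda>z::complex. (exp z - exp (-z)) / (exp z + exp (-z))) analytic_on {z}"
    using assms by (intro analytic_intros) auto
  thus "tanh analytic_on {z}" unfolding tanh_altdef[abs_def] .
  have "cosh z \<noteq> 0" using assms by (simp add: cosh_field_def)
  from has_field_derivative_tanh[OF this DERIV_ident] show "deriv tanh z = 1 - (tanh z)\<^sup>2" by (simp add: DERIV_imp_deriv)
qed

text \<open>tanh omits 1 and -1, where the right hand side vanishes, so y'(x0) \<noteq> 0 excludes
  them. For other values v, the formula tanh (Ln w) = (w^2 - 1) / (w^2 + 1) leads to w^2 = (1 + v) /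
  (1 - v).\<close>

lemma tanh_solve:
  fixes y :: "complex \<Rightarrow> complex"
  assumes y: "y analytic_on {x0}" "deriv y x0 \<noteq> 0" "\<forall>\<^sub>F x in nhds x0. (deriv y x)\<^sup>2 = \<kappa>\<^sup>2 * (1 - (y x)\<^sup>2)\<^sup>2" and \<kappa>: "\<kappa> \<noteq> 0"
  obtains z0 \<epsilon> where "\<epsilon> = 1 \<or> \<epsilon> = -1" "tanh analytic_on {z0}" "\<forall>\<^sub>F x in nhds x0. y x = tanh (z0 + \<epsilon> * \<kappa> * (x - x0))"
proof -
  define v where "v = y x0"
  have "(deriv y x0)\<^sup>2 = \<kappa>\<^sup>2 * (1 - v\<^sup>2)\<^sup>2" using eventually_nhds_x_imp_x[OF y(3)] by (simp add: v_def)
  hence "1 - v\<^sup>2 \<noteq> 0" using y(2) by auto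
  moreover have "1 - v\<^sup>2 = (1 - v) * (1 + v)" by (simp add: power2_eq_square algebra_simps)
  ultimately have v: "1 - v \<noteq> 0" "1 + v \<noteq> 0" by auto
  define w where "w = csqrt ((1 + v) / (1 - v))"
  have w2: "w\<^sup>2 = (1 + v) / (1 - v)" by (simp add: w_def)
  have w0: "w \<noteq> 0" using w2 v by auto
  have p: "w\<^sup>2 + 1 = 2 / (1 - v)" "w\<^sup>2 - 1 = 2 * v / (1 - v)" using v(1) by (simp_all add: w2 field_simps)
  have t: "tanh (Ln w) = v" unfolding tanh_ln_complex[OF w0] p using v(1) by simp
  have "(exp (Ln w) + exp (- Ln w)) * w = w\<^sup>2 + 1" using w0 by (simp add: exp_minus field_simps power2_eq_square)
  hence nz: "exp (Ln w) + exp (- Ln w) \<noteq> 0" using p(1) v(1) by auto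
  have "isCont (\<lambda>z. exp z + exp (- z)) (Ln w)" by (intro continuous_intros)
  hence "\<forall>\<^sub>F z in nhds (Ln w). exp z + exp (- z) \<noteq> 0" by (rule eventually_nonzero) (rule nz)
  hence "\<forall>\<^sub>F z in nhds (Ln w). \<kappa>\<^sup>2 * (deriv tanh z)\<^sup>2 = \<kappa>\<^sup>2 * (1 - (tanh z)\<^sup>2)\<^sup>2" by eventually_elim (simp add: analytic_tanh)
  note E = this
  show ?thesis
    by (rule ode_solve[OF y analytic_tanh(1)[OF nz] t[unfolded v_def] E \<kappa>]) (rule that[OF _ analytic_tanh(1)[OF nz]])
qed

text \<open>Passing to the exponential makes the equation polynomial of degree at most 4. The free
  factor \<open>k\<close> serves to normalize its two outer coefficients.\<close>

lemma scaled_exp_ode: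
  fixes f :: "complex \<Rightarrow> complex"
  assumes f: "f analytic_on {x0}" "deriv f x0 \<noteq> 0" "\<beta> \<noteq> 0" "k \<noteq> 0"
    and eq: "\<forall>\<^sub>F x in nhds x0. (deriv f x)\<^sup>2 = A * exp (2 * \<beta> * f x) + A' * exp (- (2 * \<beta> * f x)) + \<gamma>"
  shows "(\<lambda>x. k * exp (\<beta> * f x)) analytic_on {x0}" "deriv (\<lambda>x. k * exp (\<beta> * f x)) x0 \<noteq> 0"
    "\<forall>\<^sub>F x in nhds x0. (deriv (\<lambda>x. k * exp (\<beta> * f x)) x)\<^sup>2 =
       \<beta>\<^sup>2 * (A / k\<^sup>2 * (k * exp (\<beta> * f x))^4 + A' * k\<^sup>2 + \<gamma> * (k * exp (\<beta> * f x))\<^sup>2)"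
proof -
  show "(\<lambda>x. k * exp (\<beta> * f x)) analytic_on {x0}" by (intro analytic_intros f)
  have d: "deriv (\<lambda>x. k * exp (\<beta> * f x)) x = k * (exp (\<beta> * f x) * (\<beta> * deriv f x))" if "f analytic_on {x}" for x
    by (rule DERIV_imp_deriv) (rule derivative_eq_intros analytic_DERIV that refl | simp)+
  show "deriv (\<lambda>x. k * exp (\<beta> * f x)) x0 \<noteq> 0" using f by (simp add: d)
  show "\<forall>\<^sub>F x in nhds x0. (deriv (\<lambda>x. k * exp (\<beta> * f x)) x)\<^sup>2 =
       \<beta>\<^sup>2 * (A / k\<^sup>2 * (k * exp (\<beta> * f x))^4 + A' * k\<^sup>2 + \<gamma> * (k * exp (\<beta> * f x))\<^sup>2)"
    using eq analytic_eventually[OF f(1)]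
  proof eventually_elim
    case (elim x)
    define E where "E = exp (\<beta> * f x)"
    have E: "E \<noteq> 0" "exp (2 * \<beta> * f x) = E\<^sup>2" "exp (- (2 * \<beta> * f x)) = 1 / E\<^sup>2"
      by (simp_all add: E_def exp_double[symmetric] exp_minus divide_inverse mult.assoc)
    have "(deriv (\<lambda>x. k * exp (\<beta> * f x)) x)\<^sup>2 = k\<^sup>2 * E\<^sup>2 * \<beta>\<^sup>2 * (A * E\<^sup>2 + A' * (1 / E\<^sup>2) + \<gamma>)"
      unfolding d[OF elim(2)] E_def[symmetric] elim(1)[unfolded E(2,3), symmetric] by (simp add: power_mult_distrib mult_ac)
    also have "\<dots> = \<beta>\<^sup>2 * (A / k\<^sup>2 * (k * E)^4 + A' * k\<^sup>2 + \<gamma> * (k * E)\<^sup>2)"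
      using E(1) f(4) by (simp add: field_simps power2_eq_square power4_eq_xxxx)
    finally show ?case by (simp only: E_def)
  qed
qed

section \<open>Transport of webs defined by a sum \<open>f(x) + g(y)\<close> to the models\<close>

locale hexagonal =
  fixes x0 y0 :: complex and u :: "point \<Rightarrow> complex" and f g \<Phi> :: "complex \<Rightarrow> complex"
  assumes u: "holomorphic_germ (x0, y0) u" "transversality (x0, y0) u"
    and f: "f analytic_on {x0}" "f x0 = 0" "deriv f x0 \<noteq> 0"
    and g: "g analytic_on {y0}" "g y0 = 0" "deriv g y0 \<noteq> 0"
    and \<Phi>: "\<Phi> analytic_on {u (x0, y0)}" "\<Phi> (u (x0, y0)) = 0" "deriv \<Phi> (u (x0, y0)) \<noteq> 0"
    and eq: "\<forall>\<^sub>F z in nhds (x0, y0). \<Phi> (u z) = f (fst z) + g (snd z)"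
    and distinct: "(deriv f x0)\<^sup>2 \<noteq> (deriv g y0)\<^sup>2"
definition (in hexagonal) modelled :: bool where
  "modelled \<longleftrightarrow> (\<exists>\<sigma>\<in>Sym_T0. \<exists>w\<in>model_functions. \<exists>p'. holomorphic_germ p' w \<and> transversality p' w \<and> \<sigma> p' = (x0, y0) \<and>
           web (x0, y0) (T_web u) = image_web \<sigma> (web p' (T_web w)))"

lemma (in hexagonal) compose_\<Phi>:
  assumes \<Theta>: "\<Theta> analytic_on {0}" "deriv \<Theta> 0 \<noteq> 0"
  shows "(\<lambda>t. \<Theta> (\<Phi> t)) analytic_on {u (x0, y0)}" "deriv (\<lambda>t. \<Theta> (\<Phi> t)) (u (x0, y0)) \<noteq> 0"
proof -
  have \<Theta>': "\<Theta> analytic_on {\<Phi> (u (x0, y0))}" using \<Theta>(1) by (simp add: \<Phi>(2))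
  show "(\<lambda>t. \<Theta> (\<Phi> t)) analytic_on {u (x0, y0)}" by (rule analytic_compose[OF \<Theta>' \<Phi>(1)])
  have "deriv (\<lambda>t. \<Theta> (\<Phi> t)) (u (x0, y0)) = deriv \<Theta> (\<Phi> (u (x0, y0))) * deriv \<Phi> (u (x0, y0))"
    by (rule DERIV_imp_deriv, rule DERIV_chain2[where f = \<Theta> and g = \<Phi>]) (rule analytic_DERIV[OF \<Theta>'] analytic_DERIV[OF \<Phi>(1)])+
  thus "deriv (\<lambda>t. \<Theta> (\<Phi> t)) (u (x0, y0)) \<noteq> 0" using \<Theta>(2) \<Phi>(2,3) by simp
qed

lemma (in hexagonal) modelledI:
  assumes "T0_linear a b a' b'" "w \<in> model_functions" "\<Theta> analytic_on {0}" "deriv \<Theta> 0 \<noteq> 0"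
    and "holomorphic_germ (a * x0 + b * y0 + c, a' * x0 + b' * y0 + c') w"
    and ev: "\<forall>\<^sub>F z in nhds (x0, y0). w (a * fst z + b * snd z + c, a' * fst z + b' * snd z + c') = \<Theta> (f (fst z) + g (snd z))"
  shows modelled
proof -
  have "\<forall>\<^sub>F z in nhds (x0, y0). w (a * fst z + b * snd z + c, a' * fst z + b' * snd z + c') = \<Theta> (\<Phi> (u z))"
    using ev eq by eventually_elim simp
  from web_model[OF u assms(1) _ compose_\<Phi>[OF assms(3,4)] this] show ?thesis
    unfolding modelled_def using assms(2,5) by auto
qed

text \<open>A diagonal map permuting the four directions scales both variables by the same number up
  to sign; hence one \<open>\<kappa>\<close> and two separate signs.\<close>

lemma (in hexagonal) modelled_diag:
  assumes s: "\<epsilon> = 1 \<or> \<epsilon> = -1" "\<epsilon>' = 1 \<or> \<epsilon>' = -1" "\<kappa> \<noteq> 0" and w: "w \<in> model_functions" "holomorphic_germ (z0, w0) w"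
    and \<Theta>: "\<Theta> analytic_on {0}" "deriv \<Theta> 0 \<noteq> 0"
    and ev: "\<forall>\<^sub>F z in nhds (x0, y0). w (z0 + \<epsilon> * \<kappa> * (fst z - x0), w0 + \<epsilon>' * \<kappa> * (snd z - y0)) = \<Theta> (f (fst z) + g (snd z))"
  shows modelled
proof (rule modelledI[where a = "\<epsilon> * \<kappa>" and b = 0 and a' = 0 and b' = "\<epsilon>' * \<kappa>" and c = "z0 - \<epsilon> * \<kappa> * x0" and c' = "w0 - \<epsilon>' * \<kappa> * y0", OF _ w(1) \<Theta>])
  show "T0_linear (\<epsilon> * \<kappa>) 0 0 (\<epsilon>' * \<kappa>)" unfolding T0_linear_def
    by (rule exI[of _ "\<epsilon> * \<kappa>"], rule exI[of _ "\<epsilon>' * \<epsilon>"], rule exI[of _ 1]) (use s in auto)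
  show "holomorphic_germ (\<epsilon> * \<kappa> * x0 + 0 * y0 + (z0 - \<epsilon> * \<kappa> * x0), 0 * x0 + \<epsilon>' * \<kappa> * y0 + (w0 - \<epsilon>' * \<kappa> * y0)) w"
    using w(2) by simp
  show "\<forall>\<^sub>F z in nhds (x0, y0). w (\<epsilon> * \<kappa> * fst z + 0 * snd z + (z0 - \<epsilon> * \<kappa> * x0), 0 * fst z + \<epsilon>' * \<kappa> * snd z + (w0 - \<epsilon>' * \<kappa> * y0)) = \<Theta> (f (fst z) + g (snd z))"
    using ev by (simp add: algebra_simps)
qed

text \<open>For models evaluated at multiples of X + Y and X - Y, where X and Y are the affine
  arguments of the two one-variable solutions. The factors \<open>\<mu>\<close> and
  \<open>\<mu>'\<close> agree up to sign so that the four directions are permuted.\<close>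

lemma (in hexagonal) modelled_mixed:
  assumes s: "\<epsilon> = 1 \<or> \<epsilon> = -1" "\<epsilon>' = 1 \<or> \<epsilon>' = -1" "\<kappa> \<noteq> 0" "\<mu> \<noteq> 0" "\<mu>' = \<mu> \<or> \<mu>' = - \<mu>"
    and w: "w \<in> model_functions" "holomorphic_germ (\<mu> * (z0 + w0), \<mu>' * (z0 - w0) + c0) w"
    and \<Theta>: "\<Theta> analytic_on {0}" "deriv \<Theta> 0 \<noteq> 0"
    and ev: "\<forall>\<^sub>F z in nhds (x0, y0). w (\<mu> * ((z0 + \<epsilon> * \<kappa> * (fst z - x0)) + (w0 + \<epsilon>' * \<kappa> * (snd z - y0))),
        \<mu>' * ((z0 + \<epsilon> * \<kappa> * (fst z - x0)) - (w0 + \<epsilon>' * \<kappa> * (snd z - y0))) + c0) = \<Theta> (f (fst z) + g (snd z))"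
  shows modelled
proof (rule modelledI[where a = "\<mu> * \<epsilon> * \<kappa>" and b = "\<mu> * \<epsilon>' * \<kappa>" and a' = "\<mu>' * \<epsilon> * \<kappa>" and b' = "- \<mu>' * \<epsilon>' * \<kappa>"
      and c = "\<mu> * (z0 - \<epsilon> * \<kappa> * x0 + w0 - \<epsilon>' * \<kappa> * y0)" and c' = "\<mu>' * (z0 - \<epsilon> * \<kappa> * x0 - w0 + \<epsilon>' * \<kappa> * y0) + c0", OF _ w(1) \<Theta>])
  show "T0_linear (\<mu> * \<epsilon> * \<kappa>) (\<mu> * \<epsilon>' * \<kappa>) (\<mu>' * \<epsilon> * \<kappa>) (- \<mu>' * \<epsilon>' * \<kappa>)" unfolding T0_linear_def
    by (rule exI[of _ "\<mu> * \<epsilon> * \<kappa>"], rule exI[of _ "\<mu>' / \<mu>"], rule exI[of _ "\<epsilon> * \<epsilon>'"]) (use s in auto)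
  have L: "\<mu> * \<epsilon> * \<kappa> * x + \<mu> * \<epsilon>' * \<kappa> * y + \<mu> * (z0 - \<epsilon> * \<kappa> * x0 + w0 - \<epsilon>' * \<kappa> * y0) =
      \<mu> * ((z0 + \<epsilon> * \<kappa> * (x - x0)) + (w0 + \<epsilon>' * \<kappa> * (y - y0)))"
    "\<mu>' * \<epsilon> * \<kappa> * x + - \<mu>' * \<epsilon>' * \<kappa> * y + (\<mu>' * (z0 - \<epsilon> * \<kappa> * x0 - w0 + \<epsilon>' * \<kappa> * y0) + c0) =
      \<mu>' * ((z0 + \<epsilon> * \<kappa> * (x - x0)) - (w0 + \<epsilon>' * \<kappa> * (y - y0))) + c0" for x y
    by (simp_all add: algebra_simps)
  show "holomorphic_germ (\<mu> * \<epsilon> * \<kappa> * x0 + \<mu> * \<epsilon>' * \<kappa> * y0 + \<mu> * (z0 - \<epsilon> * \<kappa> * x0 + w0 - \<epsilon>' * \<kappa> * y0),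
     \<mu>' * \<epsilon> * \<kappa> * x0 + - \<mu>' * \<epsilon>' * \<kappa> * y0 + (\<mu>' * (z0 - \<epsilon> * \<kappa> * x0 - w0 + \<epsilon>' * \<kappa> * y0) + c0)) w"
    unfolding L using w(2) by simp
  show "\<forall>\<^sub>F z in nhds (x0, y0). w (\<mu> * \<epsilon> * \<kappa> * fst z + \<mu> * \<epsilon>' * \<kappa> * snd z + \<mu> * (z0 - \<epsilon> * \<kappa> * x0 + w0 - \<epsilon>' * \<kappa> * y0),
     \<mu>' * \<epsilon> * \<kappa> * fst z + - \<mu>' * \<epsilon>' * \<kappa> * snd z + (\<mu>' * (z0 - \<epsilon> * \<kappa> * x0 - w0 + \<epsilon>' * \<kappa> * y0) + c0)) = \<Theta> (f (fst z) + g (snd z))"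
    unfolding L by (rule ev)
qed

section \<open>Exponential and elliptic cases: \<open>b\<close> nonzero\<close>

lemma exp_\<Theta>:
  fixes \<beta> K :: complex
  assumes "\<beta> \<noteq> 0" "K \<noteq> 0" shows "(\<lambda>t. K * exp (\<beta> * t)) analytic_on {0}" "deriv (\<lambda>t. K * exp (\<beta> * t)) 0 \<noteq> 0"
proof -
  show "(\<lambda>t. K * exp (\<beta> * t)) analytic_on {0}" by (intro analytic_intros)
  have "deriv (\<lambda>t. K * exp (\<beta> * t)) 0 = K * \<beta>" by (rule DERIV_imp_deriv) (auto intro!: derivative_eq_intros)
  thus "deriv (\<lambda>t. K * exp (\<beta> * t)) 0 \<noteq> 0" using assms by simp
qed

lemma affine_\<Theta>:
  fixes K c :: complex
  assumes "K \<noteq> 0" shows "(\<lambda>t. K * t + c) analytic_on {0}" "deriv (\<lambda>t. K * t + c) 0 \<noteq> 0"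
proof -
  show "(\<lambda>t. K * t + c) analytic_on {0}" by (intro analytic_intros)
  have "deriv (\<lambda>t. K * t + c) 0 = K" by (rule DERIV_imp_deriv) (auto intro!: derivative_eq_intros)
  thus "deriv (\<lambda>t. K * t + c) 0 \<noteq> 0" using assms by simp
qed

text \<open>The functions k exp (\<beta> f) and l exp (\<beta> g) multiply to a multiple of exp
  (\<beta> (f + g)), a function of u; so it suffices that both solve the equation of one and the
  same model.\<close>

lemma (in hexagonal) case_elliptic:
  assumes \<beta>: "\<beta> \<noteq> 0" and m: "A * A' = B * B'" "A * A' \<noteq> 0"
    and F: "\<forall>\<^sub>F x in nhds x0. (deriv f x)\<^sup>2 = A * exp (2 * \<beta> * f x) + A' * exp (- (2 * \<beta> * f x)) + \<gamma>"
    and G: "\<forall>\<^sub>F y in nhds y0. (deriv g y)\<^sup>2 = B * exp (2 * \<beta> * g y) + B' * exp (- (2 * \<beta> * g y)) + \<gamma>"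
  shows modelled
proof -
  have nz: "A \<noteq> 0" "A' \<noteq> 0" "B \<noteq> 0" "B' \<noteq> 0" using m by auto
  have ode: "\<exists>k l. k \<noteq> 0 \<and> l \<noteq> 0 \<and>
      (\<forall>\<^sub>F x in nhds x0. (deriv (\<lambda>x. k * exp (\<beta> * f x)) x)\<^sup>2 = \<beta>\<^sup>2 * (\<delta> * ((k * exp (\<beta> * f x))^4 + 1) + \<gamma> * (k * exp (\<beta> * f x))\<^sup>2)) \<and>
      (\<forall>\<^sub>F y in nhds y0. (deriv (\<lambda>y. l * exp (\<beta> * g y)) y)\<^sup>2 = \<beta>\<^sup>2 * (\<delta> * ((l * exp (\<beta> * g y))^4 + 1) + \<gamma> * (l * exp (\<beta> * g y))\<^sup>2))"
    if \<delta>: "\<delta>\<^sup>2 = A * A'" for \<delta>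
  proof -
    have \<delta>0: "\<delta> \<noteq> 0" using \<delta> m by auto
    \<comment> \<open>These scalings make both outer coefficients equal to \<delta>, for f and g
      alike, because A A' = B B' = \<delta>^2.\<close>
    define k l where "k = csqrt (A / \<delta>)" "l = csqrt (B / \<delta>)"
    have k: "k\<^sup>2 = A / \<delta>" "l\<^sup>2 = B / \<delta>" by (simp_all add: k_l_def)
    have kl: "k \<noteq> 0" "l \<noteq> 0" using nz \<delta>0 by (simp_all add: k_l_def)
    have c: "A / k\<^sup>2 = \<delta>" "A' * k\<^sup>2 = \<delta>" "B / l\<^sup>2 = \<delta>" "B' * l\<^sup>2 = \<delta>"
      unfolding k using nz \<delta>0 \<delta> m(1) by (simp_all add: field_simps power2_eq_square)
    show ?thesis
      by (rule exI[of _ k], rule exI[of _ l])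
         (use kl scaled_exp_ode(3)[OF f(1,3) \<beta> kl(1) F, unfolded c] scaled_exp_ode(3)[OF g(1,3) \<beta> kl(2) G, unfolded c]
           in \<open>simp add: algebra_simps\<close>)
  qed
  \<comment> \<open>For \<gamma> = - 2 \<delta> the quartic is \<delta> (1 - v^2)^2. The root
    \<delta> of A A' is left free, so that \<gamma> = 2 \<delta> is covered by replacing \<delta>
    with - \<delta>.\<close>
  have tanh_case: modelled if \<delta>: "\<delta>\<^sup>2 = A * A'" and \<gamma>: "\<gamma> = - 2 * \<delta>" for \<delta>
  proof -
    have \<delta>0: "\<delta> \<noteq> 0" using \<delta> m by auto
    obtain k l where kl: "k \<noteq> 0" "l \<noteq> 0" and
      o: "\<forall>\<^sub>F x in nhds x0. (deriv (\<lambda>x. k * exp (\<beta> * f x)) x)\<^sup>2 = \<beta>\<^sup>2 * (\<delta> * ((k * exp (\<beta> * f x))^4 + 1) + \<gamma> * (k * exp (\<beta> * f x))\<^sup>2)"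
      "\<forall>\<^sub>F y in nhds y0. (deriv (\<lambda>y. l * exp (\<beta> * g y)) y)\<^sup>2 = \<beta>\<^sup>2 * (\<delta> * ((l * exp (\<beta> * g y))^4 + 1) + \<gamma> * (l * exp (\<beta> * g y))\<^sup>2)"
      using ode[OF \<delta>] by (elim exE conjE)
    define \<kappa> where "\<kappa> = csqrt (\<beta>\<^sup>2 * \<delta>)"
    have \<kappa>: "\<kappa>\<^sup>2 = \<beta>\<^sup>2 * \<delta>" "\<kappa> \<noteq> 0" using \<beta> \<delta>0 by (simp_all add: \<kappa>_def)
    have R: "\<beta>\<^sup>2 * (\<delta> * (v^4 + 1) + \<gamma> * v\<^sup>2) = \<kappa>\<^sup>2 * (1 - v\<^sup>2)\<^sup>2" for v
      unfolding \<kappa> \<gamma> by (simp add: power2_eq_square power4_eq_xxxx algebra_simps)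
    obtain z0 \<epsilon> where z: "\<epsilon> = 1 \<or> \<epsilon> = -1" "tanh analytic_on {z0}" "\<forall>\<^sub>F x in nhds x0. k * exp (\<beta> * f x) = tanh (z0 + \<epsilon> * \<kappa> * (x - x0))"
      by (rule tanh_solve[OF scaled_exp_ode(1,2)[OF f(1,3) \<beta> kl(1) F] o(1)[unfolded R] \<kappa>(2)]) blast
    obtain w0 \<epsilon>' where w: "\<epsilon>' = 1 \<or> \<epsilon>' = -1" "tanh analytic_on {w0}" "\<forall>\<^sub>F y in nhds y0. l * exp (\<beta> * g y) = tanh (w0 + \<epsilon>' * \<kappa> * (y - y0))"
      by (rule tanh_solve[OF scaled_exp_ode(1,2)[OF g(1,3) \<beta> kl(2) G] o(2)[unfolded R] \<kappa>(2)]) blast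
    show ?thesis
    proof (rule modelled_diag[OF z(1) w(1) \<kappa>(2), where w = "\<lambda>(x, y). tanh x * tanh y"])
      show "holomorphic_germ (z0, w0) (\<lambda>(x, y). tanh x * tanh y)"
        using holomorphic_germ_mult(1)[OF z(2) w(2)] by (simp add: case_prod_beta')
      show "(\<lambda>t. (k * l) * exp (\<beta> * t)) analytic_on {0}" "deriv (\<lambda>t. (k * l) * exp (\<beta> * t)) 0 \<noteq> 0"
        using exp_\<Theta>[of \<beta> "k * l"] \<beta> kl by auto
      show "\<forall>\<^sub>F z in nhds (x0, y0). (case (z0 + \<epsilon> * \<kappa> * (fst z - x0), w0 + \<epsilon>' * \<kappa> * (snd z - y0)) of (x, y) \<Rightarrow> tanh x * tanh y)
          = (k * l) * exp (\<beta> * (f (fst z) + g (snd z)))"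
        using eventually_fst[OF z(3), of y0] eventually_snd[OF w(3), of x0]
      proof eventually_elim
        case (elim z)
        show ?case unfolding case_prod_conv fst_conv snd_conv elim[symmetric] by (simp add: distrib_left exp_add)
      qed
    qed (simp add: model_functions_def)
  qed
  define \<delta> where "\<delta> = csqrt (A * A')"
  have \<delta>: "\<delta>\<^sup>2 = A * A'" by (simp add: \<delta>_def)
  have \<delta>0: "\<delta> \<noteq> 0" using \<delta> m by auto
  consider "\<gamma> = - 2 * \<delta>" | "\<gamma> = 2 * \<delta>" | "\<gamma> / \<delta> \<noteq> 2" "\<gamma> / \<delta> \<noteq> -2" using \<delta>0 by (auto simp: field_simps)
  thus ?thesis
  proof cases
    case 1 thus ?thesis by (rule tanh_case[OF \<delta>])
  next
    case 2 thus ?thesis by (intro tanh_case[of "- \<delta>"]) (use \<delta> in simp_all)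
  next
    case 3
    define \<rho> where "\<rho> = \<gamma> / \<delta>"
    have r: "\<rho> \<noteq> 2" "\<rho> \<noteq> -2" using 3 by (simp_all add: \<rho>_def)
    obtain \<tau> K where \<tau>: "Im \<tau> > 0" "K \<noteq> 0"
      "\<And>z. t4 \<tau> z \<noteq> 0 \<Longrightarrow> ((\<lambda>z. t1 \<tau> z / t4 \<tau> z) has_field_derivative deriv (\<lambda>z. t1 \<tau> z / t4 \<tau> z) z) (at z)"
      "\<And>z. t4 \<tau> z \<noteq> 0 \<Longrightarrow> (deriv (\<lambda>z. t1 \<tau> z / t4 \<tau> z) z)\<^sup>2 = K * ((t1 \<tau> z / t4 \<tau> z)^4 + 1 + \<rho> * (t1 \<tau> z / t4 \<tau> z)\<^sup>2)"
      by (rule theta_quotient_ode[OF r]) (rule that)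
    define \<psi> where "\<psi> z = t1 \<tau> z / t4 \<tau> z" for z
    obtain k l where kl: "k \<noteq> 0" "l \<noteq> 0" and
      o: "\<forall>\<^sub>F x in nhds x0. (deriv (\<lambda>x. k * exp (\<beta> * f x)) x)\<^sup>2 = \<beta>\<^sup>2 * (\<delta> * ((k * exp (\<beta> * f x))^4 + 1) + \<gamma> * (k * exp (\<beta> * f x))\<^sup>2)"
      "\<forall>\<^sub>F y in nhds y0. (deriv (\<lambda>y. l * exp (\<beta> * g y)) y)\<^sup>2 = \<beta>\<^sup>2 * (\<delta> * ((l * exp (\<beta> * g y))^4 + 1) + \<gamma> * (l * exp (\<beta> * g y))\<^sup>2)"
      using ode[OF \<delta>] by (elim exE conjE)
    \<comment> \<open>The constant \<open>K\<close> in the equation of the theta quotient is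
      absorbed in the scaling of its argument.\<close>
    define \<kappa> where "\<kappa> = csqrt (\<beta>\<^sup>2 * \<delta> / K)"
    have \<kappa>: "\<kappa>\<^sup>2 * K = \<beta>\<^sup>2 * \<delta>" "\<kappa> \<noteq> 0" using \<beta> \<delta>0 \<tau>(2) by (simp_all add: \<kappa>_def)
    define S where "S y a z0 \<epsilon> \<longleftrightarrow> (\<epsilon> = 1 \<or> \<epsilon> = -1) \<and> \<psi> analytic_on {z0} \<and> (\<forall>\<^sub>F x in nhds a. y x = \<psi> (z0 + \<epsilon> * \<kappa> * (x - a)))"
      for y and a z0 \<epsilon> :: complex
    have solve: "\<exists>z0 \<epsilon>. S y a z0 \<epsilon>"
      if y: "y analytic_on {a}" "deriv y a \<noteq> 0" "\<forall>\<^sub>F x in nhds a. (deriv y x)\<^sup>2 = \<beta>\<^sup>2 * (\<delta> * ((y x)^4 + 1) + \<gamma> * (y x)\<^sup>2)" for y and a :: complex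
    proof -
      obtain z0 where z0: "t4 \<tau> z0 \<noteq> 0" "t1 \<tau> z0 / t4 \<tau> z0 = y a" by (rule theta_quotient_surj[OF \<tau>(1)])
      have an: "t1 \<tau> analytic_on {z}" "t4 \<tau> analytic_on {z}" for z
        unfolding analytic_at using t1_t4_holomorphic[OF \<tau>(1), of UNIV] by auto
      have \<psi>a: "\<psi> analytic_on {z0}" unfolding \<psi>_def[abs_def] by (intro analytic_on_divide an) (use z0 in auto)
      have "\<forall>\<^sub>F z in nhds z0. t4 \<tau> z \<noteq> 0" by (rule eventually_nonzero[OF analytic_isCont[OF an(2)] z0(1)])
      hence "\<forall>\<^sub>F z in nhds z0. \<kappa>\<^sup>2 * (deriv \<psi> z)\<^sup>2 = \<beta>\<^sup>2 * (\<delta> * ((\<psi> z)^4 + 1) + \<gamma> * (\<psi> z)\<^sup>2)"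
      proof eventually_elim
        case (elim z)
        have "\<kappa>\<^sup>2 * (deriv \<psi> z)\<^sup>2 = (\<kappa>\<^sup>2 * K) * ((\<psi> z)^4 + 1 + \<rho> * (\<psi> z)\<^sup>2)"
          using \<tau>(4)[OF elim] unfolding \<psi>_def[abs_def] by simp
        also have "\<dots> = \<beta>\<^sup>2 * (\<delta> * ((\<psi> z)^4 + 1) + \<gamma> * (\<psi> z)\<^sup>2)" unfolding \<kappa>(1) using \<delta>0 by (simp add: \<rho>_def field_simps)
        finally show ?case .
      qed
      note E = this
      have "\<psi> z0 = y a" using z0(2) by (simp add: \<psi>_def)
      then obtain \<epsilon> where "\<epsilon> = 1 \<or> \<epsilon> = -1" "\<forall>\<^sub>F x in nhds a. y x = \<psi> (z0 + \<epsilon> * \<kappa> * (x - a))"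
        by (rule ode_solve[OF y(1,2), of "\<lambda>v. \<beta>\<^sup>2 * (\<delta> * (v^4 + 1) + \<gamma> * v\<^sup>2)" \<psi> z0 \<kappa>, OF y(3) \<psi>a _ E \<kappa>(2)]) blast
      hence "S y a z0 \<epsilon>" using \<psi>a by (simp add: S_def)
      thus ?thesis by blast
    qed
    obtain z0 \<epsilon> where S1: "S (\<lambda>x. k * exp (\<beta> * f x)) x0 z0 \<epsilon>"
      using solve[OF scaled_exp_ode(1,2)[OF f(1,3) \<beta> kl(1) F] o(1)] by (elim exE)
    note z = S1[unfolded S_def, THEN conjunct1] S1[unfolded S_def, THEN conjunct2, THEN conjunct1] S1[unfolded S_def, THEN conjunct2, THEN conjunct2]
    obtain w0 \<epsilon>' where S2: "S (\<lambda>y. l * exp (\<beta> * g y)) y0 w0 \<epsilon>'"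
      using solve[OF scaled_exp_ode(1,2)[OF g(1,3) \<beta> kl(2) G] o(2)] by (elim exE)
    note w = S2[unfolded S_def, THEN conjunct1] S2[unfolded S_def, THEN conjunct2, THEN conjunct1] S2[unfolded S_def, THEN conjunct2, THEN conjunct2]
    have mf: "(\<lambda>(x, y). theta1 x \<tau> / theta4 x \<tau> * (theta1 y \<tau> / theta4 y \<tau>)) = (\<lambda>z. \<psi> (fst z) * \<psi> (snd z))"
      by (simp add: theta_eq \<psi>_def case_prod_beta')
    show ?thesis
    proof (rule modelled_diag[OF z(1) w(1) \<kappa>(2), where w = "\<lambda>z. \<psi> (fst z) * \<psi> (snd z)"])
      show "(\<lambda>z. \<psi> (fst z) * \<psi> (snd z)) \<in> model_functions" unfolding mf[symmetric] model_functions_def using \<tau>(1) by blast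
      show "holomorphic_germ (z0, w0) (\<lambda>z. \<psi> (fst z) * \<psi> (snd z))" by (rule holomorphic_germ_mult(1)[OF z(2) w(2)])
      show "(\<lambda>t. (k * l) * exp (\<beta> * t)) analytic_on {0}" "deriv (\<lambda>t. (k * l) * exp (\<beta> * t)) 0 \<noteq> 0"
        using exp_\<Theta>[of \<beta> "k * l"] \<beta> kl by auto
      show "\<forall>\<^sub>F z in nhds (x0, y0). \<psi> (fst (z0 + \<epsilon> * \<kappa> * (fst z - x0), w0 + \<epsilon>' * \<kappa> * (snd z - y0))) * \<psi> (snd (z0 + \<epsilon> * \<kappa> * (fst z - x0), w0 + \<epsilon>' * \<kappa> * (snd z - y0)))
          = (k * l) * exp (\<beta> * (f (fst z) + g (snd z)))"
        using eventually_fst[OF z(3), of y0] eventually_snd[OF w(3), of x0]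
      proof eventually_elim
        case (elim z)
        show ?case unfolding case_prod_conv fst_conv snd_conv elim[symmetric] by (simp add: distrib_left exp_add)
      qed
    qed
  qed
qed

lemma holomorphic_germ_models:
  "holomorphic_germ q (\<lambda>(x, y). sin x * sin y)" "holomorphic_germ q (\<lambda>(x, y). exp x + exp y)"
  "holomorphic_germ q (\<lambda>(x, y). x\<^sup>2 - y\<^sup>2)" "holomorphic_germ q (\<lambda>(x, y). x\<^sup>2 + y\<^sup>2)"
proof -
  obtain a b where q: "q = (a, b)" by (cases q)
  have "sin analytic_on {a}" "sin analytic_on {b}" "exp analytic_on {a}" "exp analytic_on {b}"
    "(\<lambda>x. x\<^sup>2) analytic_on {a}" "(\<lambda>x. x\<^sup>2) analytic_on {b}" "(\<lambda>x. - x\<^sup>2) analytic_on {b}"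
    by (intro analytic_intros)+
  note A = this
  show "holomorphic_germ q (\<lambda>(x, y). sin x * sin y)" "holomorphic_germ q (\<lambda>(x, y). exp x + exp y)"
    "holomorphic_germ q (\<lambda>(x, y). x\<^sup>2 - y\<^sup>2)" "holomorphic_germ q (\<lambda>(x, y). x\<^sup>2 + y\<^sup>2)"
    using holomorphic_germ_mult(1)[OF A(1,2)] holomorphic_germ_mult(2)[OF A(3,4)]
      holomorphic_germ_mult(2)[OF A(5,7)] holomorphic_germ_mult(2)[OF A(5,6)]
    by (simp_all add: q case_prod_beta')
qed

text \<open>The shift by i \<pi> turns the sum of exponentials of the model into the difference that
  occurs in the sine.\<close>

lemma exp_plus_exp_sin:
  fixes X Y :: complex
  shows "exp (X + \<i> * Y) + exp (X - \<i> * Y + \<i> * of_real pi) = 2 * \<i> * (exp X * sin Y)"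
proof -
  have "exp (X - \<i> * Y + \<i> * of_real pi) = - (exp X * exp (- (\<i> * Y)))"
    unfolding diff_conv_add_uminus exp_add exp_pi_i' by simp
  moreover have "exp (X + \<i> * Y) = exp X * exp (\<i> * Y)" by (rule exp_add)
  moreover have "2 * \<i> * sin Y = exp (\<i> * Y) - exp (- (\<i> * Y))" by (simp add: sin_exp_eq)
  ultimately show ?thesis by (simp add: right_diff_distrib mult.left_commute)
qed

text \<open>Both equations contain the same exponential, so exp (- \<beta> f) and exp (- \<beta> g)
  solve y'^2 = \<beta>^2 (C + \<gamma> y^2), with C proportional to A or B. According to \<gamma>
  and C these are affine functions, sines or exponentials. A product of two affine functions is a
  difference of squares, and a sine times an exponential is a sum of two exponentials.\<close>

lemma (in hexagonal) case_one_sided: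
  assumes \<beta>: "\<beta> \<noteq> 0"
    and F: "\<forall>\<^sub>F x in nhds x0. (deriv f x)\<^sup>2 = A * exp (2 * \<beta> * f x) + \<gamma>"
    and G: "\<forall>\<^sub>F y in nhds y0. (deriv g y)\<^sup>2 = B * exp (2 * \<beta> * g y) + \<gamma>"
  shows modelled
proof -
  have b: "- \<beta> \<noteq> 0" "(- \<beta>)\<^sup>2 = \<beta>\<^sup>2" using \<beta> by simp_all
  have f0: "(deriv f x0)\<^sup>2 = A + \<gamma>" and g0: "(deriv g y0)\<^sup>2 = B + \<gamma>"
    using eventually_nhds_x_imp_x[OF F] eventually_nhds_x_imp_x[OF G] f(2) g(2) by simp_all
  \<comment> \<open>Equality of A and B would contradict \<open>distinct\<close>; in particular they
    are not both 0, which leaves the four cases below.\<close>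
  have AB: "A \<noteq> B" "A + \<gamma> \<noteq> 0" "B + \<gamma> \<noteq> 0" using distinct f(3) g(3) f0 g0 by auto
  have F': "\<forall>\<^sub>F x in nhds x0. (deriv f x)\<^sup>2 = 0 * exp (2 * (- \<beta>) * f x) + A * exp (- (2 * (- \<beta>) * f x)) + \<gamma>" using F by simp
  have G': "\<forall>\<^sub>F y in nhds y0. (deriv g y)\<^sup>2 = 0 * exp (2 * (- \<beta>) * g y) + B * exp (- (2 * (- \<beta>) * g y)) + \<gamma>" using G by simp
  define h where "h k x = k * exp (- \<beta> * f x)" for k x
  define l where "l k y = k * exp (- \<beta> * g y)" for k y
  have h: "h k analytic_on {x0}" "deriv (h k) x0 \<noteq> 0" "\<forall>\<^sub>F x in nhds x0. (deriv (h k) x)\<^sup>2 = \<beta>\<^sup>2 * (A * k\<^sup>2 + \<gamma> * (h k x)\<^sup>2)" if "k \<noteq> 0" for k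
    using scaled_exp_ode[OF f(1,3) b(1) that F'] unfolding b h_def[abs_def] by simp_all
  have l: "l k analytic_on {y0}" "deriv (l k) y0 \<noteq> 0" "\<forall>\<^sub>F y in nhds y0. (deriv (l k) y)\<^sup>2 = \<beta>\<^sup>2 * (B * k\<^sup>2 + \<gamma> * (l k y)\<^sup>2)" if "k \<noteq> 0" for k
    using scaled_exp_ode[OF g(1,3) b(1) that G'] unfolding b l_def[abs_def] by simp_all
  have hl: "h k x * l k' y = (k * k') * exp (- \<beta> * (f x + g y))" for k k' x y
  proof -
    have "exp (- \<beta> * (f x + g y)) = exp (- \<beta> * f x) * exp (- \<beta> * g y)" unfolding distrib_left by (rule exp_add)
    thus ?thesis by (simp only: h_def l_def mult_ac)
  qed
  define \<kappa> where "\<kappa> = csqrt (- (\<beta>\<^sup>2 * \<gamma>))"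
  have \<kappa>: "\<kappa>\<^sup>2 = - (\<beta>\<^sup>2 * \<gamma>)" by (simp add: \<kappa>_def)
  have i\<kappa>: "(\<i> * \<kappa>)\<^sup>2 = \<beta>\<^sup>2 * \<gamma>" by (simp add: power_mult_distrib \<kappa>)
  have sinR: "\<beta>\<^sup>2 * (C * k\<^sup>2 + \<gamma> * v\<^sup>2) = \<kappa>\<^sup>2 * (1 - v\<^sup>2)" if "C * k\<^sup>2 = - \<gamma>" for C k v :: complex
    unfolding \<kappa> that by (simp add: algebra_simps)
  have root: "\<exists>k. k \<noteq> 0 \<and> C * k\<^sup>2 = - \<gamma>" if "C \<noteq> 0" "\<gamma> \<noteq> 0" for C
    by (rule exI[of _ "csqrt (- \<gamma> / C)"]) (use that in simp)
  consider "\<gamma> = 0" | "\<gamma> \<noteq> 0" "A \<noteq> 0" "B \<noteq> 0" | "\<gamma> \<noteq> 0" "A = 0" "B \<noteq> 0" | "\<gamma> \<noteq> 0" "A \<noteq> 0" "B = 0" using AB by blast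
  thus ?thesis
  proof cases
    case 1
    have A0: "A \<noteq> 0" "B \<noteq> 0" using AB 1 by auto
    define k k' where "k = csqrt (1 / A)" "k' = csqrt (1 / B)"
    have k: "k \<noteq> 0" "k' \<noteq> 0" "A * k\<^sup>2 = 1" "B * k'\<^sup>2 = 1" using A0 by (simp_all add: k_k'_def)
    have 1: "\<forall>\<^sub>F x in nhds x0. (deriv (h k) x)\<^sup>2 = \<beta>\<^sup>2" "\<forall>\<^sub>F y in nhds y0. (deriv (l k') y)\<^sup>2 = \<beta>\<^sup>2"
      using h(3)[OF k(1)] l(3)[OF k(2)] k 1 by simp_all
    obtain \<epsilon> where e: "\<epsilon> = 1 \<or> \<epsilon> = -1" "\<forall>\<^sub>F x in nhds x0. h k x = h k x0 + \<epsilon> * \<beta> * (x - x0)"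
      by (rule line_solve[OF h(1,2)[OF k(1)] 1(1) \<beta>]) (rule that)
    obtain \<epsilon>' where e': "\<epsilon>' = 1 \<or> \<epsilon>' = -1" "\<forall>\<^sub>F y in nhds y0. l k' y = l k' y0 + \<epsilon>' * \<beta> * (y - y0)"
      by (rule line_solve[OF l(1,2)[OF k(2)] 1(2) \<beta>]) (rule that)
    show ?thesis
    proof (rule modelled_mixed[OF e(1) e'(1) \<beta>, where \<mu> = "1/2" and \<mu>' = "1/2" and ?c0.0 = 0 and w = "\<lambda>(x, y). x\<^sup>2 - y\<^sup>2" and ?z0.0 = "h k x0" and ?w0.0 = "l k' y0" and \<Theta> = "\<lambda>t. (k * k') * exp (- \<beta> * t)"])
      show "holomorphic_germ (1 / 2 * (h k x0 + l k' y0), 1 / 2 * (h k x0 - l k' y0) + 0) (\<lambda>(x, y). x\<^sup>2 - y\<^sup>2)"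
        by (rule holomorphic_germ_models)
      show "\<forall>\<^sub>F z in nhds (x0, y0). (case (1 / 2 * (h k x0 + \<epsilon> * \<beta> * (fst z - x0) + (l k' y0 + \<epsilon>' * \<beta> * (snd z - y0))),
            1 / 2 * (h k x0 + \<epsilon> * \<beta> * (fst z - x0) - (l k' y0 + \<epsilon>' * \<beta> * (snd z - y0))) + 0) of (x, y) \<Rightarrow> x\<^sup>2 - y\<^sup>2) =
            k * k' * exp (- \<beta> * (f (fst z) + g (snd z)))"
        using eventually_fst[OF e(2), of y0] eventually_snd[OF e'(2), of x0]
      proof eventually_elim
        case (elim z)
        have "(1 / 2 * (a + b))\<^sup>2 - (1 / 2 * (a - b) + 0)\<^sup>2 = a * b" for a b :: complex by (simp add: power2_eq_square field_simps)
        thus ?case unfolding case_prod_conv elim[symmetric] by (simp only: hl)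
      qed
    qed (use exp_\<Theta>[of "-\<beta>" "k * k'"] k \<beta> in \<open>simp_all add: model_functions_def\<close>)
  next
    case 2
    obtain k where k: "k \<noteq> 0" "A * k\<^sup>2 = - \<gamma>" using root[OF 2(2,1)] by blast
    obtain k' where k': "k' \<noteq> 0" "B * k'\<^sup>2 = - \<gamma>" using root[OF 2(3,1)] by blast
    have \<kappa>0: "\<kappa> \<noteq> 0" using 2 \<beta> by (simp add: \<kappa>_def)
    obtain z0 \<epsilon> where z: "\<epsilon> = 1 \<or> \<epsilon> = -1" "\<forall>\<^sub>F x in nhds x0. h k x = sin (z0 + \<epsilon> * \<kappa> * (x - x0))"
      by (rule sin_solve[OF h(1,2)[OF k(1)] h(3)[OF k(1), unfolded sinR[OF k(2)]] \<kappa>0]) (rule that)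
    obtain w0 \<epsilon>' where w: "\<epsilon>' = 1 \<or> \<epsilon>' = -1" "\<forall>\<^sub>F y in nhds y0. l k' y = sin (w0 + \<epsilon>' * \<kappa> * (y - y0))"
      by (rule sin_solve[OF l(1,2)[OF k'(1)] l(3)[OF k'(1), unfolded sinR[OF k'(2)]] \<kappa>0]) (rule that)
    show ?thesis
    proof (rule modelled_diag[OF z(1) w(1) \<kappa>0, where w = "\<lambda>(x, y). sin x * sin y" and \<Theta> = "\<lambda>t. (k * k') * exp (- \<beta> * t)"])
      show "holomorphic_germ (z0, w0) (\<lambda>(x, y). sin x * sin y)"
        by (rule holomorphic_germ_models)
      show "\<forall>\<^sub>F z in nhds (x0, y0). (case (z0 + \<epsilon> * \<kappa> * (fst z - x0), w0 + \<epsilon>' * \<kappa> * (snd z - y0)) of (x, y) \<Rightarrow> sin x * sin y) = k * k' * exp (- \<beta> * (f (fst z) + g (snd z)))"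
        using eventually_fst[OF z(2), of y0] eventually_snd[OF w(2), of x0]
      proof eventually_elim
        case (elim z)
        show ?case unfolding case_prod_conv elim[symmetric] by (simp only: hl)
      qed
    qed (use exp_\<Theta>[of "-\<beta>" "k * k'"] k k' \<beta> in \<open>simp_all add: model_functions_def\<close>)
  next
    case 3
    obtain k' where k': "k' \<noteq> 0" "B * k'\<^sup>2 = - \<gamma>" using root[OF 3(3,1)] by blast
    have \<kappa>0: "\<kappa> \<noteq> 0" "\<i> * \<kappa> \<noteq> 0" using 3 \<beta> by (simp_all add: \<kappa>_def)
    have "\<forall>\<^sub>F x in nhds x0. (deriv (h 1) x)\<^sup>2 = (\<i> * \<kappa>)\<^sup>2 * (h 1 x)\<^sup>2" using h(3)[of 1] 3 unfolding i\<kappa> by (simp add: mult.assoc)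
    from h(1,2)[OF one_neq_zero] this \<kappa>0(2)
    obtain z0 \<epsilon> where z: "\<epsilon> = 1 \<or> \<epsilon> = -1" "\<forall>\<^sub>F x in nhds x0. h 1 x = exp (z0 + \<epsilon> * (\<i> * \<kappa>) * (x - x0))"
      by (rule exp_solve) (rule that)
    obtain w0 \<epsilon>' where w: "\<epsilon>' = 1 \<or> \<epsilon>' = -1" "\<forall>\<^sub>F y in nhds y0. l k' y = sin (w0 + \<epsilon>' * \<kappa> * (y - y0))"
      by (rule sin_solve[OF l(1,2)[OF k'(1)] l(3)[OF k'(1), unfolded sinR[OF k'(2)]] \<kappa>0(1)]) (rule that)
    show ?thesis
    \<comment> \<open>The exponential has multiplier i \<kappa> and the sine has \<kappa>, so the
      argument of the sine is multiplied by i before sum and difference are formed.\<close>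
    proof (rule modelled_mixed[OF z(1) w(1) \<kappa>0(2), where \<mu> = 1 and \<mu>' = 1 and ?c0.0 = "\<i> * of_real pi" and w = "\<lambda>(x, y). exp x + exp y" and ?z0.0 = z0 and ?w0.0 = "\<i> * w0" and \<Theta> = "\<lambda>t. (2 * \<i> * k') * exp (- \<beta> * t)"])
      show "holomorphic_germ (1 * (z0 + \<i> * w0), 1 * (z0 - \<i> * w0) + \<i> * of_real pi) (\<lambda>(x, y). exp x + exp y)"
        by (rule holomorphic_germ_models)
      show "\<forall>\<^sub>F z in nhds (x0, y0). (case (1 * (z0 + \<epsilon> * (\<i> * \<kappa>) * (fst z - x0) + (\<i> * w0 + \<epsilon>' * (\<i> * \<kappa>) * (snd z - y0))),
           1 * (z0 + \<epsilon> * (\<i> * \<kappa>) * (fst z - x0) - (\<i> * w0 + \<epsilon>' * (\<i> * \<kappa>) * (snd z - y0))) + \<i> * of_real pi) of (x, y) \<Rightarrow> exp x + exp y) =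
           2 * \<i> * k' * exp (- \<beta> * (f (fst z) + g (snd z)))"
        using eventually_fst[OF z(2), of y0] eventually_snd[OF w(2), of x0]
      proof eventually_elim
        case (elim z)
        define X Y where "X = z0 + \<epsilon> * (\<i> * \<kappa>) * (fst z - x0)" "Y = w0 + \<epsilon>' * \<kappa> * (snd z - y0)"
        have Y: "\<i> * w0 + \<epsilon>' * (\<i> * \<kappa>) * (snd z - y0) = \<i> * Y" by (simp add: X_Y_def algebra_simps)
        have "exp (1 * (X + \<i> * Y)) + exp (1 * (X - \<i> * Y) + \<i> * of_real pi) = 2 * \<i> * (exp X * sin Y)"
          using exp_plus_exp_sin[of X Y] by simp
        also have "\<dots> = 2 * \<i> * (h 1 (fst z) * l k' (snd z))" using elim by (simp add: X_Y_def)
        finally show ?case unfolding case_prod_conv Y X_Y_def(1)[symmetric] hl by (simp add: mult.assoc)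
      qed
    qed (use exp_\<Theta>[of "-\<beta>" "2 * \<i> * k'"] k' \<beta> in \<open>simp_all add: model_functions_def\<close>)
  next
    case 4
    obtain k where k: "k \<noteq> 0" "A * k\<^sup>2 = - \<gamma>" using root[OF 4(2,1)] by blast
    have \<kappa>0: "\<kappa> \<noteq> 0" "\<i> * \<kappa> \<noteq> 0" using 4 \<beta> by (simp_all add: \<kappa>_def)
    obtain z0 \<epsilon> where z: "\<epsilon> = 1 \<or> \<epsilon> = -1" "\<forall>\<^sub>F x in nhds x0. h k x = sin (z0 + \<epsilon> * \<kappa> * (x - x0))"
      by (rule sin_solve[OF h(1,2)[OF k(1)] h(3)[OF k(1), unfolded sinR[OF k(2)]] \<kappa>0(1)]) (rule that)
    have "\<forall>\<^sub>F y in nhds y0. (deriv (l 1) y)\<^sup>2 = (\<i> * \<kappa>)\<^sup>2 * (l 1 y)\<^sup>2" using l(3)[of 1] 4 unfolding i\<kappa> by (simp add: mult.assoc)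
    from l(1,2)[OF one_neq_zero] this \<kappa>0(2)
    obtain w0 \<epsilon>' where w: "\<epsilon>' = 1 \<or> \<epsilon>' = -1" "\<forall>\<^sub>F y in nhds y0. l 1 y = exp (w0 + \<epsilon>' * (\<i> * \<kappa>) * (y - y0))"
      by (rule exp_solve) (rule that)
    show ?thesis
    proof (rule modelled_mixed[OF z(1) w(1) \<kappa>0(2), where \<mu> = 1 and \<mu>' = "-1" and ?c0.0 = "\<i> * of_real pi" and w = "\<lambda>(x, y). exp x + exp y" and ?z0.0 = "\<i> * z0" and ?w0.0 = w0 and \<Theta> = "\<lambda>t. (2 * \<i> * k) * exp (- \<beta> * t)"])
      show "holomorphic_germ (1 * (\<i> * z0 + w0), - 1 * (\<i> * z0 - w0) + \<i> * of_real pi) (\<lambda>(x, y). exp x + exp y)"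
        by (rule holomorphic_germ_models)
      show "\<forall>\<^sub>F z in nhds (x0, y0). (case (1 * (\<i> * z0 + \<epsilon> * (\<i> * \<kappa>) * (fst z - x0) + (w0 + \<epsilon>' * (\<i> * \<kappa>) * (snd z - y0))),
           - 1 * (\<i> * z0 + \<epsilon> * (\<i> * \<kappa>) * (fst z - x0) - (w0 + \<epsilon>' * (\<i> * \<kappa>) * (snd z - y0))) + \<i> * of_real pi) of (x, y) \<Rightarrow> exp x + exp y) =
           2 * \<i> * k * exp (- \<beta> * (f (fst z) + g (snd z)))"
        using eventually_fst[OF z(2), of y0] eventually_snd[OF w(2), of x0]
      proof eventually_elim
        case (elim z)
        define X Y where "X = z0 + \<epsilon> * \<kappa> * (fst z - x0)" "Y = w0 + \<epsilon>' * (\<i> * \<kappa>) * (snd z - y0)"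
        have X: "\<i> * z0 + \<epsilon> * (\<i> * \<kappa>) * (fst z - x0) = \<i> * X" by (simp add: X_Y_def algebra_simps)
        have "exp (1 * (\<i> * X + Y)) + exp (- 1 * (\<i> * X - Y) + \<i> * of_real pi) = 2 * \<i> * (sin X * exp Y)"
          using exp_plus_exp_sin[of Y X] by (simp add: add.commute mult.commute)
        also have "\<dots> = 2 * \<i> * (h k (fst z) * l 1 (snd z))" using elim by (simp add: X_Y_def)
        finally show ?case unfolding case_prod_conv X X_Y_def(2)[symmetric] hl by (simp add: mult.assoc)
      qed
    qed (use exp_\<Theta>[of "-\<beta>" "2 * \<i> * k"] k \<beta> in \<open>simp_all add: model_functions_def\<close>)
  qed
qed

text \<open>Here \<open>exp (- \<beta> * \<Phi> u)\<close> is a multiple of \<open>sin X / sin Y\<close>, a homographic function of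
  \<open>(sin X + sin Y) / (sin X - sin Y) = tan ((X + Y) / 2) * cot ((X - Y) / 2)\<close>.\<close>

lemma (in hexagonal) case_opposite:
  assumes \<beta>: "\<beta> \<noteq> 0" and nz: "A \<noteq> 0" "B \<noteq> 0" "\<gamma> \<noteq> 0"
    and F: "\<forall>\<^sub>F x in nhds x0. (deriv f x)\<^sup>2 = A * exp (2 * \<beta> * f x) + \<gamma>"
    and G: "\<forall>\<^sub>F y in nhds y0. (deriv g y)\<^sup>2 = B * exp (- (2 * \<beta> * g y)) + \<gamma>"
  shows modelled
proof -
  have b: "- \<beta> \<noteq> 0" "(- \<beta>)\<^sup>2 = \<beta>\<^sup>2" using \<beta> by simp_all
  have "(deriv f x0)\<^sup>2 = A + \<gamma>" "(deriv g y0)\<^sup>2 = B + \<gamma>"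
    using eventually_nhds_x_imp_x[OF F] eventually_nhds_x_imp_x[OF G] f(2) g(2) by simp_all
  hence AB: "A \<noteq> B" using distinct by auto
  have F': "\<forall>\<^sub>F x in nhds x0. (deriv f x)\<^sup>2 = 0 * exp (2 * (- \<beta>) * f x) + A * exp (- (2 * (- \<beta>) * f x)) + \<gamma>" using F by simp
  have G': "\<forall>\<^sub>F y in nhds y0. (deriv g y)\<^sup>2 = 0 * exp (2 * \<beta> * g y) + B * exp (- (2 * \<beta> * g y)) + \<gamma>" using G by simp
  define k k' where "k = csqrt (- \<gamma> / A)" "k' = csqrt (- \<gamma> / B)"
  have k: "k \<noteq> 0" "k' \<noteq> 0" "A * k\<^sup>2 = - \<gamma>" "B * k'\<^sup>2 = - \<gamma>" using nz by (simp_all add: k_k'_def)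
  have kk: "k\<^sup>2 \<noteq> k'\<^sup>2"
  proof
    assume "k\<^sup>2 = k'\<^sup>2"
    hence "A * k\<^sup>2 = B * k\<^sup>2" using k by simp
    thus False using AB k(1) by simp
  qed
  define h where "h x = k * exp (- \<beta> * f x)" for x
  define l where "l y = k' * exp (\<beta> * g y)" for y
  define \<kappa> where "\<kappa> = csqrt (- (\<beta>\<^sup>2 * \<gamma>))"
  have \<kappa>: "\<kappa>\<^sup>2 = - (\<beta>\<^sup>2 * \<gamma>)" "\<kappa> \<noteq> 0" using nz \<beta> by (simp_all add: \<kappa>_def)
  have h: "h analytic_on {x0}" "deriv h x0 \<noteq> 0" "\<forall>\<^sub>F x in nhds x0. (deriv h x)\<^sup>2 = \<kappa>\<^sup>2 * (1 - (h x)\<^sup>2)"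
    using scaled_exp_ode[OF f(1,3) b(1) k(1) F'] unfolding b k \<kappa>(1) h_def[abs_def] by (simp_all add: algebra_simps)
  have l: "l analytic_on {y0}" "deriv l y0 \<noteq> 0" "\<forall>\<^sub>F y in nhds y0. (deriv l y)\<^sup>2 = \<kappa>\<^sup>2 * (1 - (l y)\<^sup>2)"
    using scaled_exp_ode[OF g(1,3) \<beta> k(2) G'] unfolding b k \<kappa>(1) l_def[abs_def] by (simp_all add: algebra_simps)
  define r where "r t = k / k' * exp (- \<beta> * t)" for t
  have hl: "h x / l y = r (f x + g y)" for x y
  proof -
    have "exp (- \<beta> * (f x + g y)) = exp (- \<beta> * f x) / exp (\<beta> * g y)" unfolding distrib_left exp_diff[symmetric] by simp
    thus ?thesis by (simp only: h_def l_def r_def times_divide_times_eq)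
  qed
  have l0: "l y \<noteq> 0" for y using k by (simp add: l_def)
  have "k / k' \<noteq> 1" using kk k(2) by (simp add: divide_eq_1_iff) blast
  hence r0: "r 0 - 1 \<noteq> 0" by (simp add: r_def)
  define \<Theta> where "\<Theta> t = (r t + 1) / (r t - 1)" for t
  have dr: "(r has_field_derivative - \<beta> * r t) (at t)" for t
  proof -
    have "((\<lambda>t. exp (- \<beta> * t)) has_field_derivative exp (- \<beta> * t) * (- \<beta> * 1)) (at t)"
      by (rule DERIV_fun_exp[OF DERIV_cmult[OF DERIV_ident]])
    from DERIV_cmult[OF this, of "k / k'"] show ?thesis by (simp add: r_def[abs_def] mult_ac)
  qed
  have \<Theta>a: "\<Theta> analytic_on {0}" unfolding \<Theta>_def[abs_def]
  proof (rule analytic_on_divide)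
    show "(\<lambda>t. r t + 1) analytic_on {0}" "(\<lambda>t. r t - 1) analytic_on {0}" unfolding r_def by (intro analytic_intros)+
  qed (use r0 in auto)
  have "(\<Theta> has_field_derivative ((- \<beta> * r 0) * (r 0 - 1) - (r 0 + 1) * (- \<beta> * r 0)) / ((r 0 - 1) * (r 0 - 1))) (at 0)"
    unfolding \<Theta>_def[abs_def] by (rule DERIV_divide) (use r0 dr[of 0] in \<open>auto intro!: derivative_eq_intros\<close>)
  hence "deriv \<Theta> 0 = ((- \<beta> * r 0) * (r 0 - 1) - (r 0 + 1) * (- \<beta> * r 0)) / ((r 0 - 1) * (r 0 - 1))" by (rule DERIV_imp_deriv)
  also have "\<dots> = 2 * \<beta> * r 0 / ((r 0 - 1) * (r 0 - 1))" by (simp add: algebra_simps)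
  finally have \<Theta>d: "deriv \<Theta> 0 \<noteq> 0" using r0 \<beta> k by (simp add: r_def)
  obtain z0 \<epsilon> where z: "\<epsilon> = 1 \<or> \<epsilon> = -1" "\<forall>\<^sub>F x in nhds x0. h x = sin (z0 + \<epsilon> * \<kappa> * (x - x0))"
    by (rule sin_solve[OF h \<kappa>(2)]) (rule that)
  obtain w0 \<epsilon>' where w: "\<epsilon>' = 1 \<or> \<epsilon>' = -1" "\<forall>\<^sub>F y in nhds y0. l y = sin (w0 + \<epsilon>' * \<kappa> * (y - y0))"
    by (rule sin_solve[OF l \<kappa>(2)]) (rule that)
  have s0: "sin z0 = k" "sin w0 = k'" using eventually_nhds_x_imp_x[OF z(2)] eventually_nhds_x_imp_x[OF w(2)] f(2) g(2)
    by (simp_all add: h_def l_def)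
  \<comment> \<open>Since k^2 and k'^2 differ, sin z0 is neither sin w0 nor - sin w0; therefore the
    tangent of the half sum and the cotangent of the half difference are finite at the base
    point.\<close>
  have "sin z0 + sin w0 \<noteq> 0" "sin z0 - sin w0 \<noteq> 0" using kk unfolding s0 by (auto simp: add_eq_0_iff2)
  hence nz0: "cos ((z0 + w0) / 2) \<noteq> 0" "sin ((z0 - w0) / 2) \<noteq> 0" unfolding sin_plus_sin sin_diff_sin by auto
  have tanh_i: "tanh (\<i> * a) = \<i> * tan a" for a by (simp add: tan_conv_tanh)
  have cosh_i: "exp (\<i> * a) + exp (- (\<i> * a)) = 2 * cos a" for a by (simp add: cos_exp_eq)
  have shift: "cos (a + of_real pi / 2) = - sin a" "sin (a + of_real pi / 2) = cos a" for a :: complex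
    by (simp_all add: cos_add sin_add)
  show ?thesis
  \<comment> \<open>tanh (i a) = i tan a, and the shift by \<pi>/2 turns the second tangent into
    minus a cotangent, whose sign is cancelled by i^2.\<close>
  proof (rule modelled_mixed[OF z(1) w(1) \<kappa>(2), where \<mu> = "\<i> / 2" and \<mu>' = "\<i> / 2" and ?c0.0 = "\<i> * (of_real pi / 2)" and w = "\<lambda>(x, y). tanh x * tanh y" and ?z0.0 = z0 and ?w0.0 = w0 and \<Theta> = \<Theta>])
    have a: "tanh analytic_on {\<i> * ((z0 + w0) / 2)}" "tanh analytic_on {\<i> * ((z0 - w0) / 2 + of_real pi / 2)}"
      by (intro analytic_tanh(1); use nz0 in \<open>simp only: cosh_i shift, simp\<close>)+
    have e: "\<i> / 2 * (z0 + w0) = \<i> * ((z0 + w0) / 2)" "\<i> / 2 * (z0 - w0) + \<i> * (of_real pi / 2) = \<i> * ((z0 - w0) / 2 + of_real pi / 2)"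
      by (simp_all add: field_simps)
    show "holomorphic_germ (\<i> / 2 * (z0 + w0), \<i> / 2 * (z0 - w0) + \<i> * (of_real pi / 2)) (\<lambda>(x, y). tanh x * tanh y)"
      unfolding e using holomorphic_germ_mult(1)[OF a] by (simp only: case_prod_beta')
    show "\<forall>\<^sub>F z in nhds (x0, y0). (case (\<i> / 2 * (z0 + \<epsilon> * \<kappa> * (fst z - x0) + (w0 + \<epsilon>' * \<kappa> * (snd z - y0))),
         \<i> / 2 * (z0 + \<epsilon> * \<kappa> * (fst z - x0) - (w0 + \<epsilon>' * \<kappa> * (snd z - y0))) + \<i> * (of_real pi / 2)) of (x, y) \<Rightarrow> tanh x * tanh y) =
         \<Theta> (f (fst z) + g (snd z))"
      using eventually_fst[OF z(2), of y0] eventually_snd[OF w(2), of x0]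
    proof eventually_elim
      case (elim z)
      define X Y where "X = z0 + \<epsilon> * \<kappa> * (fst z - x0)" "Y = w0 + \<epsilon>' * \<kappa> * (snd z - y0)"
      have e: "\<i> / 2 * (X + Y) = \<i> * ((X + Y) / 2)" "\<i> / 2 * (X - Y) + \<i> * (of_real pi / 2) = \<i> * ((X - Y) / 2 + of_real pi / 2)"
        by (simp_all add: field_simps)
      have "tanh (\<i> / 2 * (X + Y)) * tanh (\<i> / 2 * (X - Y) + \<i> * (of_real pi / 2)) =
          (sin ((X + Y) / 2) * cos ((X - Y) / 2)) / (cos ((X + Y) / 2) * sin ((X - Y) / 2))"
        unfolding e tanh_i tan_def shift by (simp add: mult_ac)
      also have "\<dots> = (sin X + sin Y) / (sin X - sin Y)" unfolding sin_plus_sin sin_diff_sin by (simp add: mult_ac)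
      also have "\<dots> = (h (fst z) + l (snd z)) / (h (fst z) - l (snd z))" using elim by (simp add: X_Y_def)
      also have "\<dots> = (h (fst z) / l (snd z) + 1) / (h (fst z) / l (snd z) - 1)"
        using l0[of "snd z"] by (simp add: divide_simps)
      also have "\<dots> = \<Theta> (f (fst z) + g (snd z))" unfolding hl \<Theta>_def ..
      finally show ?case unfolding case_prod_conv X_Y_def .
    qed
  qed (use \<Theta>a \<Theta>d in \<open>simp_all add: model_functions_def\<close>)
qed

section \<open>Polynomial cases: \<open>b\<close> = 0\<close>

lemma (in hexagonal) case_quadratic:
  assumes c: "c \<noteq> 0" and e: "p1\<^sup>2 - 2 * c * p0 = q1\<^sup>2 - 2 * c * q0"
    and F: "\<forall>\<^sub>F x in nhds x0. (deriv f x)\<^sup>2 = c / 2 * (f x)\<^sup>2 + p1 * f x + p0"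
    and G: "\<forall>\<^sub>F y in nhds y0. (deriv g y)\<^sup>2 = c / 2 * (g y)\<^sup>2 + q1 * g y + q0"
  shows modelled
proof -
  define m where "m = p1\<^sup>2 - 2 * c * p0"
  \<comment> \<open>After completing the square the constant term is a multiple of \<open>m\<close>,
    which \<open>e\<close> makes common to f and g. For m \<noteq> 0 the scaling by \<eta> adjusts
    it to the quadratic coefficient and yields the equation of a sine; for m = 0 the equation is
    that of an exponential.\<close>
  define \<eta> where "\<eta> = (if m = 0 then 1 else csqrt m / c)"
  have \<eta>: "\<eta> \<noteq> 0" "m \<noteq> 0 \<Longrightarrow> \<eta>\<^sup>2 * c\<^sup>2 = m" using c by (auto simp: \<eta>_def power_divide)
  define h where "h x = 1 / \<eta> * f x + p1 / (c * \<eta>)" for x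
  define l where "l y = 1 / \<eta> * g y + q1 / (c * \<eta>)" for y
  have d: "deriv (\<lambda>x. 1 / \<eta> * y x + t) a = deriv y a / \<eta>" if "y analytic_on {a}" for y and t a :: complex
    by (rule DERIV_imp_deriv) (rule derivative_eq_intros analytic_DERIV that refl | simp)+
  have hl: "h analytic_on {x0}" "deriv h x0 \<noteq> 0" "l analytic_on {y0}" "deriv l y0 \<noteq> 0"
    unfolding h_def[abs_def] l_def[abs_def] d[OF f(1)] d[OF g(1)] using f g \<eta> by (auto intro!: analytic_intros)
  have id: "(c / 2 * y\<^sup>2 + s1 * y + s0) / \<eta>\<^sup>2 = c / 2 * (1 / \<eta> * y + s1 / (c * \<eta>))\<^sup>2 - (s1\<^sup>2 - 2 * c * s0) / (2 * c * \<eta>\<^sup>2)" for y s1 s0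
    using c \<eta>(1) by (simp add: field_simps power2_eq_square)
  have oh: "\<forall>\<^sub>F x in nhds x0. (deriv h x)\<^sup>2 = c / 2 * (h x)\<^sup>2 - m / (2 * c * \<eta>\<^sup>2)"
    using F analytic_eventually[OF f(1)]
  proof eventually_elim
    case (elim x)
    show ?case unfolding h_def[abs_def] d[OF elim(2)] power_divide elim(1) m_def by (rule id)
  qed
  have ol: "\<forall>\<^sub>F y in nhds y0. (deriv l y)\<^sup>2 = c / 2 * (l y)\<^sup>2 - m / (2 * c * \<eta>\<^sup>2)"
    using G analytic_eventually[OF g(1)]
  proof eventually_elim
    case (elim y)
    show ?case unfolding l_def[abs_def] d[OF elim(2)] power_divide elim(1) m_def e by (rule id)
  qed
  have sum: "h x + l y = 1 / \<eta> * (f x + g y) + (p1 + q1) / (c * \<eta>)" for x y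
    by (simp add: h_def l_def add_divide_distrib)
  show ?thesis
  proof (cases "m = 0")
    case True
    define \<kappa> where "\<kappa> = csqrt (c / 2)"
    have \<kappa>: "\<kappa>\<^sup>2 = c / 2" "\<kappa> \<noteq> 0" using c by (simp_all add: \<kappa>_def)
    have o: "\<forall>\<^sub>F x in nhds x0. (deriv h x)\<^sup>2 = \<kappa>\<^sup>2 * (h x)\<^sup>2" "\<forall>\<^sub>F y in nhds y0. (deriv l y)\<^sup>2 = \<kappa>\<^sup>2 * (l y)\<^sup>2"
      using oh ol True unfolding \<kappa> by simp_all
    obtain z0 \<epsilon> where z: "\<epsilon> = 1 \<or> \<epsilon> = -1" "\<forall>\<^sub>F x in nhds x0. h x = exp (z0 + \<epsilon> * \<kappa> * (x - x0))"
      by (rule exp_solve[OF hl(1,2) o(1) \<kappa>(2)]) (rule that)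
    obtain w0 \<epsilon>' where w: "\<epsilon>' = 1 \<or> \<epsilon>' = -1" "\<forall>\<^sub>F y in nhds y0. l y = exp (w0 + \<epsilon>' * \<kappa> * (y - y0))"
      by (rule exp_solve[OF hl(3,4) o(2) \<kappa>(2)]) (rule that)
    show ?thesis
    proof (rule modelled_diag[OF z(1) w(1) \<kappa>(2), where w = "\<lambda>(x, y). exp x + exp y" and \<Theta> = "\<lambda>t. 1 / \<eta> * t + (p1 + q1) / (c * \<eta>)"])
      show "holomorphic_germ (z0, w0) (\<lambda>(x, y). exp x + exp y)"
        by (rule holomorphic_germ_models)
      show "\<forall>\<^sub>F z in nhds (x0, y0). (case (z0 + \<epsilon> * \<kappa> * (fst z - x0), w0 + \<epsilon>' * \<kappa> * (snd z - y0)) of (x, y) \<Rightarrow> exp x + exp y) =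
         1 / \<eta> * (f (fst z) + g (snd z)) + (p1 + q1) / (c * \<eta>)"
        using eventually_fst[OF z(2), of y0] eventually_snd[OF w(2), of x0]
      proof eventually_elim
        case (elim z)
        show ?case unfolding case_prod_conv elim[symmetric] by (rule sum)
      qed
    qed (use affine_\<Theta>[of "1 / \<eta>" "(p1 + q1) / (c * \<eta>)"] \<eta> in \<open>simp_all add: model_functions_def\<close>)
  next
    case False
    define \<kappa> where "\<kappa> = csqrt (- (c / 2))"
    have \<kappa>: "\<kappa>\<^sup>2 = - (c / 2)" "\<kappa> \<noteq> 0" using c by (simp_all add: \<kappa>_def)
    have "m / (2 * c * \<eta>\<^sup>2) = c / 2" unfolding \<eta>(2)[OF False, symmetric] using c \<eta>(1) by (simp add: field_simps power2_eq_square)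
    hence o: "\<forall>\<^sub>F x in nhds x0. (deriv h x)\<^sup>2 = \<kappa>\<^sup>2 * (1 - (h x)\<^sup>2)" "\<forall>\<^sub>F y in nhds y0. (deriv l y)\<^sup>2 = \<kappa>\<^sup>2 * (1 - (l y)\<^sup>2)"
      using oh ol unfolding \<kappa> by (simp_all add: algebra_simps)
    obtain z0 \<epsilon> where z: "\<epsilon> = 1 \<or> \<epsilon> = -1" "\<forall>\<^sub>F x in nhds x0. h x = sin (z0 + \<epsilon> * \<kappa> * (x - x0))"
      by (rule sin_solve[OF hl(1,2) o(1) \<kappa>(2)]) (rule that)
    obtain w0 \<epsilon>' where w: "\<epsilon>' = 1 \<or> \<epsilon>' = -1" "\<forall>\<^sub>F y in nhds y0. l y = sin (w0 + \<epsilon>' * \<kappa> * (y - y0))"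
      by (rule sin_solve[OF hl(3,4) o(2) \<kappa>(2)]) (rule that)
    have shift: "sin (a + of_real pi / 2) = cos a" for a :: complex by (simp add: sin_add)
    show ?thesis
    \<comment> \<open>sin X + sin Y = 2 sin ((X + Y)/2) cos ((X - Y)/2), and the shift by \<pi>/2
      turns the cosine into a sine.\<close>
    proof (rule modelled_mixed[OF z(1) w(1) \<kappa>(2), where \<mu> = "1 / 2" and \<mu>' = "1 / 2" and ?c0.0 = "of_real pi / 2" and w = "\<lambda>(x, y). sin x * sin y" and ?z0.0 = z0 and ?w0.0 = w0
         and \<Theta> = "\<lambda>t. 1 / (2 * \<eta>) * t + (p1 + q1) / (2 * c * \<eta>)"])
      show "holomorphic_germ (1 / 2 * (z0 + w0), 1 / 2 * (z0 - w0) + of_real pi / 2) (\<lambda>(x, y). sin x * sin y)"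
        by (rule holomorphic_germ_models)
      show "\<forall>\<^sub>F z in nhds (x0, y0). (case (1 / 2 * (z0 + \<epsilon> * \<kappa> * (fst z - x0) + (w0 + \<epsilon>' * \<kappa> * (snd z - y0))),
         1 / 2 * (z0 + \<epsilon> * \<kappa> * (fst z - x0) - (w0 + \<epsilon>' * \<kappa> * (snd z - y0))) + of_real pi / 2) of (x, y) \<Rightarrow> sin x * sin y) =
         1 / (2 * \<eta>) * (f (fst z) + g (snd z)) + (p1 + q1) / (2 * c * \<eta>)"
        using eventually_fst[OF z(2), of y0] eventually_snd[OF w(2), of x0]
      proof eventually_elim
        case (elim z)
        define X Y where "X = z0 + \<epsilon> * \<kappa> * (fst z - x0)" "Y = w0 + \<epsilon>' * \<kappa> * (snd z - y0)"
        have "sin (1 / 2 * (X + Y)) * sin (1 / 2 * (X - Y) + of_real pi / 2) = (sin X + sin Y) / 2"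
          unfolding shift sin_plus_sin by simp
        also have "\<dots> = (h (fst z) + l (snd z)) / 2" using elim by (simp add: X_Y_def)
        also have "\<dots> = 1 / (2 * \<eta>) * (f (fst z) + g (snd z)) + (p1 + q1) / (2 * c * \<eta>)"
          unfolding sum by (simp add: add_divide_distrib mult_ac)
        finally show ?case unfolding case_prod_conv X_Y_def .
      qed
    qed (use affine_\<Theta>[of "1 / (2 * \<eta>)" "(p1 + q1) / (2 * c * \<eta>)"] \<eta> in \<open>simp_all add: model_functions_def\<close>)
  qed
qed

text \<open>Affine functions of f and of g solve y'^2 = p1 y and are therefore squares of affine
  functions. If q1 = - p1, the sign \<open>s\<close> in \<open>l\<close> restores the coefficient
  p1; it reappears in front of the second square of the model.\<close>

lemma (in hexagonal) case_linear:
  assumes p1: "p1 \<noteq> 0" "q1 = p1 \<or> q1 = - p1"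
    and F: "\<forall>\<^sub>F x in nhds x0. (deriv f x)\<^sup>2 = p1 * f x + p0"
    and G: "\<forall>\<^sub>F y in nhds y0. (deriv g y)\<^sup>2 = q1 * g y + q0"
  shows modelled
proof -
  obtain s :: complex where s: "s = 1 \<or> s = -1" "q1 = s * p1" using p1(2) by (metis mult_1 mult_minus1)
  have ss: "s * s = 1" using s by auto
  define h where "h x = 1 * f x + p0 / p1" for x
  define l where "l y = s * g y + s * (q0 / q1)" for y
  have d: "deriv (\<lambda>x. r * y x + t) a = r * deriv y a" if "y analytic_on {a}" for y and r t a :: complex
    by (rule DERIV_imp_deriv) (rule derivative_eq_intros analytic_DERIV that refl | simp)+
  have hl: "h analytic_on {x0}" "deriv h x0 \<noteq> 0" "l analytic_on {y0}" "deriv l y0 \<noteq> 0"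
    unfolding h_def[abs_def] l_def[abs_def] d[OF f(1)] d[OF g(1)] using f g s by (auto intro!: analytic_intros)
  define \<kappa> where "\<kappa> = csqrt (p1 / 4)"
  have \<kappa>: "\<kappa>\<^sup>2 = p1 / 4" "\<kappa> \<noteq> 0" using p1 by (simp_all add: \<kappa>_def)
  have oh: "\<forall>\<^sub>F x in nhds x0. (deriv h x)\<^sup>2 = \<kappa>\<^sup>2 * (4 * h x)"
    using F analytic_eventually[OF f(1)]
  proof eventually_elim
    case (elim x)
    show ?case unfolding h_def[abs_def] d[OF elim(2)] power_mult_distrib elim(1) \<kappa> using p1 by (simp add: field_simps)
  qed
  have ol: "\<forall>\<^sub>F y in nhds y0. (deriv l y)\<^sup>2 = \<kappa>\<^sup>2 * (4 * l y)"
    using G analytic_eventually[OF g(1)]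
  proof eventually_elim
    case (elim y)
    have "s\<^sup>2 * (q1 * g y + q0) = p1 * (s * g y + s * (q0 / q1))"
      using p1 s by (auto simp: field_simps)
    thus ?case unfolding l_def[abs_def] d[OF elim(2)] power_mult_distrib elim(1) \<kappa> by simp
  qed
  obtain z0 \<epsilon> where z: "\<epsilon> = 1 \<or> \<epsilon> = -1" "\<forall>\<^sub>F x in nhds x0. h x = (z0 + \<epsilon> * \<kappa> * (x - x0))\<^sup>2"
    by (rule square_solve[OF hl(1,2) oh \<kappa>(2)]) (rule that)
  obtain w0 \<epsilon>' where w: "\<epsilon>' = 1 \<or> \<epsilon>' = -1" "\<forall>\<^sub>F y in nhds y0. l y = (w0 + \<epsilon>' * \<kappa> * (y - y0))\<^sup>2"
    by (rule square_solve[OF hl(3,4) ol \<kappa>(2)]) (rule that)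
  have mf: "(\<lambda>z. (fst z)\<^sup>2 + s * (snd z)\<^sup>2) \<in> model_functions"
    using s(1) unfolding model_functions_def by (auto simp: case_prod_beta')
  show ?thesis
  proof (rule modelled_diag[OF z(1) w(1) \<kappa>(2) mf, where \<Theta> = "\<lambda>t. 1 * t + (p0 / p1 + q0 / q1)"])
    show "holomorphic_germ (z0, w0) (\<lambda>z. (fst z)\<^sup>2 + s * (snd z)\<^sup>2)"
      by (rule holomorphic_germ_mult(2)[of "\<lambda>x. x\<^sup>2" z0 "\<lambda>y. s * y\<^sup>2" w0]) (intro analytic_intros)+
    show "\<forall>\<^sub>F z in nhds (x0, y0). (fst (z0 + \<epsilon> * \<kappa> * (fst z - x0), w0 + \<epsilon>' * \<kappa> * (snd z - y0)))\<^sup>2 +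
       s * (snd (z0 + \<epsilon> * \<kappa> * (fst z - x0), w0 + \<epsilon>' * \<kappa> * (snd z - y0)))\<^sup>2 = 1 * (f (fst z) + g (snd z)) + (p0 / p1 + q0 / q1)"
      using eventually_fst[OF z(2), of y0] eventually_snd[OF w(2), of x0]
    proof eventually_elim
      case (elim z)
      have "s * l (snd z) = (s * s) * g (snd z) + (s * s) * (q0 / q1)" unfolding l_def by (simp only: distrib_left mult.assoc)
      thus ?case unfolding fst_conv snd_conv elim[symmetric] h_def ss by simp
    qed
  qed (use affine_\<Theta>[of 1 "p0 / p1 + q0 / q1"] in simp_all)
qed

section \<open>Webs whose fifth foliation is a pencil of lines\<close>

lemma (in hexagonal) foliation_compose:
  assumes "\<Theta> analytic_on {0}" "deriv \<Theta> 0 \<noteq> 0" "\<forall>\<^sub>F z in nhds (x0, y0). v z = \<Theta> (f (fst z) + g (snd z))"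
  shows "foliation (x0, y0) v = foliation (x0, y0) u"
proof (rule foliation_cong_analytic[OF _ holomorphic_germ_isCont[OF u(1)] compose_\<Phi>[OF assms(1,2)]])
  show "\<forall>\<^sub>F z in nhds (x0, y0). v z = \<Theta> (\<Phi> (u z))" using assms(3) eq by eventually_elim simp
qed

text \<open>f and g are affine, so the leaves of u are parallel lines A x + B y = const, which meet
  at the point (B : -A : 0) at infinity.\<close>

lemma (in hexagonal) algebraizable_constant:
  assumes F: "\<forall>\<^sub>F x in nhds x0. (deriv f x)\<^sup>2 = p0" and G: "\<forall>\<^sub>F y in nhds y0. (deriv g y)\<^sup>2 = q0"
  shows "algebraizable (x0, y0) (T_web u)"
proof -
  have 0: "(deriv f x0)\<^sup>2 = p0" "(deriv g y0)\<^sup>2 = q0" using eventually_nhds_x_imp_x[OF F] eventually_nhds_x_imp_x[OF G] by simp_all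
  define \<alpha> \<beta> where "\<alpha> = deriv f x0" "\<beta> = deriv g y0"
  have ab: "\<alpha> \<noteq> 0" "\<beta> \<noteq> 0" "\<alpha>\<^sup>2 \<noteq> \<beta>\<^sup>2" "\<alpha>\<^sup>2 = p0" "\<beta>\<^sup>2 = q0" using f g distinct 0 by (simp_all add: \<alpha>_\<beta>_def)
  obtain \<epsilon> where e: "\<epsilon> = 1 \<or> \<epsilon> = -1" "\<forall>\<^sub>F x in nhds x0. f x = f x0 + \<epsilon> * \<alpha> * (x - x0)"
    by (rule line_solve[OF f(1,3) F[folded ab(4)] ab(1)]) (rule that)
  obtain \<epsilon>' where e': "\<epsilon>' = 1 \<or> \<epsilon>' = -1" "\<forall>\<^sub>F y in nhds y0. g y = g y0 + \<epsilon>' * \<beta> * (y - y0)"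
    by (rule line_solve[OF g(1,3) G[folded ab(5)] ab(2)]) (rule that)
  define A B where "A = \<epsilon> * \<alpha>" "B = \<epsilon>' * \<beta>"
  have AB: "B * (- A) * (B\<^sup>2 - (- A)\<^sup>2) \<noteq> 0" using ab e(1) e'(1) by (auto simp: A_B_def power_mult_distrib)
  define q :: "complex^3" where "q = vector [B, - A, 0]"
  have "foliation (x0, y0) (\<lambda>z. A * fst z + B * snd z) = foliation (x0, y0) u"
  proof (rule foliation_compose[where \<Theta> = "\<lambda>t. 1 * t + (A * x0 + B * y0)"])
    show "\<forall>\<^sub>F z in nhds (x0, y0). A * fst z + B * snd z = 1 * (f (fst z) + g (snd z)) + (A * x0 + B * y0)"
      using eventually_fst[OF e(2), of y0] eventually_snd[OF e'(2), of x0]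
    proof eventually_elim
      case (elim z)
      show ?case unfolding elim f(2) g(2) A_B_def by (simp add: algebra_simps)
    qed
  qed (use affine_\<Theta>[of 1] in simp_all)
  moreover have "foliation (x0, y0) (\<lambda>z. A * fst z + B * snd z) = relation_germ (x0, y0) {(z, z'). dot3 (cr3 (affine_point z) q) (affine_point z') = 0}"
    unfolding foliation_def
  proof (rule relation_germ_cong, rule always_eventually, rule allI)
    fix ab :: "point \<times> point"
    obtain x y x' y' where ab: "ab = ((x, y), (x', y'))" by (cases ab, cases "fst ab", cases "snd ab") auto
    have "dot3 (cr3 (affine_point (x, y)) q) (affine_point (x', y')) = (A * x' + B * y') - (A * x + B * y)"
      by (simp add: dot3_def cr3_def affine_point_def q_def algebra_simps)
    thus "ab \<in> {(a, b). A * fst a + B * snd a = A * fst b + B * snd b} \<longleftrightarrow> ab \<in> {(z, z'). dot3 (cr3 (affine_point z) q) (affine_point z') = 0}"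
      unfolding ab by auto
  qed
  ultimately show ?thesis by (intro pencil_algebraizable[where q = q]) (use AB in \<open>simp_all add: q_def\<close>)
qed

text \<open>Up to a constant, exp (- \<beta> (f + g)) is an affine function of x divided by an
  affine function of y, so the leaves of u are the lines through the point (s, t) where both
  vanish.\<close>

lemma (in hexagonal) algebraizable_pencil:
  assumes \<beta>: "\<beta> \<noteq> 0" and nz: "A \<noteq> 0" "B \<noteq> 0"
    and F: "\<forall>\<^sub>F x in nhds x0. (deriv f x)\<^sup>2 = A * exp (2 * \<beta> * f x)"
    and G: "\<forall>\<^sub>F y in nhds y0. (deriv g y)\<^sup>2 = B * exp (- (2 * \<beta> * g y))"
  shows "algebraizable (x0, y0) (T_web u)"
proof -
  have b: "- \<beta> \<noteq> 0" "(- \<beta>)\<^sup>2 = \<beta>\<^sup>2" using \<beta> by simp_all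
  have "(deriv f x0)\<^sup>2 = A" "(deriv g y0)\<^sup>2 = B"
    using eventually_nhds_x_imp_x[OF F] eventually_nhds_x_imp_x[OF G] f(2) g(2) by simp_all
  hence AB: "A \<noteq> B" using distinct by auto
  have F': "\<forall>\<^sub>F x in nhds x0. (deriv f x)\<^sup>2 = 0 * exp (2 * (- \<beta>) * f x) + A * exp (- (2 * (- \<beta>) * f x)) + 0" using F by simp
  have G': "\<forall>\<^sub>F y in nhds y0. (deriv g y)\<^sup>2 = 0 * exp (2 * \<beta> * g y) + B * exp (- (2 * \<beta> * g y)) + 0" using G by simp
  define k k' where "k = csqrt (1 / A)" "k' = csqrt (1 / B)"
  have k: "k \<noteq> 0" "k' \<noteq> 0" "A * k\<^sup>2 = 1" "B * k'\<^sup>2 = 1" using nz by (simp_all add: k_k'_def)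
  have kk: "k\<^sup>2 \<noteq> k'\<^sup>2"
  proof
    assume "k\<^sup>2 = k'\<^sup>2"
    hence "A * k\<^sup>2 = B * k\<^sup>2" using k by simp
    thus False using AB k(1) by simp
  qed
  define h where "h x = k * exp (- \<beta> * f x)" for x
  define l where "l y = k' * exp (\<beta> * g y)" for y
  have h: "h analytic_on {x0}" "deriv h x0 \<noteq> 0" "\<forall>\<^sub>F x in nhds x0. (deriv h x)\<^sup>2 = \<beta>\<^sup>2"
    using scaled_exp_ode[OF f(1,3) b(1) k(1) F'] unfolding b k h_def[abs_def] by simp_all
  have l: "l analytic_on {y0}" "deriv l y0 \<noteq> 0" "\<forall>\<^sub>F y in nhds y0. (deriv l y)\<^sup>2 = \<beta>\<^sup>2"
    using scaled_exp_ode[OF g(1,3) \<beta> k(2) G'] unfolding k l_def[abs_def] by simp_all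
  obtain \<epsilon> where e: "\<epsilon> = 1 \<or> \<epsilon> = -1" "\<forall>\<^sub>F x in nhds x0. h x = h x0 + \<epsilon> * \<beta> * (x - x0)"
    by (rule line_solve[OF h \<beta>]) (rule that)
  obtain \<epsilon>' where e': "\<epsilon>' = 1 \<or> \<epsilon>' = -1" "\<forall>\<^sub>F y in nhds y0. l y = l y0 + \<epsilon>' * \<beta> * (y - y0)"
    by (rule line_solve[OF l \<beta>]) (rule that)
  have h0: "h x0 = k" "l y0 = k'" by (simp_all add: h_def l_def f g)
  define s t where "s = x0 - \<epsilon> * k / \<beta>" "t = y0 - \<epsilon>' * k' / \<beta>"
  have hs: "k + \<epsilon> * \<beta> * (x - x0) = \<epsilon> * \<beta> * (x - s)" and lt: "k' + \<epsilon>' * \<beta> * (y - y0) = \<epsilon>' * \<beta> * (y - t)" for x y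
    using \<beta> e(1) e'(1) by (auto simp: s_t_def field_simps)
  define q :: "complex^3" where "q = vector [s, t, 1]"
  \<comment> \<open>The inequality of k^2 and k'^2 says that (s, t) is seen from the base point in
    neither diagonal direction.\<close>
  have "- \<epsilon> * k / \<beta> * (- \<epsilon>' * k' / \<beta>) * ((- \<epsilon> * k / \<beta>)\<^sup>2 - (- \<epsilon>' * k' / \<beta>)\<^sup>2) \<noteq> 0"
    using kk k \<beta> e(1) e'(1) by (auto simp: power_divide power_mult_distrib)
  hence tr: "(s - x0) * (t - y0) * ((s - x0)\<^sup>2 - (t - y0)\<^sup>2) \<noteq> 0" by (simp add: s_t_def)
  have hl: "h x / l y = k / k' * exp (- \<beta> * (f x + g y))" for x y
  proof -
    have "exp (- \<beta> * (f x + g y)) = exp (- \<beta> * f x) / exp (\<beta> * g y)" unfolding distrib_left exp_diff[symmetric] by simp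
    thus ?thesis by (simp only: h_def l_def times_divide_times_eq)
  qed
  have 1: "foliation (x0, y0) (\<lambda>z. h (fst z) / l (snd z)) = foliation (x0, y0) u"
    by (rule foliation_compose[where \<Theta> = "\<lambda>t. k / k' * exp (- \<beta> * t)"]) (use exp_\<Theta>[OF b(1), of "k / k'"] k in \<open>simp_all add: hl\<close>)
  have hl_ev: "\<forall>\<^sub>F z in nhds (x0, y0). h (fst z) = \<epsilon> * \<beta> * (fst z - s) \<and> l (snd z) = \<epsilon>' * \<beta> * (snd z - t)"
    using eventually_fst[OF e(2), of y0] eventually_snd[OF e'(2), of x0]
    by eventually_elim (simp only: h0 hs lt)
  have 2: "foliation (x0, y0) (\<lambda>z. h (fst z) / l (snd z)) = relation_germ (x0, y0) {(z, z'). dot3 (cr3 (affine_point z) q) (affine_point z') = 0}"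
    unfolding foliation_def
  proof (rule relation_germ_cong, unfold nhds_prod, rule eventually_mono[OF eventually_prodI[OF hl_ev[unfolded nhds_prod] hl_ev[unfolded nhds_prod]]])
    fix ab :: "point \<times> point"
    assume a: "(h (fst (fst ab)) = \<epsilon> * \<beta> * (fst (fst ab) - s) \<and> l (snd (fst ab)) = \<epsilon>' * \<beta> * (snd (fst ab) - t)) \<and>
      h (fst (snd ab)) = \<epsilon> * \<beta> * (fst (snd ab) - s) \<and> l (snd (snd ab)) = \<epsilon>' * \<beta> * (snd (snd ab) - t)"
    obtain x y x' y' where ab: "ab = ((x, y), (x', y'))" by (cases ab, cases "fst ab", cases "snd ab") auto
    have a: "h x = \<epsilon> * \<beta> * (x - s)" "l y = \<epsilon>' * \<beta> * (y - t)" "h x' = \<epsilon> * \<beta> * (x' - s)" "l y' = \<epsilon>' * \<beta> * (y' - t)"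
      using a by (simp_all add: ab)
    have l0: "l y \<noteq> 0" "l y' \<noteq> 0" using k by (simp_all add: l_def)
    have "dot3 (cr3 (affine_point (x, y)) q) (affine_point (x', y')) = (x' - s) * (y - t) - (x - s) * (y' - t)"
      by (simp add: dot3_def cr3_def affine_point_def q_def algebra_simps)
    moreover have "h x' * l y - h x * l y' = (\<epsilon> * \<beta> * (\<epsilon>' * \<beta>)) * ((x' - s) * (y - t) - (x - s) * (y' - t))"
      unfolding a by (simp add: algebra_simps)
    moreover have "\<epsilon> * \<beta> * (\<epsilon>' * \<beta>) \<noteq> 0" using \<beta> e(1) e'(1) by auto
    ultimately have "dot3 (cr3 (affine_point (x, y)) q) (affine_point (x', y')) = 0 \<longleftrightarrow> h x' * l y - h x * l y' = 0" by simp
    moreover have "h x / l y = h x' / l y' \<longleftrightarrow> h x' * l y - h x * l y' = 0" using l0 by (auto simp: frac_eq_eq)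
    ultimately show "ab \<in> {(a, b). h (fst a) / l (snd a) = h (fst b) / l (snd b)} \<longleftrightarrow> ab \<in> {(z, z'). dot3 (cr3 (affine_point z) q) (affine_point z') = 0}"
      unfolding ab by simp
  qed
  show ?thesis by (rule pencil_algebraizable[where q = q]) (use tr 1 2 in \<open>simp_all add: q_def\<close>)
qed

section \<open>Assembly of the classification\<close>

lemma hexagonal_structure:
  assumes u: "holomorphic_germ (x0, y0) u" and tr: "transversality (x0, y0) u"
    and rk: "maximal_rank (x0, y0) (T_web u)" "maximal_rank (x0, y0) [fst, snd, u]"
  obtains f g \<Phi> P Q b c e where "hexagonal x0 y0 u f g \<Phi>"
    "P analytic_on {0}" "Q analytic_on {0}"
    "\<forall>\<^sub>F x in nhds x0. (deriv f x)\<^sup>2 = P (f x)" "\<forall>\<^sub>F y in nhds y0. (deriv g y)\<^sup>2 = Q (g y)"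
    "\<forall>\<^sub>F s in nhds 0. deriv (deriv P) s = b * P s + c" "\<forall>\<^sub>F s in nhds 0. deriv (deriv Q) s = b * Q s + c"
    "(deriv P 0)\<^sup>2 = b * (P 0)\<^sup>2 + 2 * c * P 0 + e" "(deriv Q 0)\<^sup>2 = b * (Q 0)\<^sup>2 + 2 * c * Q 0 + e"
proof -
  have nz: "dx u (x0, y0) \<noteq> 0" "dy u (x0, y0) \<noteq> 0" and sq: "(dx u (x0, y0))\<^sup>2 \<noteq> (dy u (x0, y0))\<^sup>2"
    using tr by (auto simp: transversality_def)
  obtain f g \<Phi> where f: "f analytic_on {x0}" "f x0 = 0" "deriv f x0 \<noteq> 0" and g: "g analytic_on {y0}" "g y0 = 0" "deriv g y0 \<noteq> 0"
    and \<Phi>: "\<Phi> analytic_on {u (x0, y0)}" "\<Phi> (u (x0, y0)) = 0" "deriv \<Phi> (u (x0, y0)) \<noteq> 0"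
    and eq: "\<forall>\<^sub>F z in nhds (x0, y0). \<Phi> (u z) = f (fst z) + g (snd z)"
    by (rule hexagonal_web[OF u nz rk(2)]) (rule that)
  obtain \<Psi> where \<Psi>: "\<Psi> analytic_on {0}" "deriv \<Psi> 0 \<noteq> 0" "\<forall>\<^sub>F t in nhds (u (x0, y0)). \<Psi> (\<Phi> t) = t"
    by (rule local_inverse[OF \<Phi>(1,3)]) (use that in \<open>simp add: \<Phi>(2)\<close>)
  have "\<forall>\<^sub>F z in nhds (x0, y0). \<Psi> (\<Phi> (u z)) = u z"
    by (rule eventually_nhds_compose[where P = "\<lambda>t. \<Psi> (\<Phi> t) = t" and f = u]) (rule holomorphic_germ_isCont[OF u] \<Psi>(3))+
  hence eq': "\<forall>\<^sub>F z in nhds (x0, y0). u z = \<Psi> (f (fst z) + g (snd z))"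
    using eq by eventually_elim simp
  have d\<Psi>: "(\<Psi> has_field_derivative deriv \<Psi> 0) (at 0)" by (rule analytic_DERIV[OF \<Psi>(1)])
  have "dx u (x0, y0) = deriv (\<lambda>s. \<Psi> (f s)) x0"
    unfolding dx_def fst_conv snd_conv by (rule deriv_cong_ev) (use eventually_slice(1)[OF eq'] g(2) in simp_all)
  also have "\<dots> = deriv \<Psi> 0 * deriv f x0"
    by (rule DERIV_imp_deriv, rule DERIV_chain2[where f = \<Psi> and g = f]) (use d\<Psi> f analytic_DERIV in simp_all)
  finally have x: "dx u (x0, y0) = deriv \<Psi> 0 * deriv f x0" .
  have "dy u (x0, y0) = deriv (\<lambda>s. \<Psi> (g s)) y0"
    unfolding dy_def fst_conv snd_conv by (rule deriv_cong_ev) (use eventually_slice(2)[OF eq'] f(2) in simp_all)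
  also have "\<dots> = deriv \<Psi> 0 * deriv g y0"
    by (rule DERIV_imp_deriv, rule DERIV_chain2[where f = \<Psi> and g = g]) (use d\<Psi> g analytic_DERIV in simp_all)
  finally have y: "dy u (x0, y0) = deriv \<Psi> 0 * deriv g y0" .
  have ne: "(deriv f x0)\<^sup>2 \<noteq> (deriv g y0)\<^sup>2" using sq unfolding x y power_mult_distrib by auto
  obtain a where a: "a analytic_on {0}"
    "\<forall>\<^sub>F z in nhds (x0, y0). 2 * (deriv (deriv f) (fst z) - deriv (deriv g) (snd z)) =
        a (f (fst z) + g (snd z)) * ((deriv f (fst z))\<^sup>2 - (deriv g (snd z))\<^sup>2)"
    by (rule functional_equation[OF rk(1) \<Psi>(1,2) f(1,2) g(1,2) eq' f(3) g(3) ne]) (rule that)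
  obtain X P where X: "X analytic_on {0}" "X 0 = x0" "P analytic_on {0}" "P 0 = (deriv f x0)\<^sup>2"
    "\<forall>\<^sub>F s in nhds 0. f (X s) = s \<and> P s = (deriv f (X s))\<^sup>2 \<and> deriv P s = 2 * deriv (deriv f) (X s)"
    "\<forall>\<^sub>F x in nhds x0. (deriv f x)\<^sup>2 = P (f x)"
    by (rule arc_length_square[OF f]) (rule that)
  obtain Y Q where Y: "Y analytic_on {0}" "Y 0 = y0" "Q analytic_on {0}" "Q 0 = (deriv g y0)\<^sup>2"
    "\<forall>\<^sub>F s in nhds 0. g (Y s) = s \<and> Q s = (deriv g (Y s))\<^sup>2 \<and> deriv Q s = 2 * deriv (deriv g) (Y s)"
    "\<forall>\<^sub>F x in nhds y0. (deriv g x)\<^sup>2 = Q (g x)"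
    by (rule arc_length_square[OF g]) (rule that)
  have cont: "isCont (\<lambda>z. (X (fst z), Y (snd z))) (0, 0)"
    by (intro isCont_Pair isCont_o2[OF isCont_fst] isCont_o2[OF isCont_snd])
       (use analytic_isCont[OF X(1)] analytic_isCont[OF Y(1)] in simp_all)
  have "\<forall>\<^sub>F z in nhds (0, 0). 2 * (deriv (deriv f) (X (fst z)) - deriv (deriv g) (Y (snd z))) =
        a (f (X (fst z)) + g (Y (snd z))) * ((deriv f (X (fst z)))\<^sup>2 - (deriv g (Y (snd z)))\<^sup>2)"
    using eventually_nhds_compose[where P = "\<lambda>z. 2 * (deriv (deriv f) (fst z) - deriv (deriv g) (snd z)) =
        a (f (fst z) + g (snd z)) * ((deriv f (fst z))\<^sup>2 - (deriv g (snd z))\<^sup>2)", OF _ cont] a(2) X(2) Y(2) by simp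
  hence "\<forall>\<^sub>F z in nhds (0, 0). deriv P (fst z) - deriv Q (snd z) = a (fst z + snd z) * (P (fst z) - Q (snd z))"
    using eventually_fst[OF X(5), of 0] eventually_snd[OF Y(5), of 0]
    by eventually_elim (metis right_diff_distrib)
  note E = this
  obtain b c e where ode: "\<forall>\<^sub>F s in nhds 0. deriv (deriv P) s = b * P s + c" "\<forall>\<^sub>F s in nhds 0. deriv (deriv Q) s = b * Q s + c"
    "(deriv P 0)\<^sup>2 = b * (P 0)\<^sup>2 + 2 * c * P 0 + e" "(deriv Q 0)\<^sup>2 = b * (Q 0)\<^sup>2 + 2 * c * Q 0 + e"
    by (rule functional_equation_ode[OF X(3) Y(3) a(1) E]) (use ne X(4) Y(4) in simp, rule that)
  have "hexagonal x0 y0 u f g \<Phi>" by (rule hexagonal.intro) (fact u tr f g \<Phi> eq ne)+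
  thus ?thesis by (rule that[OF _ X(3) Y(3) X(6) Y(6) ode])
qed

text \<open>For b \<noteq> 0 the common first integral gives A A' = B B', so the products vanish
  together. If they do, each equation keeps at most one exponential, and only the relative sign of
  the two exponents matters, since \<beta> may be replaced by - \<beta>. Opposite exponents with
  \<gamma> = 0 give concurrent lines.\<close>

lemma (in hexagonal) classification:
  assumes P: "P analytic_on {0}" and Q: "Q analytic_on {0}"
    and F: "\<forall>\<^sub>F x in nhds x0. (deriv f x)\<^sup>2 = P (f x)" and G: "\<forall>\<^sub>F y in nhds y0. (deriv g y)\<^sup>2 = Q (g y)"
    and odeP: "\<forall>\<^sub>F s in nhds 0. deriv (deriv P) s = b * P s + c" and odeQ: "\<forall>\<^sub>F s in nhds 0. deriv (deriv Q) s = b * Q s + c"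
    and eP: "(deriv P 0)\<^sup>2 = b * (P 0)\<^sup>2 + 2 * c * P 0 + e" and eQ: "(deriv Q 0)\<^sup>2 = b * (Q 0)\<^sup>2 + 2 * c * Q 0 + e"
  shows "modelled \<or> algebraizable (x0, y0) (T_web u)"
proof -
  have FP: "\<forall>\<^sub>F x in nhds x0. (deriv f x)\<^sup>2 = R (f x)" if "\<forall>\<^sub>F s in nhds 0. P s = R s" for R
  proof -
    have "\<forall>\<^sub>F x in nhds x0. P (f x) = R (f x)"
      by (rule eventually_nhds_compose[where P = "\<lambda>s. P s = R s" and f = f]) (use that f analytic_isCont in simp_all)
    thus ?thesis using F by eventually_elim simp
  qed
  have GQ: "\<forall>\<^sub>F y in nhds y0. (deriv g y)\<^sup>2 = R (g y)" if "\<forall>\<^sub>F s in nhds 0. Q s = R s" for R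
  proof -
    have "\<forall>\<^sub>F y in nhds y0. Q (g y) = R (g y)"
      by (rule eventually_nhds_compose[where P = "\<lambda>s. Q s = R s" and f = g]) (use that g analytic_isCont in simp_all)
    thus ?thesis using G by eventually_elim simp
  qed
  show ?thesis
  proof (cases "b = 0")
    case True
    have odeP': "\<forall>\<^sub>F s in nhds 0. deriv (deriv P) s = c" and odeQ': "\<forall>\<^sub>F s in nhds 0. deriv (deriv Q) s = c"
      using odeP odeQ True by simp_all
    note F' = FP[OF linear_ode_poly[OF P odeP']]
    note G' = GQ[OF linear_ode_poly[OF Q odeQ']]
    show ?thesis
    proof (cases "c = 0")
      case c: True
      have e: "(deriv P 0)\<^sup>2 = (deriv Q 0)\<^sup>2" using eP eQ True c by simp
      have F'': "\<forall>\<^sub>F x in nhds x0. (deriv f x)\<^sup>2 = deriv P 0 * f x + P 0" using F' c by simp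
      have G'': "\<forall>\<^sub>F y in nhds y0. (deriv g y)\<^sup>2 = deriv Q 0 * g y + Q 0" using G' c by simp
      show ?thesis
      proof (cases "deriv P 0 = 0")
        case True
        hence "deriv Q 0 = 0" using e by simp
        thus ?thesis using algebraizable_constant[of "P 0" "Q 0"] F'' G'' True by simp
      next
        case False
        thus ?thesis using case_linear[OF _ _ F'' G''] e by (metis power2_eq_iff)
      qed
    next
      case False
      have "(deriv P 0)\<^sup>2 - 2 * c * P 0 = (deriv Q 0)\<^sup>2 - 2 * c * Q 0" using eP eQ True by simp
      thus ?thesis using case_quadratic[OF False _ F' G'] by blast
    qed
  next
    case False
    define \<beta> where "\<beta> = csqrt b / 2"
    have \<beta>: "b = 4 * \<beta>\<^sup>2" "\<beta> \<noteq> 0" using False by (simp_all add: \<beta>_def power_divide)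
    define \<gamma> where "\<gamma> = - c / b"
    obtain A A' where A: "\<forall>\<^sub>F s in nhds 0. P s = A * exp (2 * \<beta> * s) + A' * exp (- (2 * \<beta> * s)) - c / b"
      "A * A' = (c\<^sup>2 - b * e) / (4 * b\<^sup>2)"
      by (rule linear_ode_exp[OF P odeP \<beta> eP]) (rule that)
    obtain B B' where B: "\<forall>\<^sub>F s in nhds 0. Q s = B * exp (2 * \<beta> * s) + B' * exp (- (2 * \<beta> * s)) - c / b"
      "B * B' = (c\<^sup>2 - b * e) / (4 * b\<^sup>2)"
      by (rule linear_ode_exp[OF Q odeQ \<beta> eQ]) (rule that)
    have F': "\<forall>\<^sub>F x in nhds x0. (deriv f x)\<^sup>2 = A * exp (2 * \<beta> * f x) + A' * exp (- (2 * \<beta> * f x)) + \<gamma>"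
      using FP[OF A(1)] by (simp add: \<gamma>_def)
    have G': "\<forall>\<^sub>F y in nhds y0. (deriv g y)\<^sup>2 = B * exp (2 * \<beta> * g y) + B' * exp (- (2 * \<beta> * g y)) + \<gamma>"
      using GQ[OF B(1)] by (simp add: \<gamma>_def)
    have AB: "A * A' = B * B'" using A(2) B(2) by simp
    have m\<beta>: "- \<beta> \<noteq> 0" using \<beta>(2) by simp
    show ?thesis
    proof (cases "A * A' = 0")
      case False
      thus ?thesis using case_elliptic[OF \<beta>(2) AB _ F' G'] by blast
    next
      case True
      hence z: "A = 0 \<or> A' = 0" "B = 0 \<or> B' = 0" using AB by auto
      consider "A' = 0" "B' = 0" | "A = 0" "B = 0" | "A' = 0" "B = 0" "A \<noteq> 0" "B' \<noteq> 0" | "A = 0" "B' = 0" "A' \<noteq> 0" "B \<noteq> 0"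
        using z by blast
      thus ?thesis
      proof cases
        case 1
        have "modelled" by (rule case_one_sided[OF \<beta>(2), of A \<gamma> B]) (use F' G' 1 in simp_all)
        thus ?thesis ..
      next
        case 2
        have "modelled" by (rule case_one_sided[OF m\<beta>, of A' \<gamma> B']) (use F' G' 2 in simp_all)
        thus ?thesis ..
      next
        case 3
        show ?thesis
        proof (cases "\<gamma> = 0")
          case True
          have "algebraizable (x0, y0) (T_web u)" by (rule algebraizable_pencil[OF \<beta>(2) 3(3,4)]) (use F' G' 3 True in simp_all)
          thus ?thesis ..
        next
          case False
          have modelled by (rule case_opposite[OF \<beta>(2) 3(3,4) False]) (use F' G' 3 in simp_all)
          thus ?thesis ..
        qed
      next
        case 4
        show ?thesis
        proof (cases "\<gamma> = 0")
          case True
          have "algebraizable (x0, y0) (T_web u)" by (rule algebraizable_pencil[OF m\<beta> 4(3,4)]) (use F' G' 4 True in simp_all)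
          thus ?thesis ..
        next
          case False
          have modelled by (rule case_opposite[OF m\<beta> 4(3,4) False]) (use F' G' 4 in simp_all)
          thus ?thesis ..
        qed
      qed
    qed
  qed
qed

theorem mainTheorem3:
  fixes p :: "complex \<times> complex" and u :: "complex \<times> complex \<Rightarrow> complex"
  assumes "holomorphic_germ p u"
    and "transversality p u"
    and "exceptional p (T_web u)"
    and "maximal_rank p [fst, snd, u]"
  shows "\<exists>g\<in>Sym_T0. \<exists>w\<in>model_functions. \<exists>p'.
           holomorphic_germ p' w \<and> transversality p' w \<and> g p' = p \<and>
           web p (T_web u) = image_web g (web p' (T_web w))"
proof -
  obtain x0 y0 where p: "p = (x0, y0)" by (cases p)
  have rk: "maximal_rank (x0, y0) (T_web u)" and na: "\<not> algebraizable (x0, y0) (T_web u)"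
    using assms(3) unfolding exceptional_def p by simp_all
  obtain f g \<Phi> P Q b c e where H: "hexagonal x0 y0 u f g \<Phi>"
    and PQ: "P analytic_on {0}" "Q analytic_on {0}"
    "\<forall>\<^sub>F x in nhds x0. (deriv f x)\<^sup>2 = P (f x)" "\<forall>\<^sub>F y in nhds y0. (deriv g y)\<^sup>2 = Q (g y)"
    "\<forall>\<^sub>F s in nhds 0. deriv (deriv P) s = b * P s + c" "\<forall>\<^sub>F s in nhds 0. deriv (deriv Q) s = b * Q s + c"
    "(deriv P 0)\<^sup>2 = b * (P 0)\<^sup>2 + 2 * c * P 0 + e" "(deriv Q 0)\<^sup>2 = b * (Q 0)\<^sup>2 + 2 * c * Q 0 + e"
    by (rule hexagonal_structure[OF assms(1,2)[unfolded p] rk assms(4)[unfolded p]]) (rule that)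
  from hexagonal.classification[OF H PQ] na have "hexagonal.modelled x0 y0 u" by blast
  thus ?thesis unfolding hexagonal.modelled_def[OF H] p .
qed

end
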